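(* Let $x\in X$ be such that $\mathfrak a(x)\neq \mathrm{cl}(x)$. Then $\mathrm{St}_{x,l}^{\mathrm v}$ has a presentation $\langle \Omega_x\mid R_x\rangle$.
   Context: Let $\Gamma$ be a finite simple graph with vertex set $X$, and let $\mathbb G=\mathbb G_\Gamma$ be the partially commutative group (right-angled Artin group) generated by $X$ with relations $[x,y]=1$ for each edge $\{x,y\}$ of $\Gamma$. For $Y\subseteq X$, $\mathbb G(Y)$ is the subgroup generated by $Y$. Automorphisms act on the right and products are read left to right. For $x\in X$: $\mathrm{lk}(x)$ is the set of vertices adjacent to $x$, $\mathrm{st}(x)=\mathrm{lk}(x)\cup\{x\}$. Write $x\sim y$ if $\mathrm{st}(x)=\mathrm{st}(y)$ or $\mathrm{lk}(x)=\mathrm{lk}(y)$; this is an equivalence relation with classes $[x]$. Put $\mathfrak a(x)=\bigcap_{y\in \mathrm{lk}(x)}\mathrm{st}(y)$ (equal to $X$ if $\mathrm{lk}(x)=\emptyset$), $\mathrm{cl}(x)=\bigcap_{y\in \mathrm{st}(x)}\mathrm{st}(y)$, $\mathfrak a_{\mathrm{out}}(x)=\mathfrak a(x)\setminus(\mathrm{cl}(x)\cup [x])$, $\mathcal K=\{\mathfrak a(x): x\in X\}$. $\mathrm{St}(\mathcal K)=\{\phi\in\mathrm{Aut}(\mathbb G): \mathbb G(Y)\phi=\mathbb G(Y)\ \forall Y\in\mathcal K\}$, $\mathrm{St}_x^{\mathrm v}=\{\phi\in \mathrm{St}(\mathcal K): y\phi=y\ \forall y\in X\setminus [x]\}$ and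 $\mathrm{St}_{x,l}^{\mathrm v}=\{\phi\in \mathrm{St}_x^{\mathrm v}: y\phi\in \mathbb G([x]\cup \mathfrak a_{\mathrm{out}}(x))\ \forall y\in [x]\}$. Let $L=X\cup X^{-1}$. For $a\in L$ put $\mathrm{lk}(a)=\mathrm{lk}(v)$, $\mathrm{st}(a)=\mathrm{st}(v)$, with $v\in X\cap\{a,a^{-1}\}$. Subscript $L$ means union with the set of inverses: $[x]_L=[x]\cup[x]^{-1}$, $\mathrm{lk}_L(a)=\mathrm{lk}(a)\cup\mathrm{lk}(a)^{-1}$, $\mathfrak a_{\mathrm{out},L}(x)=\mathfrak a_{\mathrm{out}}(x)\cup\mathfrak a_{\mathrm{out}}(x)^{-1}$. Whitehead automorphisms of $\mathbb G$: Type 1 are the automorphisms permuting $L$. Type 2 are the automorphisms $(A,a)$, where $a\in A\subseteq L$, $a^{-1}\notin A$, and $A\setminus\{a\}$ is a disjoint union of $C\cup C^{-1}$, $T$ and $U\cup U^{-1}$, with $C\subseteq X\setminus \mathrm{st}(a)$ the vertex set of a union of connected components of $\Gamma\setminus\mathrm{st}(a)$, $T\subseteq L\setminus\{a^{\pm1}\}$ with $T\cap T^{-1}=\emptyset$ and $\mathrm{lk}(t)\subseteq \mathrm{st}(a)$ for all $t\in T$, $U\subseteq \mathrm{lk}(a)$, and $C\cup T\neq\emptyset$; $(A,a)$ maps $c\mapsto a^{-1}ca$ for $c\in C$, $t\mapsto ta$ for $t\in T$, and fixes all elements of $X$ not in $C\cup T\cup T^{-1}$. $\Omega_x$ is the set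 of Whitehead automorphisms lying in $\mathrm{St}_{x,l}^{\mathrm v}$; explicitly it consists of the Type 1 automorphisms fixing every element of $X\setminus[x]$, and the Type 2 automorphisms $(A,a)$ with $A\setminus\{a\}\subseteq[x]_L$ and $a\in[x]_L\cup\mathfrak a_{\mathrm{out},L}(x)$. Notation: $A+B$ is $A\cup B$ when $A\cap B=\emptyset$; $B-A$ is $B\setminus A$ when $A\subseteq B$; $A\pm a$ means $A\pm\{a\}$. $R_x$ is the set of all the following relations: (R1) $(A,a)^{-1}=(A-a+a^{-1},a^{-1})$ for $(A,a)\in\Omega_x$. (R2) $(A,a)(B,a)=(A\cup B,a)$ for $(A,a),(B,a)\in\Omega_x$ with $A\cap B=\{a\}$. (R3) $(B,b)^{-1}(A,a)(B,b)=(A,a)$ for $(A,a),(B,b)\in\Omega_x$ with $a^{-1}\notin B$, $b^{-1}\notin A$ and either (a) $A\cap B=\emptyset$ or (b) $a\in\mathrm{lk}_L(b)$. (R3* ) $(B,b)^{-1}(A,a)(B,b)=(A,a)$ for $(A,a),(B,b)\in\Omega_x$ with $a^{-1}\in B$, $b\notin A$ and $A\subseteq B$. (R4) $(B,b)^{-1}(A,a)(B,b)=(A+B-b,a)$ for $(A,a),(B,b)\in\Omega_x$ with $a^{-1}\notin B$, $b^{-1}\in A$ and $A\cap B=\emptyset$. (R4* ) $(B,b)^{-1}(A,a)(B,b)=(B-A+b^{-1},a^{-1})$ for $(A,a),(B,b)\in\Omega_x$ with $a^{-1}\in B$, $b\in A$ and $A\subseteq B$. (R5) $(A,a)(A-a+a^{-1},b)=\sigma_{a,b}(A-b+b^{-1},a)$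 for $(A,a)\in\Omega_x$, $a,b\in[x]_L$, $a\ne b$, $b\in A$, $b^{-1}\notin A$, where $\sigma_{a,b}$ is the Type 1 automorphism permuting $[x]_L$ by the cycle $(a,b^{-1},a^{-1},b)$. (R6) $\sigma^{-1}(A,a)\sigma=(A\sigma,a\sigma)$ for $(A,a)\in\Omega_x$ of Type 2 and $\sigma\in\Omega_x$ of Type 1. (R7) The multiplication table of the subgroup of Type 1 automorphisms in $\Omega_x$. *)

theory Defs
  imports "Graph_Theory.Digraph_Component" "Graph_Theory.Pair_Digraph" "HOL-Algebra.Bij" "HOL-Algebra.Generated_Groups"
begin

section \<open>Group presentations\<close>

text \<open>A letter \<open>(g, True)\<close> stands for the generator \<open>g\<close> and \<open>(g, False)\<close> for its formal
  inverse. A relation \<open>u = v\<close> is the pair of words \<open>(u, v)\<close>.\<close>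

type_synonym 'g letter = "'g \<times> bool"
type_synonym 'g word = "'g letter list"

definition linv :: "'g letter \<Rightarrow> 'g letter" where
  "linv l = (fst l, \<not> snd l)"

definition words :: "'g set \<Rightarrow> 'g word set" where
  "words S = lists (S \<times> UNIV)"

inductive_set pres_rel :: "'g set \<Rightarrow> ('g word \<times> 'g word) set \<Rightarrow> ('g word \<times> 'g word) set"
  for S :: "'g set" and R :: "('g word \<times> 'g word) set" where
  refl: "w \<in> words S \<Longrightarrow> (w, w) \<in> pres_rel S R"
| sym: "(u, v) \<in> pres_rel S R \<Longrightarrow> (v, u) \<in> pres_rel S R"
| trans: "(u, v) \<in> pres_rel S R \<Longrightarrow> (v, w) \<in> pres_rel S R \<Longrightarrow> (u, w) \<in> pres_rel S R"
| append: "(u, u') \<in> pres_rel S R \<Longrightarrow> (v, v') \<in> pres_rel S R \<Longrightarrow> (u @ v, u' @ v') \<in> pres_rel S R"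
| cancel: "l \<in> S \<times> UNIV \<Longrightarrow> ([l, linv l], []) \<in> pres_rel S R"
| relation: "(u, v) \<in> R \<Longrightarrow> u \<in> words S \<Longrightarrow> v \<in> words S \<Longrightarrow> (u, v) \<in> pres_rel S R"

definition pres_class :: "'g set \<Rightarrow> ('g word \<times> 'g word) set \<Rightarrow> 'g word \<Rightarrow> 'g word set" where
  "pres_class S R w = pres_rel S R `` {w}"

definition pres_group :: "'g set \<Rightarrow> ('g word \<times> 'g word) set \<Rightarrow> 'g word set monoid" where
  "pres_group S R =
    \<lparr>carrier = words S // pres_rel S R,
     mult = \<lambda>p q. \<Union>u\<in>p. \<Union>v\<in>q. pres_class S R (u @ v),
     one = pres_class S R []\<rparr>"

text \<open>\<open>H\<close> has the presentation with generating set \<open>S\<close>, consisting of elements of \<open>H\<close>, and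
  relations \<open>R\<close>: the inclusion of \<open>S\<close> into \<open>H\<close> induces an isomorphism.\<close>

definition has_presentation ::
    "('g, 'b) monoid_scheme \<Rightarrow> 'g set \<Rightarrow> ('g word \<times> 'g word) set \<Rightarrow> bool" where
  "has_presentation H S R \<longleftrightarrow>
     group H \<and> S \<subseteq> carrier H \<and> R \<subseteq> words S \<times> words S \<and>
     (\<exists>h \<in> iso (pres_group S R) H. \<forall>s\<in>S. h (pres_class S R [(s, True)]) = s)"

lemma pres_rel_words: "(u, v) \<in> pres_rel S R \<Longrightarrow> u \<in> words S \<and> v \<in> words S"
  by (induction rule: pres_rel.induct) (auto simp: words_def linv_def)

lemma equiv_pres_rel: "equiv (words S) (pres_rel S R)"
proof (rule equivI)
  show "pres_rel S R \<subseteq> words S \<times> words S"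
    by (auto dest: pres_rel_words)
  show "refl_on (words S) (pres_rel S R)"
    by (rule refl_onI) (rule pres_rel.refl)
  show "sym (pres_rel S R)"
    by (rule symI) (rule pres_rel.sym)
  show "trans (pres_rel S R)"
    by (rule transI) (rule pres_rel.trans)
qed

lemma pres_class_eq_iff:
  "u \<in> words S \<Longrightarrow> v \<in> words S \<Longrightarrow> pres_class S R u = pres_class S R v \<longleftrightarrow> (u, v) \<in> pres_rel S R"
  unfolding pres_class_def by (rule eq_equiv_class_iff[OF equiv_pres_rel])

lemma mult_pres_class:
  assumes "u \<in> words S" "v \<in> words S"
  shows "pres_class S R u \<otimes>\<^bsub>pres_group S R\<^esub> pres_class S R v = pres_class S R (u @ v)"
proof -
  have "pres_class S R (u' @ v') = pres_class S R (u @ v)"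
    if "u' \<in> pres_class S R u" "v' \<in> pres_class S R v" for u' v'
  proof -
    have 1: "(u, u') \<in> pres_rel S R" "(v, v') \<in> pres_rel S R"
      using that by (auto simp: pres_class_def)
    then have "(u @ v, u' @ v') \<in> pres_rel S R" by (rule pres_rel.append)
    then show ?thesis
      using pres_rel_words[of "u @ v" "u' @ v'" S R] by (metis pres_class_eq_iff pres_rel.sym)
  qed
  note eq = this
  have mem: "u \<in> pres_class S R u" "v \<in> pres_class S R v"
    using assms by (auto simp: pres_class_def intro: pres_rel.refl)
  show ?thesis
  proof -
    have "(\<Union>u'\<in>pres_class S R u. \<Union>v'\<in>pres_class S R v. pres_class S R (u' @ v')) =
        (\<Union>u'\<in>pres_class S R u. \<Union>v'\<in>pres_class S R v. pres_class S R (u @ v))"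
      using eq by (intro SUP_cong refl) auto
    also have "\<dots> = pres_class S R (u @ v)"
      using mem by auto
    finally show ?thesis
      by (simp add: pres_group_def)
  qed
qed

lemma group_pres_group: "group (pres_group S R)"
proof -
  have car: "\<exists>u\<in>words S. p = pres_class S R u" if "p \<in> carrier (pres_group S R)" for p
    using that by (auto simp: pres_group_def quotient_def pres_class_def)
  have car': "pres_class S R u \<in> carrier (pres_group S R)" if "u \<in> words S" for u
    using that by (auto simp: pres_group_def quotient_def pres_class_def)
  have app: "u @ v \<in> words S" if "u \<in> words S" "v \<in> words S" for u v :: "'a word"
    using that by (auto simp: words_def)
  have nil: "[] \<in> words S" by (simp add: words_def)
  have one: "\<one>\<^bsub>pres_group S R\<^esub> = pres_class S R []" by (simp add: pres_group_def)
  have ex_inv: "\<exists>v\<in>words S. (v @ u, []) \<in> pres_rel S R" if "u \<in> words S" for u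
    using that
  proof (induction u)
    case Nil
    then show ?case using nil by (auto intro: pres_rel.refl)
  next
    case (Cons l u)
    then have l: "l \<in> S \<times> UNIV" and u: "u \<in> words S" by (auto simp: words_def)
    from Cons.IH[OF u] obtain v where v: "v \<in> words S" "(v @ u, []) \<in> pres_rel S R" by blast
    have ll: "linv l \<in> S \<times> UNIV" "linv (linv l) = l" using l by (auto simp: linv_def)
    have "([linv l, l], []) \<in> pres_rel S R"
      using pres_rel.cancel[OF ll(1)] ll(2) by simp
    then have "([linv l, l] @ u, [] @ u) \<in> pres_rel S R"
      by (rule pres_rel.append) (rule pres_rel.refl[OF u])
    then have "(v @ ([linv l, l] @ u), v @ ([] @ u)) \<in> pres_rel S R"
      by (rule pres_rel.append[OF pres_rel.refl[OF v(1)]])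
    then have "((v @ [linv l]) @ (l # u), []) \<in> pres_rel S R"
      using pres_rel.trans[OF _ v(2)] by simp
    moreover have "v @ [linv l] \<in> words S" using v(1) ll(1) by (simp add: words_def)
    ultimately show ?case by blast
  qed
  show ?thesis
  proof (rule groupI)
    show "\<one>\<^bsub>pres_group S R\<^esub> \<in> carrier (pres_group S R)"
      using one car'[OF nil] by simp
  next
    fix p q assume "p \<in> carrier (pres_group S R)" "q \<in> carrier (pres_group S R)"
    then have "p \<in> pres_class S R ` words S" "q \<in> pres_class S R ` words S"
      using car by auto
    then show "p \<otimes>\<^bsub>pres_group S R\<^esub> q \<in> carrier (pres_group S R)"
      by (auto simp: mult_pres_class app car')
  next
    fix p q r assume "p \<in> carrier (pres_group S R)" "q \<in> carrier (pres_group S R)"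
      "r \<in> carrier (pres_group S R)"
    then have "p \<in> pres_class S R ` words S" "q \<in> pres_class S R ` words S"
      "r \<in> pres_class S R ` words S"
      using car by auto
    then show "p \<otimes>\<^bsub>pres_group S R\<^esub> q \<otimes>\<^bsub>pres_group S R\<^esub> r =
        p \<otimes>\<^bsub>pres_group S R\<^esub> (q \<otimes>\<^bsub>pres_group S R\<^esub> r)"
      by (auto simp: mult_pres_class app)
  next
    fix p assume "p \<in> carrier (pres_group S R)"
    then obtain u where u: "u \<in> words S" "p = pres_class S R u" using car by blast
    show "\<one>\<^bsub>pres_group S R\<^esub> \<otimes>\<^bsub>pres_group S R\<^esub> p = p"
      by (simp add: one u mult_pres_class nil)
    from ex_inv[OF u(1)] obtain v where v: "v \<in> words S" "(v @ u, []) \<in> pres_rel S R" by blast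
    then have "pres_class S R v \<otimes>\<^bsub>pres_group S R\<^esub> p = \<one>\<^bsub>pres_group S R\<^esub>"
      using u by (simp add: one mult_pres_class pres_class_eq_iff app nil)
    then show "\<exists>q\<in>carrier (pres_group S R). q \<otimes>\<^bsub>pres_group S R\<^esub> p = \<one>\<^bsub>pres_group S R\<^esub>"
      using car'[OF v(1)] by blast
  qed
qed


section \<open>Graph notation\<close>

text \<open>A finite simple graph is a \<^const>\<open>pair_graph\<close>: a finite loop-free digraph whose set of arcs
  is symmetric, so that an edge is a pair of opposite arcs.\<close>

type_synonym 'v graph = "'v pair_pre_digraph"

definition lk :: "'v graph \<Rightarrow> 'v \<Rightarrow> 'v set" where
  "lk \<Gamma> x = {y \<in> pverts \<Gamma>. (x, y) \<in> parcs \<Gamma>}"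

definition st :: "'v graph \<Rightarrow> 'v \<Rightarrow> 'v set" where
  "st \<Gamma> x = insert x (lk \<Gamma> x)"

definition cls :: "'v graph \<Rightarrow> 'v \<Rightarrow> 'v set" where
  "cls \<Gamma> x = {y \<in> pverts \<Gamma>. st \<Gamma> x = st \<Gamma> y \<or> lk \<Gamma> x = lk \<Gamma> y}"

definition adm :: "'v graph \<Rightarrow> 'v \<Rightarrow> 'v set" where
  "adm \<Gamma> x = {z \<in> pverts \<Gamma>. \<forall>y \<in> lk \<Gamma> x. z \<in> st \<Gamma> y}"

definition cl :: "'v graph \<Rightarrow> 'v \<Rightarrow> 'v set" where
  "cl \<Gamma> x = (\<Inter>y \<in> st \<Gamma> x. st \<Gamma> y)"

definition adm_out :: "'v graph \<Rightarrow> 'v \<Rightarrow> 'v set" where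
  "adm_out \<Gamma> x = adm \<Gamma> x - (cl \<Gamma> x \<union> cls \<Gamma> x)"

definition unions_of_components :: "'v graph \<Rightarrow> 'v set \<Rightarrow> 'v set set" where
  "unions_of_components \<Gamma> Y =
     {\<Union>F |F. F \<subseteq> pre_digraph.sccs_verts (induce_subgraph (with_proj \<Gamma>) Y)}"


section \<open>The partially commutative group and its automorphisms\<close>

definition raag_rels :: "'v graph \<Rightarrow> ('v word \<times> 'v word) set" where
  "raag_rels \<Gamma> = {([(x, True), (y, True)], [(y, True), (x, True)]) |x y. (x, y) \<in> parcs \<Gamma>}"

definition raag :: "'v graph \<Rightarrow> 'v word set monoid" where
  "raag \<Gamma> = pres_group (pverts \<Gamma>) (raag_rels \<Gamma>)"

text \<open>The set \<open>L\<close> of generators and their inverses is represented by letters; \<open>elt \<Gamma> a\<close> is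
  the element of the group denoted by the letter \<open>a\<close>.\<close>

definition elt :: "'v graph \<Rightarrow> 'v letter \<Rightarrow> 'v word set" where
  "elt \<Gamma> a = pres_class (pverts \<Gamma>) (raag_rels \<Gamma>) [a]"

abbreviation gen :: "'v graph \<Rightarrow> 'v \<Rightarrow> 'v word set" where
  "gen \<Gamma> v \<equiv> elt \<Gamma> (v, True)"

definition sgn_set :: "'v set \<Rightarrow> 'v letter set" where
  "sgn_set Y = Y \<times> UNIV"

definition letters :: "'v graph \<Rightarrow> 'v letter set" where
  "letters \<Gamma> = sgn_set (pverts \<Gamma>)"

definition par_subgroup :: "'v graph \<Rightarrow> 'v set \<Rightarrow> 'v word set set" where
  "par_subgroup \<Gamma> Y = generate (raag \<Gamma>) (gen \<Gamma> ` Y)"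

type_synonym 'v aut = "'v word set \<Rightarrow> 'v word set"

text \<open>Automorphisms act on the right: the product of \<open>\<phi>\<close> and \<open>\<psi>\<close> is \<open>\<phi>\<close> followed by
  \<open>\<psi>\<close>, opposite to the product of \<^const>\<open>AutoGroup\<close>.\<close>

definition aut_right :: "('a, 'b) monoid_scheme \<Rightarrow> ('a \<Rightarrow> 'a) monoid" where
  "aut_right G = (AutoGroup G) \<lparr>mult := \<lambda>\<phi> \<psi>. \<psi> \<otimes>\<^bsub>AutoGroup G\<^esub> \<phi>\<rparr>"

definition StK :: "'v graph \<Rightarrow> 'v aut set" where
  "StK \<Gamma> = {\<phi> \<in> auto (raag \<Gamma>).
     \<forall>Y \<in> adm \<Gamma> ` pverts \<Gamma>. \<phi> ` par_subgroup \<Gamma> Y = par_subgroup \<Gamma> Y}"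

definition Stv :: "'v graph \<Rightarrow> 'v \<Rightarrow> 'v aut set" where
  "Stv \<Gamma> x = {\<phi> \<in> StK \<Gamma>. \<forall>y \<in> pverts \<Gamma> - cls \<Gamma> x. \<phi> (gen \<Gamma> y) = gen \<Gamma> y}"

definition Stvl :: "'v graph \<Rightarrow> 'v \<Rightarrow> 'v aut set" where
  "Stvl \<Gamma> x = {\<phi> \<in> Stv \<Gamma> x.
     \<forall>y \<in> cls \<Gamma> x. \<phi> (gen \<Gamma> y) \<in> par_subgroup \<Gamma> (cls \<Gamma> x \<union> adm_out \<Gamma> x)}"

definition Stvl_group :: "'v graph \<Rightarrow> 'v \<Rightarrow> 'v aut monoid" where
  "Stvl_group \<Gamma> x = (aut_right (raag \<Gamma>)) \<lparr>carrier := Stvl \<Gamma> x\<rparr>"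


section \<open>Whitehead automorphisms\<close>

definition type1 :: "'v graph \<Rightarrow> 'v aut \<Rightarrow> bool" where
  "type1 \<Gamma> \<phi> \<longleftrightarrow> \<phi> \<in> auto (raag \<Gamma>) \<and> \<phi> ` elt \<Gamma> ` letters \<Gamma> = elt \<Gamma> ` letters \<Gamma>"

text \<open>The decomposition of \<open>A - {a}\<close> required of a Type 2 pair. It is unique: \<open>T\<close> is the part
  not closed under inversion, and the rest is split by membership in \<open>lk(a)\<close>.\<close>

definition wh_split ::
    "'v graph \<Rightarrow> 'v letter set \<Rightarrow> 'v letter \<Rightarrow> 'v set \<Rightarrow> 'v letter set \<Rightarrow> 'v set \<Rightarrow> bool" where
  "wh_split \<Gamma> A a C T U \<longleftrightarrow>
     A \<subseteq> letters \<Gamma> \<and> a \<in> A \<and> linv a \<notin> A \<and>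
     A - {a} = sgn_set C \<union> T \<union> sgn_set U \<and>
     sgn_set C \<inter> T = {} \<and> sgn_set C \<inter> sgn_set U = {} \<and> T \<inter> sgn_set U = {} \<and>
     C \<subseteq> pverts \<Gamma> - st \<Gamma> (fst a) \<and>
     C \<in> unions_of_components \<Gamma> (pverts \<Gamma> - st \<Gamma> (fst a)) \<and>
     T \<subseteq> letters \<Gamma> - {a, linv a} \<and> T \<inter> linv ` T = {} \<and>
     (\<forall>t \<in> T. lk \<Gamma> (fst t) \<subseteq> st \<Gamma> (fst a)) \<and>
     U \<subseteq> lk \<Gamma> (fst a) \<and>
     (C \<noteq> {} \<or> T \<noteq> {})"

definition wh_pair :: "'v graph \<Rightarrow> 'v letter set \<Rightarrow> 'v letter \<Rightarrow> bool" where
  "wh_pair \<Gamma> A a \<longleftrightarrow> (\<exists>C T U. wh_split \<Gamma> A a C T U)"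

definition is_wh :: "'v graph \<Rightarrow> 'v letter set \<Rightarrow> 'v letter \<Rightarrow> 'v aut \<Rightarrow> bool" where
  "is_wh \<Gamma> A a \<phi> \<longleftrightarrow> \<phi> \<in> auto (raag \<Gamma>) \<and>
     (\<exists>C T U. wh_split \<Gamma> A a C T U \<and>
       (\<forall>c \<in> C. \<phi> (gen \<Gamma> c) =
          elt \<Gamma> (linv a) \<otimes>\<^bsub>raag \<Gamma>\<^esub> gen \<Gamma> c \<otimes>\<^bsub>raag \<Gamma>\<^esub> elt \<Gamma> a) \<and>
       (\<forall>t \<in> T. \<phi> (elt \<Gamma> t) = elt \<Gamma> t \<otimes>\<^bsub>raag \<Gamma>\<^esub> elt \<Gamma> a) \<and>
       (\<forall>v \<in> pverts \<Gamma>. v \<notin> C \<and> (v, True) \<notin> T \<union> linv ` T \<longrightarrow> \<phi> (gen \<Gamma> v) = gen \<Gamma> v))"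

text \<open>The automorphism denoted by \<open>(A, a)\<close>. It is only meaningful if \<open>wh_pair \<Gamma> A a\<close>.\<close>

definition wh :: "'v graph \<Rightarrow> 'v letter set \<Rightarrow> 'v letter \<Rightarrow> 'v aut" where
  "wh \<Gamma> A a = (THE \<phi>. is_wh \<Gamma> A a \<phi>)"

definition Omega :: "'v graph \<Rightarrow> 'v \<Rightarrow> 'v aut set" where
  "Omega \<Gamma> x = {\<phi> \<in> Stvl \<Gamma> x. type1 \<Gamma> \<phi> \<or> (\<exists>A a. is_wh \<Gamma> A a \<phi>)}"

definition Omega1 :: "'v graph \<Rightarrow> 'v \<Rightarrow> 'v aut set" where
  "Omega1 \<Gamma> x = {\<sigma> \<in> Omega \<Gamma> x. type1 \<Gamma> \<sigma>}"

text \<open>The pairs \<open>(A, a)\<close> that are considered to belong to \<open>\<Omega>\<^sub>x\<close>. As \<open>U\<close> does not affect the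
  automorphism, the same automorphism is also denoted by pairs with \<open>A - {a}\<close> not contained in
  \<open>[x]\<^sub>L\<close>; these are not used in the relations.\<close>

definition Omega2 :: "'v graph \<Rightarrow> 'v \<Rightarrow> 'v letter set \<Rightarrow> 'v letter \<Rightarrow> bool" where
  "Omega2 \<Gamma> x A a \<longleftrightarrow> wh_pair \<Gamma> A a \<and> A - {a} \<subseteq> sgn_set (cls \<Gamma> x) \<and>
     a \<in> sgn_set (cls \<Gamma> x) \<union> sgn_set (adm_out \<Gamma> x)"

text \<open>The Type 1 automorphism inducing the cycle \<open>(a, b\<^sup>-\<^sup>1, a\<^sup>-\<^sup>1, b)\<close> on letters.\<close>

definition sigma :: "'v graph \<Rightarrow> 'v letter \<Rightarrow> 'v letter \<Rightarrow> 'v aut" where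
  "sigma \<Gamma> a b = (THE \<phi>. type1 \<Gamma> \<phi> \<and>
     \<phi> (elt \<Gamma> a) = elt \<Gamma> (linv b) \<and> \<phi> (elt \<Gamma> (linv b)) = elt \<Gamma> (linv a) \<and>
     \<phi> (elt \<Gamma> (linv a)) = elt \<Gamma> b \<and> \<phi> (elt \<Gamma> b) = elt \<Gamma> a \<and>
     (\<forall>l \<in> letters \<Gamma> - {a, linv b, linv a, b}. \<phi> (elt \<Gamma> l) = elt \<Gamma> l))"

text \<open>The letter \<open>l\<sigma>\<close>, for \<open>\<sigma>\<close> of Type 1.\<close>

definition lact :: "'v graph \<Rightarrow> 'v letter \<Rightarrow> 'v aut \<Rightarrow> 'v letter" where
  "lact \<Gamma> l \<sigma> = (THE m. m \<in> letters \<Gamma> \<and> elt \<Gamma> m = \<sigma> (elt \<Gamma> l))"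


section \<open>The relations\<close>

abbreviation pos :: "'g \<Rightarrow> 'g letter" where "pos g \<equiv> (g, True)"
abbreviation neg :: "'g \<Rightarrow> 'g letter" where "neg g \<equiv> (g, False)"

definition R1 :: "'v graph \<Rightarrow> 'v \<Rightarrow> ('v aut word \<times> 'v aut word) set" where
  "R1 \<Gamma> x = {([neg (wh \<Gamma> A a)], [pos (wh \<Gamma> (insert (linv a) (A - {a})) (linv a))]) |A a.
     Omega2 \<Gamma> x A a}"

definition R2 :: "'v graph \<Rightarrow> 'v \<Rightarrow> ('v aut word \<times> 'v aut word) set" where
  "R2 \<Gamma> x = {([pos (wh \<Gamma> A a), pos (wh \<Gamma> B a)], [pos (wh \<Gamma> (A \<union> B) a)]) |A B a.
     Omega2 \<Gamma> x A a \<and> Omega2 \<Gamma> x B a \<and> A \<inter> B = {a}}"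

definition R3 :: "'v graph \<Rightarrow> 'v \<Rightarrow> ('v aut word \<times> 'v aut word) set" where
  "R3 \<Gamma> x = {([neg (wh \<Gamma> B b), pos (wh \<Gamma> A a), pos (wh \<Gamma> B b)], [pos (wh \<Gamma> A a)]) |A a B b.
     Omega2 \<Gamma> x A a \<and> Omega2 \<Gamma> x B b \<and> linv a \<notin> B \<and> linv b \<notin> A \<and>
     (A \<inter> B = {} \<or> a \<in> sgn_set (lk \<Gamma> (fst b)))}"

definition R3s :: "'v graph \<Rightarrow> 'v \<Rightarrow> ('v aut word \<times> 'v aut word) set" where
  "R3s \<Gamma> x = {([neg (wh \<Gamma> B b), pos (wh \<Gamma> A a), pos (wh \<Gamma> B b)], [pos (wh \<Gamma> A a)]) |A a B b.
     Omega2 \<Gamma> x A a \<and> Omega2 \<Gamma> x B b \<and> linv a \<in> B \<and> b \<notin> A \<and> A \<subseteq> B}"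

definition R4 :: "'v graph \<Rightarrow> 'v \<Rightarrow> ('v aut word \<times> 'v aut word) set" where
  "R4 \<Gamma> x = {([neg (wh \<Gamma> B b), pos (wh \<Gamma> A a), pos (wh \<Gamma> B b)], [pos (wh \<Gamma> (A \<union> B - {b}) a)])
     |A a B b.
     Omega2 \<Gamma> x A a \<and> Omega2 \<Gamma> x B b \<and> linv a \<notin> B \<and> linv b \<in> A \<and> A \<inter> B = {}}"

definition R4s :: "'v graph \<Rightarrow> 'v \<Rightarrow> ('v aut word \<times> 'v aut word) set" where
  "R4s \<Gamma> x = {([neg (wh \<Gamma> B b), pos (wh \<Gamma> A a), pos (wh \<Gamma> B b)],
               [pos (wh \<Gamma> (insert (linv b) (B - A)) (linv a))]) |A a B b.
     Omega2 \<Gamma> x A a \<and> Omega2 \<Gamma> x B b \<and> linv a \<in> B \<and> b \<in> A \<and> A \<subseteq> B}"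

definition R5 :: "'v graph \<Rightarrow> 'v \<Rightarrow> ('v aut word \<times> 'v aut word) set" where
  "R5 \<Gamma> x = {([pos (wh \<Gamma> A a), pos (wh \<Gamma> (insert (linv a) (A - {a})) b)],
              [pos (sigma \<Gamma> a b), pos (wh \<Gamma> (insert (linv b) (A - {b})) a)]) |A a b.
     Omega2 \<Gamma> x A a \<and> a \<in> sgn_set (cls \<Gamma> x) \<and> b \<in> sgn_set (cls \<Gamma> x) \<and> a \<noteq> b \<and>
     b \<in> A \<and> linv b \<notin> A}"

definition R6 :: "'v graph \<Rightarrow> 'v \<Rightarrow> ('v aut word \<times> 'v aut word) set" where
  "R6 \<Gamma> x = {([neg \<sigma>, pos (wh \<Gamma> A a), pos \<sigma>],
              [pos (wh \<Gamma> ((\<lambda>l. lact \<Gamma> l \<sigma>) ` A) (lact \<Gamma> a \<sigma>))]) |A a \<sigma>.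
     Omega2 \<Gamma> x A a \<and> \<sigma> \<in> Omega1 \<Gamma> x}"

definition R7 :: "'v graph \<Rightarrow> 'v \<Rightarrow> ('v aut word \<times> 'v aut word) set" where
  "R7 \<Gamma> x = {([pos \<sigma>, pos \<tau>], [pos (\<sigma> \<otimes>\<^bsub>aut_right (raag \<Gamma>)\<^esub> \<tau>)]) |\<sigma> \<tau>.
     \<sigma> \<in> Omega1 \<Gamma> x \<and> \<tau> \<in> Omega1 \<Gamma> x}"

definition Rels :: "'v graph \<Rightarrow> 'v \<Rightarrow> ('v aut word \<times> 'v aut word) set" where
  "Rels \<Gamma> x = R1 \<Gamma> x \<union> R2 \<Gamma> x \<union> R3 \<Gamma> x \<union> R3s \<Gamma> x \<union> R4 \<Gamma> x \<union> R4s \<Gamma> x \<union> R5 \<Gamma> x \<union> R6 \<Gamma> x \<union> R7 \<Gamma> x"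

end

theory Submission
  imports Defs
begin

text \<open>Since \<open>a(x) \<noteq> cl(x)\<close>, the group \<open>G([x] \<union> a_out(x))\<close> is the free product of the free group
  on \<open>[x]\<close> and \<open>H = G(a_out(x))\<close>, and restriction identifies the group in question with the
  automorphisms of this free product that fix \<open>H\<close> pointwise. For such an automorphism \<open>\<phi>\<close>, let
  the capacity of a set \<open>S\<close> be the number of edges of the Cayley tree of \<open>[x]\<close>-letters, pulled back by
  \<open>\<phi>\<close>, that leave \<open>S\<close>; the sum of the capacities of the cylinders \<open>Z u\<close> counts the
  \<open>[x]\<close>-letters in the images of the generators. A Whitehead automorphism changes this length by the
  difference of two capacities, and submodularity of the capacity gives peak reduction, with the
  relations supplying the moves. An automorphism of minimal length is a permutation of the letters
  up to multiplication by \<open>H\<close>, and these are presented directly.\<close>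

section \<open>Ping-pong in a free product with a free factor\<close>

text \<open>The obstacle is that H is in general infinite: the directions at the base vertex of the
  tree are the pairs in \<open>L \<times> H\<close>, not only the letters. A reduction of length is
  therefore described by a finite partial function from letters to H, that is, by a Whitehead pair
  with multiplier in \<open>[x]\<close> preceded by a twist by elements of H. Two such partial
  functions may meet after several different shifts by H, and then their union need not be
  single-valued; \<open>crossing_reduction\<close> first shows that, unless a better reduction
  exists, only one shift matters. Pairs with multiplier in \<open>a_out\<close> do not change the
  length. Together with the letter permutations they form the subgroup \<open>Lam\<close>, and peak
  reduction is carried out modulo \<open>Lam\<close>. It is stated for an abstract group
  \<open>P\<close> acting through \<Phi>, because it is applied to the presented group, where an
  equation may be used only if it follows from the relations; the automorphisms enter through
  lengths and capacities. Injectivity of the map to automorphisms is thereby reduced to injectivity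
  on \<open>Lam\<close>.\<close>

lemma linv_linv [simp]: "linv (linv u) = u"
  by (simp add: linv_def)

lemma linv_neq [simp]: "linv u \<noteq> u" "u \<noteq> linv u"
  by (auto simp: linv_def prod_eq_iff)

lemma fst_linv [simp]: "fst (linv u) = fst u"
  by (simp add: linv_def)

lemma linv_eq_iff: "linv u = v \<longleftrightarrow> u = linv v"
  by (metis linv_linv)

lemma linv_inject [simp]: "linv u = linv v \<longleftrightarrow> u = v"
  by (metis linv_linv)

lemma fst_eq_linv: "fst u = fst v \<longleftrightarrow> u = v \<or> u = linv v"
  by (auto simp: linv_def prod_eq_iff)

lemma linv_sgn_set [simp]: "linv u \<in> sgn_set Y \<longleftrightarrow> u \<in> sgn_set Y"
  by (auto simp: sgn_set_def linv_def mem_Times_iff)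

lemma finite_sgn_set [simp]: "finite Y \<Longrightarrow> finite (sgn_set Y)"
  by (simp add: sgn_set_def)

lemma (in group) inv_mult_cancel [simp]:
  "x \<in> carrier G \<Longrightarrow> y \<in> carrier G \<Longrightarrow> inv x \<otimes> (x \<otimes> y) = y"
  "x \<in> carrier G \<Longrightarrow> y \<in> carrier G \<Longrightarrow> x \<otimes> (inv x \<otimes> y) = y"
  by (simp_all flip: m_assoc)

text \<open>Bounding union and intersection separately lets submodularity be checked edge by edge:
  what is counted twice on the left must be counted twice on the right.\<close>

lemma card_add_le_of_Un_Int:
  assumes "finite C" "finite D" "A \<union> B \<subseteq> C \<union> D" "A \<inter> B \<subseteq> C \<inter> D"
  shows "card A + card B \<le> card C + card D"
proof -
  have "finite (A \<union> B)"
    using finite_subset[OF assms(3)] assms(1,2) by simp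
  then have f: "finite A" "finite B" by simp_all
  have "card A + card B = card (A \<union> B) + card (A \<inter> B)"
    using f by (rule card_Un_Int)
  also have "\<dots> \<le> card (C \<union> D) + card (C \<inter> D)"
    using assms by (intro add_mono card_mono) auto
  also have "\<dots> = card C + card D"
    using card_Un_Int[OF assms(1,2)] by simp
  finally show ?thesis .
qed

text \<open>In the application \<open>Z u\<close> consists of the elements whose reduced form begins
  with the inverse of \<open>u\<close>, without a coefficient in front, so that left multiplication
  by \<open>e u\<close> shortens exactly these; \<open>len\<close> counts the letters from
  \<open>X\<close>. The vertices of the tree are the cosets of H, its edges lead from k to
  \<open>k \<otimes> e u\<close>, and the pair \<open>(u, h)\<close> with
  \<open>h \<otimes> g \<in> Z u\<close> is the direction from the base vertex towards
  \<open>g\<close>.\<close>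

locale rel_free = group G for G (structure) +
  fixes H :: "'a set" and X :: "'v set" and e :: "'v letter \<Rightarrow> 'a"
    and Z :: "'v letter \<Rightarrow> 'a set" and len :: "'a \<Rightarrow> nat"
  assumes subH: "subgroup H G"
    and finX: "finite X"
    and e_carrier [simp]: "u \<in> sgn_set X \<Longrightarrow> e u \<in> carrier G"
    and e_linv: "u \<in> sgn_set X \<Longrightarrow> e (linv u) = inv (e u)"
    and Z_carrier: "u \<in> sgn_set X \<Longrightarrow> Z u \<subseteq> carrier G"
    and cover: "g \<in> carrier G \<Longrightarrow> g \<notin> H \<Longrightarrow> \<exists>h\<in>H. \<exists>u\<in>sgn_set X. h \<otimes> g \<in> Z u"
    and H_Z: "u \<in> sgn_set X \<Longrightarrow> h \<in> H \<Longrightarrow> h \<notin> Z u"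
    and disj: "u \<in> sgn_set X \<Longrightarrow> v \<in> sgn_set X \<Longrightarrow> h \<in> H \<Longrightarrow> g \<in> Z u \<Longrightarrow> h \<otimes> g \<in> Z v \<Longrightarrow> u = v \<and> h = \<one>"
    and flip: "u \<in> sgn_set X \<Longrightarrow> g \<in> carrier G \<Longrightarrow> e u \<otimes> g \<in> Z (linv u) \<longleftrightarrow> g \<notin> Z u"
    and Z_right: "u \<in> sgn_set X \<Longrightarrow> g \<in> Z u \<Longrightarrow> h \<in> H \<Longrightarrow> g \<otimes> h \<in> Z u"
    and len_H: "h \<in> H \<Longrightarrow> len h = 0"
    and len_left: "h \<in> H \<Longrightarrow> g \<in> carrier G \<Longrightarrow> len (h \<otimes> g) = len g"
    and len_Z: "u \<in> sgn_set X \<Longrightarrow> g \<in> Z u \<Longrightarrow> len g = Suc (len (e u \<otimes> g))"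
begin

abbreviation L where "L \<equiv> sgn_set X"

lemma H_carrier [simp]: "h \<in> H \<Longrightarrow> h \<in> carrier G"
  using subgroup.mem_carrier[OF subH] .

lemma H_one [simp]: "\<one> \<in> H"
  using subgroup.one_closed[OF subH] .

lemma H_inv [simp]: "h \<in> H \<Longrightarrow> inv h \<in> H"
  using subgroup.m_inv_closed[OF subH] .

lemma H_mult [simp]: "h \<in> H \<Longrightarrow> k \<in> H \<Longrightarrow> h \<otimes> k \<in> H"
  using subgroup.m_closed[OF subH] .

lemma Z_car: "u \<in> L \<Longrightarrow> g \<in> Z u \<Longrightarrow> g \<in> carrier G"
  using Z_carrier by blast

lemma finL: "finite L"
  by (simp add: finX)

lemma Z_disj: "u \<in> L \<Longrightarrow> v \<in> L \<Longrightarrow> g \<in> Z u \<Longrightarrow> g \<in> Z v \<Longrightarrow> u = v"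
  using disj[of u v \<one> g] by (simp add: Z_car)

lemma Z_right_iff: "u \<in> L \<Longrightarrow> g \<in> carrier G \<Longrightarrow> h \<in> H \<Longrightarrow> g \<otimes> h \<in> Z u \<longleftrightarrow> g \<in> Z u"
  using Z_right[of u g h] Z_right[of u "g \<otimes> h" "inv h"] by (auto simp: m_assoc)

lemma flip_inv: "u \<in> L \<Longrightarrow> g \<in> carrier G \<Longrightarrow> inv (e u) \<otimes> g \<in> Z u \<longleftrightarrow> g \<notin> Z (linv u)"
  using flip[of "linv u" g] by (simp add: e_linv)

lemma Z_linv: "u \<in> L \<Longrightarrow> g \<in> carrier G \<Longrightarrow> g \<in> Z (linv u) \<longleftrightarrow> inv (e u) \<otimes> g \<notin> Z u"
  using flip_inv by blast

lemma e_in_Z: "u \<in> L \<Longrightarrow> e u \<in> Z (linv u)"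
  using flip[of u \<one>] H_Z[of u \<one>] by simp

lemma inv_e_in_Z: "u \<in> L \<Longrightarrow> inv (e u) \<in> Z u"
  using e_in_Z[of "linv u"] by (simp add: e_linv)

lemma e_notin_H: "u \<in> L \<Longrightarrow> e u \<notin> H"
  using e_in_Z[of u] H_Z[of "linv u" "e u"] by auto

lemma left_cases [consumes 1, case_names H Z]:
  assumes "g \<in> carrier G"
  obtains "g \<in> H" | h u where "h \<in> H" "u \<in> L" "h \<otimes> g \<in> Z u"
  using cover assms by blast

text \<open>The leading coefficient and the leading letter are stripped, which lowers
  \<open>len\<close>; the side condition \<open>g \<notin> Z u\<close> records that putting them
  back causes no cancellation.\<close>

lemma left_induct [consumes 1, case_names H Z]:
  assumes "g \<in> carrier G"
    and H: "\<And>h. h \<in> H \<Longrightarrow> Q h"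
    and Z: "\<And>h u g. h \<in> H \<Longrightarrow> u \<in> L \<Longrightarrow> g \<in> carrier G \<Longrightarrow> g \<notin> Z u \<Longrightarrow> Q g \<Longrightarrow> Q (h \<otimes> (e u \<otimes> g))"
  shows "Q g"
  using assms(1)
proof (induction "len g" arbitrary: g rule: less_induct)
  case less
  from \<open>g \<in> carrier G\<close> show ?case
  proof (cases rule: left_cases)
    case H
    then show ?thesis using assms(2) by blast
  next
    case (Z h u)
    let ?k = "e u \<otimes> (h \<otimes> g)"
    have car: "?k \<in> carrier G" using Z less.prems by simp
    have "len ?k < len g"
      using len_Z[OF Z(2,3)] len_left[OF Z(1) less(2)] by simp
    then have Q: "Q ?k" using less.hyps car by blast
    have nin: "?k \<notin> Z (linv u)" using flip[of u "h \<otimes> g"] Z less.prems by simp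
    have "Q (inv h \<otimes> (e (linv u) \<otimes> ?k))"
      using Z by (intro assms(3) car nin Q) auto
    moreover have "inv h \<otimes> (e (linv u) \<otimes> ?k) = g"
      using Z less.prems by (simp add: e_linv)
    ultimately show ?thesis by simp
  qed
qed

text \<open>Connectedness of the Cayley graph for the generators from H and L. It is used in the
  form that a nonempty set without boundary edges is everything.\<close>

lemma closed_imp_all:
  assumes "g \<in> S" "g \<in> carrier G" "k \<in> carrier G"
    and H: "\<And>g h. g \<in> S \<Longrightarrow> g \<in> carrier G \<Longrightarrow> h \<in> H \<Longrightarrow> g \<otimes> h \<in> S"
    and L: "\<And>g u. g \<in> S \<Longrightarrow> g \<in> carrier G \<Longrightarrow> u \<in> L \<Longrightarrow> g \<otimes> e u \<in> S"
  shows "k \<in> S"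
proof -
  \<comment> \<open>Generators are peeled off the left of \<open>x\<close> and absorbed into the
    starting point, which therefore has to be universally quantified.\<close>
  have "\<forall>g\<in>S. g \<in> carrier G \<longrightarrow> g \<otimes> x \<in> S" if "x \<in> carrier G" for x
    using that
  proof (induction rule: left_induct)
    case (H h)
    then show ?case using assms(4) by blast
  next
    case (Z h u x)
    show ?case
    proof (intro ballI impI)
      fix g assume g: "g \<in> S" "g \<in> carrier G"
      have "(g \<otimes> h) \<otimes> e u \<in> S" using g Z assms(4,5) by simp
      then have "(g \<otimes> h) \<otimes> e u \<otimes> x \<in> S" using Z g by simp
      then show "g \<otimes> (h \<otimes> (e u \<otimes> x)) \<in> S" using Z g by (simp add: m_assoc)
    qed
  qed
  from this[of "inv g \<otimes> k"] show ?thesis using assms by auto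
qed

definition Au :: "('a \<Rightarrow> 'a) set" where
  "Au = {\<phi> \<in> hom G G. bij_betw \<phi> (carrier G) (carrier G) \<and> (\<forall>h\<in>H. \<phi> h = h)}"

lemma AuD:
  assumes "\<phi> \<in> Au"
  shows "\<phi> \<in> hom G G" "bij_betw \<phi> (carrier G) (carrier G)" "h \<in> H \<Longrightarrow> \<phi> h = h"
  using assms unfolding Au_def by blast+

lemma Au_mult:
  "\<phi> \<in> Au \<Longrightarrow> g \<in> carrier G \<Longrightarrow> k \<in> carrier G \<Longrightarrow> \<phi> (g \<otimes> k) = \<phi> g \<otimes> \<phi> k"
  by (rule hom_mult[OF AuD(1)])

lemma Au_closed: "\<phi> \<in> Au \<Longrightarrow> g \<in> carrier G \<Longrightarrow> \<phi> g \<in> carrier G"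
  by (rule hom_in_carrier[OF AuD(1)])

lemmas Au_H = AuD(3)

lemma Au_inv:
  assumes "\<phi> \<in> Au" "g \<in> carrier G"
  shows "\<phi> (inv g) = inv (\<phi> g)"
proof -
  have "\<phi> (inv g) \<otimes> \<phi> g = \<one>"
    using Au_mult[OF assms(1), of "inv g" g] Au_H[OF assms(1) H_one] assms(2) by simp
  then show ?thesis
    using Au_closed[OF assms(1)] assms(2) by (metis inv_closed inv_equality)
qed

lemma Au_inj:
  "\<phi> \<in> Au \<Longrightarrow> g \<in> carrier G \<Longrightarrow> k \<in> carrier G \<Longrightarrow> \<phi> g = \<phi> k \<longleftrightarrow> g = k"
  by (rule inj_on_eq_iff[OF bij_betw_imp_inj_on[OF AuD(2)]])

lemma Au_surj: "\<phi> \<in> Au \<Longrightarrow> g \<in> carrier G \<Longrightarrow> \<exists>k\<in>carrier G. \<phi> k = g"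
proof -
  assume "\<phi> \<in> Au" "g \<in> carrier G"
  then have "g \<in> \<phi> ` carrier G" by (simp add: Au_def bij_betw_def)
  then show ?thesis by blast
qed

lemma Au_H_iff: "\<phi> \<in> Au \<Longrightarrow> g \<in> carrier G \<Longrightarrow> \<phi> g \<in> H \<longleftrightarrow> g \<in> H"
  by (metis Au_H Au_inj H_carrier)

text \<open>The sets \<open>Z u\<close> are determined by the basis through the ping-pong conditions.\<close>

lemma Z_transport:
  assumes \<phi>: "\<phi> \<in> Au"
    and CH: "\<And>u h. u \<in> L \<Longrightarrow> h \<in> H \<Longrightarrow> h \<notin> C u"
    and Cdisj: "\<And>u v h g. u \<in> L \<Longrightarrow> v \<in> L \<Longrightarrow> h \<in> H \<Longrightarrow> g \<in> carrier G \<Longrightarrow> g \<in> C u \<Longrightarrow> h \<otimes> g \<in> C v \<Longrightarrow> u = v \<and> h = \<one>"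
    and Cflip: "\<And>u g. u \<in> L \<Longrightarrow> g \<in> carrier G \<Longrightarrow> \<phi> (e u) \<otimes> g \<in> C (linv u) \<longleftrightarrow> g \<notin> C u"
    and u: "u \<in> L" and g: "g \<in> carrier G"
  shows "\<phi> g \<in> C u \<longleftrightarrow> g \<in> Z u"
proof -
  have sub: "\<phi> g \<in> C u" if "u \<in> L" "g \<in> Z u" for u g
    using that
  proof (induction "len g" arbitrary: g u rule: less_induct)
    case less
    let ?k = "e u \<otimes> g"
    note ul = less.prems(1)
    have gc: "g \<in> carrier G" using less.prems Z_car by blast
    have pg: "\<phi> g \<in> carrier G" using Au_closed[OF \<phi> gc] .
    have pe: "\<phi> (e u) \<in> carrier G" using Au_closed[OF \<phi>] ul by simp
    have kc: "?k \<in> carrier G" using less.prems gc by simp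
    have kn: "?k \<notin> Z (linv u)" using flip[of u g] less.prems gc by simp
    have "\<phi> ?k \<notin> C (linv u)"
      using kc
    proof (cases rule: left_cases)
      case H
      then have "\<phi> ?k \<in> H" using Au_H_iff[OF \<phi> kc] by simp
      then show ?thesis using CH[of "linv u"] less.prems by auto
    next
      case (Z h v)
      have "len (h \<otimes> ?k) < len g"
        using len_Z[OF less(2,3)] len_left[OF Z(1) kc] by simp
      then have "\<phi> (h \<otimes> ?k) \<in> C v" using less.hyps Z by blast
      then have "h \<otimes> \<phi> ?k \<in> C v" using Z kc Au_mult[OF \<phi>, of h ?k] Au_H[OF \<phi>] by simp
      then show ?thesis
        using Cdisj[of "linv u" v h "\<phi> ?k"] Z ul kc kn \<phi> by (metis Au_closed l_one linv_sgn_set)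
    qed
    then show ?case
      using Cflip[of u "\<phi> g"] ul gc pg Au_mult[OF \<phi>, of "e u" g] by simp
  qed
  show ?thesis
  proof
    \<comment> \<open>No second induction is needed for the converse: an element outside H lies in a
      translate of some \<open>Z v\<close>, its image lies in the same translate of
      \<open>C v\<close>, and translates of the \<open>C\<close> are disjoint.\<close>
    assume a: "\<phi> g \<in> C u"
    from g show "g \<in> Z u"
    proof (cases rule: left_cases)
      case H
      then show ?thesis using a CH u \<phi> by (metis Au_H)
    next
      case (Z h v)
      then have "\<phi> (h \<otimes> g) \<in> C v" using sub by blast
      then have "h \<otimes> \<phi> g \<in> C v" using Z g Au_mult[OF \<phi>, of h g] Au_H[OF \<phi>] by simp
      then have "u = v \<and> h = \<one>" using Cdisj[of u v h "\<phi> g"] a u Z Au_closed[OF \<phi> g] by simp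
      then show ?thesis using Z g by simp
    qed
  qed (use sub u in blast)
qed

lemma boundary_unique:
  assumes "u \<in> L" "v \<in> L" "k \<in> Z v" "k \<otimes> e u \<notin> Z v"
  shows "u = v \<and> k = inv (e u)"
  using assms
proof (induction "len k" arbitrary: k v rule: less_induct)
  case less
  let ?k = "e v \<otimes> k"
  have kc: "k \<in> carrier G" using less.prems Z_car by blast
  have k1c: "?k \<in> carrier G" using kc less.prems by simp
  have k1n: "?k \<notin> Z (linv v)" using flip[of v k] less.prems kc by simp
  have k1u: "?k \<otimes> e u \<in> Z (linv v)"
    using flip[of v "k \<otimes> e u"] less.prems kc by (simp add: m_assoc)
  from k1c show ?case
  proof (cases rule: left_cases)
    case H
    have "linv u = linv v \<and> ?k = \<one>"
      using disj[OF _ _ H e_in_Z[OF less(2)] k1u] less.prems by simp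
    then have "inv k = e v" "u = v" using inv_equality[of "e v" k] less.prems kc by auto
    then show ?thesis using inv_inv[OF kc] by simp
  next
    case (Z h z)
    have "len (h \<otimes> ?k) < len k"
      using len_Z[OF less(3,4)] len_left[OF Z(1) k1c] by simp
    moreover have "h \<otimes> ?k \<otimes> e u \<notin> Z z"
    proof
      assume "h \<otimes> ?k \<otimes> e u \<in> Z z"
      then have "h \<otimes> (?k \<otimes> e u) \<in> Z z" using Z k1c less.prems by (simp add: m_assoc)
      then have "linv v = z \<and> h = \<one>" using disj[OF _ Z(2,1) k1u] less.prems by simp
      then show False using k1n Z k1c by simp
    qed
    ultimately have *: "u = z \<and> h \<otimes> ?k = inv (e u)"
      using less.hyps less.prems(1) Z by blast
    then have "inv h \<otimes> (h \<otimes> ?k) \<otimes> e u = inv h \<otimes> inv (e u) \<otimes> e u" by simp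
    then have "?k \<otimes> e u = inv h" using Z k1c less(2) by (simp add: m_assoc)
    then show ?thesis using k1u H_Z[of "linv v" "inv h"] Z less.prems by simp
  qed
qed

lemma boundary_enter:
  assumes "u \<in> L" "v \<in> L" "k \<in> carrier G" "k \<notin> Z v" "k \<otimes> e u \<in> Z v"
  shows "v = linv u \<and> k = \<one>"
proof -
  have "linv u = v \<and> k \<otimes> e u = inv (e (linv u))"
    using assms by (intro boundary_unique) (auto simp: e_linv m_assoc)
  then have "v = linv u" "k \<otimes> e u \<otimes> inv (e u) = e u \<otimes> inv (e u)"
    using assms by (auto simp: e_linv)
  then show ?thesis using assms by (simp add: m_assoc)
qed

text \<open>No cancellation takes place in \<open>k \<otimes> m\<close> if \<open>m\<close> begins with \<open>inv (e z)\<close> and \<open>k\<close> does not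
  end with \<open>e z\<close>.\<close>

lemma no_cancel:
  assumes "z \<in> L" "m \<in> Z z" "k \<in> carrier G" "inv k \<notin> Z z"
  shows "len (k \<otimes> m) = len k + len m \<and>
    (\<forall>h\<in>H. \<forall>v\<in>L. h \<otimes> k \<in> Z v \<longrightarrow> h \<otimes> (k \<otimes> m) \<in> Z v)"
  using assms(3,4)
proof (induction rule: left_induct)
  case (H h)
  then show ?case using assms H_Z by (auto simp: len_H len_left Z_car)
next
  case (Z h u k)
  have mc: "m \<in> carrier G" using assms Z_car by blast
  \<comment> \<open>Otherwise the step from \<open>inv k\<close> to
    \<open>inv k \<otimes> e (linv u)\<close> leaves \<open>Z z\<close>, which forces
    \<open>k = inv (e u)\<close>, contrary to \<open>k \<notin> Z u\<close>.\<close>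
  have "inv k \<notin> Z z"
  proof
    assume a: "inv k \<in> Z z"
    have "inv (h \<otimes> (e u \<otimes> k)) = inv k \<otimes> e (linv u) \<otimes> inv h"
      using Z by (simp add: inv_mult_group e_linv m_assoc)
    then have "inv k \<otimes> e (linv u) \<notin> Z z"
      using Z Z_right_iff[of z "inv k \<otimes> e (linv u)" "inv h"] assms by simp
    then have "linv u = z \<and> inv k = inv (e (linv u))"
      using boundary_unique[of "linv u" z "inv k"] a Z assms by simp
    then have "k = inv (e u)" using Z by (metis e_linv inv_inv e_carrier linv_sgn_set)
    then show False using Z inv_e_in_Z by blast
  qed
  then have IH: "len (k \<otimes> m) = len k + len m"
      "\<And>h v. h \<in> H \<Longrightarrow> v \<in> L \<Longrightarrow> h \<otimes> k \<in> Z v \<Longrightarrow> h \<otimes> (k \<otimes> m) \<in> Z v"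
    using Z by auto
  have km: "k \<otimes> m \<notin> Z u"
    using \<open>k \<in> carrier G\<close>
  proof (cases rule: left_cases)
    case H
    show ?thesis
    proof
      assume "k \<otimes> m \<in> Z u"
      then have *: "z = u \<and> k = \<one>" using disj[of z u k m] assms H Z by simp
      then have "inv (h \<otimes> (e u \<otimes> k)) = inv (e z) \<otimes> inv h"
        using Z by (simp add: inv_mult_group)
      then show False using Z assms Z_right_iff[of z "inv (e z)" "inv h"] inv_e_in_Z[of z] by simp
    qed
  next
    case hv: (Z h' v)
    then have "h' \<otimes> (k \<otimes> m) \<in> Z v" using IH by blast
    then show ?thesis
      using disj[of u v h' "k \<otimes> m"] hv Z by auto
  qed
  have t: "e u \<otimes> k \<in> Z (linv u)" "e u \<otimes> (k \<otimes> m) \<in> Z (linv u)"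
    using flip[of u] Z km mc by auto
  have "len (h \<otimes> (e u \<otimes> k) \<otimes> m) = len (e u \<otimes> (k \<otimes> m))"
    using Z mc len_left[of h "e u \<otimes> (k \<otimes> m)"] by (simp add: m_assoc)
  also have "\<dots> = Suc (len (k \<otimes> m))"
    using len_Z[of "linv u" "e u \<otimes> (k \<otimes> m)"] t Z mc by (simp add: e_linv)
  also have "\<dots> = len (e u \<otimes> k) + len m"
    using len_Z[of "linv u" "e u \<otimes> k"] t Z IH by (simp add: e_linv)
  finally have 1: "len (h \<otimes> (e u \<otimes> k) \<otimes> m) = len (h \<otimes> (e u \<otimes> k)) + len m"
    using Z by (simp add: len_left)
  have 2: "h' \<otimes> (h \<otimes> (e u \<otimes> k) \<otimes> m) \<in> Z v"
    if "h' \<in> H" "v \<in> L" "h' \<otimes> (h \<otimes> (e u \<otimes> k)) \<in> Z v" for h' v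
  proof -
    have "linv u = v \<and> h' \<otimes> h = \<one>"
      using disj[of "linv u" v "h' \<otimes> h" "e u \<otimes> k"] that Z t by (simp add: m_assoc)
    moreover have "h' \<otimes> (h \<otimes> (e u \<otimes> k) \<otimes> m) = h' \<otimes> h \<otimes> (e u \<otimes> (k \<otimes> m))"
      using that Z mc by (simp add: m_assoc)
    ultimately show ?thesis using t Z mc by simp
  qed
  show ?case using 1 2 by blast
qed

end

section \<open>Capacities of subsets and their submodularity\<close>

context rel_free
begin

text \<open>Together with \<open>cover\<close> this gives every element outside H a unique first
  edge from the base vertex, labelled by a pair in \<open>L \<times> H\<close>.\<close>

lemma direction_unique:
  assumes "u \<in> L" "v \<in> L" "h \<in> H" "k \<in> H" "g \<in> carrier G" "h \<otimes> g \<in> Z u" "k \<otimes> g \<in> Z v"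
  shows "u = v \<and> h = k"
proof -
  have "(k \<otimes> inv h) \<otimes> (h \<otimes> g) \<in> Z v" using assms by (simp add: m_assoc)
  then have *: "u = v \<and> k \<otimes> inv h = \<one>" using disj[of u v "k \<otimes> inv h" "h \<otimes> g"] assms by simp
  have "k = k \<otimes> inv h \<otimes> h" using assms by (simp add: m_assoc)
  then show ?thesis using * assms by simp
qed

text \<open>For a basis element \<open>g\<close> this is the part of the coboundary of
  \<open>S\<close> formed by the edges with label \<open>g\<close>, indexed by their initial
  vertices.\<close>

definition cross :: "'a set \<Rightarrow> 'a \<Rightarrow> 'a set" where
  "cross S g = {k \<in> carrier G. (k \<in> S) \<noteq> (k \<otimes> g \<in> S)}"

text \<open>The almost invariant sets of the theory of ends. As \<open>card\<close> of an infinite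
  set is 0, capacities are meaningful only for such sets.\<close>

definition tame :: "'a set \<Rightarrow> bool" where
  "tame S \<longleftrightarrow> (\<forall>g\<in>carrier G. finite (cross S g))"

text \<open>The left translate of \<open>S\<close> by \<open>inv h\<close>. The inverse is chosen to
  match the pairs \<open>(u, h)\<close>, which stand for the condition
  \<open>h \<otimes> g \<in> Z u\<close>.\<close>

definition transl :: "'a \<Rightarrow> 'a set \<Rightarrow> 'a set" where
  "transl h S = {g \<in> carrier G. h \<otimes> g \<in> S}"

definition right_inv :: "'a set \<Rightarrow> bool" where
  "right_inv S \<longleftrightarrow> (\<forall>g\<in>carrier G. \<forall>h\<in>H. g \<otimes> h \<in> S \<longleftrightarrow> g \<in> S)"

text \<open>Only positive letters are summed, because a letter and its inverse traverse the same
  edges. For \<open>S = Z u\<close> this counts the occurrences of \<open>u\<close> and its inverse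
  in the images of the generators.\<close>

definition cap :: "('a \<Rightarrow> 'a) \<Rightarrow> 'a set \<Rightarrow> nat" where
  "cap \<phi> S = (\<Sum>x\<in>X. card (cross S (\<phi> (e (x, True)))))"

definition pre :: "('a \<Rightarrow> 'a) \<Rightarrow> 'a set \<Rightarrow> 'a set" where
  "pre \<psi> S = {g \<in> carrier G. \<psi> g \<in> S}"

lemma pos_L [simp]: "x \<in> X \<Longrightarrow> (x, b) \<in> L"
  by (simp add: sgn_set_def)

lemma gen_closed: "\<phi> \<in> Au \<Longrightarrow> x \<in> X \<Longrightarrow> \<phi> (e (x, b)) \<in> carrier G"
  using Au_closed[of \<phi> "e (x, b)"] by simp

lemma cross_sub:
  assumes "g \<in> carrier G" "k \<in> carrier G"
  shows "cross S (g \<otimes> k) \<subseteq> cross S g \<union> (\<lambda>m. m \<otimes> inv g) ` cross S k"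
proof
  fix m assume m: "m \<in> cross S (g \<otimes> k)"
  show "m \<in> cross S g \<union> (\<lambda>m. m \<otimes> inv g) ` cross S k"
  proof (cases "m \<in> cross S g")
    case False
    then have "m \<otimes> g \<in> cross S k" using m assms by (auto simp: cross_def m_assoc)
    moreover have "m = m \<otimes> g \<otimes> inv g" using m assms by (auto simp: cross_def m_assoc)
    ultimately show ?thesis by blast
  qed simp
qed

lemma cross_H: "right_inv S \<Longrightarrow> h \<in> H \<Longrightarrow> cross S h = {}"
  by (auto simp: cross_def right_inv_def)

lemma Z_right_inv: "u \<in> L \<Longrightarrow> right_inv (Z u)"
  by (simp add: right_inv_def Z_right_iff)

lemma cross_Z_letter:
  assumes "u \<in> L" "v \<in> L"
  shows "cross (Z v) (e u) \<subseteq> {\<one>, inv (e u)}"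
  using boundary_unique[of u v] boundary_enter[of u v] assms by (auto simp: cross_def)

lemma cross_Z_letter_other:
  assumes "u \<in> L" "v \<in> L" "fst u \<noteq> fst v"
  shows "cross (Z v) (e u) = {}"
proof -
  have "u \<noteq> v" "v \<noteq> linv u" using assms by auto
  then show ?thesis
    using boundary_unique[OF assms(1,2)] boundary_enter[OF assms(1,2)] by (auto simp: cross_def)
qed

lemma cross_Z_pos:
  assumes "u \<in> L"
  shows "cross (Z u) (e u) = {inv (e u)}" "cross (Z (linv u)) (e u) = {\<one>}"
proof -
  have 1: "\<one> \<notin> Z u" "\<one> \<notin> Z (linv u)" using H_Z[OF _ H_one] assms by simp_all
  have 2: "e u \<in> Z (linv u)" "inv (e u) \<in> Z u" using e_in_Z inv_e_in_Z assms by simp_all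
  have 3: "e u \<notin> Z u" "inv (e u) \<notin> Z (linv u)"
    using Z_disj[of u "linv u" "e u"] Z_disj[of u "linv u" "inv (e u)"] 2 assms by auto
  show "cross (Z u) (e u) = {inv (e u)}" "cross (Z (linv u)) (e u) = {\<one>}"
    using cross_Z_letter[of u u] cross_Z_letter[of u "linv u"] 1 2 3 assms
    unfolding cross_def by auto
qed

text \<open>A single letter crosses \<open>Z u\<close> in at most two places, an element of H
  nowhere, and the crossings of a product are crossings of the factors up to translation.\<close>

lemma tame_Z: "u \<in> L \<Longrightarrow> tame (Z u)"
  unfolding tame_def
proof
  fix g assume u: "u \<in> L" and "g \<in> carrier G"
  from this(2) show "finite (cross (Z u) g)"
  proof (induction rule: left_induct)
    case (H h)
    then show ?case using cross_H Z_right_inv u by simp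
  next
    case (Z h v g)
    have "finite (cross (Z u) (e v \<otimes> g))"
      using Z u cross_Z_letter[of v u]
      by (intro finite_subset[OF cross_sub]) (auto intro: finite_subset)
    then show ?case
      using Z u cross_H[OF Z_right_inv[OF u] Z(1)]
      by (intro finite_subset[OF cross_sub]) auto
  qed
qed

lemma tame_of_cross_subset:
  assumes "tame S" "tame T" "\<And>g. cross U g \<subseteq> cross S g \<union> cross T g"
  shows "tame U"
  unfolding tame_def
proof
  fix g assume "g \<in> carrier G"
  then have "finite (cross S g \<union> cross T g)" using assms(1,2) by (simp add: tame_def)
  then show "finite (cross U g)" by (rule finite_subset[OF assms(3)])
qed

lemma tame_Int: "tame S \<Longrightarrow> tame T \<Longrightarrow> tame (S \<inter> T)"
  by (erule (1) tame_of_cross_subset) (auto simp: cross_def)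

lemma tame_Un: "tame S \<Longrightarrow> tame T \<Longrightarrow> tame (S \<union> T)"
  by (erule (1) tame_of_cross_subset) (auto simp: cross_def)

lemma cross_compl: "g \<in> carrier G \<Longrightarrow> cross (carrier G - S) g = cross S g"
  by (auto simp: cross_def)

lemma cross_transl:
  assumes "h \<in> carrier G" "g \<in> carrier G"
  shows "cross (transl h S) g = (\<lambda>k. inv h \<otimes> k) ` cross S g"
proof
  show "cross (transl h S) g \<subseteq> (\<lambda>k. inv h \<otimes> k) ` cross S g"
  proof
    fix k assume "k \<in> cross (transl h S) g"
    then have "h \<otimes> k \<in> cross S g" "k = inv h \<otimes> (h \<otimes> k)"
      using assms by (auto simp: cross_def transl_def m_assoc)
    then show "k \<in> (\<lambda>k. inv h \<otimes> k) ` cross S g" by blast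
  qed
qed (use assms in \<open>auto simp: cross_def transl_def m_assoc\<close>)

lemma tame_transl: "tame S \<Longrightarrow> h \<in> carrier G \<Longrightarrow> tame (transl h S)"
  by (simp add: tame_def cross_transl)

lemma card_cross_transl:
  assumes "h \<in> carrier G" "g \<in> carrier G"
  shows "card (cross (transl h S) g) = card (cross S g)"
proof -
  have "inj_on (\<lambda>k. inv h \<otimes> k) (cross S g)"
    using assms by (intro inj_onI) (simp add: cross_def)
  then show ?thesis by (simp add: cross_transl assms card_image)
qed

lemma cap_transl: "\<phi> \<in> Au \<Longrightarrow> h \<in> carrier G \<Longrightarrow> cap \<phi> (transl h S) = cap \<phi> S"
  by (simp add: cap_def card_cross_transl gen_closed)

lemma cap_compl: "\<phi> \<in> Au \<Longrightarrow> cap \<phi> (carrier G - S) = cap \<phi> S"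
  by (simp add: cap_def cross_compl gen_closed)

text \<open>The two half-trees cut off by one edge are complementary: \<open>Z (linv u)\<close> is
  the complement of a translate of \<open>Z u\<close>.\<close>

lemma cap_Z_linv:
  assumes "\<phi> \<in> Au" "u \<in> L"
  shows "cap \<phi> (Z (linv u)) = cap \<phi> (Z u)"
proof -
  have "Z (linv u) = carrier G - transl (inv (e u)) (Z u)"
    using Z_linv[OF assms(2)] Z_car[of "linv u"] assms(2) by (auto simp: transl_def)
  then show ?thesis using assms by (simp add: cap_compl cap_transl)
qed

lemma cap_Z_fst: "\<phi> \<in> Au \<Longrightarrow> u \<in> L \<Longrightarrow> v \<in> L \<Longrightarrow> fst u = fst v \<Longrightarrow> cap \<phi> (Z u) = cap \<phi> (Z v)"
  using fst_eq_linv[of u v] cap_Z_linv[of \<phi> v] by auto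

text \<open>An automorphism carries the coboundary of a preimage bijectively to the coboundary of
  the set. So following \<phi> by \<psi> can be traded for pulling the set back along \<psi>, and
  the effect of a Whitehead automorphism on length is read off from preimages of cylinders.\<close>

lemma cap_comp:
  assumes \<phi>: "\<phi> \<in> Au" and \<psi>: "\<psi> \<in> Au"
    and \<chi>: "\<And>x. x \<in> X \<Longrightarrow> \<chi> (e (x, True)) = \<psi> (\<phi> (e (x, True)))"
  shows "cap \<chi> S = cap \<phi> (pre \<psi> S)"
  unfolding cap_def
proof (intro sum.cong HOL.refl)
  fix x assume x: "x \<in> X"
  let ?g = "\<phi> (e (x, True))"
  have g: "?g \<in> carrier G" using gen_closed[OF \<phi> x] .
  have "cross S (\<psi> ?g) = \<psi> ` cross (pre \<psi> S) ?g"
  proof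
    show "cross S (\<psi> ?g) \<subseteq> \<psi> ` cross (pre \<psi> S) ?g"
    proof
      fix k assume k: "k \<in> cross S (\<psi> ?g)"
      then obtain m where m: "m \<in> carrier G" "\<psi> m = k"
        using Au_surj[OF \<psi>, of k] by (auto simp: cross_def)
      then have "m \<in> cross (pre \<psi> S) ?g"
        using k g Au_mult[OF \<psi>, of m ?g] by (auto simp: cross_def pre_def)
      then show "k \<in> \<psi> ` cross (pre \<psi> S) ?g" using m by blast
    qed
    show "\<psi> ` cross (pre \<psi> S) ?g \<subseteq> cross S (\<psi> ?g)"
    proof
      fix k assume "k \<in> \<psi> ` cross (pre \<psi> S) ?g"
      then obtain m where m: "m \<in> cross (pre \<psi> S) ?g" "k = \<psi> m" by blast
      then have "m \<in> carrier G" by (simp add: cross_def)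
      then show "k \<in> cross S (\<psi> ?g)"
        using m g Au_mult[OF \<psi>, of m ?g] Au_closed[OF \<psi>, of m] by (simp add: cross_def pre_def)
    qed
  qed
  moreover have "inj_on \<psi> (cross (pre \<psi> S) ?g)"
    by (rule inj_on_subset[OF bij_betw_imp_inj_on[OF AuD(2)[OF \<psi>]]]) (auto simp: cross_def)
  ultimately show "card (cross S (\<chi> (e (x, True)))) = card (cross (pre \<psi> S) ?g)"
    using \<chi>[OF x] by (simp add: card_image)
qed

text \<open>Checked edge by edge: an edge in the coboundary of one of the two corners lies in that
  of \<open>S\<close> or of \<open>T\<close>, and an edge in the coboundaries of both corners lies
  in those of both \<open>S\<close> and \<open>T\<close>.\<close>

lemma cap_submodular:
  assumes \<phi>: "\<phi> \<in> Au" and "tame S" "tame T"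
  shows "cap \<phi> (S \<inter> T) + cap \<phi> (S \<union> T) \<le> cap \<phi> S + cap \<phi> T"
    and "cap \<phi> (S - T) + cap \<phi> (T - S) \<le> cap \<phi> S + cap \<phi> T"
proof -
  have f: "finite (cross S (\<phi> (e (x, True))))" "finite (cross T (\<phi> (e (x, True))))" if "x \<in> X" for x
    using assms that gen_closed by (auto simp: tame_def)
  show "cap \<phi> (S \<inter> T) + cap \<phi> (S \<union> T) \<le> cap \<phi> S + cap \<phi> T"
    unfolding cap_def sum.distrib[symmetric]
    by (intro sum_mono card_add_le_of_Un_Int f) (auto simp: cross_def)
  show "cap \<phi> (S - T) + cap \<phi> (T - S) \<le> cap \<phi> S + cap \<phi> T"
    unfolding cap_def sum.distrib[symmetric]
    by (intro sum_mono card_add_le_of_Un_Int f) (auto simp: cross_def)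
qed

text \<open>A crossing of one of the intersections may cross \<open>S\<close>; then its end in
  \<open>S\<close> lies in only one of the two disjoint translates of \<open>T\<close>. Otherwise
  both its ends are in \<open>S\<close>, and its translate by \<open>k1\<close> or \<open>k2\<close>
  crosses \<open>T\<close> with its ends in one of the two disjoint translates of \<open>S\<close>.
  So no crossing of \<open>S\<close> or \<open>T\<close> is charged twice.\<close>

lemma cap_Int_two:
  assumes \<phi>: "\<phi> \<in> Au" and S: "tame S" "tame T" and k: "k1 \<in> carrier G" "k2 \<in> carrier G"
    and T: "transl k1 T \<inter> transl k2 T = {}"
    and S': "transl (inv k1) S \<inter> transl (inv k2) S = {}"
  shows "cap \<phi> (S \<inter> transl k1 T) + cap \<phi> (S \<inter> transl k2 T) \<le> cap \<phi> S + cap \<phi> T"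
  unfolding cap_def sum.distrib[symmetric]
proof (intro sum_mono)
  fix x assume x: "x \<in> X"
  define g where "g = \<phi> (e (x, True))"
  have g: "g \<in> carrier G" unfolding g_def using gen_closed[OF \<phi> x] .
  define X1 X2 where "X1 = cross (S \<inter> transl k1 T) g" and "X2 = cross (S \<inter> transl k2 T) g"
  define N1 N2 where "N1 = (\<lambda>j. k1 \<otimes> j) ` (X1 - cross S g)" and "N2 = (\<lambda>j. k2 \<otimes> j) ` (X2 - cross S g)"
  have fin: "finite (cross S g)" "finite (cross T g)" using S g by (auto simp: tame_def)
  have P: "X1 \<inter> cross S g \<inter> (X2 \<inter> cross S g) = {}"
    using T unfolding X1_def X2_def cross_def by blast
  have both: "j \<in> carrier G \<and> j \<in> S \<and> j \<otimes> g \<in> S \<and> k1 \<otimes> j \<in> cross T g" if "j \<in> X1 - cross S g" for j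
    using that g k unfolding X1_def cross_def transl_def by (auto simp: m_assoc)
  have both2: "j \<in> carrier G \<and> j \<in> S \<and> j \<otimes> g \<in> S \<and> k2 \<otimes> j \<in> cross T g" if "j \<in> X2 - cross S g" for j
    using that g k unfolding X2_def cross_def transl_def by (auto simp: m_assoc)
  have N: "N1 \<subseteq> cross T g" "N2 \<subseteq> cross T g"
    using both both2 by (auto simp: N1_def N2_def)
  have N1: "N1 \<subseteq> transl (inv k1) S"
    using both k by (auto simp: N1_def transl_def)
  have N2: "N2 \<subseteq> transl (inv k2) S"
    using both2 k by (auto simp: N2_def transl_def)
  have N12: "N1 \<inter> N2 = {}" using N1 N2 S' by blast
  have c1: "card N1 = card (X1 - cross S g)" unfolding N1_def
    using k by (intro card_image inj_onI) (auto simp: X1_def cross_def)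
  have c2: "card N2 = card (X2 - cross S g)" unfolding N2_def
    using k by (intro card_image inj_onI) (auto simp: X2_def cross_def)
  have tame: "tame (S \<inter> transl k1 T)" "tame (S \<inter> transl k2 T)"
    using S k by (auto intro: tame_Int tame_transl)
  then have fX: "finite X1" "finite X2" using g by (auto simp: X1_def X2_def tame_def)
  have d1: "card X1 = card (X1 \<inter> cross S g) + card (X1 - cross S g)"
    using fX(1) card_Un_disjoint[of "X1 \<inter> cross S g" "X1 - cross S g"] by (simp add: Int_Diff_Un Int_Diff_disjoint)
  have d2: "card X2 = card (X2 \<inter> cross S g) + card (X2 - cross S g)"
    using fX(2) card_Un_disjoint[of "X2 \<inter> cross S g" "X2 - cross S g"] by (simp add: Int_Diff_Un Int_Diff_disjoint)
  have a: "card (X1 \<inter> cross S g) + card (X2 \<inter> cross S g) \<le> card (cross S g)"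
    using card_Un_disjoint[OF _ _ P] fX card_mono[OF fin(1), of "(X1 \<inter> cross S g) \<union> (X2 \<inter> cross S g)"]
    by auto
  have b: "card N1 + card N2 \<le> card (cross T g)"
    using card_Un_disjoint[OF _ _ N12] finite_subset[OF N(1) fin(2)] finite_subset[OF N(2) fin(2)]
      card_mono[OF fin(2), of "N1 \<union> N2"] N by auto
  show "card (cross (S \<inter> transl k1 T) (\<phi> (e (x, True)))) + card (cross (S \<inter> transl k2 T) (\<phi> (e (x, True))))
    \<le> card (cross S (\<phi> (e (x, True)))) + card (cross T (\<phi> (e (x, True))))"
    using d1 d2 a b c1 c2 unfolding X1_def X2_def g_def[symmetric] by linarith
qed

text \<open>A set crossed by no edge of the image basis is closed under right multiplication by H
  and by the images of all letters, so by \<open>closed_imp_all\<close> its preimage would be empty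
  or everything.\<close>

lemma cap_pos:
  assumes \<phi>: "\<phi> \<in> Au" and S: "tame S" "right_inv S"
    and "g \<in> S" "g \<in> carrier G" "k \<notin> S" "k \<in> carrier G"
  shows "0 < cap \<phi> S"
proof (rule ccontr)
  assume "\<not> 0 < cap \<phi> S"
  then have z: "card (cross S (\<phi> (e (x, True)))) = 0" if "x \<in> X" for x
    using that finX by (simp add: cap_def)
  have empty: "cross S (\<phi> (e (x, True))) = {}" if "x \<in> X" for x
    using z[OF that] S(1) gen_closed[OF \<phi> that] by (simp add: tame_def)
  have pos: "m \<otimes> \<phi> (e (x, True)) \<in> S \<longleftrightarrow> m \<in> S" if "x \<in> X" "m \<in> carrier G" for x m
    using empty[OF that(1)] that by (auto simp: cross_def)
  have letter: "m \<otimes> \<phi> (e u) \<in> S \<longleftrightarrow> m \<in> S" if u: "u \<in> L" and m: "m \<in> carrier G" for u m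
  proof (cases u)
    case (Pair x b)
    with u have x: "x \<in> X" by (simp add: sgn_set_def)
    show ?thesis
    proof (cases b)
      case True
      then show ?thesis using pos[OF x m] Pair by simp
    next
      case False
      let ?y = "\<phi> (e (x, True))"
      have "e u = inv (e (x, True))" using e_linv[of "(x, True)"] x False Pair by (simp add: linv_def)
      then have *: "\<phi> (e u) = inv ?y" using Au_inv[OF \<phi>] x by simp
      have "m \<otimes> inv ?y \<otimes> ?y \<in> S \<longleftrightarrow> m \<otimes> inv ?y \<in> S"
        using pos[OF x] m gen_closed[OF \<phi> x] by simp
      then show ?thesis using * m gen_closed[OF \<phi> x] by (simp add: m_assoc)
    qed
  qed
  obtain g' where g': "g' \<in> carrier G" "\<phi> g' = g" using Au_surj[OF \<phi> assms(5)] by blast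
  obtain k' where k': "k' \<in> carrier G" "\<phi> k' = k" using Au_surj[OF \<phi> assms(7)] by blast
  have "k' \<in> pre \<phi> S"
  proof (rule closed_imp_all[of g'])
    show "g' \<in> pre \<phi> S" using g' assms by (simp add: pre_def)
    show "m \<otimes> h \<in> pre \<phi> S" if "m \<in> pre \<phi> S" "m \<in> carrier G" "h \<in> H" for m h
      using that S(2) Au_mult[OF \<phi>, of m h] Au_H[OF \<phi>] Au_closed[OF \<phi>, of m]
      by (simp add: pre_def right_inv_def)
    show "m \<otimes> e u \<in> pre \<phi> S" if "m \<in> pre \<phi> S" "m \<in> carrier G" "u \<in> L" for m u
      using that letter[of u "\<phi> m"] Au_mult[OF \<phi>, of m "e u"] Au_closed[OF \<phi>, of m]
      by (simp add: pre_def)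
  qed (use g' k' in auto)
  then show False using k' assms by (simp add: pre_def)
qed

text \<open>\<open>A\<close> is a set of directions at the base vertex, and \<open>ZZ A\<close> is
  the part of the tree lying in them.\<close>

definition ZZ :: "('v letter \<times> 'a) set \<Rightarrow> 'a set" where
  "ZZ A = {g \<in> carrier G. \<exists>(u, h)\<in>A. h \<otimes> g \<in> Z u}"

text \<open>An element of H fixes the base vertex and permutes the directions there; this is the
  resulting relabelling, see \<open>ZZ_shift\<close>.\<close>

definition shift :: "'a \<Rightarrow> ('v letter \<times> 'a) set \<Rightarrow> ('v letter \<times> 'a) set" where
  "shift k A = (\<lambda>(u, h). (u, h \<otimes> k)) ` A"

lemma in_ZZ: "g \<in> ZZ A \<longleftrightarrow> g \<in> carrier G \<and> (\<exists>u h. (u, h) \<in> A \<and> h \<otimes> g \<in> Z u)"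
  by (auto simp: ZZ_def)

lemma in_shift: "(u, h) \<in> shift k A \<longleftrightarrow> (\<exists>h'. (u, h') \<in> A \<and> h = h' \<otimes> k)"
  by (cases u) (auto simp: shift_def image_iff Bex_def)

lemma fst_shift [simp]: "fst ` shift k A = fst ` A"
  by (simp add: shift_def image_image case_prod_beta)

lemma shift_sub: "A \<subseteq> L \<times> H \<Longrightarrow> k \<in> H \<Longrightarrow> shift k A \<subseteq> L \<times> H"
  by (auto simp: shift_def)

lemma finite_shift: "finite A \<Longrightarrow> finite (shift k A)"
  by (simp add: shift_def)

lemma in_shift_iff:
  assumes "A \<subseteq> L \<times> H" "k \<in> H" "h \<in> H"
  shows "(u, h) \<in> shift k A \<longleftrightarrow> (u, h \<otimes> inv k) \<in> A"
proof -
  have "h = h \<otimes> inv k \<otimes> k" using assms by (simp add: m_assoc)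
  moreover have "h' \<otimes> k \<otimes> inv k = h'" if "(u, h') \<in> A" for h'
    using assms that by (auto simp: m_assoc)
  ultimately show ?thesis unfolding in_shift by metis
qed

lemma ZZ_shift:
  assumes "A \<subseteq> L \<times> H" "k \<in> H"
  shows "ZZ (shift k A) = transl k (ZZ A)"
proof (rule Set.set_eqI)
  fix g
  have "h \<otimes> k \<otimes> g = h \<otimes> (k \<otimes> g)" if "(u, h) \<in> A" "g \<in> carrier G" for u h
    using that assms by (auto simp: m_assoc)
  moreover have "g \<in> carrier G \<Longrightarrow> k \<otimes> g \<in> carrier G" using assms by simp
  ultimately show "g \<in> ZZ (shift k A) \<longleftrightarrow> g \<in> transl k (ZZ A)"
    unfolding in_ZZ in_shift transl_def mem_Collect_eq by metis
qed

lemma ZZ_Un: "ZZ (A \<union> B) = ZZ A \<union> ZZ B"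
  unfolding set_eq_iff in_ZZ Un_iff by blast

lemma ZZ_unique:
  assumes "A \<subseteq> L \<times> H" "u \<in> L" "h \<in> H" "g \<in> carrier G" "h \<otimes> g \<in> Z u"
  shows "g \<in> ZZ A \<longleftrightarrow> (u, h) \<in> A"
proof
  assume "g \<in> ZZ A"
  then obtain v k where vk: "(v, k) \<in> A" "k \<otimes> g \<in> Z v" unfolding in_ZZ by blast
  then have "u = v \<and> h = k" using direction_unique[of u v h k g] assms by blast
  then show "(u, h) \<in> A" using vk by simp
qed (use assms in \<open>unfold in_ZZ, blast\<close>)

lemma ZZ_Int:
  assumes "A \<subseteq> L \<times> H" "B \<subseteq> L \<times> H"
  shows "ZZ (A \<inter> B) = ZZ A \<inter> ZZ B"
proof
  show "ZZ A \<inter> ZZ B \<subseteq> ZZ (A \<inter> B)"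
  proof
    fix g assume g: "g \<in> ZZ A \<inter> ZZ B"
    then obtain u h where uh: "(u, h) \<in> A" "h \<otimes> g \<in> Z u" "g \<in> carrier G" unfolding Int_iff in_ZZ by blast
    then have "(u, h) \<in> B"
      using g ZZ_unique[OF assms(2), of u h g] assms by blast
    then show "g \<in> ZZ (A \<inter> B)" unfolding in_ZZ using uh by blast
  qed
qed (unfold subset_iff Int_iff in_ZZ, blast)

lemma ZZ_Diff:
  assumes "A \<subseteq> L \<times> H" "B \<subseteq> L \<times> H"
  shows "ZZ (A - B) = ZZ A - ZZ B"
proof
  show "ZZ (A - B) \<subseteq> ZZ A - ZZ B"
  proof
    fix g assume "g \<in> ZZ (A - B)"
    then obtain u h where uh: "(u, h) \<in> A" "(u, h) \<notin> B" "h \<otimes> g \<in> Z u" "g \<in> carrier G"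
      unfolding in_ZZ by blast
    then have "g \<notin> ZZ B"
      using ZZ_unique[OF assms(2), of u h g] assms by blast
    then show "g \<in> ZZ A - ZZ B" unfolding Diff_iff in_ZZ using uh by blast
  qed
qed (unfold subset_iff Diff_iff in_ZZ, blast)

lemma ZZ_empty [simp]: "ZZ {} = {}"
  by (simp add: ZZ_def)

lemma ZZ_insert: "ZZ (insert (u, h) A) = transl h (Z u) \<union> ZZ A"
  unfolding set_eq_iff in_ZZ Un_iff transl_def by blast

lemma tame_empty: "tame {}"
  by (simp add: tame_def cross_def)

lemma tame_ZZ: "finite A \<Longrightarrow> A \<subseteq> L \<times> H \<Longrightarrow> tame (ZZ A)"
proof (induction rule: finite_induct)
  case empty
  then show ?case by (simp add: tame_empty)
next
  case (insert p A)
  then show ?case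
    by (cases p) (auto simp: ZZ_insert intro!: tame_Un tame_transl tame_Z)
qed

lemma ZZ_right_inv: "A \<subseteq> L \<times> H \<Longrightarrow> right_inv (ZZ A)"
  unfolding right_inv_def
proof (intro ballI)
  fix g k assume A: "A \<subseteq> L \<times> H" and g: "g \<in> carrier G" "k \<in> H"
  have "h \<otimes> (g \<otimes> k) \<in> Z u \<longleftrightarrow> h \<otimes> g \<in> Z u" if "(u, h) \<in> A" for u h
    using Z_right_iff[of u "h \<otimes> g" k] that g A by (auto simp: m_assoc)
  moreover have "g \<otimes> k \<in> carrier G" using g by simp
  ultimately show "g \<otimes> k \<in> ZZ A \<longleftrightarrow> g \<in> ZZ A" unfolding in_ZZ using g by metis
qed

lemma one_notin_ZZ: "A \<subseteq> L \<times> H \<Longrightarrow> h \<in> H \<Longrightarrow> h \<notin> ZZ A"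
proof
  assume A: "A \<subseteq> L \<times> H" "h \<in> H" and "h \<in> ZZ A"
  then obtain u k where uk: "(u, k) \<in> A" "k \<otimes> h \<in> Z u" unfolding in_ZZ by blast
  then have "u \<in> L" "k \<otimes> h \<in> H" using A by auto
  then show False using H_Z uk by blast
qed

lemma cap_ZZ_pos:
  assumes "\<phi> \<in> Au" "finite A" "A \<subseteq> L \<times> H" "A \<noteq> {}"
  shows "0 < cap \<phi> (ZZ A)"
proof -
  obtain u h where uh: "(u, h) \<in> A" "u \<in> L" "h \<in> H" using assms by auto
  have "inv h \<otimes> inv (e u) \<in> ZZ A"
    using uh inv_e_in_Z[of u] ZZ_unique[OF assms(3), of u h "inv h \<otimes> inv (e u)"] by auto
  then show ?thesis
    using cap_pos[of \<phi> "ZZ A" "inv h \<otimes> inv (e u)" \<one>] tame_ZZ ZZ_right_inv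
      one_notin_ZZ[OF assms(3), of \<one>] assms uh by simp
qed

end

section \<open>Effect of Whitehead automorphisms and twists on cylinders and on length\<close>

context rel_free
begin

definition mulp :: "'v letter set \<Rightarrow> 'v letter \<Rightarrow> 'v letter \<Rightarrow> 'a" where
  "mulp D a u = (if u \<in> D then e a else \<one>)"

text \<open>The middle factor is trivial at \<open>a\<close> and its inverse, so that with
  \<open>a \<in> D\<close> and \<open>linv a \<notin> D\<close> the one formula also returns
  \<open>e a\<close> and \<open>inv (e a)\<close> there.\<close>

definition wform :: "'v letter set \<Rightarrow> 'v letter \<Rightarrow> 'v letter \<Rightarrow> 'a" where
  "wform D a u = inv (mulp D a (linv u)) \<otimes> (if fst u = fst a then \<one> else e u) \<otimes> mulp D a u"

definition wp :: "'v letter set \<Rightarrow> 'v letter \<Rightarrow> bool" where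
  "wp D a \<longleftrightarrow> D \<subseteq> L \<and> a \<in> D \<and> linv a \<notin> D"

definition acts_w :: "('a \<Rightarrow> 'a) \<Rightarrow> 'v letter set \<Rightarrow> 'v letter \<Rightarrow> bool" where
  "acts_w \<psi> D a \<longleftrightarrow> \<psi> \<in> Au \<and> wp D a \<and> (\<forall>u\<in>L. \<psi> (e u) = wform D a u)"

text \<open>The value \<open>s u\<close> is attached to the end of the letter \<open>u\<close>, so
  its beginning carries the value at \<open>linv u\<close>. These automorphisms permute the
  directions at the base vertex, see \<open>twist_image\<close>.\<close>

definition twist :: "('v letter \<Rightarrow> 'a) \<Rightarrow> ('v letter \<Rightarrow> 'v letter) \<Rightarrow> ('a \<Rightarrow> 'a) \<Rightarrow> bool" where
  "twist s \<sigma> \<psi> \<longleftrightarrow> \<psi> \<in> Au \<and> s ` L \<subseteq> H \<and> bij_betw \<sigma> L L \<and> (\<forall>u\<in>L. \<sigma> (linv u) = linv (\<sigma> u)) \<and>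
     (\<forall>u\<in>L. \<psi> (e u) = s (linv u) \<otimes> e (\<sigma> u) \<otimes> inv (s u))"

definition U :: "'v letter set \<Rightarrow> 'a set" where
  "U D = (\<Union>u\<in>D. Z u)"

text \<open>The directions into which the letters of \<open>D\<close> are pulled back by a twist
  with coefficients \<open>s\<close>, see \<open>twist_pre_U\<close>.\<close>

definition graph :: "('v letter \<Rightarrow> 'a) \<Rightarrow> 'v letter set \<Rightarrow> ('v letter \<times> 'a) set" where
  "graph s D = (\<lambda>u. (u, s u)) ` D"

definition size :: "('a \<Rightarrow> 'a) \<Rightarrow> nat" where
  "size \<phi> = (\<Sum>x\<in>X. cap \<phi> (Z (x, True)))"

lemma mulp_closed [simp]: "a \<in> L \<Longrightarrow> mulp D a u \<in> carrier G"
  by (simp add: mulp_def)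

text \<open>By \<open>Z_transport\<close> it suffices to guess the images of the cylinders. Those of
  the \<open>Z y\<close> with \<open>y\<close> in \<open>D\<close> are moved into \<open>Z a\<close>
  and together make it up; the image of \<open>Z (linv a)\<close> grows by the cylinders vacated in
  this way; all others stay where they are.\<close>

lemma acts_w_image:
  assumes "acts_w \<psi> D a" and g: "g \<in> carrier G"
  shows "\<psi> g \<in> Z a \<longleftrightarrow> g \<in> U D"
    and "\<psi> g \<in> Z (linv a) \<or> \<psi> g \<in> U (D - {a}) \<longleftrightarrow> g \<in> Z (linv a)"
    and "u \<in> L \<Longrightarrow> u \<notin> D \<Longrightarrow> u \<noteq> linv a \<Longrightarrow> \<psi> g \<in> Z u \<longleftrightarrow> g \<in> Z u"
    and "u \<in> D \<Longrightarrow> u \<noteq> a \<Longrightarrow> e a \<otimes> \<psi> g \<in> Z u \<longleftrightarrow> g \<in> Z u"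
proof -
  have \<psi>: "\<psi> \<in> Au" and D: "D \<subseteq> L" and aD: "a \<in> D" "linv a \<notin> D"
    and form: "\<And>u. u \<in> L \<Longrightarrow> \<psi> (e u) = wform D a u"
    using assms(1) by (auto simp: acts_w_def wp_def)
  have aL: "a \<in> L" "linv a \<in> L" using D aD by auto
  \<comment> \<open>The guessed image of \<open>Z u\<close> under \<psi>, to be confirmed by the
    ping-pong conditions.\<close>
  define C where "C u = (if u = a then {g \<in> Z a. \<forall>y\<in>D - {a}. e a \<otimes> g \<notin> Z y}
      else if u = linv a then Z (linv a) \<union> U (D - {a})
      else {g \<in> carrier G. mulp D a u \<otimes> g \<in> Z u})" for u
  have Ca: "C a = {g \<in> Z a. \<forall>y\<in>D - {a}. e a \<otimes> g \<notin> Z y}" by (simp add: C_def)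
  have Cla: "C (linv a) = Z (linv a) \<union> U (D - {a})" by (simp add: C_def)
  have Co: "C u = {g \<in> carrier G. mulp D a u \<otimes> g \<in> Z u}" if "u \<noteq> a" "u \<noteq> linv a" for u
    using that by (simp add: C_def)
  have bk: "g \<in> Z a" if "e a \<otimes> g \<in> Z y" "y \<in> D" "g \<in> carrier G" for g y
  proof (rule ccontr)
    assume "g \<notin> Z a"
    then have "e a \<otimes> g \<in> Z (linv a)" using flip[OF aL(1) that(3)] by simp
    then have "y = linv a" using Z_disj[of y "linv a"] that D aL by blast
    then show False using that aD by simp
  qed
  \<comment> \<open>Locates \<open>C u\<close> among the old cylinders. The old cylinder
    \<open>Z d\<close> of \<open>g\<close>, refined for \<open>d = a\<close> by the cylinder of
    \<open>e a \<otimes> g\<close>, determines \<open>u\<close>; hence the \<open>C u\<close>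
    inherit disjointness from the \<open>Z d\<close>.\<close>
  have C_in: "\<exists>d\<in>L. g \<in> Z d \<and>
      (d = a \<and> (u = a \<and> (\<forall>y\<in>D - {a}. e a \<otimes> g \<notin> Z y) \<or> u \<in> D - {a} \<and> e a \<otimes> g \<in> Z u) \<or>
       d \<in> D - {a} \<and> u = linv a \<or> d \<notin> D \<and> u = d)"
    if "u \<in> L" "g \<in> carrier G" "g \<in> C u" for u g
  proof -
    consider "u = a" | "u = linv a" | "u \<noteq> a" "u \<noteq> linv a" by blast
    then show ?thesis
    proof cases
      case 1
      then show ?thesis using that Ca aL by blast
    next
      case 2
      then show ?thesis using that Cla aL aD D unfolding U_def by blast
    next
      case 3
      then have *: "mulp D a u \<otimes> g \<in> Z u" using that Co by blast
      show ?thesis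
      proof (cases "u \<in> D")
        case True
        then have "e a \<otimes> g \<in> Z u" using * by (simp add: mulp_def)
        then show ?thesis using bk[of g u] True 3 aL that by blast
      next
        case False
        then have "g \<in> Z u" using * that by (simp add: mulp_def)
        then show ?thesis using False 3 that by blast
      qed
    qed
  qed
  have main: "\<psi> g \<in> C u \<longleftrightarrow> g \<in> Z u" if "u \<in> L" "g \<in> carrier G" for u g
    using \<psi> _ _ _ that
  proof (rule Z_transport)
    fix u h assume u: "u \<in> L" "h \<in> H"
    show "h \<notin> C u"
    proof
      assume "h \<in> C u"
      then obtain d where "d \<in> L" "h \<in> Z d" using C_in[of u h] u by auto
      then show False using H_Z u by blast
    qed
  next
    fix u v h g
    assume uv: "u \<in> L" "v \<in> L" "h \<in> H" "g \<in> carrier G" "g \<in> C u" "h \<otimes> g \<in> C v"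
    have hg: "h \<otimes> g \<in> carrier G" using uv by simp
    obtain d where d: "d \<in> L" "g \<in> Z d"
      "d = a \<and> (u = a \<and> (\<forall>y\<in>D - {a}. e a \<otimes> g \<notin> Z y) \<or> u \<in> D - {a} \<and> e a \<otimes> g \<in> Z u) \<or>
       d \<in> D - {a} \<and> u = linv a \<or> d \<notin> D \<and> u = d"
      using C_in[OF uv(1,4,5)] by blast
    obtain d' where d': "d' \<in> L" "h \<otimes> g \<in> Z d'"
      "d' = a \<and> (v = a \<and> (\<forall>y\<in>D - {a}. e a \<otimes> (h \<otimes> g) \<notin> Z y) \<or> v \<in> D - {a} \<and> e a \<otimes> (h \<otimes> g) \<in> Z v) \<or>
       d' \<in> D - {a} \<and> v = linv a \<or> d' \<notin> D \<and> v = d'"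
      using C_in[OF uv(2) hg uv(6)] by blast
    have eq: "d = d' \<and> h = \<one>" using disj[OF d(1) d'(1) uv(3) d(2) d'(2)] .
    then have "h \<otimes> g = g" using uv by simp
    then have "u = v" using d(3) d'(3) eq aD uv Z_disj[of u v "e a \<otimes> g"] by auto
    then show "u = v \<and> h = \<one>" using eq by simp
  next
    fix u g assume u: "u \<in> L" and g: "g \<in> carrier G"
    consider "u = a" | "u = linv a" | "u \<noteq> a" "u \<noteq> linv a" by blast
    then show "\<psi> (e u) \<otimes> g \<in> C (linv u) \<longleftrightarrow> g \<notin> C u"
    proof cases
      case 1
      have ea: "\<psi> (e a) = e a" using form[OF aL(1)] aD aL by (simp add: wform_def mulp_def)
      show ?thesis
        unfolding 1 ea Ca Cla U_def using flip[OF aL(1) g] bk[OF _ _ g] by blast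
    next
      case 2
      have "\<psi> (e (linv a)) = inv (e a)" using form[OF aL(2)] aD aL by (simp add: wform_def mulp_def)
      moreover have "inv (e a) \<otimes> g \<in> Z a \<longleftrightarrow> g \<notin> Z (linv a)"
        using flip_inv[OF aL(1) g] .
      moreover have "e a \<otimes> (inv (e a) \<otimes> g) = g" using aL g by simp
      ultimately show ?thesis unfolding 2 linv_linv Ca Cla U_def by auto
    next
      case 3
      then have "\<psi> (e u) = inv (mulp D a (linv u)) \<otimes> e u \<otimes> mulp D a u"
        using form[OF u] by (simp add: wform_def fst_eq_linv)
      then have "mulp D a (linv u) \<otimes> (\<psi> (e u) \<otimes> g) = e u \<otimes> (mulp D a u \<otimes> g)"
        using u g aL by (simp add: m_assoc)
      moreover have "\<psi> (e u) \<otimes> g \<in> carrier G" using Au_closed[OF \<psi>] u g by simp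
      moreover have "linv u \<noteq> a" "linv u \<noteq> linv a" using 3 by (auto simp: linv_eq_iff)
      ultimately show ?thesis
        using flip[OF u, of "mulp D a u \<otimes> g"] g aL 3 by (simp add: Co)
    qed
  qed
  have g': "\<psi> g \<in> carrier G" using Au_closed[OF \<psi> g] .
  show 4: "e a \<otimes> \<psi> g \<in> Z u \<longleftrightarrow> g \<in> Z u" if "u \<in> D" "u \<noteq> a" for u
  proof -
    have "u \<in> L" "u \<noteq> linv a" using that D aD by auto
    then show ?thesis using main[of u g] Co[of u] that g g' by (simp add: mulp_def)
  qed
  show "\<psi> g \<in> Z a \<longleftrightarrow> g \<in> U D"
  proof
    assume a: "\<psi> g \<in> Z a"
    show "g \<in> U D"
    proof (cases "\<exists>y\<in>D - {a}. e a \<otimes> \<psi> g \<in> Z y")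
      case True
      then obtain y where "y \<in> D" "y \<noteq> a" "e a \<otimes> \<psi> g \<in> Z y" by blast
      then show ?thesis using 4 unfolding U_def by blast
    next
      case False
      then have "g \<in> Z a" using a main[OF aL(1) g] unfolding Ca by simp
      then show ?thesis using aD unfolding U_def by blast
    qed
  next
    assume "g \<in> U D"
    then obtain y where y: "y \<in> D" "g \<in> Z y" unfolding U_def by blast
    show "\<psi> g \<in> Z a"
    proof (cases "y = a")
      case True
      then show ?thesis using y main[OF aL(1) g] unfolding Ca by simp
    next
      case False
      then show ?thesis using y 4[of y] bk[of "\<psi> g" y] g' by simp
    qed
  qed
  show "\<psi> g \<in> Z (linv a) \<or> \<psi> g \<in> U (D - {a}) \<longleftrightarrow> g \<in> Z (linv a)"
    using main[OF aL(2) g] unfolding Cla by blast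
  show "u \<in> L \<Longrightarrow> u \<notin> D \<Longrightarrow> u \<noteq> linv a \<Longrightarrow> \<psi> g \<in> Z u \<longleftrightarrow> g \<in> Z u"
    using main[of u g] Co[of u] aD g g' by (cases "u = a") (simp_all add: mulp_def)
qed

lemma twist_image:
  assumes "twist s \<sigma> \<psi>" and u: "u \<in> L" and g: "g \<in> carrier G"
  shows "\<psi> g \<in> Z (\<sigma> u) \<longleftrightarrow> s u \<otimes> g \<in> Z u"
proof -
  have \<psi>: "\<psi> \<in> Au" and s: "\<And>u. u \<in> L \<Longrightarrow> s u \<in> H"
    and \<sigma>: "bij_betw \<sigma> L L" "\<And>u. u \<in> L \<Longrightarrow> \<sigma> (linv u) = linv (\<sigma> u)"
    and form: "\<And>u. u \<in> L \<Longrightarrow> \<psi> (e u) = s (linv u) \<otimes> e (\<sigma> u) \<otimes> inv (s u)"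
    using assms(1) by (auto simp: twist_def)
  have \<sigma>L: "\<sigma> u \<in> L" if "u \<in> L" for u using \<sigma>(1) that by (auto simp: bij_betw_def)
  define C where "C u = {g \<in> carrier G. inv (s u) \<otimes> g \<in> Z (\<sigma> u)}" for u
  have main: "\<psi> g \<in> C u \<longleftrightarrow> g \<in> Z u" if "u \<in> L" "g \<in> carrier G" for u g
    using \<psi> _ _ _ that
  proof (rule Z_transport)
    show "h \<notin> C u" if "u \<in> L" "h \<in> H" for u h
      using H_Z[OF \<sigma>L[OF that(1)], of "inv (s u) \<otimes> h"] s that by (simp add: C_def)
  next
    fix u v h g
    assume uv: "u \<in> L" "v \<in> L" "h \<in> H" "g \<in> carrier G" "g \<in> C u" "h \<otimes> g \<in> C v"
    have "(inv (s v) \<otimes> h) \<otimes> g \<in> Z (\<sigma> v)" using uv s by (simp add: C_def m_assoc)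
    then have *: "\<sigma> u = \<sigma> v \<and> inv (s u) = inv (s v) \<otimes> h"
      using direction_unique[OF \<sigma>L \<sigma>L, of u v "inv (s u)" "inv (s v) \<otimes> h" g] uv s
      by (simp add: C_def)
    then have "u = v" using \<sigma>(1) uv by (auto simp: bij_betw_def inj_on_def)
    then have "h = s u \<otimes> inv (s u)" using * s uv by (metis H_carrier H_inv inv_mult_cancel(2))
    then show "u = v \<and> h = \<one>" using \<open>u = v\<close> s uv by simp
  next
    fix u g assume u: "u \<in> L" and g: "g \<in> carrier G"
    have "inv (s (linv u)) \<otimes> (\<psi> (e u) \<otimes> g) = e (\<sigma> u) \<otimes> (inv (s u) \<otimes> g)"
      using u g s[OF u] s[of "linv u"] \<sigma>L[OF u] by (simp add: form m_assoc)
    moreover have "\<psi> (e u) \<otimes> g \<in> carrier G" using Au_closed[OF \<psi>] u g by simp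
    ultimately show "\<psi> (e u) \<otimes> g \<in> C (linv u) \<longleftrightarrow> g \<notin> C u"
      using flip[OF \<sigma>L[OF u], of "inv (s u) \<otimes> g"] g s[OF u] \<sigma>(2)[OF u] by (simp add: C_def)
  qed
  have "\<psi> (s u \<otimes> g) = s u \<otimes> \<psi> g"
    using Au_mult[OF \<psi>, of "s u" g] Au_H[OF \<psi>] s u g by simp
  then show ?thesis
    using main[OF u, of "s u \<otimes> g"] s[OF u] g Au_closed[OF \<psi> g] by (simp add: C_def)
qed

lemma pos_fst: "u \<in> L \<Longrightarrow> fst u \<in> X"
  by (auto simp: sgn_set_def)

lemma bij_fst:
  assumes "bij_betw \<sigma> L L" "\<And>u. u \<in> L \<Longrightarrow> \<sigma> (linv u) = linv (\<sigma> u)"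
  shows "bij_betw (\<lambda>x. fst (\<sigma> (x, True))) X X"
proof -
  have "(\<lambda>x. fst (\<sigma> (x, True))) ` X = X"
  proof
    show "(\<lambda>x. fst (\<sigma> (x, True))) ` X \<subseteq> X"
      using bij_betwE[OF assms(1)] pos_fst pos_L by blast
    show "X \<subseteq> (\<lambda>x. fst (\<sigma> (x, True))) ` X"
    proof
      fix x assume "x \<in> X"
      then have "(x, True) \<in> \<sigma> ` L" using assms(1) by (simp add: bij_betw_def)
      then obtain y b where y: "(y, b) \<in> L" "\<sigma> (y, b) = (x, True)" by auto
      have "fst (\<sigma> (y, True)) = x"
      proof (cases b)
        case True
        then show ?thesis using y by simp
      next
        case False
        then have "(y, True) = linv (y, b)" by (simp add: linv_def)
        then show ?thesis using assms(2)[OF y(1)] y(2) by simp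
      qed
      moreover have "y \<in> X" using pos_fst[OF y(1)] by simp
      ultimately show "x \<in> (\<lambda>x. fst (\<sigma> (x, True))) ` X" by blast
    qed
  qed
  then show ?thesis using finX by (simp add: bij_betw_def finite_surj_inj)
qed

lemma size_twist:
  assumes t: "twist s \<sigma> \<psi>" and \<phi>: "\<phi> \<in> Au" and \<chi>A: "\<chi> \<in> Au"
    and \<chi>: "\<And>x. x \<in> X \<Longrightarrow> \<chi> (e (x, True)) = \<psi> (\<phi> (e (x, True)))"
  shows "size \<chi> = size \<phi>"
proof -
  have \<psi>: "\<psi> \<in> Au" and s: "\<And>u. u \<in> L \<Longrightarrow> s u \<in> H"
    and \<sigma>: "bij_betw \<sigma> L L" "\<And>u. u \<in> L \<Longrightarrow> \<sigma> (linv u) = linv (\<sigma> u)"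
    using t by (auto simp: twist_def)
  have 1: "cap \<chi> (Z (\<sigma> u)) = cap \<phi> (Z u)" if u: "u \<in> L" for u
  proof -
    have "pre \<psi> (Z (\<sigma> u)) = transl (s u) (Z u)"
      using twist_image[OF t u] by (auto simp: pre_def transl_def)
    then show ?thesis using cap_comp[OF \<phi> \<psi> \<chi>] cap_transl[OF \<phi>] s[OF u] by simp
  qed
  have "size \<chi> = (\<Sum>x\<in>X. cap \<chi> (Z (fst (\<sigma> (x, True)), True)))"
    unfolding size_def using sum.reindex_bij_betw[OF bij_fst[OF \<sigma>], of "\<lambda>x. cap \<chi> (Z (x, True))"] by simp
  also have "\<dots> = (\<Sum>x\<in>X. cap \<chi> (Z (\<sigma> (x, True))))"
  proof (intro sum.cong HOL.refl cap_Z_fst[OF \<chi>A])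
    fix x assume x: "x \<in> X"
    show "\<sigma> (x, True) \<in> L" using \<sigma>(1) pos_L[OF x] by (auto simp: bij_betw_def)
    then show "(fst (\<sigma> (x, True)), True) \<in> L" using pos_fst by simp
  qed simp
  also have "\<dots> = size \<phi>" unfolding size_def using 1 by simp
  finally show ?thesis .
qed

text \<open>Every cylinder except those at \<open>a\<close> and its inverse is pulled back to a
  translate of itself, so only the summand at \<open>a\<close> changes, from the capacity of
  \<open>Z a\<close> to that of \<open>U D\<close>.\<close>

lemma size_acts_w:
  assumes w: "acts_w \<psi> D a" and \<phi>: "\<phi> \<in> Au" and \<chi>A: "\<chi> \<in> Au"
    and \<chi>: "\<And>x. x \<in> X \<Longrightarrow> \<chi> (e (x, True)) = \<psi> (\<phi> (e (x, True)))"
  shows "size \<chi> + cap \<phi> (Z a) = size \<phi> + cap \<phi> (U D)"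
    and "u \<in> L \<Longrightarrow> fst u \<noteq> fst a \<Longrightarrow> cap \<chi> (Z u) = cap \<phi> (Z u)"
proof -
  have \<psi>: "\<psi> \<in> Au" and D: "D \<subseteq> L" and aD: "a \<in> D" "linv a \<notin> D"
    and form: "\<And>u. u \<in> L \<Longrightarrow> \<psi> (e u) = wform D a u"
    using w by (auto simp: acts_w_def wp_def)
  have aL: "a \<in> L" "linv a \<in> L" using D aD by auto
  have fix_a: "\<psi> (e a) = e a" using form[OF aL(1)] aD aL by (simp add: wform_def mulp_def)
  show 1: "cap \<chi> (Z u) = cap \<phi> (Z u)" if u: "u \<in> L" "fst u \<noteq> fst a" for u
  proof (cases "u \<in> D")
    case True
    have "pre \<psi> (Z u) = transl (inv (e a)) (Z u)"
    proof (intro Set.set_eqI)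
      fix g
      have "\<psi> g \<in> Z u \<longleftrightarrow> inv (e a) \<otimes> g \<in> Z u" if g: "g \<in> carrier G"
      proof -
        have "e a \<otimes> \<psi> (inv (e a) \<otimes> g) = \<psi> (e a \<otimes> (inv (e a) \<otimes> g))"
          using Au_mult[OF \<psi>, of "e a" "inv (e a) \<otimes> g"] fix_a aL g by simp
        also have "\<dots> = \<psi> g" using aL g by simp
        finally show ?thesis
          using acts_w_image(4)[OF w, of "inv (e a) \<otimes> g" u] True u g aL by auto
      qed
      then show "g \<in> pre \<psi> (Z u) \<longleftrightarrow> g \<in> transl (inv (e a)) (Z u)"
        by (auto simp: pre_def transl_def)
    qed
    then show ?thesis using cap_comp[OF \<phi> \<psi> \<chi>] cap_transl[OF \<phi>] aL by simp
  next
    case False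
    moreover have "u \<noteq> linv a" using u(2) by auto
    ultimately have "pre \<psi> (Z u) = Z u"
      using acts_w_image(3)[OF w _ u(1)] Z_car[OF u(1)] by (auto simp: pre_def)
    then show ?thesis using cap_comp[OF \<phi> \<psi> \<chi>] by simp
  qed
  have "U D \<subseteq> carrier G" unfolding U_def using D Z_car by blast
  then have "pre \<psi> (Z a) = U D"
    unfolding pre_def using acts_w_image(1)[OF w] by blast
  then have "cap \<chi> (Z a) = cap \<phi> (U D)" using cap_comp[OF \<phi> \<psi> \<chi>] by simp
  then have 2: "cap \<chi> (Z (fst a, True)) = cap \<phi> (U D)"
    using cap_Z_fst[OF \<chi>A, of "(fst a, True)" a] aL pos_fst[OF aL(1)] by simp
  have 3: "cap \<phi> (Z (fst a, True)) = cap \<phi> (Z a)"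
    using cap_Z_fst[OF \<phi>, of "(fst a, True)" a] aL pos_fst[OF aL(1)] by simp
  have "(\<Sum>x\<in>X - {fst a}. cap \<chi> (Z (x, True))) = (\<Sum>x\<in>X - {fst a}. cap \<phi> (Z (x, True)))"
    using 1 by (intro sum.cong) auto
  then show "size \<chi> + cap \<phi> (Z a) = size \<phi> + cap \<phi> (U D)"
    unfolding size_def
    using sum.remove[OF finX pos_fst[OF aL(1)], of "\<lambda>x. cap \<chi> (Z (x, True))"]
      sum.remove[OF finX pos_fst[OF aL(1)], of "\<lambda>x. cap \<phi> (Z (x, True))"] 2 3 by simp
qed

text \<open>These are the positions of two Whitehead sets in which the second move has the same
  effect on length after the first as before it. In the last one the first move collapses
  \<open>A\<close> to its multiplier, so \<open>B\<close> has to be replaced by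
  \<open>insert a (B - A)\<close>.\<close>

lemma acts_w_pre_U:
  assumes w: "acts_w \<psi> A a" and B: "B \<subseteq> L"
  shows "A \<inter> B = {} \<Longrightarrow> linv a \<notin> B \<Longrightarrow> pre \<psi> (U B) = U B"
    and "A \<subseteq> B \<Longrightarrow> linv a \<in> B \<Longrightarrow> pre \<psi> (U B) = U B"
    and "A \<subseteq> B \<Longrightarrow> linv a \<notin> B \<Longrightarrow> pre \<psi> (U (insert a (B - A))) = U B"
proof -
  have A: "A \<subseteq> L" "a \<in> A" using w by (auto simp: acts_w_def wp_def)
  have carU: "g \<in> carrier G" if "g \<in> U B" for g using that B Z_car by (auto simp: U_def)
  have out: "\<psi> g \<in> U C \<longleftrightarrow> g \<in> U C" if "C \<inter> A = {}" "linv a \<notin> C" "C \<subseteq> B" "g \<in> carrier G" for C g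
    using acts_w_image(3)[OF w that(4)] that B unfolding U_def by blast
  note im = acts_w_image(1,2)[OF w]
  show "pre \<psi> (U B) = U B" if "A \<inter> B = {}" "linv a \<notin> B"
    using out[of B] that carU by (auto simp: pre_def)
  show "pre \<psi> (U B) = U B" if "A \<subseteq> B" "linv a \<in> B"
  proof -
    have *: "U B = U A \<union> Z (linv a) \<union> U (B - A - {linv a})"
      "U B = Z a \<union> (Z (linv a) \<union> U (A - {a})) \<union> U (B - A - {linv a})"
      using that A by (auto simp: U_def)
    have "\<psi> g \<in> U B \<longleftrightarrow> g \<in> U B" if "g \<in> carrier G" for g
    proof -
      have "\<psi> g \<in> U B \<longleftrightarrow> \<psi> g \<in> Z a \<or> (\<psi> g \<in> Z (linv a) \<or> \<psi> g \<in> U (A - {a})) \<or> \<psi> g \<in> U (B - A - {linv a})"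
        by (subst *(2)) simp
      also have "\<dots> \<longleftrightarrow> g \<in> U A \<or> g \<in> Z (linv a) \<or> g \<in> U (B - A - {linv a})"
      proof -
        have "\<psi> g \<in> U (B - A - {linv a}) \<longleftrightarrow> g \<in> U (B - A - {linv a})"
          by (rule out) (use that in auto)
        then show ?thesis using im[OF that] by simp
      qed
      also have "\<dots> \<longleftrightarrow> g \<in> U B" by (subst *(1)) simp
      finally show ?thesis .
    qed
    then show ?thesis using carU by (auto simp: pre_def)
  qed
  show "pre \<psi> (U (insert a (B - A))) = U B" if "A \<subseteq> B" "linv a \<notin> B"
  proof -
    have *: "U (insert a (B - A)) = Z a \<union> U (B - A)" "U B = U A \<union> U (B - A)"
      using that by (auto simp: U_def)
    have "\<psi> g \<in> U (insert a (B - A)) \<longleftrightarrow> g \<in> U B" if g: "g \<in> carrier G" for g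
    proof -
      have "\<psi> g \<in> U (B - A) \<longleftrightarrow> g \<in> U (B - A)"
        by (rule out) (use that g \<open>linv a \<notin> B\<close> in auto)
      then show ?thesis unfolding * using im(1)[OF g] by simp
    qed
    then show ?thesis using carU by (auto simp: pre_def)
  qed
qed

lemma in_ZZ_graph: "g \<in> ZZ (graph s D) \<longleftrightarrow> g \<in> carrier G \<and> (\<exists>u\<in>D. s u \<otimes> g \<in> Z u)"
  unfolding in_ZZ graph_def image_iff by blast

lemma twist_pre_U:
  assumes t: "twist s id \<psi>" and D: "D \<subseteq> L"
  shows "pre \<psi> (U D) = ZZ (graph s D)"
proof (rule Set.set_eqI)
  fix g
  show "g \<in> pre \<psi> (U D) \<longleftrightarrow> g \<in> ZZ (graph s D)"
    using twist_image[OF t _, of _ g] D unfolding pre_def U_def in_ZZ_graph id_apply by blast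
qed

lemma twist_pre_Z:
  assumes t: "twist s id \<psi>" and u: "u \<in> L"
  shows "pre \<psi> (Z u) = transl (s u) (Z u)"
  using twist_image[OF t u] by (auto simp: pre_def transl_def)

end

section \<open>Uncrossing two reductions\<close>

context rel_free
begin

lemma fst_image_iff: "u \<in> fst ` A \<longleftrightarrow> (\<exists>h. (u, h) \<in> A)"
  by force

text \<open>At most one direction per letter: these are the sets of directions that a twist can turn
  into a plain set of letters.\<close>

definition sval :: "('v letter \<times> 'a) set \<Rightarrow> bool" where
  "sval A \<longleftrightarrow> A \<subseteq> L \<times> H \<and> finite A \<and> single_valued A"

definition twp :: "('v letter \<times> 'a) set \<Rightarrow> 'v letter \<Rightarrow> bool" where
  "twp A a \<longleftrightarrow> sval A \<and> a \<in> fst ` A \<and> linv a \<notin> fst ` A"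

text \<open>Disjointness is asked of the letters and not of the directions, because a letter with
  different coefficients in the two sets could not be straightened by one common twist.\<close>

definition nested :: "('v letter \<times> 'a) set \<Rightarrow> ('v letter \<times> 'a) set \<Rightarrow> bool" where
  "nested A B \<longleftrightarrow> fst ` A \<inter> fst ` B = {} \<or> (\<exists>k\<in>H. A \<subseteq> shift k B \<or> shift k B \<subseteq> A)"

abbreviation overlap :: "('v letter \<times> 'a) set \<Rightarrow> ('v letter \<times> 'a) set \<Rightarrow> nat" where
  "overlap A B \<equiv> card (fst ` A \<inter> fst ` B)"

lemma sval_subset: "sval A \<Longrightarrow> B \<subseteq> A \<Longrightarrow> sval B"
  by (meson sval_def finite_subset single_valued_subset subset_trans)

lemma svalD:
  assumes "sval A"
  shows "A \<subseteq> L \<times> H" "finite A" "(u, h) \<in> A \<Longrightarrow> (u, k) \<in> A \<Longrightarrow> h = k"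
  using assms unfolding sval_def single_valued_def by blast+

lemma shift_one: "A \<subseteq> L \<times> H \<Longrightarrow> shift \<one> A = A"
  using in_shift_iff[of A \<one>] shift_sub[of A \<one>] in_shift by (auto simp: in_shift)

lemma sval_shift:
  assumes "sval A" "k \<in> H"
  shows "sval (shift k A)"
  unfolding sval_def single_valued_def
proof (intro conjI allI impI)
  show "shift k A \<subseteq> L \<times> H" "finite (shift k A)"
    using assms shift_sub finite_shift by (auto simp: sval_def)
  fix u h h' assume "(u, h) \<in> shift k A" "(u, h') \<in> shift k A"
  then show "h = h'" using svalD(3)[OF assms(1)] unfolding in_shift by metis
qed

lemma shift_distinct:
  assumes "sval A" "k \<in> H" "l \<in> H" "p \<in> shift k A" "p \<in> shift l A"
  shows "k = l"
proof -
  obtain u m where p: "p = (u, m)" by (cases p)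
  obtain h h' where h: "(u, h) \<in> A" "(u, h') \<in> A" "m = h \<otimes> k" "m = h' \<otimes> l"
    using assms(4,5) unfolding p in_shift by blast
  then have "h = h'" using svalD(3)[OF assms(1)] by blast
  moreover have "h \<in> H" using h svalD(1)[OF assms(1)] by blast
  ultimately show ?thesis using h assms by (metis H_carrier inv_mult_cancel(1))
qed

lemma cap_shift:
  assumes "\<phi> \<in> Au" "A \<subseteq> L \<times> H" "k \<in> H"
  shows "cap \<phi> (ZZ (shift k A)) = cap \<phi> (ZZ A)"
  using assms by (simp add: ZZ_shift cap_transl)

text \<open>If no such \<open>Q\<close> exists, every admissible set cut out of \<open>A\<close> and
  a shift of \<open>B\<close> has at least the capacity of its multiplier. So it suffices to find
  two sets, one admitting \<open>a\<close> or its inverse and one admitting \<open>b\<close> or its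
  inverse, whose capacities add up to at most those of \<open>A\<close> and \<open>B\<close>.
  Differences serve if some shift of \<open>B\<close> meets \<open>A\<close> away from
  \<open>a\<close> and \<open>b\<close>; intersections serve if \<open>a\<close> and
  \<open>b\<close> are met by different shifts; otherwise a single shift meets \<open>A\<close>, and
  two opposite corners serve as in the classical argument.\<close>

lemma crossing_reduction:
  assumes \<phi>: "\<phi> \<in> Au" and A: "twp A a" and B: "twp B b"
    and less: "cap \<phi> (ZZ A) + cap \<phi> (ZZ B) < cap \<phi> (Z a) + cap \<phi> (Z b)"
    and not_nested: "\<not> nested A B"
  shows "\<exists>Q c. twp Q c \<and> cap \<phi> (ZZ Q) < cap \<phi> (Z c) \<and>
    (nested Q A \<or> overlap Q A < overlap A B) \<and> (nested Q B \<or> overlap Q B < overlap A B)"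
proof (rule ccontr)
  assume none: "\<not> ?thesis"
  have sA: "sval A" and sB: "sval B" and aA: "a \<in> fst ` A" "linv a \<notin> fst ` A"
    and bB: "b \<in> fst ` B" "linv b \<notin> fst ` B"
    using A B by (auto simp: twp_def)
  note AL = svalD(1)[OF sA] and BL = svalD(1)[OF sB]
  have sub_nested: "nested Q C" if "Q \<subseteq> shift k C" "k \<in> H" for Q C k
    unfolding nested_def using that by blast
  have sub_nested1: "nested Q C" if "Q \<subseteq> C" "sval C" for Q C
    using sub_nested[of Q \<one> C] that shift_one svalD(1) by auto
  have tamA: "tame (ZZ A)" using tame_ZZ svalD[OF sA] by blast
  have tamB: "tame (ZZ (shift k B))" if "k \<in> H" for k
    using tame_ZZ svalD[OF sval_shift[OF sB that]] by blast
  have big: "cap \<phi> (Z c) \<le> cap \<phi> (ZZ Q)"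
    if "sval Q" "c \<in> fst ` Q" "linv c \<notin> fst ` Q"
      "nested Q A \<or> overlap Q A < overlap A B" "nested Q B \<or> overlap Q B < overlap A B" for Q c
    using none that unfolding twp_def by (meson not_le)
  let ?B = "\<lambda>k. shift k B"
  have sBk: "sval (?B k)" if "k \<in> H" for k using sval_shift[OF sB that] .
  have finD: "finite (fst ` A \<inter> fst ` B)" using svalD(2)[OF sA] by blast
  \<comment> \<open>Both differences keep their multipliers, and each loses a letter of the
    overlap.\<close>
  have i: False if k: "k \<in> H" and ne: "A \<inter> ?B k \<noteq> {}"
    and na: "a \<notin> fst ` (A \<inter> ?B k)" and nb: "b \<notin> fst ` (A \<inter> ?B k)" for k
  proof -
    obtain u h where uh: "(u, h) \<in> A" "(u, h) \<in> ?B k" using ne by auto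
    have uB: "u \<in> fst ` B" using uh(2) fst_shift[of k B] by (metis fst_conv image_eqI)
    have u1: "u \<notin> fst ` (A - ?B k)"
    proof
      assume "u \<in> fst ` (A - ?B k)"
      then obtain h' where "(u, h') \<in> A" "(u, h') \<notin> ?B k" by auto
      then show False using uh svalD(3)[OF sA, of u h h'] by simp
    qed
    have u2: "u \<notin> fst ` (?B k - A)"
    proof
      assume "u \<in> fst ` (?B k - A)"
      then obtain h' where "(u, h') \<notin> A" "(u, h') \<in> ?B k" by auto
      then show False using uh svalD(3)[OF sBk[OF k], of u h h'] by simp
    qed
    have uA: "u \<in> fst ` A" using uh(1) by (metis fst_conv image_eqI)
    have "b \<in> fst ` ?B k" using bB by simp
    then have b1: "b \<in> fst ` (?B k - A)" using nb by blast
    have a1: "a \<in> fst ` (A - ?B k)" using aA na by blast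
    have o1: "overlap (A - ?B k) B < overlap A B"
      by (rule psubset_card_mono[OF finD]) (use uA uB u1 in blast)
    have o2: "overlap (?B k - A) A < overlap A B"
      by (rule psubset_card_mono[OF finD]) (use uA uB u2 fst_shift[of k B] in blast)
    have "cap \<phi> (Z a) \<le> cap \<phi> (ZZ (A - ?B k))"
      by (rule big) (use sval_subset[OF sA] a1 aA o1 sub_nested1[OF _ sA] in auto)
    moreover have "cap \<phi> (Z b) \<le> cap \<phi> (ZZ (?B k - A))"
    proof (rule big)
      show "linv b \<notin> fst ` (?B k - A)" using bB fst_shift[of k B] by blast
    qed (use sval_subset[OF sBk[OF k]] b1 o2 sub_nested[OF _ k] in auto)
    moreover have "cap \<phi> (ZZ (A - ?B k)) + cap \<phi> (ZZ (?B k - A)) \<le> cap \<phi> (ZZ A) + cap \<phi> (ZZ B)"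
      using cap_submodular(2)[OF \<phi> tamA tamB[OF k]] cap_shift[OF \<phi> BL k]
        ZZ_Diff[OF AL shift_sub[OF BL k]] ZZ_Diff[OF shift_sub[OF BL k] AL] by simp
    ultimately show False using less by simp
  qed
  \<comment> \<open>Distinct shifts of a partial function are disjoint, which is what
    \<open>cap_Int_two\<close> asks for on either side.\<close>
  have ii: "k = l" if k: "k \<in> H" "l \<in> H" "a \<in> fst ` (A \<inter> ?B k)" "b \<in> fst ` (A \<inter> ?B l)" for k l
  proof (rule ccontr)
    assume "k \<noteq> l"
    then have d: "?B k \<inter> ?B l = {}" using shift_distinct[OF sB k(1,2)] by blast
    have "inv k \<noteq> inv l" using \<open>k \<noteq> l\<close> k by (metis H_carrier inv_inv)
    then have d': "shift (inv k) A \<inter> shift (inv l) A = {}"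
      using shift_distinct[OF sA, of "inv k" "inv l"] k by auto
    have "cap \<phi> (ZZ A \<inter> transl k (ZZ B)) + cap \<phi> (ZZ A \<inter> transl l (ZZ B)) \<le> cap \<phi> (ZZ A) + cap \<phi> (ZZ B)"
    proof (rule cap_Int_two[OF \<phi> tamA])
      show "tame (ZZ B)" using tame_ZZ svalD[OF sB] by blast
      show "transl k (ZZ B) \<inter> transl l (ZZ B) = {}"
        using ZZ_Int[OF shift_sub[OF BL k(1)] shift_sub[OF BL k(2)]] d k BL by (simp add: ZZ_shift)
      show "transl (inv k) (ZZ A) \<inter> transl (inv l) (ZZ A) = {}"
        using ZZ_Int[OF shift_sub[OF AL, of "inv k"] shift_sub[OF AL, of "inv l"]] d' k AL
        by (simp add: ZZ_shift)
    qed (use k in auto)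
    then have "cap \<phi> (ZZ (A \<inter> ?B k)) + cap \<phi> (ZZ (A \<inter> ?B l)) \<le> cap \<phi> (ZZ A) + cap \<phi> (ZZ B)"
      using ZZ_Int[OF AL shift_sub[OF BL]] k BL by (simp add: ZZ_shift)
    moreover have "cap \<phi> (Z a) \<le> cap \<phi> (ZZ (A \<inter> ?B k))"
      by (rule big) (use sval_subset[OF sA] k aA sub_nested1[OF _ sA] sub_nested[OF _ k(1)] in auto)
    moreover have "cap \<phi> (Z b) \<le> cap \<phi> (ZZ (A \<inter> ?B l))"
    proof (rule big)
      show "linv b \<notin> fst ` (A \<inter> ?B l)" using bB fst_shift[of l B] by blast
    qed (use sval_subset[OF sA] k sub_nested1[OF _ sA] sub_nested[OF _ k(2)] in auto)
    ultimately show False using less by simp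
  qed
  have uniq_a: "k = l" if kl: "k \<in> H" "l \<in> H" "c \<in> fst ` (A \<inter> ?B k)" "c \<in> fst ` (A \<inter> ?B l)" for c k l
  proof -
    obtain h where h: "(c, h) \<in> A" "(c, h) \<in> ?B k" using kl(3) unfolding fst_image_iff by blast
    obtain h' where h': "(c, h') \<in> A" "(c, h') \<in> ?B l" using kl(4) unfolding fst_image_iff by blast
    have "h = h'" using svalD(3)[OF sA h(1) h'(1)] .
    then show ?thesis using shift_distinct[OF sB kl(1,2) h(2)] h' by blast
  qed
  obtain u where u: "u \<in> fst ` A" "u \<in> fst ` B" using not_nested unfolding nested_def by blast
  have meet: "\<exists>k\<in>H. (v, h) \<in> A \<inter> ?B k" if vh: "(v, h) \<in> A" "v \<in> fst ` B" for v h
  proof -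
    obtain h' where h': "(v, h') \<in> B" using vh(2) unfolding fst_image_iff by blast
    have H: "h \<in> H" "h' \<in> H" using h' vh AL BL by auto
    then have "h = h' \<otimes> (inv h' \<otimes> h)" by simp
    then have "(v, h) \<in> ?B (inv h' \<otimes> h)" using h' unfolding in_shift by blast
    then show ?thesis using H vh by (meson H_inv H_mult IntI)
  qed
  obtain h where "(u, h) \<in> A" using u(1) unfolding fst_image_iff by blast
  then obtain k where k: "k \<in> H" "A \<inter> ?B k \<noteq> {}" using meet[of u h] u by blast
  have only_k: "l = k" if l: "l \<in> H" "A \<inter> ?B l \<noteq> {}" for l
  proof -
    have "a \<in> fst ` (A \<inter> ?B k) \<or> b \<in> fst ` (A \<inter> ?B k)" using i[OF k] by blast
    moreover have "a \<in> fst ` (A \<inter> ?B l) \<or> b \<in> fst ` (A \<inter> ?B l)" using i[OF l] by blast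
    ultimately show ?thesis using uniq_a k(1) l(1) ii by blast
  qed
  define B' where "B' = ?B k"
  have sB': "sval B'" unfolding B'_def using sBk[OF k(1)] .
  have fB: "fst ` B' = fst ` B" unfolding B'_def by simp
  \<comment> \<open>As no other shift of \<open>B\<close> meets \<open>A\<close>, the two functions
    agree on every common letter. Hence the union is again a partial function, and forgetting
    coefficients commutes with forming the corners.\<close>
  have agree: "(v, h) \<in> A \<and> (v, h) \<in> B'" if "(v, h) \<in> A \<and> v \<in> fst ` B' \<or> (v, h) \<in> B' \<and> v \<in> fst ` A" for v h
  proof -
    from that show ?thesis
    proof
      assume *: "(v, h) \<in> A \<and> v \<in> fst ` B'"
      then obtain l where "l \<in> H" "(v, h) \<in> A \<inter> ?B l" using meet[of v h] fB by blast
      then show ?thesis using only_k unfolding B'_def by blast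
    next
      assume *: "(v, h) \<in> B' \<and> v \<in> fst ` A"
      then obtain h' where h': "(v, h') \<in> A" unfolding fst_image_iff by blast
      have "v \<in> fst ` B" using * fB fst_image_iff by metis
      then obtain l where "l \<in> H" "(v, h') \<in> A \<inter> ?B l" using meet[OF h'] by blast
      then have "(v, h') \<in> B'" using only_k unfolding B'_def by blast
      then show ?thesis using * h' svalD(3)[OF sB'] by blast
    qed
  qed
  have sU: "sval (A \<union> B')"
    unfolding sval_def single_valued_def
  proof (intro conjI allI impI)
    show "A \<union> B' \<subseteq> L \<times> H" "finite (A \<union> B')" using svalD(1,2)[OF sA] svalD(1,2)[OF sB'] by auto
    fix v h h' assume *: "(v, h) \<in> A \<union> B'" "(v, h') \<in> A \<union> B'"
    show "h = h'"
    proof (cases "v \<in> fst ` A \<and> v \<in> fst ` B'")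
      case True
      then have "(v, h) \<in> A" "(v, h') \<in> A" using * agree by blast+
      then show ?thesis using svalD(3)[OF sA] by blast
    next
      case False
      then show ?thesis using * svalD(3)[OF sA] svalD(3)[OF sB'] unfolding fst_image_iff by blast
    qed
  qed
  have f1: "fst ` (A \<inter> B') = fst ` A \<inter> fst ` B'"
  proof
    show "fst ` A \<inter> fst ` B' \<subseteq> fst ` (A \<inter> B')"
    proof
      fix v assume v: "v \<in> fst ` A \<inter> fst ` B'"
      then obtain h where "(v, h) \<in> A" unfolding Int_iff fst_image_iff by blast
      then have "(v, h) \<in> A \<inter> B'" using agree v by blast
      then show "v \<in> fst ` (A \<inter> B')" unfolding fst_image_iff by blast
    qed
  qed blast
  have f2: "fst ` (A - B') = fst ` A - fst ` B'"
  proof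
    show "fst ` (A - B') \<subseteq> fst ` A - fst ` B'"
    proof
      fix v assume "v \<in> fst ` (A - B')"
      then obtain h where h: "(v, h) \<in> A" "(v, h) \<notin> B'" unfolding fst_image_iff by blast
      then have "v \<notin> fst ` B'" using agree by blast
      then show "v \<in> fst ` A - fst ` B'" using h unfolding Diff_iff fst_image_iff by blast
    qed
  qed (unfold subset_iff Diff_iff fst_image_iff, blast)
  have f3: "fst ` (B' - A) = fst ` B' - fst ` A"
  proof
    show "fst ` (B' - A) \<subseteq> fst ` B' - fst ` A"
    proof
      fix v assume "v \<in> fst ` (B' - A)"
      then obtain h where h: "(v, h) \<in> B'" "(v, h) \<notin> A" unfolding fst_image_iff by blast
      then have "v \<notin> fst ` A" using agree by blast
      then show "v \<in> fst ` B' - fst ` A" using h unfolding Diff_iff fst_image_iff by blast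
    qed
  qed (unfold subset_iff Diff_iff fst_image_iff, blast)
  have f4: "fst ` (A \<union> B') = fst ` A \<union> fst ` B'" by blast
  have nA: "nested Q A \<and> nested Q B" if "Q \<in> {A \<inter> B', A - B', B' - A, A \<union> B'}" for Q
  proof -
    have "fst ` (A - B') \<inter> fst ` B = {}" "fst ` (B' - A) \<inter> fst ` A = {}"
      unfolding f2 f3 fB by blast+
    then have "nested (A - B') B" "nested (B' - A) A" unfolding nested_def by simp_all
    moreover have "shift \<one> A \<subseteq> A \<union> B'" "shift k B \<subseteq> A \<union> B'"
      unfolding shift_one[OF AL] B'_def by simp_all
    then have "nested (A \<union> B') A" "nested (A \<union> B') B"
      unfolding nested_def using k(1) H_one by meson+
    moreover have "nested (A \<inter> B') A" "nested (A - B') A"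
      using sub_nested1[OF _ sA, of "A \<inter> B'"] sub_nested1[OF _ sA, of "A - B'"] by simp_all
    moreover have "nested (A \<inter> B') B" "nested (B' - A) B"
      using sub_nested[OF _ k(1), of "A \<inter> B'" B] sub_nested[OF _ k(1), of "B' - A" B]
      unfolding B'_def by simp_all
    ultimately show ?thesis using that by blast
  qed
  have bigQ: "cap \<phi> (Z c) \<le> cap \<phi> (ZZ Q)"
    if "Q \<in> {A \<inter> B', A - B', B' - A, A \<union> B'}" "c \<in> fst ` Q" "linv c \<notin> fst ` Q" for Q c
  proof -
    have "Q \<subseteq> A \<union> B'" using that by blast
    then show ?thesis using big[OF sval_subset[OF sU] that(2,3)] nA[OF that(1)] by blast
  qed
  have aL: "a \<in> L" "b \<in> L" using aA bB AL BL by auto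
  have da: "cap \<phi> (Z (linv a)) = cap \<phi> (Z a)" "cap \<phi> (Z (linv b)) = cap \<phi> (Z b)"
    using cap_Z_linv[OF \<phi>] aL by auto
  have tB': "tame (ZZ B')" unfolding B'_def using tamB[OF k(1)] .
  have BL': "B' \<subseteq> L \<times> H" using svalD(1)[OF sB'] .
  have c: "cap \<phi> (ZZ B') = cap \<phi> (ZZ B)" unfolding B'_def using cap_shift[OF \<phi> BL k(1)] .
  have s1: "cap \<phi> (ZZ (A \<inter> B')) + cap \<phi> (ZZ (A \<union> B')) < cap \<phi> (Z a) + cap \<phi> (Z b)"
    using cap_submodular(1)[OF \<phi> tamA tB'] c less by (simp add: ZZ_Int[OF AL BL'] ZZ_Un)
  have s2: "cap \<phi> (ZZ (A - B')) + cap \<phi> (ZZ (B' - A)) < cap \<phi> (Z a) + cap \<phi> (Z b)"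
    using cap_submodular(2)[OF \<phi> tamA tB'] c less by (simp add: ZZ_Diff[OF AL BL'] ZZ_Diff[OF BL' AL])
  define DA DB where "DA = fst ` A" and "DB = fst ` B'"
  have q1: "cap \<phi> (Z c) \<le> cap \<phi> (ZZ (A \<inter> B'))" if "c \<in> DA \<inter> DB" "linv c \<notin> DA \<inter> DB" for c
    using bigQ[of "A \<inter> B'" c] that f1 unfolding DA_def DB_def by simp
  have q2: "cap \<phi> (Z c) \<le> cap \<phi> (ZZ (A - B'))" if "c \<in> DA - DB" "linv c \<notin> DA - DB" for c
    using bigQ[of "A - B'" c] that f2 unfolding DA_def DB_def by simp
  have q3: "cap \<phi> (Z c) \<le> cap \<phi> (ZZ (B' - A))" if "c \<in> DB - DA" "linv c \<notin> DB - DA" for c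
    using bigQ[of "B' - A" c] that f3 unfolding DA_def DB_def by simp
  have q4: "cap \<phi> (Z c) \<le> cap \<phi> (ZZ (A \<union> B'))" if "c \<in> DA \<union> DB" "linv c \<notin> DA \<union> DB" for c
    using bigQ[of "A \<union> B'" c] that f4 unfolding DA_def DB_def by simp
  have m: "a \<in> DA" "linv a \<notin> DA" "b \<in> DB" "linv b \<notin> DB"
    using aA bB fB unfolding DA_def DB_def by auto
  \<comment> \<open>Each of \<open>a\<close>, \<open>linv a\<close>, \<open>b\<close>,
    \<open>linv b\<close> lies in one of the four corners of \<open>DA\<close> and
    \<open>DB\<close>, the first two on different sides of \<open>DA\<close> and the last two on
    different sides of \<open>DB\<close>. In every case one pair of opposite corners admits both
    multipliers up to inversion; the outer corner is represented by the union.\<close>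
  show False
    using s1 s2 da m q1[of a] q1[of b] q2[of a] q2[of b] q2[of "linv a"] q2[of "linv b"]
      q3[of a] q3[of "linv a"] q3[of b] q3[of "linv b"] q4[of a] q4[of b] q4[of "linv a"] q4[of "linv b"]
    by (cases "a \<in> DB"; cases "linv a \<in> DB"; cases "b \<in> DA"; cases "linv b \<in> DA") simp_all
qed

end

section \<open>Irreducible automorphisms are twists\<close>

context rel_free
begin

lemma len_right: "g \<in> carrier G \<Longrightarrow> h \<in> H \<Longrightarrow> len (g \<otimes> h) = len g"
proof (induction rule: left_induct)
  case (H k)
  then show ?case by (simp add: len_H)
next
  case (Z k u g)
  have 1: "e u \<otimes> g \<in> Z (linv u)" using flip[of u g] Z by simp
  then have 2: "e u \<otimes> g \<otimes> h \<in> Z (linv u)" using Z_right[of "linv u"] Z by simp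
  have "len (e u \<otimes> g \<otimes> h) = len (e u \<otimes> g)"
    using len_Z[OF _ 1] len_Z[OF _ 2] Z by (simp add: e_linv m_assoc)
  then show ?case using Z by (simp add: len_left m_assoc)
qed

lemma len_pos: "g \<in> carrier G \<Longrightarrow> g \<notin> H \<Longrightarrow> 0 < len g"
  using cover[of g] len_Z len_left by fastforce

text \<open>Connectedness inside the half-tree \<open>Z z\<close>: the elements on the same side of
  \<open>S\<close> as \<open>m\<close> form a set that can be left only through the edge from
  \<open>inv (e z)\<close> to the identity.\<close>

lemma const_on_Z:
  assumes S: "right_inv S" and z: "z \<in> L" "m \<in> Z z"
    and step: "\<And>k u. k \<in> Z z \<Longrightarrow> u \<in> L \<Longrightarrow> k \<otimes> e u \<in> Z z \<Longrightarrow> k \<in> S \<longleftrightarrow> k \<otimes> e u \<in> S"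
  shows "m \<in> S \<longleftrightarrow> inv (e z) \<in> S"
proof (rule ccontr)
  assume neq: "\<not> ?thesis"
  define V where "V = {k \<in> Z z. (k \<in> S) = (m \<in> S)}"
  have "\<one> \<in> V"
  proof (rule closed_imp_all[of m])
    show "m \<in> V" using z by (simp add: V_def)
    show "g \<otimes> h \<in> V" if "g \<in> V" "g \<in> carrier G" "h \<in> H" for g h
      using that S Z_right[OF z(1)] by (simp add: V_def right_inv_def)
    show "g \<otimes> e u \<in> V" if g: "g \<in> V" "g \<in> carrier G" "u \<in> L" for g u
    proof (cases "g \<otimes> e u \<in> Z z")
      case True
      then show ?thesis using g step[of g u] by (simp add: V_def)
    next
      case False
      then have "g = inv (e z)" using boundary_unique[of u z g] g z by (simp add: V_def)
      then show ?thesis using g neq by (simp add: V_def)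
    qed
  qed (use z Z_car in auto)
  then show False using H_Z[OF z(1) H_one] by (simp add: V_def)
qed

text \<open>The half-tree of the \<open>g\<close> with \<open>k \<otimes> g \<in> Z v\<close> misses
  the base vertex, so by \<open>no_cancel\<close> it lies in a single direction there; a nontrivial
  \<open>r\<close> in H moves this direction to a different one.\<close>

lemma half_space_disjoint:
  assumes v: "v \<in> L" and k: "k \<in> carrier G" "k \<notin> Z v" and r: "r \<in> H"
    and g: "g \<in> carrier G" "k \<otimes> g \<in> Z v" "k \<otimes> (r \<otimes> g) \<in> Z v"
  shows "r = \<one>"
proof -
  have ext: "h \<otimes> x \<in> Z w" if "h \<in> H" "w \<in> L" "h \<otimes> inv k \<in> Z w" "x \<in> carrier G" "k \<otimes> x \<in> Z v" for h w x
    using no_cancel[OF v that(5), of "inv k"] k that by simp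
  have "inv k \<in> carrier G" using k by simp
  then have "\<exists>h w. h \<in> H \<and> w \<in> L \<and> h \<otimes> g \<in> Z w \<and> h \<otimes> (r \<otimes> g) \<in> Z w"
  proof (cases rule: left_cases)
    case H
    then have "k \<in> H" using H_inv[OF H] k by simp
    then show ?thesis using g v by blast
  next
    case (Z h w)
    then have "h \<otimes> g \<in> Z w" "h \<otimes> (r \<otimes> g) \<in> Z w" using ext[of h w g] ext[of h w "r \<otimes> g"] g r by auto
    then show ?thesis using Z by blast
  qed
  then obtain h w where hw: "h \<in> H" "w \<in> L" "h \<otimes> g \<in> Z w" "h \<otimes> (r \<otimes> g) \<in> Z w" by blast
  then have "(h \<otimes> r) \<otimes> g \<in> Z w" using r g by (simp add: m_assoc)
  then have "h = h \<otimes> r" using direction_unique[of w w h "h \<otimes> r" g] hw r g by simp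
  then show ?thesis using hw r by (metis H_carrier inv_mult_cancel(1) l_inv)
qed

definition reducible :: "('a \<Rightarrow> 'a) \<Rightarrow> bool" where
  "reducible \<phi> \<longleftrightarrow> (\<exists>A a. twp A a \<and> cap \<phi> (ZZ A) < cap \<phi> (Z a))"

lemma Au_image_iff: "\<phi> \<in> Au \<Longrightarrow> S \<subseteq> carrier G \<Longrightarrow> y \<in> carrier G \<Longrightarrow> \<phi> y \<in> \<phi> ` S \<longleftrightarrow> y \<in> S"
  using Au_inj by blast

lemma tame_image:
  assumes \<phi>: "\<phi> \<in> Au" and S: "S \<subseteq> carrier G" "tame S"
  shows "tame (\<phi> ` S)"
  unfolding tame_def
proof
  fix g assume "g \<in> carrier G"
  then obtain g' where g': "g' \<in> carrier G" "\<phi> g' = g" using Au_surj[OF \<phi>] by blast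
  have "cross (\<phi> ` S) g \<subseteq> \<phi> ` cross S g'"
  proof
    fix k assume k: "k \<in> cross (\<phi> ` S) g"
    then obtain k' where k': "k' \<in> carrier G" "\<phi> k' = k" using Au_surj[OF \<phi>, of k] by (auto simp: cross_def)
    have "k \<otimes> g = \<phi> (k' \<otimes> g')" using Au_mult[OF \<phi>] g' k' by simp
    then have "(k' \<in> S) \<noteq> (k' \<otimes> g' \<in> S)"
      using k Au_image_iff[OF \<phi> S(1)] k' g' by (auto simp: cross_def)
    then have "k' \<in> cross S g'" using k' by (simp add: cross_def)
    then show "k \<in> \<phi> ` cross S g'" using k' by blast
  qed
  then show "finite (cross (\<phi> ` S) g)"
    using S(2) g' by (meson finite_imageI finite_subset tame_def)
qed

text \<open>The edges of the tree of \<open>G\<close> crossing the half-space \<open>\<phi> ` Z v\<close> of the image basis are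
  examined at a vertex \<open>g\<close> of maximal length; if it is not the base vertex, the directions at \<open>g\<close>
  separated from the rest by the direction towards the base vertex give a reduction.\<close>

lemma crossing_at_base:
  assumes \<phi>: "\<phi> \<in> Au" and v: "v \<in> L" and irred: "\<not> reducible \<phi>"
    and k: "k \<in> carrier G" and u: "u \<in> L" and kE: "(k \<in> \<phi> ` Z v) \<noteq> (k \<otimes> e u \<in> \<phi> ` Z v)"
  shows "k \<in> H \<or> k \<otimes> e u \<in> H"
proof (rule ccontr)
  assume notH: "\<not> ?thesis"
  let ?E = "\<phi> ` Z v"
  have Ecar: "?E \<subseteq> carrier G" using Au_closed[OF \<phi>] Z_carrier[OF v] by blast
  have Zv: "Z v \<subseteq> carrier G" using Z_carrier[OF v] .
  note E_iff = Au_image_iff[OF \<phi> Zv]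
  have tameE: "tame ?E" using tame_image[OF \<phi> Zv tame_Z[OF v]] .
  \<comment> \<open>The crossing edges, oriented away from the base vertex: the last condition says
    that \<open>fst p\<close> does not end with the inverse of the letter
    \<open>snd p\<close>.\<close>
  define Cr where "Cr = {p. fst p \<in> carrier G \<and> snd p \<in> L \<and>
    (fst p \<in> ?E) \<noteq> (fst p \<otimes> e (snd p) \<in> ?E) \<and> inv (fst p) \<notin> Z (linv (snd p))}"
  have either: "(k \<in> carrier G \<longrightarrow> (k, u) \<in> Cr \<or> (k \<otimes> e u, linv u) \<in> Cr)"
    if "u \<in> L" "(k \<in> ?E) \<noteq> (k \<otimes> e u \<in> ?E)" for k u
  proof
    assume kc: "k \<in> carrier G"
    show "(k, u) \<in> Cr \<or> (k \<otimes> e u, linv u) \<in> Cr"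
    proof (cases "inv k \<in> Z (linv u)")
      case True
      then have "inv (k \<otimes> e u) \<notin> Z u"
        using flip_inv[OF that(1), of "inv k"] kc that(1) by (simp add: inv_mult_group)
      moreover have "k \<otimes> e u \<otimes> e (linv u) = k" using kc that(1) by (simp add: e_linv m_assoc)
      ultimately have "(k \<otimes> e u, linv u) \<in> Cr" using that kc by (auto simp: Cr_def)
      then show ?thesis ..
    next
      case False
      then show ?thesis using that kc by (simp add: Cr_def)
    qed
  qed
  have finC: "finite Cr"
  proof (rule finite_subset)
    show "Cr \<subseteq> (\<Union>u\<in>L. cross ?E (e u) \<times> {u})"
      unfolding Cr_def cross_def by auto
    show "finite (\<Union>u\<in>L. cross ?E (e u) \<times> {u})"
      using tameE finL by (auto simp: tame_def)
  qed
  obtain k1 u1 where k1: "(k1, u1) \<in> Cr" "k1 \<notin> H"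
    using either[OF u kE] k notH by blast
  then have "len ` fst ` Cr \<noteq> {}" by blast
  then have "Max (len ` fst ` Cr) \<in> len ` fst ` Cr" using finC by (intro Max_in) auto
  then obtain g w where gw: "(g, w) \<in> Cr" "len g = Max (len ` fst ` Cr)" by auto
  have gmax: "len k \<le> len g" if "(k, u) \<in> Cr" for k u
    unfolding gw(2) using finC that by (intro Max_ge) (auto simp: image_iff intro!: bexI[of _ "(k, u)"])
  have g: "g \<in> carrier G" and w: "w \<in> L" and gE: "(g \<in> ?E) \<noteq> (g \<otimes> e w \<in> ?E)"
    and away: "inv g \<notin> Z (linv w)"
    using gw(1) by (auto simp: Cr_def)
  have "len k1 > 0" using k1 len_pos[of k1] by (simp add: Cr_def)
  then have "g \<notin> H" using gmax[OF k1(1)] len_H by auto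
  then have "inv g \<notin> H" using H_inv[of "inv g"] g by auto
  \<comment> \<open>The direction at \<open>g\<close> that leads back to the base vertex.\<close>
  then obtain h0 w0 where h0: "h0 \<in> H" "w0 \<in> L" "h0 \<otimes> inv g \<in> Z w0"
    using cover[of "inv g"] g by auto
  \<comment> \<open>The tree is translated so that \<open>g\<close> becomes the base vertex, and of
    the two sides of the half-space the one not containing it is taken.\<close>
  define S where "S = {m \<in> carrier G. (g \<otimes> m \<in> ?E) \<noteq> (g \<in> ?E)}"
  obtain g' where g': "g' \<in> carrier G" "\<phi> g' = g" using Au_surj[OF \<phi> g] by blast
  have gm: "g \<otimes> \<phi> m = \<phi> (g' \<otimes> m)" if "m \<in> carrier G" for m
    using Au_mult[OF \<phi> g'(1) that] g' by simp
  have S_iff: "\<phi> m \<in> S \<longleftrightarrow> (g' \<otimes> m \<in> Z v) \<noteq> (g' \<in> Z v)" if "m \<in> carrier G" for m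
    using gm[OF that] E_iff[of "g' \<otimes> m"] E_iff[of g'] g' that Au_closed[OF \<phi> that]
    by (simp add: S_def)
  have S_right: "right_inv S"
    unfolding right_inv_def
  proof (intro ballI)
    fix m h assume m: "m \<in> carrier G" "h \<in> H"
    obtain n where n: "n \<in> carrier G" "\<phi> n = m" using Au_surj[OF \<phi> m(1)] by blast
    have "m \<otimes> h = \<phi> (n \<otimes> h)" using Au_mult[OF \<phi>, of n h] Au_H[OF \<phi> m(2)] n m by simp
    moreover have "g' \<otimes> (n \<otimes> h) \<in> Z v \<longleftrightarrow> g' \<otimes> n \<in> Z v"
      using Z_right_iff[OF v, of "g' \<otimes> n" h] g' n m by (simp add: m_assoc)
    ultimately show "m \<otimes> h \<in> S \<longleftrightarrow> m \<in> S" using S_iff[of "n \<otimes> h"] S_iff[of n] n m by simp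
  qed
  have S_one: "\<one> \<notin> S" using g by (simp add: S_def)
  have S_H: "h \<notin> S" if "h \<in> H" for h
    using S_right S_one that unfolding right_inv_def by (metis H_carrier l_one one_closed)
  have tameS: "tame S"
  proof -
    have "cross S x = cross (transl g ?E) x" if "x \<in> carrier G" for x
      using that g by (auto simp: S_def cross_def transl_def)
    then show ?thesis using tame_transl[OF tameE g] by (simp add: tame_def)
  qed
  \<comment> \<open>According to the side on which \<open>g\<close> lies, \<open>S\<close> is a
    translate of the image of \<open>Z v\<close> or of \<open>Z (linv v)\<close>;
    \<open>half_space_disjoint\<close> is applied in the source of \<phi>.\<close>
  have S_disj: "r = \<one>" if r: "r \<in> H" "m \<in> S" "r \<otimes> m \<in> S" for r m
  proof -
    have "m \<in> carrier G" using r by (simp add: S_def)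
    then obtain n where n: "n \<in> carrier G" "\<phi> n = m" using Au_surj[OF \<phi>] by blast
    have rn: "r \<otimes> m = \<phi> (r \<otimes> n)" using Au_mult[OF \<phi>, of r n] Au_H[OF \<phi> r(1)] n r by simp
    show ?thesis
    proof (cases "g' \<in> Z v")
      case False
      then show ?thesis
        using half_space_disjoint[OF v g'(1) False r(1) n(1)] S_iff[of n] S_iff[of "r \<otimes> n"] rn n r by simp
    next
      case True
      then have 1: "e v \<otimes> g' \<notin> Z (linv v)" using flip[OF v g'(1)] by simp
      have 2: "e v \<otimes> g' \<otimes> x \<in> Z (linv v) \<longleftrightarrow> g' \<otimes> x \<notin> Z v" if "x \<in> carrier G" for x
        using flip[OF v, of "g' \<otimes> x"] that g' v by (simp add: m_assoc)
      show ?thesis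
        using half_space_disjoint[OF _ _ 1 r(1) n(1)] S_iff[of n] S_iff[of "r \<otimes> n"] rn n r v g' True
          2[of n] 2[of "r \<otimes> n"] by simp
    qed
  qed
  \<comment> \<open>In the image basis \<open>S\<close> has only one boundary edge, and
    \<open>inv g\<close> is one of its ends. With the orientation \<open>linv v\<close> it starts
    there.\<close>
  have S_edge: "inv g = j \<or> inv g = j \<otimes> \<phi> (e x)" and S_edge': "x = linv v \<Longrightarrow> j = inv g"
    if j: "j \<in> carrier G" "x \<in> L" "(j \<in> S) \<noteq> (j \<otimes> \<phi> (e x) \<in> S)" for j x
  proof -
    obtain n where n: "n \<in> carrier G" "\<phi> n = j" using Au_surj[OF \<phi> j(1)] by blast
    have jx: "j \<otimes> \<phi> (e x) = \<phi> (n \<otimes> e x)" using Au_mult[OF \<phi>, of n "e x"] n j by simp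
    have *: "(g' \<otimes> n \<in> Z v) \<noteq> (g' \<otimes> n \<otimes> e x \<in> Z v)"
      using S_iff[of n] S_iff[of "n \<otimes> e x"] jx n j g' by (auto simp: m_assoc)
    have inv_g: "m = inv g'" if "g' \<otimes> m = \<one>" "m \<in> carrier G" for m
      using that g' by (metis inv_mult_cancel(1) r_one inv_closed)
    have inv_g': "\<phi> (inv g') = inv g" using Au_inv[OF \<phi> g'(1)] g' by simp
    show "inv g = j \<or> inv g = j \<otimes> \<phi> (e x)"
    proof (cases "g' \<otimes> n \<in> Z v")
      case True
      then have "x = v \<and> g' \<otimes> n = inv (e x)" using * boundary_unique[of x v "g' \<otimes> n"] j v by simp
      then have "g' \<otimes> n \<otimes> e x = \<one>" using j by simp
      then have "g' \<otimes> (n \<otimes> e x) = \<one>" using g' n j by (simp add: m_assoc)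
      then have "n \<otimes> e x = inv g'" using inv_g n j by simp
      then show ?thesis using jx inv_g' by simp
    next
      case False
      then have "g' \<otimes> n = \<one>" using * boundary_enter[of x v "g' \<otimes> n"] j v g' n by simp
      then show ?thesis using inv_g[OF _ n(1)] inv_g' n by simp
    qed
    show "j = inv g" if "x = linv v"
    proof (cases "g' \<otimes> n \<in> Z v")
      case True
      then show ?thesis using * boundary_unique[of x v "g' \<otimes> n"] j v that by simp
    next
      case False
      then have "g' \<otimes> n = \<one>" using * boundary_enter[of x v "g' \<otimes> n"] j v g' n by simp
      then show ?thesis using inv_g[OF _ n(1)] inv_g' n by simp
    qed
  qed
  \<comment> \<open>In every direction at \<open>g\<close> except the one back to the base vertex, a
    further crossing edge would have both ends longer than \<open>g\<close>. By the choice of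
    \<open>g\<close> there is none, so \<open>S\<close> contains all or nothing of such a
    direction.\<close>
  have const: "m \<in> S \<longleftrightarrow> inv h \<otimes> inv (e z) \<in> S"
    if m: "m \<in> carrier G" "h \<in> H" "z \<in> L" "h \<otimes> m \<in> Z z" "(z, h) \<noteq> (w0, h0)" for m h z
  proof -
    have hg: "h \<otimes> inv g \<notin> Z z" using direction_unique[of z w0 h h0 "inv g"] m h0 g by auto
    define S' where "S' = {n \<in> carrier G. inv h \<otimes> n \<in> S}"
    have "h \<otimes> m \<in> S' \<longleftrightarrow> inv (e z) \<in> S'"
    proof (rule const_on_Z[OF _ m(3,4)])
      show "right_inv S'"
        using S_right m(2) unfolding right_inv_def S'_def by (auto simp flip: m_assoc)
      fix k u assume k: "k \<in> Z z" "u \<in> L" "k \<otimes> e u \<in> Z z"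
      have kc: "k \<in> carrier G" using Z_car[OF m(3) k(1)] .
      define p where "p = g \<otimes> inv h"
      have p: "p \<in> carrier G" "inv p \<notin> Z z" "len p = len g"
        using g m hg unfolding p_def by (auto simp: inv_mult_group len_right)
      have big: "len g < len (p \<otimes> k)" "len g < len (p \<otimes> k \<otimes> e u)"
        using no_cancel[OF m(3) k(1) p(1,2)] no_cancel[OF m(3) k(3) p(1,2)] p k kc
          len_Z[OF m(3) k(1)] len_Z[OF m(3) k(3)] by (simp_all add: m_assoc)
      have "(p \<otimes> k \<in> ?E) = (p \<otimes> k \<otimes> e u \<in> ?E)"
      proof (rule ccontr)
        assume "(p \<otimes> k \<in> ?E) \<noteq> (p \<otimes> k \<otimes> e u \<in> ?E)"
        then have "(p \<otimes> k, u) \<in> Cr \<or> (p \<otimes> k \<otimes> e u, linv u) \<in> Cr"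
          using either[OF k(2)] p kc by simp
        then show False using gmax big by (meson not_le)
      qed
      then show "k \<in> S' \<longleftrightarrow> k \<otimes> e u \<in> S'"
        using kc k m g unfolding S'_def S_def p_def by (simp add: m_assoc)
    qed
    then show ?thesis using m by (simp add: S'_def)
  qed
  define A where "A = {p. fst p \<in> L \<and> snd p \<in> H \<and> p \<noteq> (w0, h0) \<and> inv (snd p) \<otimes> inv (e (fst p)) \<in> S}"
  define T where "T = transl h0 (Z w0)"
  have A_iff: "(z, h) \<in> A \<longleftrightarrow> z \<in> L \<and> h \<in> H \<and> (z, h) \<noteq> (w0, h0) \<and> inv h \<otimes> inv (e z) \<in> S" for z h
    by (simp add: A_def)
  have ALH: "A \<subseteq> L \<times> H" unfolding A_def by auto
  have finA: "finite A"
  proof (rule finite_subset)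
    show "A \<subseteq> (\<Union>z\<in>L. {z} \<times> (\<lambda>m. inv m) ` cross S (e (linv z)))"
    proof
      fix p assume p: "p \<in> A"
      obtain z h where zh: "p = (z, h)" by (cases p)
      then have z: "z \<in> L" "h \<in> H" "inv h \<otimes> inv (e z) \<in> S" using p A_iff by auto
      have "inv h \<in> cross S (e (linv z))"
        using z S_H[of "inv h"] by (simp add: cross_def e_linv)
      moreover have "h = inv (inv h)" using z by simp
      ultimately show "p \<in> (\<Union>z\<in>L. {z} \<times> (\<lambda>m. inv m) ` cross S (e (linv z)))"
        using z zh by blast
    qed
    show "finite (\<Union>z\<in>L. {z} \<times> (\<lambda>m. inv m) ` cross S (e (linv z)))"
      using tameS finL by (simp add: tame_def)
  qed
  have svA: "sval A"
    unfolding sval_def single_valued_def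
  proof (intro conjI allI impI ALH finA)
    fix z h h' assume a: "(z, h) \<in> A" "(z, h') \<in> A"
    then have z: "z \<in> L" "h \<in> H" "h' \<in> H" "inv h \<otimes> inv (e z) \<in> S" "inv h' \<otimes> inv (e z) \<in> S"
      using A_iff by auto
    have "(inv h' \<otimes> h) \<otimes> (inv h \<otimes> inv (e z)) = inv h' \<otimes> inv (e z)"
      using z by (simp add: m_assoc)
    then have "inv h' \<otimes> h = \<one>" using S_disj[of "inv h' \<otimes> h" "inv h \<otimes> inv (e z)"] z by simp
    then show "h = h'" using z by (metis H_carrier inv_mult_cancel(2) r_one)
  qed
  have "(linv w, \<one>) \<in> A"
  proof -
    have "(linv w, \<one>) \<noteq> (w0, h0)" using away h0 g by auto
    moreover have "e w \<in> S" using gE w g by (auto simp: S_def)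
    ultimately show ?thesis using w by (simp add: A_iff e_linv)
  qed
  then have A_ne: "A \<noteq> {}" by blast
  have T_A: "x \<notin> ZZ A" if "x \<in> T" for x
    using that ZZ_unique[OF ALH h0(2,1), of x] A_iff[of w0 h0] by (simp add: T_def transl_def)
  have S_A: "x \<in> S \<longleftrightarrow> x \<in> ZZ A" if x: "x \<in> carrier G" "x \<notin> T" for x
    using x(1)
  proof (cases rule: left_cases)
    case H
    then show ?thesis using S_H one_notin_ZZ[OF ALH] by blast
  next
    case (Z h z)
    have "(z, h) \<noteq> (w0, h0)" using Z x by (auto simp: T_def transl_def)
    then show ?thesis
      using const[OF x(1) Z(1,2,3)] ZZ_unique[OF ALH Z(2,1) x(1) Z(3)] A_iff[of z h] Z by simp
  qed
  have gT: "inv g \<in> T" using h0 g by (simp add: T_def transl_def)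
  \<comment> \<open>Another coefficient at \<open>w0\<close> would give a nontrivial
    \<open>r\<close> in H that moves \<open>inv g\<close> into \<open>S\<close>. As the translates
    of \<open>S\<close> are disjoint, \<open>inv g\<close> is then outside and its boundary edge
    leads into \<open>S\<close>; the translate of this edge by \<open>r\<close> is a second boundary
    edge of \<open>S\<close>, contrary to \<open>S_edge'\<close>.\<close>
  have w0A: "w0 \<notin> fst ` A"
  proof
    assume "w0 \<in> fst ` A"
    then obtain h where h: "(w0, h) \<in> A" unfolding fst_image_iff by blast
    then have h': "h \<in> H" "h \<noteq> h0" "inv h \<otimes> inv (e w0) \<in> S" using A_iff by auto
    define r where "r = inv h \<otimes> h0"
    have r: "r \<in> H" "r \<noteq> \<one>"
    proof -
      show "r \<in> H" using h' h0 by (simp add: r_def)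
      have "h \<otimes> r = h0" using h' h0 by (simp add: r_def)
      then show "r \<noteq> \<one>" using h' by auto
    qed
    have "h \<otimes> (r \<otimes> inv g) = h0 \<otimes> inv g" using h' h0 g by (simp add: r_def m_assoc)
    then have rS: "r \<otimes> inv g \<in> S"
      using const[of "r \<otimes> inv g" h w0] h' h0 r g by simp
    then have gS: "inv g \<notin> S" using S_disj[OF r(1), of "inv g"] r by blast
    have "inv g \<otimes> \<phi> (e (linv v)) \<in> S"
    proof -
      have 1: "inv g = \<phi> (inv g')" using Au_inv[OF \<phi> g'(1)] g' by simp
      have 2: "inv g \<otimes> \<phi> (e (linv v)) = \<phi> (inv g' \<otimes> e (linv v))"
        using Au_mult[OF \<phi>, of "inv g'" "e (linv v)"] g' v 1 by simp
      have "(\<phi> (inv g') \<in> S) \<noteq> (\<phi> (inv g' \<otimes> e (linv v)) \<in> S)"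
        using S_iff[of "inv g'"] S_iff[of "inv g' \<otimes> e (linv v)"] g' v
          H_Z[OF v H_one] inv_e_in_Z[OF v] by (simp add: e_linv)
      then show ?thesis using gS 1 2 by simp
    qed
    then have "r \<otimes> (inv g \<otimes> \<phi> (e (linv v))) \<notin> S" using S_disj[OF r(1)] r by blast
    moreover have "\<phi> (e (linv v)) \<in> carrier G" using Au_closed[OF \<phi>] v by simp
    ultimately have "(r \<otimes> inv g \<in> S) \<noteq> (r \<otimes> inv g \<otimes> \<phi> (e (linv v)) \<in> S)"
      using rS r g by (simp add: m_assoc)
    then have "r \<otimes> inv g = inv g" using S_edge'[of "r \<otimes> inv g" "linv v"] r g v by simp
    then show False using rS gS by simp
  qed
  \<comment> \<open>Outside \<open>T\<close> the sets \<open>S\<close> and \<open>ZZ A\<close>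
    agree, and every basis edge crossing \<open>S\<close> touches \<open>inv g\<close>, which lies
    in \<open>T\<close>. So every basis edge that leaves \<open>ZZ A\<close> leads into
    \<open>T\<close>, and the edges leaving \<open>ZZ A\<close> and those leaving
    \<open>ZZ A \<union> T\<close> are disjoint parts of the coboundary of \<open>T\<close>.\<close>
  have cr: "(a \<in> T) \<noteq> (b \<in> T) \<and> a \<in> ZZ A \<union> T \<and> b \<in> ZZ A \<union> T"
    if "(a \<in> ZZ A) \<noteq> (b \<in> ZZ A)" "a \<in> carrier G" "x \<in> L" "b = a \<otimes> \<phi> (e x)" for a b x
  proof (rule ccontr)
    assume neg: "\<not> ?thesis"
    have b: "b \<in> carrier G" using that Au_closed[OF \<phi>] by simp
    have nT: "a \<notin> T \<and> b \<notin> T" using neg that(1) T_A by blast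
    then have "(a \<in> S) \<noteq> (b \<in> S)" using S_A that(1,2) b by blast
    then have "inv g = a \<or> inv g = b" using S_edge[OF that(2,3)] that(4) by simp
    then show False using nT gT by blast
  qed
  have capT: "cap \<phi> T = cap \<phi> (Z w0)" unfolding T_def using cap_transl[OF \<phi>] h0 by simp
  have tameT: "tame T" unfolding T_def using tame_transl tame_Z h0 by simp
  have ineq: "cap \<phi> (ZZ A) + cap \<phi> (ZZ A \<union> T) \<le> cap \<phi> T"
    unfolding cap_def sum.distrib[symmetric]
  proof (intro sum_mono)
    fix x assume x: "x \<in> X"
    let ?y = "\<phi> (e (x, True))"
    have fin: "finite (cross T ?y)" using tameT gen_closed[OF \<phi> x] by (simp add: tame_def)
    note crx = cr[OF _ _ pos_L[OF x, of True]]
    have 1: "cross (ZZ A) ?y \<union> cross (ZZ A \<union> T) ?y \<subseteq> cross T ?y \<union> {}"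
    proof
      fix j assume j: "j \<in> cross (ZZ A) ?y \<union> cross (ZZ A \<union> T) ?y"
      then have jc: "j \<in> carrier G" by (auto simp: cross_def)
      show "j \<in> cross T ?y \<union> {}"
      proof (cases "(j \<in> ZZ A) = (j \<otimes> ?y \<in> ZZ A)")
        case False
        then show ?thesis using crx[OF False jc HOL.refl] jc by (simp add: cross_def)
      next
        case True
        then have "(j \<in> ZZ A \<union> T) \<noteq> (j \<otimes> ?y \<in> ZZ A \<union> T)" using j by (auto simp: cross_def)
        then show ?thesis using True jc by (auto simp: cross_def)
      qed
    qed
    have 2: "cross (ZZ A) ?y \<inter> cross (ZZ A \<union> T) ?y \<subseteq> cross T ?y \<inter> {}"
    proof
      fix j assume j: "j \<in> cross (ZZ A) ?y \<inter> cross (ZZ A \<union> T) ?y"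
      then have jc: "j \<in> carrier G" "(j \<in> ZZ A) \<noteq> (j \<otimes> ?y \<in> ZZ A)"
        "(j \<in> ZZ A \<union> T) \<noteq> (j \<otimes> ?y \<in> ZZ A \<union> T)" by (auto simp: cross_def)
      then show "j \<in> cross T ?y \<inter> {}" using crx[OF jc(2,1) HOL.refl] by blast
    qed
    show "card (cross (ZZ A) ?y) + card (cross (ZZ A \<union> T) ?y) \<le> card (cross T ?y)"
      using card_add_le_of_Un_Int[OF fin finite.emptyI 1 2] by simp
  qed
  have union: "ZZ (insert (w0, h0) A) = ZZ A \<union> T" unfolding ZZ_insert T_def by blast
  have pos1: "0 < cap \<phi> (ZZ A)" using cap_ZZ_pos[OF \<phi> finA ALH A_ne] .
  have pos2: "0 < cap \<phi> (ZZ (insert (w0, h0) A))" using cap_ZZ_pos[OF \<phi>] finA ALH h0 by simp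
  \<comment> \<open>Both summands in \<open>ineq\<close> are positive, so each is smaller than the
    capacity of \<open>Z w0\<close>. Which of the two sets admits \<open>w0\<close> or its inverse
    as a multiplier depends on whether \<open>linv w0\<close> occurs in \<open>A\<close>.\<close>
  show False
  proof (cases "linv w0 \<in> fst ` A")
    case True
    then have "twp A (linv w0)" using svA w0A by (simp add: twp_def)
    moreover have "cap \<phi> (ZZ A) < cap \<phi> (Z (linv w0))"
      using ineq capT pos2 union cap_Z_linv[OF \<phi> h0(2)] by simp
    ultimately show False using irred unfolding reducible_def by blast
  next
    case False
    have "sval (insert (w0, h0) A)"
      unfolding sval_def single_valued_def
    proof (intro conjI allI impI)
      fix z h h' assume "(z, h) \<in> insert (w0, h0) A" "(z, h') \<in> insert (w0, h0) A"
      then show "h = h'" using svalD(3)[OF svA] w0A unfolding fst_image_iff by blast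
    qed (use ALH finA h0 in auto)
    then have "twp (insert (w0, h0) A) w0" using False by (simp add: twp_def)
    moreover have "cap \<phi> (ZZ (insert (w0, h0) A)) < cap \<phi> (Z w0)"
      using ineq capT pos1 union by simp
    ultimately show False using irred unfolding reducible_def by blast
  qed
qed

text \<open>Left multiplication by \<open>\<phi> (e v)\<close> carries the half-space of
  \<open>v\<close> to the complement of that of \<open>linv v\<close>, and so an edge crossing the
  first to one crossing the second. By \<open>crossing_at_base\<close> both edges touch the base
  vertex. They cannot do so at the same end, since \<open>\<phi> (e v)\<close> is not in H; touching
  at opposite ends is the claim.\<close>

lemma irreducible_letter:
  assumes \<phi>: "\<phi> \<in> Au" and v: "v \<in> L" and irred: "\<not> reducible \<phi>"
  shows "\<exists>u\<in>L. \<exists>h\<in>H. \<exists>h'\<in>H. \<phi> (e v) = h \<otimes> e u \<otimes> h'"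
proof -
  let ?E = "\<phi> ` Z v"
  have Zv: "Z v \<subseteq> carrier G" "Z (linv v) \<subseteq> carrier G" using Z_carrier v by auto
  have y: "\<phi> (e v) \<in> carrier G" using Au_closed[OF \<phi>] v by simp
  have "\<exists>k u. k \<in> carrier G \<and> u \<in> L \<and> (k \<in> ?E) \<noteq> (k \<otimes> e u \<in> ?E)"
  proof (rule ccontr)
    assume none: "\<not> ?thesis"
    have "\<one> \<in> ?E"
    proof (rule closed_imp_all[of "\<phi> (inv (e v))"])
      show "\<phi> (inv (e v)) \<in> ?E" using inv_e_in_Z[OF v] by blast
      show "\<phi> (inv (e v)) \<in> carrier G" using Au_closed[OF \<phi>] v by simp
      show "g \<otimes> e u \<in> ?E" if "g \<in> ?E" "g \<in> carrier G" "u \<in> L" for g u using none that by blast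
      show "g \<otimes> h \<in> ?E" if g: "g \<in> ?E" "g \<in> carrier G" "h \<in> H" for g h
      proof -
        obtain n where n: "n \<in> Z v" "g = \<phi> n" using g by blast
        then have "g \<otimes> h = \<phi> (n \<otimes> h)"
          using Au_mult[OF \<phi>, of n h] Au_H[OF \<phi> g(3)] g Z_car[OF v] by simp
        then show ?thesis using Z_right[OF v n(1) g(3)] by blast
      qed
    qed simp
    then have "\<one> \<in> Z v" using Au_image_iff[OF \<phi> Zv(1), of \<one>] Au_H[OF \<phi> H_one] by simp
    then show False using H_Z[OF v H_one] by simp
  qed
  then obtain k u where k: "k \<in> carrier G" "u \<in> L" "(k \<in> ?E) \<noteq> (k \<otimes> e u \<in> ?E)" by blast
  have fl: "\<phi> (e v) \<otimes> x \<in> \<phi> ` Z (linv v) \<longleftrightarrow> x \<notin> ?E" if x: "x \<in> carrier G" for x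
  proof -
    obtain n where n: "n \<in> carrier G" "\<phi> n = x" using Au_surj[OF \<phi> x] by blast
    have "\<phi> (e v) \<otimes> x = \<phi> (e v \<otimes> n)" using Au_mult[OF \<phi>, of "e v" n] n v by simp
    then show ?thesis
      using Au_image_iff[OF \<phi> Zv(2), of "e v \<otimes> n"] Au_image_iff[OF \<phi> Zv(1), of n] n flip[OF v n(1)] v
      by simp
  qed
  define k2 where "k2 = \<phi> (e v) \<otimes> k"
  have k2: "k2 \<in> carrier G" using y k by (simp add: k2_def)
  have "(k2 \<in> \<phi> ` Z (linv v)) \<noteq> (k2 \<otimes> e u \<in> \<phi> ` Z (linv v))"
    using fl[of k] fl[of "k \<otimes> e u"] k y by (simp add: k2_def m_assoc)
  then have b2: "k2 \<in> H \<or> k2 \<otimes> e u \<in> H"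
    using crossing_at_base[OF \<phi> _ irred k2 k(2), of "linv v"] v by simp
  have b1: "k \<in> H \<or> k \<otimes> e u \<in> H" using crossing_at_base[OF \<phi> v irred k(1,2,3)] .
  have eq: "\<phi> (e v) = k2 \<otimes> inv k" using k y by (simp add: k2_def m_assoc)
  have nH: "\<phi> (e v) \<notin> H" using Au_H_iff[OF \<phi>, of "e v"] e_notin_H[OF v] v by simp
  show ?thesis
  proof (cases "k \<in> H")
    case True
    then have "k2 \<notin> H" using nH eq by auto
    then have h: "k2 \<otimes> e u \<in> H" using b2 by blast
    have "\<phi> (e v) = (k2 \<otimes> e u) \<otimes> e (linv u) \<otimes> inv k"
      using eq k k2 by (simp add: m_assoc e_linv)
    then show ?thesis using h True k by (meson H_inv linv_sgn_set)
  next
    case False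
    then have h: "k \<otimes> e u \<in> H" using b1 by blast
    have eq2: "\<phi> (e v) = k2 \<otimes> e u \<otimes> inv (k \<otimes> e u)"
      using eq k k2 by (simp add: m_assoc inv_mult_group)
    have "k2 \<otimes> e u \<notin> H" using nH eq2 h by auto
    then have "k2 \<in> H" using b2 by blast
    then show ?thesis using eq2 h k by (meson H_inv)
  qed
qed

lemma irreducible_twist:
  assumes \<phi>: "\<phi> \<in> Au" and irred: "\<not> reducible \<phi>"
  shows "\<exists>s \<sigma>. twist s \<sigma> \<phi>"
proof -
  have "\<forall>x\<in>X. \<exists>u h h'. u \<in> L \<and> h \<in> H \<and> h' \<in> H \<and> \<phi> (e (x, True)) = h \<otimes> e u \<otimes> h'"
    using irreducible_letter[OF \<phi> _ irred] by (meson pos_L)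
  then obtain u t t' where u: "\<And>x. x \<in> X \<Longrightarrow> u x \<in> L" and t: "\<And>x. x \<in> X \<Longrightarrow> t x \<in> H" "\<And>x. x \<in> X \<Longrightarrow> t' x \<in> H"
    and form: "\<And>x. x \<in> X \<Longrightarrow> \<phi> (e (x, True)) = t x \<otimes> e (u x) \<otimes> t' x"
    by metis
  define \<sigma> where "\<sigma> v = (if snd v then u (fst v) else linv (u (fst v)))" for v
  define s where "s v = (if snd v then inv (t' (fst v)) else t (fst v))" for v
  have \<sigma>_linv: "\<sigma> (linv v) = linv (\<sigma> v)" for v by (simp add: \<sigma>_def linv_def[of v])
  have \<sigma>L: "\<sigma> v \<in> L" if "v \<in> L" for v using that u[OF pos_fst[OF that]] by (simp add: \<sigma>_def)
  \<comment> \<open>A letter absent from all images would have capacity 0, against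
    \<open>cap_pos\<close>.\<close>
  have "\<exists>x\<in>X. fst (u x) = c" if c: "c \<in> X" for c
  proof (rule ccontr)
    assume none: "\<not> ?thesis"
    have cL: "(c, True) \<in> L" using c by simp
    have "cross (Z (c, True)) (\<phi> (e (x, True))) = {}" if x: "x \<in> X" for x
    proof -
      have "cross (Z (c, True)) (t x \<otimes> (e (u x) \<otimes> t' x)) = {}"
        using cross_sub[of "t x" "e (u x) \<otimes> t' x" "Z (c, True)"]
          cross_sub[of "e (u x)" "t' x" "Z (c, True)"] t[OF x] u[OF x]
          cross_H[OF Z_right_inv[OF cL]] cross_Z_letter_other[OF u[OF x] cL] none x by simp
      then show ?thesis using form[OF x] t[OF x] u[OF x] by (simp add: m_assoc)
    qed
    then have "cap \<phi> (Z (c, True)) = 0" by (simp add: cap_def)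
    moreover have "0 < cap \<phi> (Z (c, True))"
      using cap_pos[OF \<phi> tame_Z[OF cL] Z_right_inv[OF cL] inv_e_in_Z[OF cL], of \<one>] cL H_Z[OF cL H_one] by simp
    ultimately show False by simp
  qed
  note surj = this
  have "\<sigma> ` L = L"
  proof
    show "\<sigma> ` L \<subseteq> L" using \<sigma>L by blast
    show "L \<subseteq> \<sigma> ` L"
    proof
      fix v assume v: "v \<in> L"
      then obtain x where x: "x \<in> X" "fst (u x) = fst v" using surj pos_fst by blast
      then have "\<sigma> (x, True) = v \<or> \<sigma> (x, False) = v"
        using fst_eq_linv[of "u x" v] by (auto simp: \<sigma>_def)
      then show "v \<in> \<sigma> ` L" using x pos_L by blast
    qed
  qed
  then have bij: "bij_betw \<sigma> L L" using finL by (simp add: bij_betw_def finite_surj_inj)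
  have f: "\<phi> (e v) = s (linv v) \<otimes> e (\<sigma> v) \<otimes> inv (s v)" if v: "v \<in> L" for v
  proof -
    obtain x b where v': "v = (x, b)" by (cases v)
    then have x: "x \<in> X" using pos_fst[OF v] by simp
    show ?thesis
    proof (cases b)
      case True
      then show ?thesis using form[OF x] t[OF x] by (simp add: v' s_def \<sigma>_def linv_def)
    next
      case False
      have "e v = inv (e (x, True))" using e_linv[of "(x, True)"] x False by (simp add: v' linv_def)
      then have "\<phi> (e v) = inv (\<phi> (e (x, True)))" using Au_inv[OF \<phi>] x by simp
      then show ?thesis
        using form[OF x] t[OF x] u[OF x] False
        by (simp add: v' s_def \<sigma>_def linv_def[of "(x, False)"] inv_mult_group e_linv m_assoc)
    qed
  qed
  have sH: "s ` L \<subseteq> H"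
  proof
    fix h assume "h \<in> s ` L"
    then obtain v where "v \<in> L" "h = s v" by blast
    then show "h \<in> H" using t pos_fst[of v] by (simp add: s_def)
  qed
  have "twist s \<sigma> \<phi>" unfolding twist_def using \<phi> sH bij \<sigma>_linv f by blast
  then show ?thesis by blast
qed

end

section \<open>Minimal length, and partial functions as graphs of twists\<close>

context rel_free
begin

lemma Au_comp:
  assumes "\<phi> \<in> Au" "\<psi> \<in> Au" "\<And>g. g \<in> carrier G \<Longrightarrow> \<chi> g = \<psi> (\<phi> g)"
  shows "\<chi> \<in> Au"
proof -
  have "\<chi> \<in> hom G G"
  proof (rule homI)
    show "\<chi> g \<in> carrier G" if "g \<in> carrier G" for g
      using that assms Au_closed by simp
    show "\<chi> (g \<otimes> k) = \<chi> g \<otimes> \<chi> k" if "g \<in> carrier G" "k \<in> carrier G" for g k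
      using that assms(3) Au_mult[OF assms(1)] Au_mult[OF assms(2)] Au_closed[OF assms(1)] by simp
  qed
  moreover have "bij_betw \<chi> (carrier G) (carrier G)"
    using bij_betw_trans[OF AuD(2)[OF assms(1)] AuD(2)[OF assms(2)]] assms(3)
    by (simp cong: bij_betw_cong)
  moreover have "\<chi> h = h" if "h \<in> H" for h
    using that assms(3) Au_H[OF assms(1)] Au_H[OF assms(2)] by simp
  ultimately show ?thesis unfolding Au_def by blast
qed

lemma Au_ext:
  assumes "\<phi> \<in> Au" "\<psi> \<in> Au" "\<And>u. u \<in> L \<Longrightarrow> \<phi> (e u) = \<psi> (e u)" "g \<in> carrier G"
  shows "\<phi> g = \<psi> g"
  using assms(4)
proof (induction rule: left_induct)
  case (H h)
  then show ?case using Au_H[OF assms(1) H] Au_H[OF assms(2) H] by simp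
next
  case (Z h u g)
  then show ?case
    using assms(3)[of u] Au_mult[OF assms(1), of h "e u \<otimes> g"] Au_mult[OF assms(1), of "e u" g]
      Au_mult[OF assms(2), of h "e u \<otimes> g"] Au_mult[OF assms(2), of "e u" g]
      Au_H[OF assms(1)] Au_H[OF assms(2)] by simp
qed

text \<open>By \<open>cap_pos\<close> every generator occurs in the images, so each summand is at
  least 1.\<close>

lemma size_ge: "\<phi> \<in> Au \<Longrightarrow> card X \<le> size \<phi>"
proof -
  assume \<phi>: "\<phi> \<in> Au"
  have "1 \<le> cap \<phi> (Z (x, True))" if "x \<in> X" for x
    using cap_pos[of \<phi> "Z (x, True)" "inv (e (x, True))" \<one>] \<phi> tame_Z Z_right_inv inv_e_in_Z
      pos_L[OF that, of True] H_Z[OF pos_L[OF that, of True] H_one] by simp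
  then have "(\<Sum>x\<in>X. 1) \<le> size \<phi>" unfolding size_def by (intro sum_mono)
  then show ?thesis by simp
qed

lemma id_Au: "id \<in> Au"
  unfolding Au_def by (simp add: hom_def)

lemma size_id:
  assumes "\<And>x. x \<in> X \<Longrightarrow> \<phi> (e (x, True)) = e (x, True)"
  shows "size \<phi> = card X"
proof -
  have "cap \<phi> (Z (x, True)) = 1" if x: "x \<in> X" for x
  proof -
    have "card (cross (Z (x, True)) (\<phi> (e (y, True)))) = (if y = x then 1 else 0)" if y: "y \<in> X" for y
      using assms[OF y] cross_Z_pos(1)[of "(x, True)"] cross_Z_letter_other[of "(y, True)" "(x, True)"] x y
      by simp
    then show ?thesis using x finX unfolding cap_def by (simp cong: sum.cong)
  qed
  then show ?thesis unfolding size_def by simp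
qed

text \<open>Under a twist the preimage of \<open>Z a\<close> is a single direction, whereas under a
  Whitehead automorphism it is all of \<open>U D\<close>.\<close>

lemma twist_acts_w_trivial:
  assumes "acts_w \<psi> D a" "twist s \<sigma> \<psi>"
  shows "D = {a}"
proof -
  have D: "D \<subseteq> L" "a \<in> D" using assms(1) by (auto simp: acts_w_def wp_def)
  obtain v where v: "v \<in> L" "\<sigma> v = a"
    using assms(2) D unfolding twist_def bij_betw_def by (metis imageE subsetD)
  have sv: "s v \<in> H" using assms(2) v by (auto simp: twist_def)
  have "u = v" if u: "u \<in> D" for u
  proof -
    have uL: "u \<in> L" using u D by blast
    have "inv (e u) \<in> U D" unfolding U_def using u inv_e_in_Z[OF uL] by blast
    then have "\<psi> (inv (e u)) \<in> Z a" using acts_w_image(1)[OF assms(1)] uL by simp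
    then have "s v \<otimes> inv (e u) \<in> Z v" using twist_image[OF assms(2) v(1)] v(2) uL by simp
    then show ?thesis
      using direction_unique[OF uL v(1) H_one sv, of "inv (e u)"] inv_e_in_Z[OF uL] uL by simp
  qed
  then show ?thesis using D by blast
qed

lemma sval_graph: "s ` L \<subseteq> H \<Longrightarrow> D \<subseteq> L \<Longrightarrow> sval (graph s D)"
proof -
  assume *: "s ` L \<subseteq> H" "D \<subseteq> L"
  have "finite (graph s D)" using finite_subset[OF *(2) finL] by (simp add: graph_def)
  moreover have "graph s D \<subseteq> L \<times> H" using * unfolding graph_def by blast
  moreover have "single_valued (graph s D)" unfolding graph_def single_valued_def by blast
  ultimately show ?thesis by (simp add: sval_def)
qed

lemma fst_graph [simp]: "fst ` graph s D = D"
  by (simp add: graph_def image_image)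

lemma graph_eq:
  assumes "graph s D = graph t D'"
  shows "D = D'" "\<And>u. u \<in> D \<Longrightarrow> s u = t u"
proof -
  show "D = D'" using arg_cong[OF assms, of "image fst"] by simp
  fix u assume "u \<in> D"
  then have "(u, s u) \<in> graph t D'" using assms unfolding graph_def by blast
  then show "s u = t u" unfolding graph_def by auto
qed

lemma sval_is_graph:
  assumes "sval A"
  obtains s where "s ` L \<subseteq> H" "A = graph s (fst ` A)"
proof -
  define s where "s u = (if u \<in> fst ` A then (SOME h. (u, h) \<in> A) else \<one>)" for u
  have s: "(u, s u) \<in> A" if "u \<in> fst ` A" for u
    using that someI_ex[of "\<lambda>h. (u, h) \<in> A"] by (simp add: s_def fst_image_iff)
  have 1: "s ` L \<subseteq> H"
  proof
    fix h assume "h \<in> s ` L"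
    then obtain u where u: "h = s u" by blast
    show "h \<in> H"
    proof (cases "u \<in> fst ` A")
      case True
      then show ?thesis using s[OF True] svalD(1)[OF assms] u by blast
    next
      case False
      then show ?thesis using u by (simp add: s_def)
    qed
  qed
  have "A \<subseteq> graph s (fst ` A)"
  proof
    fix p assume p: "p \<in> A"
    obtain u h where uh: "p = (u, h)" by (cases p)
    have u: "u \<in> fst ` A" using p uh unfolding fst_image_iff by blast
    then have "h = s u" using s[OF u] svalD(3)[OF assms] p uh by blast
    then show "p \<in> graph s (fst ` A)" using u uh unfolding graph_def by blast
  qed
  moreover have "graph s (fst ` A) \<subseteq> A" unfolding graph_def using s by blast
  ultimately show ?thesis using that 1 by blast
qed

lemma shift_graph: "shift k (graph s D) = graph (\<lambda>u. s u \<otimes> k) D"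
  by (simp add: shift_def graph_def image_image)

text \<open>One twist \<open>t\<close> is to serve both sets. Once it has been applied,
  \<open>A\<close> and the shifted \<open>B\<close> become plain sets of letters, and a peak becomes
  one of ordinary Whitehead pairs.\<close>

lemma nested_common_graph:
  assumes A: "sval A" and B: "sval B" and n: "nested A B"
  obtains k t where "k \<in> H" "t ` L \<subseteq> H" "A = graph t (fst ` A)" "shift k B = graph t (fst ` B)"
    "fst ` A \<inter> fst ` B = {} \<or> fst ` A \<subseteq> fst ` B \<or> fst ` B \<subseteq> fst ` A"
proof -
  consider "fst ` A \<inter> fst ` B = {}" | k where "k \<in> H" "A \<subseteq> shift k B" | k where "k \<in> H" "shift k B \<subseteq> A"
    using n unfolding nested_def by blast
  then show ?thesis
  proof cases
    case 1
    obtain s where s: "s ` L \<subseteq> H" "A = graph s (fst ` A)" using sval_is_graph[OF A] .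
    obtain r where r: "r ` L \<subseteq> H" "B = graph r (fst ` B)" using sval_is_graph[OF B] .
    define t where "t u = (if u \<in> fst ` A then s u else r u)" for u
    have "t ` L \<subseteq> H" using s(1) r(1) by (auto simp: t_def)
    moreover have "graph t (fst ` A) = graph s (fst ` A)"
      unfolding graph_def by (intro image_cong) (simp_all add: t_def)
    then have "A = graph t (fst ` A)" using s(2) by metis
    moreover have "graph t (fst ` B) = graph r (fst ` B)"
      unfolding graph_def using 1 by (intro image_cong) (auto simp: t_def)
    then have "shift \<one> B = graph t (fst ` B)" using shift_one[OF svalD(1)[OF B]] r(2) by metis
    ultimately show ?thesis by (rule that[OF H_one]) (use 1 in simp)
  next
    case (2 k)
    have sB: "sval (shift k B)" using sval_shift[OF B 2(1)] .
    obtain t where t: "t ` L \<subseteq> H" "shift k B = graph t (fst ` shift k B)" using sval_is_graph[OF sB] .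
    have "fst ` A \<subseteq> fst ` B" using image_mono[OF 2(2), of fst] by simp
    moreover have "A = graph t (fst ` A)"
    proof
      show "A \<subseteq> graph t (fst ` A)"
      proof
        fix p assume p: "p \<in> A"
        obtain u h where uh: "p = (u, h)" by (cases p)
        have "p \<in> graph t (fst ` shift k B)" using p 2 t(2) by blast
        then have "h = t u" unfolding graph_def uh by blast
        then show "p \<in> graph t (fst ` A)" using p uh unfolding graph_def by force
      qed
      show "graph t (fst ` A) \<subseteq> A"
      proof
        fix p assume "p \<in> graph t (fst ` A)"
        then obtain u where u: "u \<in> fst ` A" "p = (u, t u)" unfolding graph_def by blast
        then obtain h where h: "(u, h) \<in> A" unfolding fst_image_iff by blast
        then have "(u, h) \<in> graph t (fst ` shift k B)" using 2 t(2) by blast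
        then have "h = t u" unfolding graph_def by blast
        then show "p \<in> A" using h u by simp
      qed
    qed
    ultimately show ?thesis
      using that[OF 2(1) t(1)] t(2) by (metis fst_shift)
  next
    case (3 k)
    obtain t where t: "t ` L \<subseteq> H" "A = graph t (fst ` A)" using sval_is_graph[OF A] .
    have sub: "fst ` B \<subseteq> fst ` A" using image_mono[OF 3(2), of fst] by simp
    have "shift k B = graph t (fst ` B)"
    proof
      show "shift k B \<subseteq> graph t (fst ` B)"
      proof
        fix p assume p: "p \<in> shift k B"
        obtain u h where uh: "p = (u, h)" by (cases p)
        have "p \<in> graph t (fst ` A)" using p 3 t(2) by blast
        then have "h = t u" unfolding graph_def uh by blast
        moreover have "u \<in> fst ` B" using p uh fst_shift[of k B] fst_image_iff[of u "shift k B"] by auto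
        ultimately show "p \<in> graph t (fst ` B)" using uh unfolding graph_def by blast
      qed
      show "graph t (fst ` B) \<subseteq> shift k B"
      proof
        fix p assume "p \<in> graph t (fst ` B)"
        then obtain u where u: "u \<in> fst ` shift k B" "p = (u, t u)" unfolding graph_def by auto
        then obtain h where h: "(u, h) \<in> shift k B" unfolding fst_image_iff by blast
        then have "(u, h) \<in> graph t (fst ` A)" using 3 t(2) by blast
        then have "h = t u" unfolding graph_def by blast
        then show "p \<in> shift k B" using h u by simp
      qed
    qed
    then show ?thesis using that[OF 3(1) t] sub by metis
  qed
qed

end

section \<open>Peak reduction\<close>

text \<open>\<open>P\<close> will be the presented group, and the equations between
  \<open>w\<close>, \<open>\<theta>\<close> and \<open>\<Lambda>\<close> are the consequences of the
  relations that the argument consumes. Products are read from left to right, hence the order in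
  \<open>Phi_mult\<close>. On \<open>\<Lambda>\<close>, which lifts the twists, \<Phi> is assumed to
  have trivial kernel; \<open>Phi_inj\<close> extends this to \<open>P\<close>.\<close>

locale wh_group = rel_free G H X e Z len + P: group P
  for G (structure) and H :: "'a set" and X :: "'v set" and e Z len
    and P :: "('p, 'c) monoid_scheme" +
  fixes \<Phi> :: "'p \<Rightarrow> 'a \<Rightarrow> 'a" and w :: "'v letter set \<Rightarrow> 'v letter \<Rightarrow> 'p"
    and \<Lambda> :: "'p set" and \<theta> :: "('v letter \<Rightarrow> 'a) \<Rightarrow> 'p"
  assumes Phi_Au: "p \<in> carrier P \<Longrightarrow> \<Phi> p \<in> Au"
    and Phi_mult: "p \<in> carrier P \<Longrightarrow> q \<in> carrier P \<Longrightarrow> g \<in> carrier G \<Longrightarrow> \<Phi> (p \<otimes>\<^bsub>P\<^esub> q) g = \<Phi> q (\<Phi> p g)"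
    and w_closed: "wp D a \<Longrightarrow> w D a \<in> carrier P"
    and w_acts: "wp D a \<Longrightarrow> acts_w (\<Phi> (w D a)) D a"
    and sub_Lam: "subgroup \<Lambda> P"
    and theta_Lam: "s ` L \<subseteq> H \<Longrightarrow> \<theta> s \<in> \<Lambda>"
    and theta_twist: "s ` L \<subseteq> H \<Longrightarrow> twist s id (\<Phi> (\<theta> s))"
    and Lam_twist: "l \<in> \<Lambda> \<Longrightarrow> \<exists>s \<sigma>. twist s \<sigma> (\<Phi> l)"
    and Lam_surj: "twist s \<sigma> \<phi> \<Longrightarrow> \<exists>l\<in>\<Lambda>. \<forall>u\<in>L. \<Phi> l (e u) = \<phi> (e u)"
    and Lam_inj: "l \<in> \<Lambda> \<Longrightarrow> \<forall>u\<in>L. \<Phi> l (e u) = e u \<Longrightarrow> l = \<one>\<^bsub>P\<^esub>"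
    and theta_mult: "s ` L \<subseteq> H \<Longrightarrow> r ` L \<subseteq> H \<Longrightarrow> \<theta> (\<lambda>u. s u \<otimes> r u) = \<theta> s \<otimes>\<^bsub>P\<^esub> \<theta> r"
    and theta_cong: "(\<And>u. u \<in> L \<Longrightarrow> s u = r u) \<Longrightarrow> \<theta> s = \<theta> r"
    and Lam_w: "l \<in> \<Lambda> \<Longrightarrow> wp D a \<Longrightarrow> \<exists>s D' a'. s ` L \<subseteq> H \<and> wp D' a' \<and>
        (\<exists>l'\<in>\<Lambda>. l \<otimes>\<^bsub>P\<^esub> w D a = \<theta> s \<otimes>\<^bsub>P\<^esub> w D' a' \<otimes>\<^bsub>P\<^esub> l')"
    and theta_w: "s ` L \<subseteq> H \<Longrightarrow> wp D a \<Longrightarrow> \<forall>u\<in>D. s u = h \<Longrightarrow> \<exists>l\<in>\<Lambda>. \<theta> s \<otimes>\<^bsub>P\<^esub> w D a = w D a \<otimes>\<^bsub>P\<^esub> l"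
    and w_single: "a \<in> L \<Longrightarrow> w {a} a = \<one>\<^bsub>P\<^esub>"
    and w_inv: "wp A a \<Longrightarrow> inv\<^bsub>P\<^esub> (w A a) = w (insert (linv a) (A - {a})) (linv a)"
    and w_join: "wp A a \<Longrightarrow> wp B a \<Longrightarrow> A \<inter> B = {a} \<Longrightarrow> w A a \<otimes>\<^bsub>P\<^esub> w B a = w (A \<union> B) a"
    and w_commute: "wp A a \<Longrightarrow> wp B b \<Longrightarrow> A \<inter> B = {} \<Longrightarrow> linv a \<notin> B \<Longrightarrow> linv b \<notin> A \<Longrightarrow>
        w A a \<otimes>\<^bsub>P\<^esub> w B b = w B b \<otimes>\<^bsub>P\<^esub> w A a"
    and w_commute': "wp A a \<Longrightarrow> wp B b \<Longrightarrow> A \<subseteq> B \<Longrightarrow> linv a \<in> B \<Longrightarrow> b \<notin> A \<Longrightarrow>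
        w A a \<otimes>\<^bsub>P\<^esub> w B b = w B b \<otimes>\<^bsub>P\<^esub> w A a"
    and w_slide: "wp A a \<Longrightarrow> wp B b \<Longrightarrow> A \<inter> B = {} \<Longrightarrow> linv a \<notin> B \<Longrightarrow> linv b \<in> A \<Longrightarrow>
        w A a \<otimes>\<^bsub>P\<^esub> w B b = w B b \<otimes>\<^bsub>P\<^esub> w (A \<union> B - {b}) a"
    and w_slide': "wp A a \<Longrightarrow> wp B b \<Longrightarrow> A \<subseteq> B \<Longrightarrow> linv a \<in> B \<Longrightarrow> b \<in> A \<Longrightarrow>
        w A a \<otimes>\<^bsub>P\<^esub> w B b = w B b \<otimes>\<^bsub>P\<^esub> w (insert (linv b) (B - A)) (linv a)"
    and w_exchange: "wp A a \<Longrightarrow> wp A b \<Longrightarrow> a \<noteq> b \<Longrightarrow>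
        \<exists>l\<in>\<Lambda>. inv\<^bsub>P\<^esub> (w A a) \<otimes>\<^bsub>P\<^esub> w A b = l \<otimes>\<^bsub>P\<^esub> w (insert (linv a) (insert (linv b) (A - {a, b}))) (linv a)"
    and P_gen: "carrier P = generate P (\<Lambda> \<union> {w D a |D a. wp D a})"
begin

abbreviation pm (infixl "\<cdot>" 70) where "p \<cdot> q \<equiv> p \<otimes>\<^bsub>P\<^esub> q"
abbreviation pinv where "pinv p \<equiv> inv\<^bsub>P\<^esub> p"

lemma Lam_car [simp]: "l \<in> \<Lambda> \<Longrightarrow> l \<in> carrier P"
  using subgroup.mem_carrier[OF sub_Lam] .

lemma Lam_mult [simp]: "l \<in> \<Lambda> \<Longrightarrow> m \<in> \<Lambda> \<Longrightarrow> l \<cdot> m \<in> \<Lambda>"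
  using subgroup.m_closed[OF sub_Lam] .

lemma Lam_inv [simp]: "l \<in> \<Lambda> \<Longrightarrow> pinv l \<in> \<Lambda>"
  using subgroup.m_inv_closed[OF sub_Lam] .

lemma Lam_one [simp]: "\<one>\<^bsub>P\<^esub> \<in> \<Lambda>"
  using subgroup.one_closed[OF sub_Lam] .

declare w_closed [simp] theta_Lam [simp]

text \<open>The moves along edges of the reduction graph. Allowing \<open>\<Lambda>\<close> on both
  sides makes edges stable under multiplying their ends by \<open>\<Lambda>\<close>, see
  \<open>E_Lam\<close>.\<close>

definition M :: "'p set" where
  "M = \<Lambda> \<union> {l \<cdot> w D a \<cdot> l' |l l' D a. l \<in> \<Lambda> \<and> l' \<in> \<Lambda> \<and> wp D a}"

definition sz :: "'p \<Rightarrow> nat" where "sz p = size (\<Phi> p)"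

definition E :: "'p \<Rightarrow> 'p \<Rightarrow> bool" where
  "E p q \<longleftrightarrow> p \<in> carrier P \<and> q \<in> carrier P \<and> pinv p \<cdot> q \<in> M"

text \<open>Remembers the set of directions along which a neighbour is reached. By
  \<open>Lam_w\<close> the permutation part of a factor from \<open>\<Lambda>\<close> can be moved
  to the right, so only a twist has to stand in front of the pair.\<close>

definition nb :: "'p \<Rightarrow> ('v letter \<times> 'a) set \<Rightarrow> 'v letter \<Rightarrow> 'p \<Rightarrow> bool" where
  "nb p A a q \<longleftrightarrow> p \<in> carrier P \<and>
    (\<exists>s D l. s ` L \<subseteq> H \<and> wp D a \<and> A = graph s D \<and> l \<in> \<Lambda> \<and> q = p \<cdot> \<theta> s \<cdot> w D a \<cdot> l)"

lemma wp_inv: "wp A a \<Longrightarrow> wp (insert (linv a) (A - {a})) (linv a)"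
  by (auto simp: wp_def)

lemma M_car: "x \<in> M \<Longrightarrow> x \<in> carrier P"
  unfolding M_def by auto

lemma MI: "l \<in> \<Lambda> \<Longrightarrow> l' \<in> \<Lambda> \<Longrightarrow> wp D a \<Longrightarrow> l \<cdot> w D a \<cdot> l' \<in> M"
  unfolding M_def by blast

lemma M_w: "wp D a \<Longrightarrow> w D a \<in> M"
  using MI[of "\<one>\<^bsub>P\<^esub>" "\<one>\<^bsub>P\<^esub>" D a] by simp

lemma M_Lam: "l \<in> \<Lambda> \<Longrightarrow> l \<in> M"
  unfolding M_def by blast

lemma M_mult:
  assumes "l \<in> \<Lambda>" "x \<in> M" "l' \<in> \<Lambda>"
  shows "l \<cdot> x \<cdot> l' \<in> M"
proof -
  consider "x \<in> \<Lambda>" | m m' D a where "m \<in> \<Lambda>" "m' \<in> \<Lambda>" "wp D a" "x = m \<cdot> w D a \<cdot> m'"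
    using assms(2) unfolding M_def by blast
  then show ?thesis
  proof cases
    case 1
    then show ?thesis using assms M_Lam by simp
  next
    case 2
    then have "l \<cdot> x \<cdot> l' = (l \<cdot> m) \<cdot> w D a \<cdot> (m' \<cdot> l')" using assms by (simp add: P.m_assoc)
    then show ?thesis using MI[of "l \<cdot> m" "m' \<cdot> l'" D a] 2 assms by simp
  qed
qed

lemma M_inv:
  assumes "x \<in> M"
  shows "pinv x \<in> M"
proof -
  consider "x \<in> \<Lambda>" | m m' D a where "m \<in> \<Lambda>" "m' \<in> \<Lambda>" "wp D a" "x = m \<cdot> w D a \<cdot> m'"
    using assms unfolding M_def by blast
  then show ?thesis
  proof cases
    case 1
    then show ?thesis using M_Lam by simp
  next
    case 2
    then have "pinv x = pinv m' \<cdot> w (insert (linv a) (D - {a})) (linv a) \<cdot> pinv m"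
      using w_inv[OF 2(3)] by (simp add: P.inv_mult_group P.m_assoc)
    then show ?thesis using MI[of "pinv m'" "pinv m"] wp_inv[OF 2(3)] 2 by simp
  qed
qed

lemma E_car: "E p q \<Longrightarrow> p \<in> carrier P" "E p q \<Longrightarrow> q \<in> carrier P"
  by (auto simp: E_def)

lemma E_sym: "E p q \<Longrightarrow> E q p"
  unfolding E_def using M_inv[of "pinv p \<cdot> q"] by (simp add: P.inv_mult_group)

lemma E_refl: "p \<in> carrier P \<Longrightarrow> E p p"
  unfolding E_def by (simp add: M_Lam)

lemma E_Lam:
  assumes "E p q" "l \<in> \<Lambda>" "l' \<in> \<Lambda>"
  shows "E (p \<cdot> l) (q \<cdot> l')"
proof -
  have "pinv (p \<cdot> l) \<cdot> (q \<cdot> l') = pinv l \<cdot> (pinv p \<cdot> q) \<cdot> l'"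
    using assms by (simp add: E_def P.inv_mult_group P.m_assoc)
  then show ?thesis using M_mult[of "pinv l" "pinv p \<cdot> q" l'] assms by (simp add: E_def)
qed

lemma E_mult: "p \<in> carrier P \<Longrightarrow> x \<in> M \<Longrightarrow> E p (p \<cdot> x)"
  unfolding E_def using M_car by simp

lemma E_Lam_right:
  assumes "E p q" "l \<in> \<Lambda>"
  shows "E p (q \<cdot> l)"
  using E_Lam[OF assms(1), of "\<one>\<^bsub>P\<^esub>" l] assms E_car by simp

lemma nb_E: "nb p A a q \<Longrightarrow> E p q"
proof -
  assume "nb p A a q"
  then obtain s D l where *: "p \<in> carrier P" "s ` L \<subseteq> H" "wp D a" "l \<in> \<Lambda>" "q = p \<cdot> \<theta> s \<cdot> w D a \<cdot> l"
    unfolding nb_def by blast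
  then have "q = p \<cdot> (\<theta> s \<cdot> w D a \<cdot> l)" by (simp add: P.m_assoc)
  then show ?thesis using E_mult[OF *(1) MI[of "\<theta> s" l D a]] * by simp
qed

lemma twp_graph: "s ` L \<subseteq> H \<Longrightarrow> wp D a \<Longrightarrow> twp (graph s D) a"
  by (simp add: twp_def sval_graph wp_def)

lemma nb_twp: "nb p A a q \<Longrightarrow> twp A a"
  unfolding nb_def using twp_graph by blast

lemma E_cases:
  assumes "E p q"
  obtains l where "l \<in> \<Lambda>" "q = p \<cdot> l" | A a where "nb p A a q"
proof -
  have c: "p \<in> carrier P" "q \<in> carrier P" and m: "pinv p \<cdot> q \<in> M" using assms by (auto simp: E_def)
  have q: "q = p \<cdot> (pinv p \<cdot> q)" using c by simp
  consider "pinv p \<cdot> q \<in> \<Lambda>" | l l' D a where "l \<in> \<Lambda>" "l' \<in> \<Lambda>" "wp D a" "pinv p \<cdot> q = l \<cdot> w D a \<cdot> l'"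
    using m unfolding M_def by blast
  then show ?thesis
  proof cases
    case 1
    then show ?thesis using that(1) q by blast
  next
    case 2
    obtain s D' a' l2 where *: "s ` L \<subseteq> H" "wp D' a'" "l2 \<in> \<Lambda>" "l \<cdot> w D a = \<theta> s \<cdot> w D' a' \<cdot> l2"
      using Lam_w[OF 2(1,3)] by blast
    have "q = p \<cdot> \<theta> s \<cdot> w D' a' \<cdot> (l2 \<cdot> l')"
      using q 2 * c by (simp add: P.m_assoc)
    then have "nb p (graph s D') a' q" unfolding nb_def using * 2 c Lam_mult by blast
    then show ?thesis using that(2) by blast
  qed
qed

lemma twp_nb:
  assumes "p \<in> carrier P" "twp A a"
  shows "\<exists>q. nb p A a q"
proof -
  have A: "sval A" using assms(2) by (simp add: twp_def)
  obtain s where s: "s ` L \<subseteq> H" "A = graph s (fst ` A)" using sval_is_graph[OF A] .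
  have "fst ` A \<subseteq> L" using svalD(1)[OF A] by auto
  then have "wp (fst ` A) a" using assms(2) unfolding twp_def wp_def by blast
  then have "nb p A a (p \<cdot> \<theta> s \<cdot> w (fst ` A) a \<cdot> \<one>\<^bsub>P\<^esub>)"
    unfolding nb_def using s assms(1) Lam_one by blast
  then show ?thesis by blast
qed

lemma Phi_gen:
  assumes "p \<in> carrier P" "q \<in> carrier P" "x \<in> X"
  shows "\<Phi> (p \<cdot> q) (e (x, True)) = \<Phi> q (\<Phi> p (e (x, True)))"
  using Phi_mult[OF assms(1,2)] assms(3) by simp

lemma sz_Lam:
  assumes "p \<in> carrier P" "l \<in> \<Lambda>"
  shows "sz (p \<cdot> l) = sz p"
proof -
  obtain s \<sigma> where "twist s \<sigma> (\<Phi> l)" using Lam_twist[OF assms(2)] by blast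
  then show ?thesis unfolding sz_def
    using size_twist[of s \<sigma> "\<Phi> l" "\<Phi> p" "\<Phi> (p \<cdot> l)"] Phi_Au Phi_gen assms by simp
qed

abbreviation cp where "cp p S \<equiv> cap (\<Phi> p) S"

lemma sz_w:
  assumes "p \<in> carrier P" "wp D a"
  shows "sz (p \<cdot> w D a) + cp p (Z a) = sz p + cp p (U D)"
    and "u \<in> L \<Longrightarrow> fst u \<noteq> fst a \<Longrightarrow> cp (p \<cdot> w D a) (Z u) = cp p (Z u)"
  unfolding sz_def
  using size_acts_w[OF w_acts[OF assms(2)], of "\<Phi> p" "\<Phi> (p \<cdot> w D a)"] Phi_Au Phi_gen assms by simp_all

lemma cp_theta:
  assumes "p \<in> carrier P" "s ` L \<subseteq> H"
  shows "D \<subseteq> L \<Longrightarrow> cp (p \<cdot> \<theta> s) (U D) = cp p (ZZ (graph s D))"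
    and "u \<in> L \<Longrightarrow> cp (p \<cdot> \<theta> s) (Z u) = cp p (Z u)"
proof -
  have c: "\<Phi> p \<in> Au" "\<Phi> (\<theta> s) \<in> Au" using assms Phi_Au by simp_all
  have *: "cp (p \<cdot> \<theta> s) S = cp p (pre (\<Phi> (\<theta> s)) S)" for S
    using cap_comp[OF c, of "\<Phi> (p \<cdot> \<theta> s)"] Phi_gen assms by simp
  note t = theta_twist[OF assms(2)]
  show "D \<subseteq> L \<Longrightarrow> cp (p \<cdot> \<theta> s) (U D) = cp p (ZZ (graph s D))"
    unfolding * using twist_pre_U[OF t] by simp
  show "u \<in> L \<Longrightarrow> cp (p \<cdot> \<theta> s) (Z u) = cp p (Z u)"
    unfolding * using twist_pre_Z[OF t] cap_transl[OF c(1), of "s u" "Z u"] assms(2) by auto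
qed

lemma wp_L: "wp D a \<Longrightarrow> a \<in> L" "wp D a \<Longrightarrow> D \<subseteq> L" "wp D a \<Longrightarrow> a \<in> D" "wp D a \<Longrightarrow> linv a \<notin> D"
  by (auto simp: wp_def)

text \<open>The twist in front changes no length; it only turns \<open>U D\<close> into
  \<open>ZZ A\<close>.\<close>

lemma nb_sz:
  assumes "nb p A a q"
  shows "sz q + cp p (Z a) = sz p + cp p (ZZ A)"
proof -
  obtain s D l where *: "p \<in> carrier P" "s ` L \<subseteq> H" "wp D a" "A = graph s D" "l \<in> \<Lambda>" "q = p \<cdot> \<theta> s \<cdot> w D a \<cdot> l"
    using assms unfolding nb_def by blast
  have "sz q = sz (p \<cdot> \<theta> s \<cdot> w D a)" using * sz_Lam by simp
  moreover have "sz (p \<cdot> \<theta> s \<cdot> w D a) + cp (p \<cdot> \<theta> s) (Z a) = sz (p \<cdot> \<theta> s) + cp (p \<cdot> \<theta> s) (U D)"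
    using sz_w(1) * by simp
  ultimately show ?thesis using sz_Lam[of p "\<theta> s"] cp_theta[of p s] * wp_L[OF *(3)] by simp
qed

text \<open>Two extensions of one partial function differ by a twist that is trivial on
  \<open>D\<close>, and by \<open>theta_w\<close> such a twist passes through \<open>w D a\<close>
  and ends up in \<open>\<Lambda>\<close>.\<close>

lemma nb_graph:
  assumes n: "nb p (graph t D') a q" and t: "t ` L \<subseteq> H" and D': "D' \<subseteq> L"
  shows "wp D' a \<and> (\<exists>l\<in>\<Lambda>. q = p \<cdot> \<theta> t \<cdot> w D' a \<cdot> l)"
proof -
  obtain s D l where *: "p \<in> carrier P" "s ` L \<subseteq> H" "wp D a" "graph t D' = graph s D" "l \<in> \<Lambda>"
      "q = p \<cdot> \<theta> s \<cdot> w D a \<cdot> l"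
    using n unfolding nb_def by blast
  have DD: "D' = D" and st: "\<And>u. u \<in> D \<Longrightarrow> t u = s u" using graph_eq[OF *(4)] by auto
  define r where "r u = inv (s u) \<otimes> t u" for u
  have sH: "s u \<in> H" and tH: "t u \<in> H" if "u \<in> L" for u using *(2) t that by blast+
  have r: "r ` L \<subseteq> H" unfolding image_subset_iff r_def using sH tH by simp
  have "\<theta> t = \<theta> (\<lambda>u. s u \<otimes> r u)"
    by (intro theta_cong) (simp add: r_def sH tH)
  also have "\<dots> = \<theta> s \<cdot> \<theta> r" by (rule theta_mult[OF *(2) r])
  finally have tt: "\<theta> t = \<theta> s \<cdot> \<theta> r" .
  have "s u \<in> H" if "u \<in> D" for u using *(2) wp_L(2)[OF *(3)] that by blast
  then have "\<forall>u\<in>D. r u = \<one>" using st by (simp add: r_def)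
  then obtain m where m: "m \<in> \<Lambda>" "\<theta> r \<cdot> w D a = w D a \<cdot> m" using theta_w[OF r *(3)] by blast
  have "p \<cdot> \<theta> t \<cdot> w D' a \<cdot> (pinv m \<cdot> l) = p \<cdot> \<theta> s \<cdot> (\<theta> r \<cdot> w D a) \<cdot> (pinv m \<cdot> l)"
    using * r by (simp add: tt DD P.m_assoc)
  also have "\<dots> = q" using * m by (simp add: P.m_assoc)
  finally show ?thesis using * m DD Lam_mult[OF Lam_inv[OF m(1)] *(5)] by metis
qed

text \<open>A shift by \<open>k\<close> amounts to the constant twist \<open>k\<close>, which
  \<open>theta_w\<close> again moves to the right into \<open>\<Lambda>\<close>.\<close>

lemma nb_shift:
  assumes n: "nb p A a q" and k: "k \<in> H"
  shows "nb p (shift k A) a q"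
proof -
  obtain s D l where *: "p \<in> carrier P" "s ` L \<subseteq> H" "wp D a" "A = graph s D" "l \<in> \<Lambda>" "q = p \<cdot> \<theta> s \<cdot> w D a \<cdot> l"
    using n unfolding nb_def by blast
  have c: "(\<lambda>u. k) ` L \<subseteq> H" using k by auto
  have s': "(\<lambda>u. s u \<otimes> k) ` L \<subseteq> H" using k *(2) by auto
  obtain m where m: "m \<in> \<Lambda>" "\<theta> (\<lambda>u. k) \<cdot> w D a = w D a \<cdot> m" using theta_w[OF c *(3)] by blast
  have "p \<cdot> \<theta> (\<lambda>u. s u \<otimes> k) \<cdot> w D a \<cdot> (pinv m \<cdot> l) = p \<cdot> \<theta> s \<cdot> (\<theta> (\<lambda>u. k) \<cdot> w D a) \<cdot> (pinv m \<cdot> l)"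
    using * c theta_mult[OF *(2) c] by (simp add: P.m_assoc)
  also have "\<dots> = q" using * m by (simp add: P.m_assoc)
  finally show ?thesis unfolding nb_def
    using * m s' shift_graph[of k s D] Lam_mult[OF Lam_inv[OF m(1)] *(5)] by metis
qed

text \<open>The relation \<open>\<alpha> \<beta>' = \<beta> \<gamma>\<close> replaces the peak \<open>p \<alpha> \<leftarrow> p \<rightarrow> p \<beta>\<close> by a path
  through \<open>p \<alpha> \<beta>'\<close>.\<close>

lemma peak_commute:
  assumes p: "p \<in> carrier P" and A: "wp A a" and B: "wp B b" and B': "wp B' b" and ab: "fst b \<noteq> fst a"
    and less: "cp p (U A) + cp p (U B) < cp p (Z a) + cp p (Z b)"
    and pr: "pre (\<Phi> (w A a)) (U B') = U B"
    and rel: "w A a \<cdot> w B' b = w B b \<cdot> c" and c: "c \<in> M"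
  shows "\<exists>r. sz r < sz p \<and> E (p \<cdot> w A a) r \<and> E r (p \<cdot> w B b)"
proof -
  let ?r = "p \<cdot> w A a \<cdot> w B' b"
  have "cp (p \<cdot> w A a) (U B') = cp p (U B)"
    using cap_comp[of "\<Phi> p" "\<Phi> (w A a)" "\<Phi> (p \<cdot> w A a)"] Phi_gen Phi_Au p A pr by simp
  moreover have "cp (p \<cdot> w A a) (Z b) = cp p (Z b)" using sz_w(2)[OF p A] ab wp_L[OF B] by simp
  moreover have "sz ?r + cp (p \<cdot> w A a) (Z b) = sz (p \<cdot> w A a) + cp (p \<cdot> w A a) (U B')"
    using sz_w(1)[of "p \<cdot> w A a" B' b] p A B' by simp
  moreover have "sz (p \<cdot> w A a) + cp p (Z a) = sz p + cp p (U A)" using sz_w(1)[OF p A] .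
  ultimately have "sz ?r < sz p" using less by linarith
  moreover have "E (p \<cdot> w A a) ?r" using E_mult[of "p \<cdot> w A a" "w B' b"] p A B' M_w by simp
  moreover have "?r = p \<cdot> w B b \<cdot> c" using rel p A B B' M_car[OF c] by (simp add: P.m_assoc)
  then have "E ?r (p \<cdot> w B b)" using E_sym[OF E_mult[of "p \<cdot> w B b" c]] c p B by simp
  ultimately show ?thesis by blast
qed

lemma exchange_M: "wp A a \<Longrightarrow> wp A b \<Longrightarrow> pinv (w A a) \<cdot> w A b \<in> M"
proof (cases "a = b")
  case False
  assume A: "wp A a" "wp A b"
  then obtain l where l: "l \<in> \<Lambda>"
    "pinv (w A a) \<cdot> w A b = l \<cdot> w (insert (linv a) (insert (linv b) (A - {a, b}))) (linv a)"
    using w_exchange[OF A False] by blast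
  have "a \<noteq> linv b" using A by (auto simp: wp_def)
  then have "wp (insert (linv a) (insert (linv b) (A - {a, b}))) (linv a)"
    using A by (auto simp: wp_def)
  then show ?thesis using MI[OF l(1) Lam_one] l by simp
qed (simp add: M_Lam)

lemma E_of_M:
  assumes "p \<in> carrier P" "x \<in> carrier P" "y \<in> carrier P" "pinv x \<cdot> y \<in> M"
  shows "E (p \<cdot> x) (p \<cdot> y)"
  unfolding E_def using assms by (simp add: P.inv_mult_group P.m_assoc)

text \<open>For the positions without a commuting square: a third pair, obtained by exchanging a
  multiplier, reduces on its own and is adjacent to both ends of the peak.\<close>

lemma peak_via:
  assumes p: "p \<in> carrier P" and A: "wp A a" and B: "wp B b" and C: "wp C c"
    and "cp p (U C) < cp p (Z c)"
    and "pinv (w A a) \<cdot> w C c \<in> M" "pinv (w C c) \<cdot> w B b \<in> M"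
  shows "\<exists>r. sz r < sz p \<and> E (p \<cdot> w A a) r \<and> E r (p \<cdot> w B b)"
proof (intro exI conjI)
  show "sz (p \<cdot> w C c) < sz p" using sz_w(1)[OF p C] assms(5) by linarith
  show "E (p \<cdot> w A a) (p \<cdot> w C c)" "E (p \<cdot> w C c) (p \<cdot> w B b)"
    using E_of_M p assms by simp_all
qed

lemma cp_linv: "p \<in> carrier P \<Longrightarrow> u \<in> L \<Longrightarrow> cp p (Z (linv u)) = cp p (Z u)"
  using cap_Z_linv Phi_Au by simp

text \<open>\<open>A\<close> itself reduces with the multiplier \<open>linv b\<close>. This pair
  differs from \<open>(A, a)\<close> by an exchange of multipliers; its inverse has the multiplier
  \<open>b\<close> and can be joined with \<open>(B, b)\<close> to a single pair.\<close>

lemma peak_disjoint_exchange: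
  assumes p: "p \<in> carrier P" and A: "wp A a" and B: "wp B b" and d: "A \<inter> B = {}"
    and m: "linv a \<in> B" "linv b \<in> A" and less: "cp p (U A) < cp p (Z b)"
  shows "\<exists>r. sz r < sz p \<and> E (p \<cdot> w A a) r \<and> E r (p \<cdot> w B b)"
proof (rule peak_via[OF p A B])
  show C: "wp A (linv b)" using A B d m by (auto simp: wp_def)
  show "cp p (U A) < cp p (Z (linv b))" using less cp_linv[OF p wp_L(1)[OF B]] by simp
  show "pinv (w A a) \<cdot> w A (linv b) \<in> M" using exchange_M[OF A C] .
  let ?A' = "insert b (A - {linv b})"
  have A': "wp ?A' b" using wp_inv[OF C] by simp
  have "?A' \<inter> B = {b}" using d B by (auto simp: wp_def)
  then have "w ?A' b \<cdot> w B b = w (?A' \<union> B) b" using w_join[OF A' B] by simp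
  moreover have "wp (?A' \<union> B) b" using A' B by (auto simp: wp_def)
  ultimately show "pinv (w A (linv b)) \<cdot> w B b \<in> M" using w_inv[OF C] M_w by simp
qed

lemma peak_disjoint_slide:
  assumes p: "p \<in> carrier P" and A: "wp A a" and B: "wp B b" and d: "A \<inter> B = {}"
    and m: "linv a \<notin> B" "linv b \<in> A"
    and less: "cp p (U A) + cp p (U B) < cp p (Z a) + cp p (Z b)"
  shows "\<exists>r. sz r < sz p \<and> E (p \<cdot> w A a) r \<and> E r (p \<cdot> w B b)"
proof (rule peak_commute[OF p A B B _ less])
  show "fst b \<noteq> fst a" using fst_eq_linv[of b a] d m wp_L(3)[OF A] wp_L(3)[OF B] by blast
  show "pre (\<Phi> (w A a)) (U B) = U B"
    using acts_w_pre_U(1)[OF w_acts[OF A] wp_L(2)[OF B] d m(1)] .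
  show "w A a \<cdot> w B b = w B b \<cdot> w (A \<union> B - {b}) a" using w_slide[OF A B d m] .
  have "a \<noteq> b" using d wp_L(3)[OF A] wp_L(3)[OF B] by blast
  then show "w (A \<union> B - {b}) a \<in> M" using A B d m by (intro M_w) (auto simp: wp_def)
qed

lemma peak_disjoint:
  assumes p: "p \<in> carrier P" and A: "wp A a" and B: "wp B b" and d: "A \<inter> B = {}"
    and less: "cp p (U A) + cp p (U B) < cp p (Z a) + cp p (Z b)"
  shows "\<exists>r. sz r < sz p \<and> E (p \<cdot> w A a) r \<and> E r (p \<cdot> w B b)"
proof -
  have d': "B \<inter> A = {}" using d by blast
  have less': "cp p (U B) + cp p (U A) < cp p (Z b) + cp p (Z a)" using less by simp
  consider "linv a \<notin> B" "linv b \<notin> A" | "linv a \<notin> B" "linv b \<in> A" | "linv a \<in> B" "linv b \<notin> A"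
    | "linv a \<in> B" "linv b \<in> A" by blast
  then show ?thesis
  proof cases
    case 1
    show ?thesis
    proof (rule peak_commute[OF p A B B _ less])
      show "fst b \<noteq> fst a" using fst_eq_linv[of b a] d 1 wp_L(3)[OF A] wp_L(3)[OF B] by blast
      show "pre (\<Phi> (w A a)) (U B) = U B"
        using acts_w_pre_U(1)[OF w_acts[OF A] wp_L(2)[OF B] d 1(1)] .
      show "w A a \<cdot> w B b = w B b \<cdot> w A a" using w_commute[OF A B d 1] .
      show "w A a \<in> M" using M_w[OF A] .
    qed
  next
    case 2
    then show ?thesis using peak_disjoint_slide[OF p A B d _ _ less] by blast
  next
    case 3
    then show ?thesis using peak_disjoint_slide[OF p B A d' _ _ less'] E_sym by blast
  next
    case 4
    show ?thesis
    \<comment> \<open>The inequality on the sums forces \<open>cp p (U A) < cp p (Z b)\<close> or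
      \<open>cp p (U B) < cp p (Z a)\<close>, and the two cases are symmetric.\<close>
    proof (cases "cp p (U A) < cp p (Z b)")
      case True
      then show ?thesis using peak_disjoint_exchange[OF p A B d 4] by blast
    next
      case False
      then have "cp p (U B) < cp p (Z a)" using less by linarith
      then show ?thesis using peak_disjoint_exchange[OF p B A d' 4(2,1)] E_sym by blast
    qed
  qed
qed

text \<open>This is the sliding relation for the inverse of \<open>w A a\<close>, whose set is
  disjoint from \<open>insert a (B - A)\<close>, multiplied by \<open>w A a\<close> on both
  sides.\<close>

lemma w_nested:
  assumes A: "wp A a" and B: "wp B b" and s: "A \<subseteq> B" and m: "linv a \<notin> B" "b \<notin> A"
  shows "w A a \<cdot> w (insert a (B - A)) b = w B b \<cdot> w A a"
proof -
  let ?A4 = "insert a (B - A)" and ?B4 = "insert (linv a) (A - {a})"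
  have ab: "linv b \<noteq> a" "linv b \<notin> B" "b \<noteq> linv a" "b \<noteq> a" "b \<in> B" "a \<in> A"
    using A B s m by (auto simp: wp_def)
  have A4: "wp ?A4 b" using A B ab m by (auto simp: wp_def)
  have B4: "wp ?B4 (linv a)" using wp_inv[OF A] .
  have "w ?A4 b \<cdot> w ?B4 (linv a) = w ?B4 (linv a) \<cdot> w (?A4 \<union> ?B4 - {linv a}) b"
  proof (rule w_slide[OF A4 B4])
    show "?A4 \<inter> ?B4 = {}" using m s by auto
    show "linv b \<notin> ?B4" using ab s by auto
    show "linv (linv a) \<in> ?A4" by simp
  qed
  moreover have "?A4 \<union> ?B4 - {linv a} = B" using ab s m by auto
  moreover have "w ?B4 (linv a) = pinv (w A a)" using w_inv[OF A] by simp
  ultimately have "w ?A4 b \<cdot> pinv (w A a) = pinv (w A a) \<cdot> w B b" by simp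
  then have "w A a \<cdot> (w ?A4 b \<cdot> pinv (w A a)) \<cdot> w A a = w A a \<cdot> (pinv (w A a) \<cdot> w B b) \<cdot> w A a" by simp
  then show ?thesis using A B A4 by (simp add: P.m_assoc)
qed

lemma w_sub:
  assumes A: "wp A a" and B: "wp B a" and s: "A \<subseteq> B"
  shows "w A a \<cdot> w (insert a (B - A)) a = w B a"
proof -
  have "wp (insert a (B - A)) a" using B by (auto simp: wp_def)
  moreover have "A \<inter> insert a (B - A) = {a}" "A \<union> insert a (B - A) = B" using A s by (auto simp: wp_def)
  ultimately show ?thesis using w_join[OF A, of "insert a (B - A)"] by simp
qed

lemma w_sub_M:
  assumes A: "wp A a" and B: "wp B a" and s: "A \<subseteq> B"
  shows "pinv (w A a) \<cdot> w B a \<in> M"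
proof -
  have C: "wp (insert a (B - A)) a" using B by (auto simp: wp_def)
  then have "pinv (w A a) \<cdot> w B a = w (insert a (B - A)) a" using w_sub[OF A B s, symmetric] A by simp
  then show ?thesis using M_w[OF C] by simp
qed

text \<open>The cases are whether \<open>linv a\<close> lies in \<open>B\<close> and whether
  \<open>b\<close> lies in \<open>A\<close>. Only in the last one, where each set admits the
  multiplier of the other, is no commuting square used; there the inequality makes \<open>A\<close>
  reduce with \<open>b\<close> or \<open>B\<close> reduce with \<open>a\<close>.\<close>

lemma peak_subset:
  assumes p: "p \<in> carrier P" and A: "wp A a" and B: "wp B b" and s: "A \<subseteq> B"
    and less: "cp p (U A) + cp p (U B) < cp p (Z a) + cp p (Z b)"
  shows "\<exists>r. sz r < sz p \<and> E (p \<cdot> w A a) r \<and> E r (p \<cdot> w B b)"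
proof -
  note wa = w_acts[OF A] and BL = wp_L(2)[OF B]
  consider "linv a \<in> B" "b \<notin> A" | "linv a \<in> B" "b \<in> A" | "linv a \<notin> B" "b \<notin> A" | "linv a \<notin> B" "b \<in> A"
    by blast
  then show ?thesis
  proof cases
    case 1
    show ?thesis
    proof (rule peak_commute[OF p A B B _ less])
      show "fst b \<noteq> fst a" using fst_eq_linv[of b a] s 1 A B unfolding wp_def by auto
      show "pre (\<Phi> (w A a)) (U B) = U B" using acts_w_pre_U(2)[OF wa BL s 1(1)] .
      show "w A a \<cdot> w B b = w B b \<cdot> w A a" using w_commute'[OF A B s 1] .
      show "w A a \<in> M" using M_w[OF A] .
    qed
  next
    case 2
    show ?thesis
    proof (rule peak_commute[OF p A B B _ less])
      show "fst b \<noteq> fst a" using fst_eq_linv[of b a] s 2 A B unfolding wp_def by auto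
      show "pre (\<Phi> (w A a)) (U B) = U B" using acts_w_pre_U(2)[OF wa BL s 2(1)] .
      show "w A a \<cdot> w B b = w B b \<cdot> w (insert (linv b) (B - A)) (linv a)" using w_slide'[OF A B s 2] .
      have "a \<noteq> linv b" using A B s by (auto simp: wp_def)
      then show "w (insert (linv b) (B - A)) (linv a) \<in> M" using A B 2 by (intro M_w) (auto simp: wp_def)
    qed
  next
    case 3
    show ?thesis
    proof (rule peak_commute[OF p A B _ _ less])
      have ab: "a \<noteq> linv b" using A B s by (auto simp: wp_def)
      then show "wp (insert a (B - A)) b" using A B 3 by (auto simp: wp_def)
      show "fst b \<noteq> fst a" using fst_eq_linv[of b a] 3 A B unfolding wp_def by auto
      show "pre (\<Phi> (w A a)) (U (insert a (B - A))) = U B" using acts_w_pre_U(3)[OF wa BL s 3(1)] .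
      show "w A a \<cdot> w (insert a (B - A)) b = w B b \<cdot> w A a" using w_nested[OF A B s 3] .
      show "w A a \<in> M" using M_w[OF A] .
    qed
  next
    case 4
    have Ab: "wp A b" using A B s 4 by (auto simp: wp_def)
    have Ba: "wp B a" using A B s 4 by (auto simp: wp_def)
    show ?thesis
    proof (cases "cp p (U A) < cp p (Z b)")
      case True
      show ?thesis by (rule peak_via[OF p A B Ab True exchange_M[OF A Ab] w_sub_M[OF Ab B s]])
    next
      case False
      then have "cp p (U B) < cp p (Z a)" using less by linarith
      then show ?thesis by (rule peak_via[OF p A B Ba _ w_sub_M[OF A Ba s] exchange_M[OF Ba B]])
    qed
  qed
qed

text \<open>The common twist of \<open>nested_common_graph\<close> is applied first. It changes
  neither the length nor the relevant capacities, and it leaves a peak of plain sets that are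
  disjoint or nested.\<close>

lemma peak_nested:
  assumes q1: "nb p A a q1" and q2: "nb p B b q2" and n: "nested A B"
    and less: "cp p (ZZ A) + cp p (ZZ B) < cp p (Z a) + cp p (Z b)"
  shows "\<exists>r. sz r < sz p \<and> E q1 r \<and> E r q2"
proof -
  have p: "p \<in> carrier P" using q1 by (simp add: nb_def)
  have sA: "sval A" and sB: "sval B" using nb_twp[OF q1] nb_twp[OF q2] by (auto simp: twp_def)
  obtain k t where kt: "k \<in> H" "t ` L \<subseteq> H" "A = graph t (fst ` A)" "shift k B = graph t (fst ` B)"
    "fst ` A \<inter> fst ` B = {} \<or> fst ` A \<subseteq> fst ` B \<or> fst ` B \<subseteq> fst ` A"
    using nested_common_graph[OF sA sB n] by metis
  define C D where "C = fst ` A" and "D = fst ` B"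
  have CL: "C \<subseteq> L" "D \<subseteq> L" using svalD(1)[OF sA] svalD(1)[OF sB] by (auto simp: C_def D_def)
  have AC: "A = graph t C" "shift k B = graph t D" using kt(3,4) by (simp_all add: C_def D_def)
  have q1': "nb p (graph t C) a q1" using q1 AC by metis
  have q2': "nb p (graph t D) b q2" using nb_shift[OF q2 kt(1)] AC by metis
  obtain l1 where l1: "wp C a" "l1 \<in> \<Lambda>" "q1 = p \<cdot> \<theta> t \<cdot> w C a \<cdot> l1"
    using nb_graph[OF q1' kt(2) CL(1)] by blast
  obtain l2 where l2: "wp D b" "l2 \<in> \<Lambda>" "q2 = p \<cdot> \<theta> t \<cdot> w D b \<cdot> l2"
    using nb_graph[OF q2' kt(2) CL(2)] by blast
  let ?p = "p \<cdot> \<theta> t"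
  have pc: "?p \<in> carrier P" using p kt(2) by simp
  have szp: "sz ?p = sz p" using sz_Lam[OF p] kt(2) by simp
  have "cp ?p (U C) = cp p (ZZ A)" using cp_theta(1)[OF p kt(2) CL(1)] AC by metis
  moreover have "cp ?p (U D) = cp p (ZZ B)"
    using cp_theta(1)[OF p kt(2) CL(2)] AC cap_shift[OF Phi_Au[OF p] svalD(1)[OF sB] kt(1)] by metis
  moreover have "cp ?p (Z a) = cp p (Z a)" "cp ?p (Z b) = cp p (Z b)"
    using cp_theta(2)[OF p kt(2)] wp_L(1)[OF l1(1)] wp_L(1)[OF l2(1)] by simp_all
  ultimately have less1: "cp ?p (U C) + cp ?p (U D) < cp ?p (Z a) + cp ?p (Z b)" using less by simp
  then have less2: "cp ?p (U D) + cp ?p (U C) < cp ?p (Z b) + cp ?p (Z a)" by simp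
  have "\<exists>r. sz r < sz ?p \<and> E (?p \<cdot> w C a) r \<and> E r (?p \<cdot> w D b)"
  proof -
    consider "C \<inter> D = {}" | "C \<subseteq> D" | "D \<subseteq> C" using kt(5) unfolding C_def D_def by blast
    then show ?thesis
    proof cases
      case 1
      then show ?thesis by (rule peak_disjoint[OF pc l1(1) l2(1) _ less1])
    next
      case 2
      then show ?thesis by (rule peak_subset[OF pc l1(1) l2(1) _ less1])
    next
      case 3
      then show ?thesis using peak_subset[OF pc l2(1) l1(1) 3 less2] E_sym by blast
    qed
  qed
  then obtain r where r: "sz r < sz p" "E (?p \<cdot> w C a) r" "E r (?p \<cdot> w D b)" using szp by auto
  have "E r q1" using E_Lam_right[OF E_sym[OF r(2)] l1(2)] l1(3) by simp
  moreover have "E r q2" using E_Lam_right[OF r(3) l2(2)] l2(3) by simp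
  ultimately show ?thesis using r(1) E_sym by blast
qed

end

section \<open>Connectedness below a peak and uniqueness of irreducible targets\<close>

context wh_group
begin

definition low :: "nat \<Rightarrow> ('p \<times> 'p) set" where
  "low m = {(p, q). E p q \<and> sz p < m \<and> sz q < m}"

text \<open>A path all of whose inner vertices lie strictly below \<open>m\<close>. Its ends are not
  restricted, because one side of a peak may be as high as its top.\<close>

definition link :: "nat \<Rightarrow> 'p \<Rightarrow> 'p \<Rightarrow> bool" where
  "link m q1 q2 \<longleftrightarrow> (\<exists>r r'. E q1 r \<and> sz r < m \<and> (r, r') \<in> (low m)\<^sup>* \<and> sz r' < m \<and> E r' q2)"

lemma low_sym: "(p, q) \<in> (low m)\<^sup>* \<Longrightarrow> (q, p) \<in> (low m)\<^sup>*"
proof (induction rule: rtrancl_induct)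
  case (step q r)
  then have "(r, q) \<in> low m" using E_sym by (auto simp: low_def)
  then show ?case using step.IH by (rule converse_rtrancl_into_rtrancl)
qed simp

lemma link_sym: "link m p q \<Longrightarrow> link m q p"
  unfolding link_def using low_sym E_sym by meson

lemma link_of_mid: "sz r < m \<Longrightarrow> E q1 r \<Longrightarrow> E r q2 \<Longrightarrow> link m q1 q2"
  unfolding link_def by blast

lemma link_trans:
  assumes "link m q1 q" "link m q q2" "sz q < m"
  shows "link m q1 q2"
proof -
  obtain r1 r1' where 1: "E q1 r1" "sz r1 < m" "(r1, r1') \<in> (low m)\<^sup>*" "sz r1' < m" "E r1' q"
    using assms(1) unfolding link_def by blast
  obtain r2 r2' where 2: "E q r2" "sz r2 < m" "(r2, r2') \<in> (low m)\<^sup>*" "sz r2' < m" "E r2' q2"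
    using assms(2) unfolding link_def by blast
  have "(r1', q) \<in> low m" "(q, r2) \<in> low m" using 1 2 assms(3) by (auto simp: low_def)
  then have "(r1, r2') \<in> (low m)\<^sup>*" using 1(3) 2(3) by (meson rtrancl.rtrancl_into_rtrancl rtrancl_trans)
  then show ?thesis unfolding link_def using 1 2 by blast
qed

text \<open>Induction on the number of common letters. If the sets cross, the reduction
  \<open>Q\<close> from \<open>crossing_reduction\<close> leads below \<open>p\<close>, and with
  each of \<open>A\<close> and \<open>B\<close> it is nested or has a smaller overlap; the strict
  decrease along \<open>Q\<close> restores the inequality on the sums for both new pairs.\<close>

lemma peak_link:
  assumes "nb p A a q1" "nb p B b q2"
    and "cp p (ZZ A) \<le> cp p (Z a)" "cp p (ZZ B) \<le> cp p (Z b)"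
    and "cp p (ZZ A) + cp p (ZZ B) < cp p (Z a) + cp p (Z b)"
  shows "link (sz p) q1 q2"
  using assms
proof (induction "overlap A B" arbitrary: A a q1 B b q2 rule: less_induct)
  case less
  note q1 = less.prems(1) and q2 = less.prems(2)
  have p: "p \<in> carrier P" using q1 by (simp add: nb_def)
  have tA: "twp A a" and tB: "twp B b" using nb_twp q1 q2 by blast+
  show ?case
  proof (cases "nested A B")
    case True
    then show ?thesis using peak_nested[OF q1 q2 _ less.prems(5)] link_of_mid by blast
  next
    case False
    obtain Q c where Q: "twp Q c" "cp p (ZZ Q) < cp p (Z c)"
      "nested Q A \<or> overlap Q A < overlap A B" "nested Q B \<or> overlap Q B < overlap A B"
      using crossing_reduction[OF Phi_Au[OF p] tA tB less.prems(5) False] by blast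
    obtain q where q: "nb p Q c q" using twp_nb[OF p Q(1)] by blast
    have szq: "sz q < sz p" using nb_sz[OF q] Q(2) by linarith
    have "link (sz p) q q1"
    proof (cases "nested Q A")
      case True
      have "\<exists>r. sz r < sz p \<and> E q r \<and> E r q1"
        by (rule peak_nested[OF q q1 True]) (use Q(2) less.prems(3) in linarith)
      then show ?thesis using link_of_mid by blast
    next
      case False
      then have "overlap Q A < overlap A B" using Q(3) by blast
      then show ?thesis by (rule less.hyps[OF _ q q1]) (use Q(2) less.prems(3) in linarith)+
    qed
    moreover have "link (sz p) q q2"
    proof (cases "nested Q B")
      case True
      have "\<exists>r. sz r < sz p \<and> E q r \<and> E r q2"
        by (rule peak_nested[OF q q2 True]) (use Q(2) less.prems(4) in linarith)
      then show ?thesis using link_of_mid by blast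
    next
      case False
      then have "overlap Q B < overlap A B" using Q(4) by blast
      then show ?thesis by (rule less.hyps[OF _ q q2]) (use Q(2) less.prems(4) in linarith)+
    qed
    ultimately show ?thesis using link_trans link_sym szq by blast
  qed
qed

lemma peak:
  assumes "nb p A a q1" "nb p B b q2" "sz q1 < sz p" "sz q2 \<le> sz p"
  shows "link (sz p) q1 q2"
  using peak_link[OF assms(1,2)] nb_sz[OF assms(1)] nb_sz[OF assms(2)] assms(3,4) by linarith

definition irred :: "'p \<Rightarrow> bool" where
  "irred p \<longleftrightarrow> p \<in> carrier P \<and> \<not> reducible (\<Phi> p)"

lemma not_irred:
  assumes "p \<in> carrier P" "\<not> irred p"
  shows "\<exists>q. E p q \<and> sz q < sz p"
proof -
  obtain A a where A: "twp A a" "cp p (ZZ A) < cp p (Z a)"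
    using assms unfolding irred_def reducible_def by blast
  obtain q where q: "nb p A a q" using twp_nb[OF assms(1) A(1)] by blast
  then show ?thesis using nb_sz[OF q] A(2) nb_E[OF q] by (intro exI[of _ q]) linarith
qed

lemma sz_ge: "p \<in> carrier P \<Longrightarrow> card X \<le> sz p"
  unfolding sz_def using size_ge Phi_Au by simp

lemma Phi_one: "g \<in> carrier G \<Longrightarrow> \<Phi> \<one>\<^bsub>P\<^esub> g = g"
proof -
  assume g: "g \<in> carrier G"
  have c: "\<Phi> \<one>\<^bsub>P\<^esub> \<in> Au" using Phi_Au by simp
  have "\<Phi> \<one>\<^bsub>P\<^esub> (\<Phi> \<one>\<^bsub>P\<^esub> g) = \<Phi> \<one>\<^bsub>P\<^esub> g" using Phi_mult[of "\<one>\<^bsub>P\<^esub>" "\<one>\<^bsub>P\<^esub>" g] g by simp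
  then show ?thesis using Au_inj[OF c Au_closed[OF c g] g] by simp
qed

lemma irred_Lam:
  assumes "irred p"
  shows "\<exists>l\<in>\<Lambda>. \<forall>g\<in>carrier G. \<Phi> (l \<cdot> p) g = g"
proof -
  have p: "p \<in> carrier P" using assms by (simp add: irred_def)
  obtain s \<sigma> where "twist s \<sigma> (\<Phi> p)"
    using irreducible_twist[OF Phi_Au[OF p]] assms by (auto simp: irred_def)
  then obtain l where l: "l \<in> \<Lambda>" "\<And>u. u \<in> L \<Longrightarrow> \<Phi> l (e u) = \<Phi> p (e u)" using Lam_surj by blast
  have lp: "\<Phi> l g = \<Phi> p g" if "g \<in> carrier G" for g
    using Au_ext[of "\<Phi> l" "\<Phi> p" g] l Phi_Au p that by simp
  have "\<Phi> (pinv l \<cdot> p) g = g" if g: "g \<in> carrier G" for g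
  proof -
    have c: "\<Phi> (pinv l) g \<in> carrier G" using Au_closed[OF Phi_Au] l(1) g by simp
    have "\<Phi> (pinv l \<cdot> p) g = \<Phi> l (\<Phi> (pinv l) g)"
      using Phi_mult[of "pinv l" p g] lp[OF c] l(1) p g by simp
    also have "\<dots> = \<Phi> (pinv l \<cdot> l) g" using Phi_mult[of "pinv l" l g] l(1) g by simp
    also have "\<dots> = g" using Phi_one[OF g] l(1) by simp
    finally show ?thesis .
  qed
  then show ?thesis using l(1) Lam_inv by blast
qed

lemma sz_fixed:
  assumes "\<And>g. g \<in> carrier G \<Longrightarrow> \<Phi> p g = g"
  shows "sz p = card X"
  unfolding sz_def using size_id[of "\<Phi> p"] assms by simp

lemma sz_Lam_left_fixed:
  assumes "irred p"
  shows "sz p = card X"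
proof -
  have p: "p \<in> carrier P" using assms by (simp add: irred_def)
  obtain s \<sigma> where t: "twist s \<sigma> (\<Phi> p)"
    using irreducible_twist[OF Phi_Au[OF p]] assms by (auto simp: irred_def)
  have "size (\<Phi> p) = size id"
    using size_twist[OF t id_Au Phi_Au[OF p]] by simp
  then show ?thesis unfolding sz_def using size_id[of id] by simp
qed

text \<open>A local minimum is a global one: an irreducible element acts as a twist and so has the
  length of the identity.\<close>

lemma irred_iff: "p \<in> carrier P \<Longrightarrow> irred p \<longleftrightarrow> sz p \<le> card X"
  using sz_Lam_left_fixed not_irred sz_ge E_car(2) by (metis le_eq_less_or_eq linorder_not_less)

text \<open>Modulo \<open>\<Lambda>\<close> both ends act trivially, so the Whitehead pair between
  them acts as a twist. By \<open>twist_acts_w_trivial\<close> its set is \<open>{a}\<close>, and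
  \<open>w {a} a\<close> is the identity of \<open>P\<close>. Here knowledge about an automorphism
  becomes an equation in \<open>P\<close>.\<close>

lemma irred_E:
  assumes p: "irred p" and q: "irred q" and E: "E p q"
  shows "pinv p \<cdot> q \<in> \<Lambda>"
  using E
proof (cases rule: E_cases)
  case (1 l)
  then show ?thesis using p by (simp add: irred_def)
next
  case (2 A a)
  obtain s D l where *: "p \<in> carrier P" "s ` L \<subseteq> H" "wp D a" "l \<in> \<Lambda>" "q = p \<cdot> \<theta> s \<cdot> w D a \<cdot> l"
    using 2 unfolding nb_def by blast
  have q_c: "q \<in> carrier P" using E E_car by blast
  obtain lp where lp: "lp \<in> \<Lambda>" "\<And>g. g \<in> carrier G \<Longrightarrow> \<Phi> (lp \<cdot> p) g = g" using irred_Lam[OF p] by blast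
  obtain lq where lq: "lq \<in> \<Lambda>" "\<And>g. g \<in> carrier G \<Longrightarrow> \<Phi> (lq \<cdot> q) g = g" using irred_Lam[OF q] by blast
  \<comment> \<open>Collects all factors from \<open>\<Lambda>\<close> to the left of the pair, so
    that \<open>y \<cdot> w D a \<cdot> l\<close> acts as the identity.\<close>
  define y where "y = lq \<cdot> pinv lp \<cdot> \<theta> s"
  have y: "y \<in> \<Lambda>" using lp lq * by (simp add: y_def)
  have "\<Phi> (y \<cdot> w D a \<cdot> l) g = g" if g: "g \<in> carrier G" for g
  proof -
    have "lq \<cdot> q = (lq \<cdot> pinv lp) \<cdot> ((lp \<cdot> p) \<cdot> (\<theta> s \<cdot> w D a \<cdot> l))"
      using lp lq * by (simp add: P.m_assoc)
    then have "\<Phi> (lq \<cdot> q) g = \<Phi> ((lp \<cdot> p) \<cdot> (\<theta> s \<cdot> w D a \<cdot> l)) (\<Phi> (lq \<cdot> pinv lp) g)"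
      using Phi_mult[of "lq \<cdot> pinv lp"] lp lq * g by simp
    also have "\<dots> = \<Phi> (\<theta> s \<cdot> w D a \<cdot> l) (\<Phi> (lq \<cdot> pinv lp) g)"
    proof -
      have c: "\<Phi> (lq \<cdot> pinv lp) g \<in> carrier G" using Au_closed[OF Phi_Au] lp lq g by simp
      show ?thesis using Phi_mult[of "lp \<cdot> p" "\<theta> s \<cdot> w D a \<cdot> l", OF _ _ c] lp(2)[OF c] lp(1) * by simp
    qed
    also have "\<dots> = \<Phi> ((lq \<cdot> pinv lp) \<cdot> (\<theta> s \<cdot> w D a \<cdot> l)) g"
      using Phi_mult[of "lq \<cdot> pinv lp"] lp lq * g by simp
    also have "(lq \<cdot> pinv lp) \<cdot> (\<theta> s \<cdot> w D a \<cdot> l) = y \<cdot> w D a \<cdot> l"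
      using lp lq * by (simp add: y_def P.m_assoc)
    finally show ?thesis using lq(2)[OF g] by simp
  qed
  note fix_g = this
  have yw: "\<Phi> (w D a) g = \<Phi> (pinv y \<cdot> pinv l) g" if g: "g \<in> carrier G" for g
  proof -
    have c: "\<Phi> (pinv y) g \<in> carrier G" using Au_closed[OF Phi_Au] y g by simp
    have "w D a = pinv y \<cdot> ((y \<cdot> w D a \<cdot> l) \<cdot> pinv l)" using y * by (simp add: P.m_assoc)
    then have "\<Phi> (w D a) g = \<Phi> ((y \<cdot> w D a \<cdot> l) \<cdot> pinv l) (\<Phi> (pinv y) g)"
      using Phi_mult[of "pinv y" "(y \<cdot> w D a \<cdot> l) \<cdot> pinv l" g] y * g by simp
    also have "\<dots> = \<Phi> (pinv l) (\<Phi> (pinv y) g)"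
      using Phi_mult[of "y \<cdot> w D a \<cdot> l" "pinv l", OF _ _ c] fix_g[OF c] y * by simp
    finally show ?thesis using Phi_mult[of "pinv y" "pinv l" g] y * g by simp
  qed
  obtain r \<sigma> where r: "twist r \<sigma> (\<Phi> (pinv y \<cdot> pinv l))" using Lam_twist[of "pinv y \<cdot> pinv l"] y * by auto
  have "twist r \<sigma> (\<Phi> (w D a))"
    using r yw Phi_Au[of "w D a"] *(3) unfolding twist_def by simp
  then have "D = {a}" using twist_acts_w_trivial[OF w_acts[OF *(3)]] by blast
  then have "q = p \<cdot> (\<theta> s \<cdot> l)" using * w_single[OF wp_L(1)[OF *(3)]] by (simp add: P.m_assoc)
  then show ?thesis using * by simp
qed

text \<open>\<open>target p q\<close>: the irreducible element \<open>q\<close> is reached from \<open>p\<close> by size-decreasing edges.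
  Up to \<open>\<Lambda>\<close> it is unique, as in Newman's lemma.\<close>

definition target :: "'p \<Rightarrow> 'p \<Rightarrow> bool" where
  "target p q \<longleftrightarrow> (p, q) \<in> {(p, p'). E p p' \<and> sz p' < sz p}\<^sup>* \<and> irred q"

lemma target_ex: "p \<in> carrier P \<Longrightarrow> \<exists>q. target p q"
proof (induction "sz p" arbitrary: p rule: less_induct)
  case less
  show ?case
  proof (cases "irred p")
    case True
    then show ?thesis unfolding target_def by blast
  next
    case False
    then obtain p' where p': "E p p'" "sz p' < sz p" using not_irred less.prems by blast
    then obtain q where "target p' q" using less.hyps E_car(2) by blast
    then have "target p q" using p' unfolding target_def by (auto intro: converse_rtrancl_into_rtrancl)
    then show ?thesis by blast
  qed
qed

lemma target_irred:
  assumes "irred p" "target p q"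
  shows "q = p"
proof -
  have "(p, q) \<in> {(p, p'). E p p' \<and> sz p' < sz p}\<^sup>*" using assms(2) by (simp add: target_def)
  then show ?thesis
  proof (cases rule: converse_rtranclE)
    case (step y)
    then have "sz y < card X" using sz_Lam_left_fixed[OF assms(1)] by simp
    then show ?thesis using sz_ge[of y] step E_car(2) by fastforce
  qed simp
qed

lemma target_step:
  assumes "\<not> irred p" "target p q"
  obtains p' where "E p p'" "sz p' < sz p" "target p' q"
proof -
  have "(p, q) \<in> {(p, p'). E p p' \<and> sz p' < sz p}\<^sup>*" "irred q" using assms(2) by (simp_all add: target_def)
  then show ?thesis
  proof (cases rule: converse_rtranclE)
    case base
    then show ?thesis using assms \<open>irred q\<close> by simp
  next
    case (step y)
    then show ?thesis using that[of y] \<open>irred q\<close> by (simp add: target_def)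
  qed
qed

lemma irred_car: "irred p \<Longrightarrow> p \<in> carrier P"
  by (simp add: irred_def)

lemma target_car: "target p q \<Longrightarrow> q \<in> carrier P"
  by (simp add: target_def irred_car)

lemma Lam_trans:
  assumes "p \<in> carrier P" "q \<in> carrier P" "r \<in> carrier P" "pinv p \<cdot> q \<in> \<Lambda>" "pinv q \<cdot> r \<in> \<Lambda>"
  shows "pinv p \<cdot> r \<in> \<Lambda>"
  using Lam_mult[OF assms(4,5)] assms(1-3) by (simp add: P.m_assoc)

lemma Lam_sym: "p \<in> carrier P \<Longrightarrow> q \<in> carrier P \<Longrightarrow> pinv p \<cdot> q \<in> \<Lambda> \<Longrightarrow> pinv q \<cdot> p \<in> \<Lambda>"
  using Lam_inv[of "pinv p \<cdot> q"] by (simp add: P.inv_mult_group)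

lemma peaks_connected:
  assumes "E p p1" "E p p2" "sz p1 < sz p" "sz p2 < sz p"
  shows "(p1, p2) \<in> (low (sz p))\<^sup>*"
proof -
  have p: "p \<in> carrier P" using E_car assms by blast
  obtain A a where A: "nb p A a p1" using E_cases[OF assms(1)] assms(3) sz_Lam[OF p] by (metis less_irrefl)
  obtain B b where B: "nb p B b p2" using E_cases[OF assms(2)] assms(4) sz_Lam[OF p] by (metis less_irrefl)
  have "link (sz p) p1 p2" using peak[OF A B assms(3)] assms(4) by simp
  then obtain r r' where r: "E p1 r" "sz r < sz p" "(r, r') \<in> (low (sz p))\<^sup>*" "sz r' < sz p" "E r' p2"
    unfolding link_def by blast
  have "(p1, r) \<in> low (sz p)" "(r', p2) \<in> low (sz p)" using r assms by (auto simp: low_def)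
  then show ?thesis using r(3) by (meson converse_rtrancl_into_rtrancl rtrancl.rtrancl_into_rtrancl)
qed

text \<open>The induction is on a strict bound for the lengths of both ends. A peak is bypassed
  below its top, and along the bypass the targets agree by induction. Unlike in Newman's lemma there
  are also horizontal edges; these are treated as peaks with one side that does not descend.\<close>

lemma target_unique:
  assumes "E p p'" "target p q" "target p' q'"
  shows "pinv q \<cdot> q' \<in> \<Lambda>"
proof -
  have "\<forall>p p' q q'. E p p' \<longrightarrow> sz p < m \<longrightarrow> sz p' < m \<longrightarrow> target p q \<longrightarrow> target p' q' \<longrightarrow> pinv q \<cdot> q' \<in> \<Lambda>" for m
  proof (induction m)
    case (Suc m)
    have IH: "pinv q \<cdot> q' \<in> \<Lambda>" if "E p p'" "sz p < m" "sz p' < m" "target p q" "target p' q'" for p p' q q'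
      using Suc that by blast
    have path: "pinv q \<cdot> q' \<in> \<Lambda>"
      if "(p, p') \<in> (low m)\<^sup>*" "p \<in> carrier P" "sz p < m" "target p q" "target p' q'" for p p' q q'
      using that
    proof (induction arbitrary: q' rule: rtrancl_induct)
      case base
      then show ?case using IH[OF E_refl] by blast
    next
      case (step y z)
      then have yz: "E y z" "sz y < m" "sz z < m" by (auto simp: low_def)
      obtain x where x: "target y x" using target_ex E_car(1)[OF yz(1)] by blast
      have "pinv q \<cdot> x \<in> \<Lambda>" using step.IH step.prems x by blast
      moreover have "pinv x \<cdot> q' \<in> \<Lambda>" using IH[OF yz x] step.prems by blast
      ultimately show ?case using Lam_trans target_car x step.prems by blast
    qed
    have one: "pinv q \<cdot> q' \<in> \<Lambda>"
      if h: "E p p'" "sz p = m" "sz p' < m" "target p q" "target p' q'" for p p' q q'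
    proof -
      have pc: "p \<in> carrier P" "p' \<in> carrier P" using E_car h by blast+
      have "\<not> irred p" using sz_Lam_left_fixed[of p] sz_ge[OF pc(2)] h by auto
      then obtain p1 where p1: "E p p1" "sz p1 < sz p" "target p1 q" using target_step h(4) by blast
      have "(p1, p') \<in> (low m)\<^sup>*" using peaks_connected[OF p1(1) h(1) p1(2)] h by simp
      then show ?thesis using path p1 h E_car(2) by blast
    qed
    have both: "pinv q \<cdot> q' \<in> \<Lambda>"
      if h: "E p p'" "sz p = m" "sz p' = m" "target p q" "target p' q'" for p p' q q'
    proof -
      have pc: "p \<in> carrier P" "p' \<in> carrier P" using E_car h by blast+
      show ?thesis
      proof (cases "irred p")
        case True
        then have "irred p'" using irred_iff pc h by simp
        then show ?thesis using irred_E[OF True _ h(1)] target_irred True h by blast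
      next
        case False
        then have F': "\<not> irred p'" using irred_iff pc h by simp
        obtain p1 where p1: "E p p1" "sz p1 < sz p" "target p1 q" using target_step[OF False h(4)] by blast
        obtain p2 where p2: "E p' p2" "sz p2 < sz p'" "target p2 q'" using target_step[OF F' h(5)] by blast
        \<comment> \<open>The descent to \<open>p1\<close> and the horizontal edge to
          \<open>p'\<close> form a peak at \<open>p\<close>. Its bypass ends in a neighbour
          \<open>r'\<close> of \<open>p'\<close>, and \<open>r'\<close> and \<open>p2\<close> form a
          second peak, at \<open>p'\<close>. If the edge lies in \<open>\<Lambda>\<close>, then
          \<open>p2\<close> is already a neighbour of \<open>p\<close>.\<close>
        have "(p1, p2) \<in> (low m)\<^sup>*"
          using h(1)
        proof (cases rule: E_cases)
          case (1 l)
          have "E (p' \<cdot> pinv l) (p2 \<cdot> \<one>\<^bsub>P\<^esub>)" by (rule E_Lam[OF p2(1)]) (use 1 in simp_all)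
          then have "E p p2" using 1 pc E_car(2)[OF p2(1)] by (simp add: P.m_assoc)
          then show ?thesis using peaks_connected[OF p1(1) _ p1(2)] p2 h by simp
        next
          case (2 B b)
          obtain A a where A: "nb p A a p1"
            using E_cases[OF p1(1)] p1(2) sz_Lam[OF pc(1)] by (metis less_irrefl)
          have "link m p1 p'" using peak[OF A 2 p1(2)] h by simp
          then obtain r r' where r: "E p1 r" "sz r < m" "(r, r') \<in> (low m)\<^sup>*" "sz r' < m" "E r' p'"
            unfolding link_def by blast
          have "(p1, r) \<in> low m" using r p1 h by (simp add: low_def)
          moreover have "(r', p2) \<in> (low m)\<^sup>*"
            using peaks_connected[OF E_sym[OF r(5)] p2(1) _ p2(2)] r h by simp
          ultimately show ?thesis using r(3) by (meson converse_rtrancl_into_rtrancl rtrancl_trans)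
        qed
        then show ?thesis using path p1 p2 h E_car(2) by blast
      qed
    qed
    show ?case
    proof (intro allI impI)
      fix p p' q q' assume h: "E p p'" "sz p < Suc m" "sz p' < Suc m" "target p q" "target p' q'"
      consider "sz p < m" "sz p' < m" | "sz p = m" "sz p' < m" | "sz p < m" "sz p' = m" | "sz p = m" "sz p' = m"
        using h by linarith
      then show "pinv q \<cdot> q' \<in> \<Lambda>"
      proof cases
        case 1
        then show ?thesis using IH h by blast
      next
        case 2
        then show ?thesis using one h by blast
      next
        case 3
        then have "pinv q' \<cdot> q \<in> \<Lambda>" using one[OF E_sym[OF h(1)]] h by blast
        then show ?thesis using Lam_sym target_car h by blast
      next
        case 4
        then show ?thesis using both h by blast
      qed
    qed
  qed simp
  then show ?thesis using assms by (meson less_Suc_eq_le max.cobounded1 max.cobounded2)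
qed

text \<open>Right multiplication by a generator or its inverse follows an edge, so the target stays
  constant modulo \<open>\<Lambda>\<close> along any word.\<close>

lemma target_Lam:
  assumes "g \<in> carrier P"
  shows "\<forall>p q q'. p \<in> carrier P \<longrightarrow> target p q \<longrightarrow> target (p \<cdot> g) q' \<longrightarrow> pinv q \<cdot> q' \<in> \<Lambda>"
proof -
  have gM: "x \<in> M" if "x \<in> \<Lambda> \<union> {w D a |D a. wp D a}" for x using that M_Lam M_w by blast
  have "g \<in> generate P (\<Lambda> \<union> {w D a |D a. wp D a})" using assms P_gen by simp
  then show ?thesis
  proof (induction rule: generate.induct)
    case one
    then show ?case using target_unique[OF E_refl] by auto
  next
    case (incl h)
    then show ?case using target_unique[OF E_mult] gM by blast
  next
    case (inv h)
    then show ?case using target_unique[OF E_mult] gM M_inv by blast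
  next
    case (eng h1 h2)
    show ?case
    proof (intro allI impI)
      fix p q q' assume h: "p \<in> carrier P" "target p q" "target (p \<cdot> (h1 \<cdot> h2)) q'"
      have c: "h1 \<in> carrier P" "h2 \<in> carrier P" using eng.hyps P_gen by simp_all
      obtain x where x: "target (p \<cdot> h1) x" using target_ex c h by (meson P.m_closed)
      have 1: "pinv q \<cdot> x \<in> \<Lambda>" using eng.IH(1) h x by blast
      have "target (p \<cdot> h1 \<cdot> h2) q'" using h c by (simp add: P.m_assoc)
      moreover have "p \<cdot> h1 \<in> carrier P" using h c by simp
      ultimately have "pinv x \<cdot> q' \<in> \<Lambda>" using eng.IH(2) x by blast
      then show "pinv q \<cdot> q' \<in> \<Lambda>" using Lam_trans[OF _ _ _ 1] target_car h x by blast
    qed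
  qed
qed

text \<open>An element that acts trivially has minimal length and is its own target, as is the
  identity. By \<open>target_Lam\<close> it lies in \<open>\<Lambda>\<close>, where
  \<open>Lam_inj\<close> applies.\<close>

theorem Phi_inj:
  assumes "g \<in> carrier P" "\<And>u. u \<in> L \<Longrightarrow> \<Phi> g (e u) = e u"
  shows "g = \<one>\<^bsub>P\<^esub>"
proof -
  have f: "\<Phi> g x = x" if "x \<in> carrier G" for x
    using Au_ext[of "\<Phi> g" id x] assms Phi_Au id_Au that by simp
  have ig: "irred g" using irred_iff[OF assms(1)] sz_fixed[of g] f by simp
  have i1: "irred \<one>\<^bsub>P\<^esub>" using irred_iff[of "\<one>\<^bsub>P\<^esub>"] sz_fixed[of "\<one>\<^bsub>P\<^esub>"] Phi_one by simp
  have "target \<one>\<^bsub>P\<^esub> \<one>\<^bsub>P\<^esub>" "target (\<one>\<^bsub>P\<^esub> \<cdot> g) g" using ig i1 assms(1) by (simp_all add: target_def)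
  then have "pinv \<one>\<^bsub>P\<^esub> \<cdot> g \<in> \<Lambda>" using target_Lam[OF assms(1)] by blast
  then show ?thesis using Lam_inj assms by simp
qed

text \<open>The reduction is run on automorphisms: a reducible \<phi> is followed by a twist and a
  Whitehead automorphism, the shorter result is lifted by induction, and the lifted moves are undone
  in \<open>P\<close>.\<close>

theorem Phi_surj:
  assumes "\<phi> \<in> Au"
  shows "\<exists>p\<in>carrier P. \<forall>u\<in>L. \<Phi> p (e u) = \<phi> (e u)"
  using assms
proof (induction "size \<phi>" arbitrary: \<phi> rule: less_induct)
  case less
  note \<phi> = less.prems
  show ?case
  proof (cases "reducible \<phi>")
    case False
    then show ?thesis using irreducible_twist[OF \<phi>] Lam_surj Lam_car by blast
  next
    case True
    then obtain A a where A: "twp A a" "cap \<phi> (ZZ A) < cap \<phi> (Z a)" unfolding reducible_def by blast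
    have sA: "sval A" using A(1) by (simp add: twp_def)
    obtain s where s: "s ` L \<subseteq> H" "A = graph s (fst ` A)" using sval_is_graph[OF sA] .
    define D where "D = fst ` A"
    have "D \<subseteq> L" using svalD(1)[OF sA] by (auto simp: D_def)
    then have D: "wp D a" using A(1) by (simp add: twp_def wp_def D_def)
    define \<chi> where "\<chi> g = \<Phi> (\<theta> s) (\<phi> g)" for g
    define \<chi>' where "\<chi>' g = \<Phi> (w D a) (\<chi> g)" for g
    have ts: "\<Phi> (\<theta> s) \<in> Au" "\<Phi> (w D a) \<in> Au" using Phi_Au s D by simp_all
    have \<chi>: "\<chi> \<in> Au" by (rule Au_comp[OF \<phi> ts(1)]) (simp add: \<chi>_def)
    have \<chi>': "\<chi>' \<in> Au" by (rule Au_comp[OF \<chi> ts(2)]) (simp add: \<chi>'_def)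
    note t = theta_twist[OF s(1)]
    have 1: "size \<chi> = size \<phi>" by (rule size_twist[OF t \<phi> \<chi>]) (simp add: \<chi>_def)
    have 2: "cap \<chi> S = cap \<phi> (pre (\<Phi> (\<theta> s)) S)" for S by (rule cap_comp[OF \<phi> ts(1)]) (simp add: \<chi>_def)
    have "cap \<chi> (U D) = cap \<phi> (ZZ A)"
      using 2 twist_pre_U[OF t \<open>D \<subseteq> L\<close>] s(2) unfolding D_def by metis
    moreover have "cap \<chi> (Z a) = cap \<phi> (Z a)"
      using 2 twist_pre_Z[OF t wp_L(1)[OF D]] cap_transl[OF \<phi>, of "s a"] s(1) wp_L(1)[OF D] by auto
    moreover have "size \<chi>' + cap \<chi> (Z a) = size \<chi> + cap \<chi> (U D)"
      by (rule size_acts_w(1)[OF w_acts[OF D] \<chi> \<chi>']) (simp add: \<chi>'_def)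
    ultimately have "size \<chi>' < size \<phi>" using 1 A(2) by linarith
    then obtain p where p: "p \<in> carrier P" "\<And>u. u \<in> L \<Longrightarrow> \<Phi> p (e u) = \<chi>' (e u)"
      using less.hyps \<chi>' by blast
    define y where "y = \<theta> s \<cdot> w D a"
    have y: "y \<in> carrier P" using s D by (simp add: y_def)
    have "\<Phi> (p \<cdot> pinv y) (e u) = \<phi> (e u)" if u: "u \<in> L" for u
    proof -
      have c: "\<phi> (e u) \<in> carrier G" using Au_closed[OF \<phi>] u by simp
      have "\<Phi> p (e u) = \<Phi> y (\<phi> (e u))"
        using p(2)[OF u] Phi_mult[of "\<theta> s" "w D a", OF _ _ c] s D by (simp add: y_def \<chi>'_def \<chi>_def)
      then have "\<Phi> (p \<cdot> pinv y) (e u) = \<Phi> (pinv y) (\<Phi> y (\<phi> (e u)))"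
        using Phi_mult[of p "pinv y"] p(1) y u by simp
      also have "\<dots> = \<Phi> (y \<cdot> pinv y) (\<phi> (e u))" using Phi_mult[of y "pinv y", OF _ _ c] y by simp
      also have "\<dots> = \<phi> (e u)" using y Phi_one[OF c] by simp
      finally show ?thesis .
    qed
    then show ?thesis using p(1) y by (meson P.inv_closed P.m_closed)
  qed
qed

end

section \<open>Presented groups\<close>

lemma words_Nil [simp]: "[] \<in> words S"
  by (simp add: words_def)

lemma words_Cons [simp]: "l # w \<in> words S \<longleftrightarrow> fst l \<in> S \<and> w \<in> words S"
  by (auto simp: words_def mem_Times_iff)

lemma words_append [simp]: "u @ v \<in> words S \<longleftrightarrow> u \<in> words S \<and> v \<in> words S"
  by (simp add: words_def)

lemma words_induct [consumes 1, case_names Nil Cons]: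
  assumes "w \<in> words S" "Q []" "\<And>l w. fst l \<in> S \<Longrightarrow> w \<in> words S \<Longrightarrow> Q w \<Longrightarrow> Q (l # w)"
  shows "Q w"
  using assms(1) by (induction w) (simp_all add: assms)

lemma foldr_act_closed:
  assumes "\<And>l s. fst l \<in> S \<Longrightarrow> s \<in> M \<Longrightarrow> act l s \<in> M" "w \<in> words S" "s \<in> M"
  shows "foldr act w s \<in> M"
  using assms(2) by (induction rule: words_induct) (use assms in auto)

text \<open>A direct way to separate words: letters act on a set so that inverses and relations are
  respected. It yields the normal forms and the small actions that tell elements of the graph group
  apart.\<close>

lemma pres_rel_act:
  assumes cl: "\<And>l s. fst l \<in> S \<Longrightarrow> s \<in> M \<Longrightarrow> act l s \<in> M"
    and inv: "\<And>l s. fst l \<in> S \<Longrightarrow> s \<in> M \<Longrightarrow> act l (act (linv l) s) = s"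
    and rel: "\<And>u v s. (u, v) \<in> R \<Longrightarrow> u \<in> words S \<Longrightarrow> v \<in> words S \<Longrightarrow> s \<in> M \<Longrightarrow> foldr act u s = foldr act v s"
    and uv: "(u, v) \<in> pres_rel S R" and s: "s \<in> M"
  shows "foldr act u s = foldr act v s"
  using uv s
proof (induction arbitrary: s rule: pres_rel.induct)
  case (append u u' v v')
  have "v' \<in> words S" using pres_rel_words append.hyps(2) by blast
  then have "foldr act v' s \<in> M" using foldr_act_closed[of S M act] cl append.prems by blast
  then show ?case using append.IH append.prems by simp
next
  case (cancel l)
  then show ?case using inv by (simp add: mem_Times_iff)
next
  case (relation u v)
  then show ?case using rel by blast
qed simp_all

definition wprod :: "('a, 'b) monoid_scheme \<Rightarrow> ('g \<Rightarrow> 'a) \<Rightarrow> 'g word \<Rightarrow> 'a" where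
  "wprod K f w = foldr (\<lambda>l y. (if snd l then f (fst l) else inv\<^bsub>K\<^esub> (f (fst l))) \<otimes>\<^bsub>K\<^esub> y) w \<one>\<^bsub>K\<^esub>"

definition pres_lift :: "('a, 'b) monoid_scheme \<Rightarrow> ('g \<Rightarrow> 'a) \<Rightarrow> 'g word set \<Rightarrow> 'a" where
  "pres_lift K f p = wprod K f (SOME w. w \<in> p)"

lemma wprod_Nil [simp]: "wprod K f [] = \<one>\<^bsub>K\<^esub>"
  by (simp add: wprod_def)

lemma wprod_Cons [simp]:
  "wprod K f (l # w) = (if snd l then f (fst l) else inv\<^bsub>K\<^esub> (f (fst l))) \<otimes>\<^bsub>K\<^esub> wprod K f w"
  by (simp add: wprod_def)

lemma (in group) wprod_closed:
  assumes "f ` S \<subseteq> carrier G" "w \<in> words S"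
  shows "wprod G f w \<in> carrier G"
  using assms(2) by (induction rule: words_induct) (use assms(1) in auto)

lemma (in group) wprod_append:
  assumes "f ` S \<subseteq> carrier G" "u \<in> words S" "v \<in> words S"
  shows "wprod G f (u @ v) = wprod G f u \<otimes> wprod G f v"
  using assms(2)
proof (induction rule: words_induct)
  case Nil
  then show ?case using wprod_closed[OF assms(1,3)] by simp
next
  case (Cons l w)
  have "f (fst l) \<in> carrier G" using assms(1) Cons by blast
  then show ?case
    using Cons wprod_closed[OF assms(1,3)] wprod_closed[OF assms(1)] by (simp add: m_assoc)
qed

definition pres_map :: "('a, 'b) monoid_scheme \<Rightarrow> ('g \<Rightarrow> 'a) \<Rightarrow> 'g set \<Rightarrow> ('g word \<times> 'g word) set \<Rightarrow> bool" where
  "pres_map K f S R \<longleftrightarrow> group K \<and> f ` S \<subseteq> carrier K \<and>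
     (\<forall>(u, v)\<in>R. u \<in> words S \<longrightarrow> v \<in> words S \<longrightarrow> wprod K f u = wprod K f v)"

lemma pres_mapD:
  assumes "pres_map K f S R"
  shows "group K" "f ` S \<subseteq> carrier K"
    "(u, v) \<in> R \<Longrightarrow> u \<in> words S \<Longrightarrow> v \<in> words S \<Longrightarrow> wprod K f u = wprod K f v"
  using assms unfolding pres_map_def by auto

lemma wprod_pres_rel:
  assumes f: "pres_map K f S R" and uv: "(u, v) \<in> pres_rel S R"
  shows "wprod K f u = wprod K f v"
proof -
  interpret K: group K using pres_mapD(1)[OF f] .
  note fS = pres_mapD(2)[OF f]
  show ?thesis
    using uv
  proof (induction rule: pres_rel.induct)
    case (append u u' v v')
    then show ?case using K.wprod_append[OF fS] pres_rel_words[OF append.hyps(1)]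
        pres_rel_words[OF append.hyps(2)] by simp
  next
    case (cancel l)
    then have "f (fst l) \<in> carrier K" using fS by auto
    then show ?case by (simp add: linv_def)
  next
    case (relation u v)
    then show ?case using pres_mapD(3)[OF f] by blast
  qed simp_all
qed

lemma pres_class_self: "w \<in> words S \<Longrightarrow> w \<in> pres_class S R w"
  by (simp add: pres_class_def pres_rel.refl)

lemma pres_lift_class:
  assumes f: "pres_map K f S R" and w: "w \<in> words S"
  shows "pres_lift K f (pres_class S R w) = wprod K f w"
proof -
  have "(SOME v. v \<in> pres_class S R w) \<in> pres_class S R w"
    using someI[of "\<lambda>v. v \<in> pres_class S R w"] pres_class_self[OF w] by metis
  then have "(w, SOME v. v \<in> pres_class S R w) \<in> pres_rel S R" by (simp add: pres_class_def)
  then show ?thesis unfolding pres_lift_def using wprod_pres_rel[OF f] by metis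
qed

lemma pres_carrier_cases:
  assumes "p \<in> carrier (pres_group S R)"
  obtains w where "w \<in> words S" "p = pres_class S R w"
  using assms unfolding pres_group_def quotient_def pres_class_def by auto

lemma pres_class_carrier: "w \<in> words S \<Longrightarrow> pres_class S R w \<in> carrier (pres_group S R)"
  unfolding pres_group_def quotient_def pres_class_def by auto

lemma pres_one: "\<one>\<^bsub>pres_group S R\<^esub> = pres_class S R []"
  by (simp add: pres_group_def)

lemma pres_lift_hom:
  assumes f: "pres_map K f S R"
  shows "pres_lift K f \<in> hom (pres_group S R) K"
proof (rule homI)
  interpret K: group K using pres_mapD(1)[OF f] .
  note fS = pres_mapD(2)[OF f]
  fix p assume "p \<in> carrier (pres_group S R)"
  then obtain u where u: "u \<in> words S" "p = pres_class S R u" by (rule pres_carrier_cases)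
  then show "pres_lift K f p \<in> carrier K" using pres_lift_class[OF f] K.wprod_closed[OF fS] by simp
  fix q assume "q \<in> carrier (pres_group S R)"
  then obtain v where v: "v \<in> words S" "q = pres_class S R v" by (rule pres_carrier_cases)
  show "pres_lift K f (p \<otimes>\<^bsub>pres_group S R\<^esub> q) = pres_lift K f p \<otimes>\<^bsub>K\<^esub> pres_lift K f q"
    using u v pres_lift_class[OF f] K.wprod_append[OF fS] by (simp add: mult_pres_class)
qed

lemma pres_lift_gen:
  assumes f: "pres_map K f S R" and s: "s \<in> S"
  shows "pres_lift K f (pres_class S R [(s, True)]) = f s"
proof -
  interpret K: group K using pres_mapD(1)[OF f] .
  have "f s \<in> carrier K" using pres_mapD(2)[OF f] s by blast
  then show ?thesis using pres_lift_class[OF f] s by simp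
qed

lemma pres_class_linv:
  assumes "fst l \<in> S"
  shows "pres_class S R [linv l] = inv\<^bsub>pres_group S R\<^esub> (pres_class S R [l])"
proof -
  interpret P: group "pres_group S R" by (rule group_pres_group)
  have "pres_class S R [linv l] \<otimes>\<^bsub>pres_group S R\<^esub> pres_class S R [l] = \<one>\<^bsub>pres_group S R\<^esub>"
    using assms pres_rel.cancel[of "linv l" S R]
    by (simp add: mult_pres_class pres_one pres_class_eq_iff mem_Times_iff)
  then show ?thesis using assms by (simp add: pres_class_carrier P.inv_equality)
qed

lemma pres_class_Cons:
  "fst l \<in> S \<Longrightarrow> w \<in> words S \<Longrightarrow>
    pres_class S R (l # w) = pres_class S R [l] \<otimes>\<^bsub>pres_group S R\<^esub> pres_class S R w"
  by (simp add: mult_pres_class)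

lemma pres_induct [consumes 1, case_names one mult]:
  assumes "p \<in> carrier (pres_group S R)" "Q \<one>\<^bsub>pres_group S R\<^esub>"
    "\<And>l p. fst l \<in> S \<Longrightarrow> p \<in> carrier (pres_group S R) \<Longrightarrow> Q p \<Longrightarrow> Q (pres_class S R [l] \<otimes>\<^bsub>pres_group S R\<^esub> p)"
  shows "Q p"
proof -
  obtain w where w: "w \<in> words S" "p = pres_class S R w" using assms(1) by (rule pres_carrier_cases)
  have "Q (pres_class S R w)" using w(1)
  proof (induction rule: words_induct)
    case Nil
    then show ?case using assms(2) by (simp add: pres_one)
  next
    case (Cons l w)
    then show ?case using assms(3) pres_class_carrier[of w S R] pres_class_Cons[of l S w R] by metis
  qed
  then show ?thesis using w by simp
qed

lemma hom_eq_pres: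
  assumes "group K" "f \<in> hom (pres_group S R) K" "g \<in> hom (pres_group S R) K"
    and eq: "\<And>s. s \<in> S \<Longrightarrow> f (pres_class S R [(s, True)]) = g (pres_class S R [(s, True)])"
    and p: "p \<in> carrier (pres_group S R)"
  shows "f p = g p"
proof -
  interpret f: group_hom "pres_group S R" K f
    by (rule group_hom.intro[OF group_pres_group assms(1) group_hom_axioms.intro[OF assms(2)]])
  interpret g: group_hom "pres_group S R" K g
    by (rule group_hom.intro[OF group_pres_group assms(1) group_hom_axioms.intro[OF assms(3)]])
  have letter: "f (pres_class S R [l]) = g (pres_class S R [l])" if "fst l \<in> S" for l
  proof (cases "snd l")
    case True
    then have "l = (fst l, True)" by (simp add: prod_eq_iff)
    then show ?thesis using eq[OF that] by metis
  next
    case False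
    then have "l = linv (fst l, True)" by (simp add: linv_def prod_eq_iff)
    then have "pres_class S R [l] = inv\<^bsub>pres_group S R\<^esub> (pres_class S R [(fst l, True)])"
      using pres_class_linv[of "(fst l, True)" S R] that by simp
    moreover have "pres_class S R [(fst l, True)] \<in> carrier (pres_group S R)"
      using that by (simp add: pres_class_carrier)
    ultimately show ?thesis using eq[OF that] f.hom_inv g.hom_inv by metis
  qed
  show ?thesis using p
  proof (induction rule: pres_induct)
    case one
    show ?case using f.hom_one g.hom_one by simp
  next
    case (mult l p)
    then have c: "pres_class S R [l] \<in> carrier (pres_group S R)" by (simp add: pres_class_carrier)
    show ?case using f.hom_mult[OF c mult(2)] g.hom_mult[OF c mult(2)] letter[OF mult(1)] mult(3) by simp
  qed
qed

section \<open>Links in the graph and the class of x\<close>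

context pair_graph
begin

lemma lk_iff: "y \<in> lk G x \<longleftrightarrow> (x, y) \<in> parcs G"
  unfolding lk_def using in_arcsD2 by blast

lemma lk_sym: "y \<in> lk G x \<Longrightarrow> x \<in> lk G y"
  unfolding lk_iff using arcs_symmetric by blast

lemma lk_irrefl: "x \<notin> lk G x"
  unfolding lk_iff using no_loops' by blast

lemma lk_verts: "lk G x \<subseteq> pverts G"
  unfolding lk_def by blast

end

text \<open>The class \<open>[x]\<close> is independent and consists of vertices with a common link, which is joined
  to every vertex of \<open>[x] \<union> a_out(x)\<close>. Hence \<open>G([x] \<union> a_out(x))\<close> is the free product of the free
  group on \<open>[x]\<close> and \<open>G(a_out(x))\<close>.\<close>

locale raag_class =
  fixes \<Gamma> :: "'v pair_pre_digraph" and x :: 'v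
  assumes graph: "pair_graph \<Gamma>" and x: "x \<in> pverts \<Gamma>" and adm_cl: "adm \<Gamma> x \<noteq> cl \<Gamma> x"

sublocale raag_class \<subseteq> g: pair_graph \<Gamma>
  by (rule graph)

context raag_class
begin

abbreviation X where "X \<equiv> cls \<Gamma> x"
abbreviation aout where "aout \<equiv> adm_out \<Gamma> x"
abbreviation Y where "Y \<equiv> X \<union> aout"

lemma cl_eq: "cl \<Gamma> x = adm \<Gamma> x \<inter> st \<Gamma> x"
proof -
  have "st \<Gamma> x \<subseteq> pverts \<Gamma>" using g.lk_verts x by (auto simp: st_def)
  then show ?thesis unfolding cl_def adm_def st_def[of _ x] by (auto simp: st_def[of _ x])
qed

text \<open>Since \<open>cl\<close> is \<open>adm\<close> cut down to the star, the assumption on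
  \<open>x\<close> provides a vertex of \<open>adm\<close> outside the star. It rules out adjacent
  vertices within \<open>[x]\<close> and provides a second vertex of \<open>Y\<close>.\<close>

lemma witness: "\<exists>z \<in> adm \<Gamma> x. z \<notin> st \<Gamma> x"
  using adm_cl cl_eq by blast

lemma x_X: "x \<in> X"
  using x by (simp add: cls_def)

lemma X_verts: "X \<subseteq> pverts \<Gamma>"
  by (auto simp: cls_def)

lemma finX: "finite X"
  using finite_subset[OF X_verts g.pair_finite_verts] .

lemma O_verts: "aout \<subseteq> pverts \<Gamma>"
  by (auto simp: adm_out_def adm_def)

lemma Y_verts: "Y \<subseteq> pverts \<Gamma>"
  using X_verts O_verts by blast

lemma X_O: "X \<inter> aout = {}"
  by (auto simp: adm_out_def)

text \<open>A vertex \<open>y\<close> other than \<open>x\<close> with the same star would be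
  adjacent to \<open>x\<close>. The witness lies in the star of every neighbour of \<open>x\<close>,
  hence in that of \<open>y\<close>, which is the star of \<open>x\<close>: a contradiction.\<close>

lemma X_lk: "y \<in> X \<Longrightarrow> lk \<Gamma> y = lk \<Gamma> x"
proof -
  assume y: "y \<in> X"
  show ?thesis
  proof (cases "y = x \<or> lk \<Gamma> x = lk \<Gamma> y")
    case False
    then have st: "st \<Gamma> x = st \<Gamma> y" and ne: "y \<noteq> x" using y by (auto simp: cls_def)
    obtain z where z: "z \<in> adm \<Gamma> x" "z \<notin> st \<Gamma> x" using witness by blast
    have "y \<in> lk \<Gamma> x" using st ne by (auto simp: st_def)
    then have "z \<in> st \<Gamma> y" using z by (auto simp: adm_def)
    then show ?thesis using st z by simp
  qed auto
qed

lemma X_indep: "y \<in> X \<Longrightarrow> z \<in> X \<Longrightarrow> z \<notin> lk \<Gamma> y"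
  using X_lk g.lk_irrefl by metis

lemma O_adm: "z \<in> aout \<Longrightarrow> v \<in> lk \<Gamma> x \<Longrightarrow> z \<in> st \<Gamma> v"
  by (auto simp: adm_out_def adm_def)

lemma X_O_indep: "y \<in> X \<Longrightarrow> z \<in> aout \<Longrightarrow> z \<notin> lk \<Gamma> y"
proof
  assume y: "y \<in> X" and z: "z \<in> aout" and "z \<in> lk \<Gamma> y"
  then have "z \<in> st \<Gamma> x" using X_lk by (simp add: st_def)
  then show False using z cl_eq by (auto simp: adm_out_def)
qed

lemma lk_Y: "v \<in> lk \<Gamma> x \<Longrightarrow> z \<in> Y \<Longrightarrow> z \<in> lk \<Gamma> v"
proof -
  assume v: "v \<in> lk \<Gamma> x" and z: "z \<in> Y"
  show ?thesis
  proof (cases "z \<in> X")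
    case True
    then have "v \<in> lk \<Gamma> z" using X_lk v by simp
    then show ?thesis by (rule g.lk_sym)
  next
    case False
    then have "z \<in> aout" using z by blast
    then have "z \<in> st \<Gamma> v" "z \<noteq> v" using O_adm v X_O_indep[OF x_X] by auto
    then show ?thesis by (simp add: st_def)
  qed
qed

lemma lk_not_Y: "v \<in> lk \<Gamma> x \<Longrightarrow> v \<notin> Y"
  using lk_Y g.lk_irrefl by blast

lemma lk_nX: "y \<in> X \<Longrightarrow> v \<in> Y \<Longrightarrow> v \<notin> lk \<Gamma> y"
  using X_indep X_O_indep by blast

lemma adm_sub: "adm \<Gamma> x \<subseteq> Y \<union> lk \<Gamma> x"
proof
  fix z assume z: "z \<in> adm \<Gamma> x"
  show "z \<in> Y \<union> lk \<Gamma> x"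
  proof (cases "z \<in> Y")
    case False
    then have "z \<in> cl \<Gamma> x" "z \<notin> X" using z by (auto simp: adm_out_def)
    then have "z \<in> st \<Gamma> x" "z \<noteq> x" using cl_eq x_X by auto
    then show ?thesis by (simp add: st_def)
  qed simp
qed

lemma Y_adm: "Y \<subseteq> adm \<Gamma> x"
proof
  fix z assume "z \<in> Y"
  then have "z \<in> pverts \<Gamma>" "\<forall>v\<in>lk \<Gamma> x. z \<in> st \<Gamma> v" using Y_verts lk_Y by (auto simp: st_def)
  then show "z \<in> adm \<Gamma> x" by (simp add: adm_def)
qed

text \<open>This makes every substitution of \<open>[x]\<close> by elements of \<open>G(Y)\<close>
  map each \<open>G(adm v)\<close> into itself: \<open>adm v\<close> contains no vertex of
  \<open>[x]\<close> or all of \<open>Y\<close>. The second vertex \<open>q\<close> of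
  \<open>Y\<close> excludes that \<open>v\<close> lies in the link of \<open>x\<close>, for then
  \<open>y\<close> would be in the star of \<open>q\<close>. So \<open>v\<close> is outside that
  link, and its own link is contained in that of \<open>x\<close>.\<close>

lemma adm_absorbs:
  assumes v: "v \<in> pverts \<Gamma>" and m: "X \<inter> adm \<Gamma> v \<noteq> {}"
  shows "Y \<subseteq> adm \<Gamma> v"
proof -
  obtain y where y: "y \<in> X" "y \<in> adm \<Gamma> v" using m by blast
  obtain q where q: "q \<in> Y" "q \<noteq> y"
  proof (cases "y = x")
    case True
    obtain z where z: "z \<in> adm \<Gamma> x" "z \<notin> st \<Gamma> x" using witness by blast
    then have "z \<in> Y" "z \<noteq> y" using adm_sub True by (auto simp: st_def)
    then show ?thesis using that by blast
  next
    case False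
    then show ?thesis using that[of x] x_X by blast
  qed
  have nlk: "v \<notin> lk \<Gamma> x"
  proof
    assume v: "v \<in> lk \<Gamma> x"
    then have "q \<in> lk \<Gamma> v" using lk_Y q by blast
    then have "y \<in> st \<Gamma> q" using y by (auto simp: adm_def)
    then have "q \<in> lk \<Gamma> y" using q g.lk_sym by (auto simp: st_def)
    then show False using lk_nX y q by blast
  qed
  have "lk \<Gamma> v \<subseteq> lk \<Gamma> x"
  proof
    fix u assume u: "u \<in> lk \<Gamma> v"
    then have "y \<in> st \<Gamma> u" using y by (auto simp: adm_def)
    moreover have "u \<noteq> y" using u nlk g.lk_sym X_lk[OF y(1)] by blast
    ultimately have "u \<in> lk \<Gamma> y" using g.lk_sym by (auto simp: st_def)
    then show "u \<in> lk \<Gamma> x" using X_lk y by simp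
  qed
  then show ?thesis using lk_Y Y_verts by (auto simp: adm_def st_def)
qed

end

section \<open>Normal forms\<close>

definition raag_respecting :: "'v graph \<Rightarrow> ('a, 'b) monoid_scheme \<Rightarrow> ('v \<Rightarrow> 'a) \<Rightarrow> bool" where
  "raag_respecting \<Gamma> K f \<longleftrightarrow> group K \<and> f ` pverts \<Gamma> \<subseteq> carrier K \<and>
     (\<forall>y z. (y, z) \<in> parcs \<Gamma> \<longrightarrow> f y \<otimes>\<^bsub>K\<^esub> f z = f z \<otimes>\<^bsub>K\<^esub> f y)"

context pair_graph
begin

lemma raag_map:
  assumes "raag_respecting G K f"
  shows "pres_map K f (pverts G) (raag_rels G)"
proof -
  interpret K: group K using assms by (simp add: raag_respecting_def)
  have "wprod K f u = wprod K f v" if uv: "(u, v) \<in> raag_rels G" for u v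
  proof -
    obtain y z where yz: "(y, z) \<in> parcs G" "u = [(y, True), (z, True)]" "v = [(z, True), (y, True)]"
      using uv unfolding raag_rels_def by blast
    have "f y \<in> carrier K" "f z \<in> carrier K"
      using assms in_arcsD1[OF yz(1)] in_arcsD2[OF yz(1)] unfolding raag_respecting_def by blast+
    moreover have "f y \<otimes>\<^bsub>K\<^esub> f z = f z \<otimes>\<^bsub>K\<^esub> f y" using assms yz(1) unfolding raag_respecting_def by blast
    ultimately show ?thesis using yz by simp
  qed
  then show ?thesis using assms unfolding pres_map_def raag_respecting_def by blast
qed

lemma raag_group: "group (raag G)"
  unfolding raag_def by (rule group_pres_group)

lemma elt_carrier: "fst a \<in> pverts G \<Longrightarrow> elt G a \<in> carrier (raag G)"
  unfolding raag_def elt_def by (rule pres_class_carrier) simp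

lemma elt_linv: "fst a \<in> pverts G \<Longrightarrow> elt G (linv a) = inv\<^bsub>raag G\<^esub> (elt G a)"
  unfolding raag_def elt_def by (rule pres_class_linv)

lemma raag_induct [consumes 1, case_names one mult]:
  assumes "p \<in> carrier (raag G)" "Q \<one>\<^bsub>raag G\<^esub>"
    "\<And>l p. fst l \<in> pverts G \<Longrightarrow> p \<in> carrier (raag G) \<Longrightarrow> Q p \<Longrightarrow> Q (elt G l \<otimes>\<^bsub>raag G\<^esub> p)"
  shows "Q p"
  using assms unfolding raag_def elt_def by (rule pres_induct)

lemma gen_commute:
  assumes "(y, z) \<in> parcs G"
  shows "gen G y \<otimes>\<^bsub>raag G\<^esub> gen G z = gen G z \<otimes>\<^bsub>raag G\<^esub> gen G y"
proof -
  have yz: "y \<in> pverts G" "z \<in> pverts G" using in_arcsD1 in_arcsD2 assms by blast+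
  have "([(y, True), (z, True)], [(z, True), (y, True)]) \<in> raag_rels G"
    using assms unfolding raag_rels_def by blast
  then have "([(y, True), (z, True)], [(z, True), (y, True)]) \<in> pres_rel (pverts G) (raag_rels G)"
    using yz by (intro pres_rel.relation) simp_all
  then show ?thesis using yz unfolding raag_def elt_def
    by (simp add: mult_pres_class pres_class_eq_iff)
qed

lemma raag_lift_hom: "raag_respecting G K f \<Longrightarrow> pres_lift K f \<in> hom (raag G) K"
  unfolding raag_def by (rule pres_lift_hom[OF raag_map])

lemma raag_lift_gen: "raag_respecting G K f \<Longrightarrow> v \<in> pverts G \<Longrightarrow> pres_lift K f (gen G v) = f v"
  unfolding elt_def by (rule pres_lift_gen[OF raag_map])

lemma raag_hom_eq:
  assumes "group K" "f \<in> hom (raag G) K" "g \<in> hom (raag G) K"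
    "\<And>v. v \<in> pverts G \<Longrightarrow> f (gen G v) = g (gen G v)" "p \<in> carrier (raag G)"
  shows "f p = g p"
  using hom_eq_pres[OF assms(1) assms(2,3)[unfolded raag_def] _ assms(5)[unfolded raag_def]] assms(4)
  unfolding elt_def by blast

lemma elt_eq_act:
  assumes cl: "\<And>l s. fst l \<in> pverts G \<Longrightarrow> s \<in> M \<Longrightarrow> act l s \<in> M"
    and inv: "\<And>l s. fst l \<in> pverts G \<Longrightarrow> s \<in> M \<Longrightarrow> act l (act (linv l) s) = s"
    and rel: "\<And>y z s. (y, z) \<in> parcs G \<Longrightarrow> s \<in> M \<Longrightarrow>
       act (y, True) (act (z, True) s) = act (z, True) (act (y, True) s)"
    and uv: "(u, v) \<in> pres_rel (pverts G) (raag_rels G)" and s: "s \<in> M"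
  shows "foldr act u s = foldr act v s"
proof (rule pres_rel_act[of "pverts G" M act "raag_rels G"])
  fix u v s assume "(u, v) \<in> raag_rels G" "s \<in> M"
  then show "foldr act u s = foldr act v s" unfolding raag_rels_def using rel by auto
qed (use cl inv uv s in blast)+

lemma par_subgroup_subgroup: "Y \<subseteq> pverts G \<Longrightarrow> subgroup (par_subgroup G Y) (raag G)"
  unfolding par_subgroup_def using elt_carrier
  by (intro group.generate_is_subgroup raag_group) auto

lemma elt_par:
  assumes "Y \<subseteq> pverts G" "fst a \<in> Y"
  shows "elt G a \<in> par_subgroup G Y"
proof -
  have *: "elt G (fst a, True) \<in> par_subgroup G Y" unfolding par_subgroup_def using assms by (auto intro: generate.incl)
  show ?thesis
  proof (cases "snd a")
    case True
    then have "a = (fst a, True)" by (simp add: prod_eq_iff)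
    then show ?thesis using * by metis
  next
    case False
    then have "a = linv (fst a, True)" by (simp add: linv_def prod_eq_iff)
    then have "elt G a = inv\<^bsub>raag G\<^esub> (elt G (fst a, True))"
      using elt_linv[of "(fst a, True)"] assms by auto
    then show ?thesis using * subgroup.m_inv_closed[OF par_subgroup_subgroup[OF assms(1)]] by simp
  qed
qed

lemma par_words:
  assumes Y: "Y \<subseteq> pverts G" and p: "p \<in> par_subgroup G Y"
  shows "\<exists>w\<in>words Y. p = pres_class (pverts G) (raag_rels G) w"
proof -
  have sub: "words Y \<subseteq> words (pverts G)" using Y by (auto simp: words_def)
  from p show ?thesis unfolding par_subgroup_def
  proof (induction rule: generate.induct)
    case one
    then show ?case by (intro bexI[of _ "[]"]) (simp_all add: raag_def pres_one)
  next
    case (incl h)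
    then show ?case by (auto simp: elt_def intro!: bexI[of _ "[(_, True)]"])
  next
    case (inv h)
    then obtain y where y: "y \<in> Y" "h = gen G y" by auto
    then have "inv\<^bsub>raag G\<^esub> h = elt G (linv (y, True))" using elt_linv[of "(y, True)"] Y by auto
    then show ?case using y by (intro bexI[of _ "[linv (y, True)]"]) (simp_all add: elt_def)
  next
    case (eng h1 h2)
    then obtain u v where uv: "u \<in> words Y" "h1 = pres_class (pverts G) (raag_rels G) u"
      "v \<in> words Y" "h2 = pres_class (pverts G) (raag_rels G) v" by blast
    then show ?case using sub by (intro bexI[of _ "u @ v"]) (simp_all add: raag_def mult_pres_class subset_iff)
  qed
qed

lemma par_induct [consumes 2, case_names one mult]:
  assumes Y: "Y \<subseteq> pverts G" and p: "p \<in> par_subgroup G Y" and "Q \<one>\<^bsub>raag G\<^esub>"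
    "\<And>l p. fst l \<in> Y \<Longrightarrow> p \<in> par_subgroup G Y \<Longrightarrow> Q p \<Longrightarrow> Q (elt G l \<otimes>\<^bsub>raag G\<^esub> p)"
  shows "Q p"
proof -
  interpret S: subgroup "par_subgroup G Y" "raag G" using par_subgroup_subgroup[OF Y] .
  obtain w where w: "w \<in> words Y" "p = pres_class (pverts G) (raag_rels G) w" using par_words[OF Y p] by blast
  have "Q (pres_class (pverts G) (raag_rels G) w) \<and> pres_class (pverts G) (raag_rels G) w \<in> par_subgroup G Y"
    using w(1)
  proof (induction rule: words_induct)
    case Nil
    then show ?case using assms(3) S.one_closed by (simp add: raag_def pres_one)
  next
    case (Cons l w)
    have "w \<in> words (pverts G)" using Cons(2) Y by (auto simp: words_def)
    then have "pres_class (pverts G) (raag_rels G) (l # w)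
        = elt G l \<otimes>\<^bsub>raag G\<^esub> pres_class (pverts G) (raag_rels G) w"
      using pres_class_Cons[of l "pverts G" w "raag_rels G"] Cons(1) Y by (auto simp: raag_def elt_def)
    then show ?case using assms(4) Cons elt_par[OF Y, of l] S.m_closed by simp
  qed
  then show ?thesis using w by simp
qed

end

section \<open>Reduced forms for the free product, obtained from an action of words\<close>

sublocale raag_class \<subseteq> R: group "raag \<Gamma>"
  by (rule g.raag_group)

context raag_class
begin

abbreviation gm (infixl "\<star>" 70) where "a \<star> b \<equiv> a \<otimes>\<^bsub>raag \<Gamma>\<^esub> b"
abbreviation ginv where "ginv a \<equiv> inv\<^bsub>raag \<Gamma>\<^esub> a"
abbreviation gone where "gone \<equiv> \<one>\<^bsub>raag \<Gamma>\<^esub>"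
abbreviation L where "L \<equiv> sgn_set X"
abbreviation el where "el \<equiv> elt \<Gamma>"
abbreviation GC where "GC \<equiv> carrier (raag \<Gamma>)"
abbreviation EH where "EH \<equiv> hom (raag \<Gamma>) (raag \<Gamma>)"
abbreviation SS where "SS \<equiv> Stvl \<Gamma> x"
abbreviation GY where "GY \<equiv> par_subgroup \<Gamma> Y"
abbreviation H where "H \<equiv> par_subgroup \<Gamma> aout"
abbreviation RY where "RY \<equiv> (raag \<Gamma>)\<lparr>carrier := GY\<rparr>"

lemma raag_gh: "f \<in> EH \<Longrightarrow> group_hom (raag \<Gamma>) (raag \<Gamma>) f"
  by (intro group_hom.intro group_hom_axioms.intro g.raag_group)

lemma sub_GY: "subgroup GY (raag \<Gamma>)"
  using g.par_subgroup_subgroup[OF Y_verts] .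

lemma sub_H: "subgroup H (raag \<Gamma>)"
  using g.par_subgroup_subgroup[OF O_verts] .

lemma H_GY: "H \<subseteq> GY"
  unfolding par_subgroup_def by (rule R.mono_generate) blast

lemma GY_car: "p \<in> GY \<Longrightarrow> p \<in> GC"
  using subgroup.mem_carrier[OF sub_GY] .

lemma H_car: "p \<in> H \<Longrightarrow> p \<in> GC"
  using subgroup.mem_carrier[OF sub_H] .

lemmas H_mult = subgroup.m_closed[OF sub_H] and H_inv = subgroup.m_inv_closed[OF sub_H]
  and H_one = subgroup.one_closed[OF sub_H]
lemmas GY_mult = subgroup.m_closed[OF sub_GY] and GY_inv = subgroup.m_inv_closed[OF sub_GY]
  and GY_one = subgroup.one_closed[OF sub_GY]

lemma L_iff: "u \<in> L \<longleftrightarrow> fst u \<in> X"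
  by (auto simp: sgn_set_def mem_Times_iff)

lemma elt_L_GY: "u \<in> L \<Longrightarrow> el u \<in> GY"
  using g.elt_par[OF Y_verts] by (simp add: L_iff)

lemma elt_car: "fst u \<in> pverts \<Gamma> \<Longrightarrow> el u \<in> GC"
  by (rule g.elt_carrier)

lemma elt_L: "u \<in> L \<Longrightarrow> el u \<in> GC"
  using elt_L_GY GY_car by blast

text \<open>A state \<open>([(h\<^sub>1, u\<^sub>1), \<dots>, (h\<^sub>n, u\<^sub>n)], k)\<close> stands for the reduced form
  \<open>h\<^sub>1 u\<^sub>1 \<dots> h\<^sub>n u\<^sub>n k\<close> in the free product; vertices outside \<open>Y\<close> act trivially.\<close>

type_synonym 'w state = "('w word set \<times> 'w letter) list \<times> 'w word set"

definition scale :: "'v word set \<Rightarrow> 'v state \<Rightarrow> 'v state" where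
  "scale h s = (case s of ([], k) \<Rightarrow> ([], h \<star> k) | ((k, u) # xs, f) \<Rightarrow> ((h \<star> k, u) # xs, f))"

definition push :: "'v letter \<Rightarrow> 'v state \<Rightarrow> 'v state" where
  "push u s = (case s of ([], f) \<Rightarrow> ([(gone, u)], f) |
     ((k, v) # xs, f) \<Rightarrow> if k = gone \<and> v = linv u then (xs, f) else ((gone, u) # (k, v) # xs, f))"

definition act :: "'v letter \<Rightarrow> 'v state \<Rightarrow> 'v state" where
  "act l s = (if fst l \<in> aout then scale (el l) s else if fst l \<in> X then push l s else s)"

text \<open>The coefficient in front of the first letter is unrestricted; only the coefficient
  between two mutually inverse letters must be nontrivial.\<close>

fun red :: "('v word set \<times> 'v letter) list \<Rightarrow> bool" where
  "red ((h, u) # (k, v) # xs) \<longleftrightarrow> \<not> (k = gone \<and> v = linv u) \<and> red ((k, v) # xs)"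
| "red _ \<longleftrightarrow> True"

definition states :: "'v state set" where
  "states = {(xs, f). set xs \<subseteq> H \<times> L \<and> f \<in> H \<and> red xs}"

definition ev :: "'v state \<Rightarrow> 'v word set" where
  "ev s = foldr (\<lambda>(h, u) y. h \<star> (el u \<star> y)) (fst s) (snd s)"

lemma red_Cons_head: "red ((h, u) # xs) \<Longrightarrow> red ((k, u) # xs)"
  by (cases xs) auto

lemma red_tl: "red (p # xs) \<Longrightarrow> red xs"
  by (cases p; cases xs) auto

lemma scale_simps [simp]:
  "scale h ([], k) = ([], h \<star> k)" "scale h ((k, u) # xs, f) = ((h \<star> k, u) # xs, f)"
  by (simp_all add: scale_def)

lemma push_simps [simp]:
  "push u ([], f) = ([(gone, u)], f)"
  "push u ((k, v) # xs, f) = (if k = gone \<and> v = linv u then (xs, f) else ((gone, u) # (k, v) # xs, f))"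
  by (simp_all add: push_def)

lemma state_cases [case_names Nil Cons]:
  obtains f where "s = ([], f)" | k u xs f where "s = ((k, u) # xs, f)"
  by (metis list.exhaust prod.exhaust)

lemma states_Nil: "([], f) \<in> states \<longleftrightarrow> f \<in> H"
  by (simp add: states_def)

lemma states_Cons: "((k, u) # xs, f) \<in> states \<longleftrightarrow> k \<in> H \<and> u \<in> L \<and> (xs, f) \<in> states \<and> red ((k, u) # xs)"
  using red_tl[of "(k, u)" xs] by (auto simp: states_def)

lemma scale_states: "h \<in> H \<Longrightarrow> s \<in> states \<Longrightarrow> scale h s \<in> states"
  by (cases s rule: state_cases) (auto simp: states_Nil states_Cons H_mult intro: red_Cons_head)

lemma push_states: "u \<in> L \<Longrightarrow> s \<in> states \<Longrightarrow> push u s \<in> states"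
  by (cases s rule: state_cases) (auto simp: states_Nil states_Cons H_one)

lemma elt_H: "fst l \<in> aout \<Longrightarrow> el l \<in> H"
  by (rule g.elt_par[OF O_verts])

lemma act_states: "s \<in> states \<Longrightarrow> act l s \<in> states"
  unfolding act_def using scale_states push_states elt_H by (simp add: L_iff)

lemma scale_scale:
  "h \<in> H \<Longrightarrow> h' \<in> H \<Longrightarrow> s \<in> states \<Longrightarrow> scale h (scale h' s) = scale (h \<star> h') s"
  by (cases s rule: state_cases) (simp_all add: states_Nil states_Cons H_car R.m_assoc)

lemma scale_one: "s \<in> states \<Longrightarrow> scale gone s = s"
  by (cases s rule: state_cases) (simp_all add: states_Nil states_Cons H_car)

lemma push_push:
  assumes "u \<in> L" "s \<in> states"
  shows "push u (push (linv u) s) = s"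
proof (cases s rule: state_cases)
  case (Nil f)
  then show ?thesis by simp
next
  case (Cons k v xs f)
  show ?thesis
  proof (cases "k = gone \<and> v = u")
    case True
    \<comment> \<open>The first push cancels the head. Pushing \<open>u\<close> back must not cancel
      a second time, which is what \<open>red\<close> guarantees.\<close>
    then have r: "red ((gone, u) # xs)" using assms Cons by (simp add: states_Cons)
    then have "push u (xs, f) = ((gone, u) # xs, f)"
    proof (cases xs)
      case xs: (Cons p ys)
      obtain k' v' where "p = (k', v')" by (cases p)
      then show ?thesis using r xs by simp
    qed simp
    then show ?thesis using True Cons by simp
  next
    case False
    then show ?thesis using Cons by auto
  qed
qed

lemma elt_linv': "fst u \<in> pverts \<Gamma> \<Longrightarrow> el (linv u) = ginv (el u)"
  by (rule g.elt_linv)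

lemma act_act: "s \<in> states \<Longrightarrow> act l (act (linv l) s) = s"
proof -
  assume s: "s \<in> states"
  show ?thesis
  proof (cases "fst l \<in> aout")
    case True
    have "el l \<star> el (linv l) = gone"
      using elt_linv'[of l] elt_car[of l] True subsetD[OF O_verts] by simp
    then show ?thesis using True s elt_H[of l] elt_H[of "linv l"] scale_scale scale_one
      by (simp add: act_def)
  next
    case False
    then show ?thesis using push_push[of l s] s by (auto simp: act_def L_iff)
  qed
qed

text \<open>A vertex of \<open>[x]\<close> is adjacent to nothing in \<open>Y\<close>. So either
  both ends of an edge lie in \<open>a_out\<close>, or one end lies outside \<open>Y\<close> or
  neither lies in \<open>Y\<close>, and vertices outside \<open>Y\<close> act trivially.\<close>

lemma act_commute:
  assumes yz: "(y, z) \<in> parcs \<Gamma>" and s: "s \<in> states"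
  shows "act (y, True) (act (z, True) s) = act (z, True) (act (y, True) s)"
proof -
  have l: "z \<in> lk \<Gamma> y" "y \<in> lk \<Gamma> z" using yz g.lk_iff g.lk_sym by blast+
  show ?thesis
  proof (cases "y \<in> aout \<and> z \<in> aout")
    case True
    then show ?thesis using s elt_H scale_scale g.gen_commute[OF yz] by (simp add: act_def)
  next
    case False
    then show ?thesis using l lk_nX[of y z] lk_nX[of z y] by (auto simp: act_def)
  qed
qed

definition nf :: "'v word set \<Rightarrow> 'v state" where
  "nf p = foldr act (SOME w. w \<in> p) ([], gone)"

lemma init_state: "([], gone) \<in> states"
  by (simp add: states_Nil H_one)

lemma nf_class:
  assumes "w \<in> words (pverts \<Gamma>)"
  shows "nf (pres_class (pverts \<Gamma>) (raag_rels \<Gamma>) w) = foldr act w ([], gone)"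
proof -
  let ?c = "pres_class (pverts \<Gamma>) (raag_rels \<Gamma>) w"
  have "(SOME v. v \<in> ?c) \<in> ?c" using someI[of "\<lambda>v. v \<in> ?c"] pres_class_self[OF assms] by metis
  then have "(w, SOME v. v \<in> ?c) \<in> pres_rel (pverts \<Gamma>) (raag_rels \<Gamma>)" by (simp add: pres_class_def)
  then show ?thesis unfolding nf_def
    using g.elt_eq_act[of states act, OF act_states act_act act_commute _ init_state] by metis
qed

lemma nf_one: "nf gone = ([], gone)"
  using nf_class[of "[]"] by (simp add: raag_def pres_one)

lemma nf_elt:
  assumes l: "fst l \<in> pverts \<Gamma>" and p: "p \<in> GC"
  shows "nf (el l \<star> p) = act l (nf p)"
proof -
  obtain w where w: "w \<in> words (pverts \<Gamma>)" "p = pres_class (pverts \<Gamma>) (raag_rels \<Gamma>) w"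
    using p unfolding raag_def by (rule pres_carrier_cases)
  have "el l \<star> p = pres_class (pverts \<Gamma>) (raag_rels \<Gamma>) (l # w)"
    using pres_class_Cons[OF l w(1)] w(2) by (simp add: raag_def elt_def)
  then show ?thesis using nf_class[of "l # w"] nf_class[OF w(1)] w l by simp
qed

lemma nf_states: "p \<in> GC \<Longrightarrow> nf p \<in> states"
  by (induction rule: g.raag_induct) (simp_all add: nf_one init_state nf_elt act_states)

lemma nf_H:
  assumes h: "h \<in> H" and p: "p \<in> GC"
  shows "nf (h \<star> p) = scale h (nf p)"
  using O_verts h
proof (induction rule: g.par_induct)
  case one
  then show ?case using p scale_one nf_states by simp
next
  case (mult l h)
  have lc: "el l \<in> GC" "fst l \<in> pverts \<Gamma>" using mult(1) subsetD[OF O_verts] elt_car[of l] by simp_all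
  have "nf (el l \<star> h \<star> p) = act l (nf (h \<star> p))"
    using nf_elt[OF lc(2), of "h \<star> p"] lc mult H_car p by (simp add: R.m_assoc)
  also have "\<dots> = scale (el l \<star> h) (nf p)"
    using mult scale_scale[OF elt_H[OF mult(1)] mult(2) nf_states[OF p]] by (simp add: act_def)
  finally show ?case .
qed

lemma ev_H: "h \<in> H \<Longrightarrow> s \<in> states \<Longrightarrow> ev (scale h s) = h \<star> ev s"
proof (cases s rule: state_cases)
  case (Cons k u xs f)
  assume h: "h \<in> H" and s: "s \<in> states"
  have "ev (xs, f) \<in> GC" if "(xs, f) \<in> states" for xs
    using that
  proof (induction xs)
    case (Cons p ys)
    obtain k u where "p = (k, u)" by (cases p)
    then show ?case using Cons H_car elt_L by (simp add: states_Cons ev_def)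
  qed (simp add: ev_def states_Nil H_car)
  then show ?thesis using Cons h s H_car elt_L
    by (simp add: ev_def states_Cons R.m_assoc)
qed (simp add: ev_def)

lemma ev_push:
  assumes u: "u \<in> L" and s: "s \<in> states"
  shows "ev (push u s) = el u \<star> ev s"
proof -
  have c: "ev (xs, f) \<in> GC" if "(xs, f) \<in> states" for xs f
    using that
  proof (induction xs)
    case (Cons p ys)
    obtain k u where "p = (k, u)" by (cases p)
    then show ?case using Cons H_car elt_L by (simp add: states_Cons ev_def)
  qed (simp add: ev_def states_Nil H_car)
  show ?thesis
  proof (cases s rule: state_cases)
    case (Nil f)
    then show ?thesis using u s elt_L H_car by (simp add: ev_def states_Nil)
  next
    case (Cons k v xs f)
    have "ev (xs, f) \<in> GC" "k \<in> GC" "el v \<in> GC"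
      using c s Cons H_car elt_L by (simp_all add: states_Cons)
    moreover have "el (linv u) = ginv (el u)" using elt_linv'[of u] u subsetD[OF X_verts] by (simp add: L_iff)
    ultimately show ?thesis using Cons u elt_L by (auto simp: ev_def R.m_assoc)
  qed
qed

text \<open>Restricted to \<open>GY\<close>, because \<open>nf\<close> forgets all letters outside
  \<open>Y\<close>.\<close>

lemma ev_nf:
  assumes "p \<in> GY"
  shows "ev (nf p) = p"
  using Y_verts assms
proof (induction rule: g.par_induct)
  case one
  then show ?case by (simp add: nf_one ev_def)
next
  case (mult l p)
  then have l: "fst l \<in> pverts \<Gamma>" using Y_verts by blast
  have s: "nf p \<in> states" using nf_states GY_car mult(2) by blast
  have "nf (el l \<star> p) = act l (nf p)" using nf_elt[OF l] GY_car mult(2) by blast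
  moreover have "ev (act l (nf p)) = el l \<star> ev (nf p)"
    using mult(1) ev_H[OF elt_H s] ev_push[OF _ s] by (auto simp: act_def L_iff)
  ultimately show ?case using mult(3) by simp
qed

definition rscale :: "'v word set \<Rightarrow> 'v state \<Rightarrow> 'v state" where
  "rscale h s = (fst s, snd s \<star> h)"

lemma act_rscale:
  assumes "h \<in> H" "s \<in> states"
  shows "act l (rscale h s) = rscale h (act l s)"
proof (cases s rule: state_cases)
  case (Nil f)
  have "fst l \<in> aout \<Longrightarrow> el l \<in> GC" using elt_H H_car by blast
  then show ?thesis using Nil assms H_car by (auto simp: act_def rscale_def states_Nil R.m_assoc)
next
  case (Cons k u xs f)
  then show ?thesis by (simp add: act_def rscale_def)
qed

lemma nf_right:
  assumes h: "h \<in> H" and p: "p \<in> GC"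
  shows "nf (p \<star> h) = rscale h (nf p)"
  using p
proof (induction rule: g.raag_induct)
  case one
  then show ?case using nf_H[OF h R.one_closed] h H_car by (simp add: nf_one rscale_def)
next
  case (mult l p)
  have c: "el l \<in> GC" using elt_car mult(1) by blast
  have "nf (el l \<star> p \<star> h) = act l (nf (p \<star> h))"
    using nf_elt[OF mult(1), of "p \<star> h"] mult(2) h H_car c by (simp add: R.m_assoc)
  also have "\<dots> = rscale h (act l (nf p))" using mult(3) act_rscale[OF h nf_states[OF mult(2)]] by simp
  finally show ?case using nf_elt[OF mult(1,2)] by simp
qed

text \<open>The letter is inverted because \<open>Z u\<close> has to contain the elements that left
  multiplication by \<open>u\<close> shortens.\<close>

definition ZY :: "'v letter \<Rightarrow> 'v word set set" where
  "ZY u = {p \<in> GY. \<exists>xs f. nf p = ((gone, linv u) # xs, f)}"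

definition lenY :: "'v word set \<Rightarrow> nat" where
  "lenY p = length (fst (nf p))"

lemma RY_simps [simp]:
  "carrier RY = GY" "p \<otimes>\<^bsub>RY\<^esub> q = p \<star> q" "\<one>\<^bsub>RY\<^esub> = gone"
  by simp_all

lemma RY_inv: "p \<in> GY \<Longrightarrow> inv\<^bsub>RY\<^esub> p = ginv p"
  by (rule R.m_inv_consistent[OF sub_GY])

lemma rel_free_RY: "rel_free RY H X (el) ZY lenY"
proof -
  show ?thesis
  proof (intro rel_free.intro rel_free_axioms.intro, goal_cases)
    case 1
    show ?case by (rule R.subgroup_imp_group[OF sub_GY])
  next
    case 2
    show ?case using R.subgroup_incl[OF sub_H sub_GY H_GY] .
  next
    case 3
    show ?case by (rule finX)
  next
    case (4 u)
    then show ?case using elt_L_GY by simp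
  next
    case (5 u)
    then have "fst u \<in> pverts \<Gamma>" using X_verts by (auto simp: L_iff)
    then show ?case using elt_linv' RY_inv[OF elt_L_GY[OF 5]] by simp
  next
    case (6 u)
    show ?case by (auto simp: ZY_def)
  next
    case (7 p)
    then have p: "p \<in> GY" "p \<in> GC" using GY_car by simp_all
    show ?case
    proof (cases "nf p" rule: state_cases)
      case (Nil f)
      then have "p = f" "f \<in> H" using ev_nf[OF p(1)] nf_states[OF p(2)] by (simp_all add: ev_def states_Nil)
      then show ?thesis using 7 by simp
    next
      case (Cons k u xs f)
      then have k: "k \<in> H" "u \<in> L" using nf_states[OF p(2)] by (simp_all add: states_Cons)
      have "nf (ginv k \<star> p) = ((gone, u) # xs, f)"
        using nf_H[OF H_inv[OF k(1)] p(2)] Cons H_car[OF k(1)] by simp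
      moreover have "ginv k \<star> p \<in> GY" using GY_mult H_inv k(1) H_GY p(1) by blast
      ultimately have "ginv k \<star> p \<in> ZY (linv u)" by (simp add: ZY_def)
      then show ?thesis using k H_inv by (intro bexI[of _ "ginv k"] bexI[of _ "linv u"]) simp_all
    qed
  next
    case (8 u h)
    have "nf h = ([], h)" using nf_H[OF 8(2) R.one_closed] H_car[OF 8(2)] by (simp add: nf_one)
    then show ?case by (simp add: ZY_def)
  next
    case (9 u v h p)
    then obtain xs f where p: "p \<in> GY" "nf p = ((gone, linv u) # xs, f)" by (auto simp: ZY_def)
    then have "nf (h \<star> p) = ((h, linv u) # xs, f)"
      using nf_H[OF 9(3) GY_car] H_car[OF 9(3)] by simp
    then show ?case using 9(5) by (auto simp: ZY_def)
  next
    case (10 u p)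
    then have p: "p \<in> GY" "p \<in> GC" using GY_car by simp_all
    have u: "fst u \<in> X" "fst u \<notin> aout" "fst u \<in> pverts \<Gamma>"
      using 10(1) X_verts X_O by (auto simp: L_iff)
    have n: "nf (el u \<star> p) = push u (nf p)" using nf_elt[OF u(3) p(2)] u by (simp add: act_def)
    have up: "el u \<star> p \<in> GY" using GY_mult elt_L_GY[OF 10(1)] p(1) by blast
    show ?case
    proof (cases "nf p" rule: state_cases)
      case (Nil f)
      then show ?thesis using n up p by (simp add: ZY_def)
    next
      case (Cons k v xs f)
      have r: "red ((k, v) # xs)" using nf_states[OF p(2)] Cons by (simp add: states_Cons)
      show ?thesis
      proof (cases "k = gone \<and> v = linv u")
        case True
        have "xs = (gone, u) # ys \<Longrightarrow> False" for ys using r True by simp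
        then show ?thesis using True n up p Cons by (auto simp: ZY_def)
      next
        case False
        then show ?thesis using n up p Cons by (auto simp: ZY_def)
      qed
    qed
  next
    case (11 u p h)
    then obtain xs f where p: "p \<in> GY" "nf p = ((gone, linv u) # xs, f)" by (auto simp: ZY_def)
    then have "nf (p \<star> h) = ((gone, linv u) # xs, f \<star> h)"
      using nf_right[OF 11(3) GY_car] by (simp add: rscale_def)
    moreover have "p \<star> h \<in> GY" using GY_mult p(1) H_GY 11(3) by blast
    ultimately show ?case by (simp add: ZY_def)
  next
    case (12 h)
    have "nf h = ([], h)" using nf_H[OF 12 R.one_closed] H_car[OF 12] by (simp add: nf_one)
    then show ?case by (simp add: lenY_def)
  next
    case (13 h p)
    then have "nf (h \<star> p) = scale h (nf p)" using nf_H[OF 13(1) GY_car] by simp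
    then show ?case by (cases "nf p" rule: state_cases) (simp_all add: lenY_def)
  next
    case (14 u p)
    then obtain xs f where p: "p \<in> GY" "nf p = ((gone, linv u) # xs, f)" by (auto simp: ZY_def)
    have u: "fst u \<in> X" "fst u \<notin> aout" "fst u \<in> pverts \<Gamma>"
      using 14(1) X_verts X_O by (auto simp: L_iff)
    have "nf (el u \<star> p) = (xs, f)" using nf_elt[OF u(3) GY_car[OF p(1)]] u p(2) by (simp add: act_def)
    then show ?case using p by (simp add: lenY_def)
  qed
qed

end

section \<open>Automorphisms fixing the complementary factor\<close>

lemma (in group) commute_inv:
  assumes "x \<in> carrier G" "y \<in> carrier G" "x \<otimes> y = y \<otimes> x"
  shows "inv x \<otimes> y = y \<otimes> inv x"
proof -
  have "inv x \<otimes> y = inv x \<otimes> (y \<otimes> x) \<otimes> inv x" using assms(1,2) by (simp add: m_assoc)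
  also have "\<dots> = y \<otimes> inv x" using assms(1,2) by (simp add: assms(3)[symmetric] m_assoc)
  finally show ?thesis .
qed

sublocale raag_class \<subseteq> F: rel_free "(raag \<Gamma>)\<lparr>carrier := par_subgroup \<Gamma> (cls \<Gamma> x \<union> adm_out \<Gamma> x)\<rparr>"
    "par_subgroup \<Gamma> (adm_out \<Gamma> x)" "cls \<Gamma> x" "elt \<Gamma>" ZY lenY
  by (rule rel_free_RY)

context raag_class
begin

lemma elt_sign_cases:
  assumes "fst l \<in> pverts \<Gamma>"
  obtains "l = (fst l, True)" | "l = linv (fst l, True)" "el l = ginv (gen \<Gamma> (fst l))"
proof (cases "snd l")
  case True
  then show ?thesis using that(1) by (simp add: prod_eq_iff)
next
  case False
  then have *: "l = linv (fst l, True)" by (simp add: linv_def prod_eq_iff)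
  moreover have "el (linv (fst l, True)) = ginv (gen \<Gamma> (fst l))"
    using elt_linv'[of "(fst l, True)"] assms by simp
  ultimately show ?thesis using that(2) by metis
qed

lemma elt_commute:
  assumes "(fst a, fst b) \<in> parcs \<Gamma>"
  shows "el a \<star> el b = el b \<star> el a"
proof -
  have v: "fst a \<in> pverts \<Gamma>" "fst b \<in> pverts \<Gamma>" using g.in_arcsD1 g.in_arcsD2 assms by blast+
  let ?a = "gen \<Gamma> (fst a)" and ?b = "gen \<Gamma> (fst b)"
  have c: "?a \<in> GC" "?b \<in> GC" using elt_car v by simp_all
  have 1: "?a \<star> ?b = ?b \<star> ?a" using g.gen_commute[OF assms] .
  have 2: "ginv ?a \<star> ?b = ?b \<star> ginv ?a" using R.commute_inv[OF c 1] .
  have 3: "ginv ?b \<star> ?a = ?a \<star> ginv ?b" using R.commute_inv[OF c(2,1)] 1 by simp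
  have 4: "ginv ?b \<star> ginv ?a = ginv ?a \<star> ginv ?b" using R.commute_inv[of ?b "ginv ?a"] c 2 by simp
  show ?thesis
    by (rule elt_sign_cases[OF v(1)]; rule elt_sign_cases[OF v(2)]) (metis 1 2 3 4)+
qed

lemma GY_lk_commute:
  assumes "p \<in> GY" "fst a \<in> lk \<Gamma> x"
  shows "p \<star> el a = el a \<star> p"
  using Y_verts assms(1)
proof (induction rule: g.par_induct)
  have "fst a \<in> pverts \<Gamma>" using assms(2) g.lk_verts by blast
  then have a: "el a \<in> GC" by (rule elt_car)
  case one
  then show ?case using a by simp
next
  have "fst a \<in> pverts \<Gamma>" using assms(2) g.lk_verts by blast
  then have a: "el a \<in> GC" by (rule elt_car)
  case (mult l p)
  have "(fst a, fst l) \<in> parcs \<Gamma>" using lk_Y[OF assms(2) mult(1)] g.lk_iff by blast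
  then have la: "el a \<star> el l = el l \<star> el a" by (rule elt_commute)
  have l: "el l \<in> GC" using elt_car mult(1) Y_verts by blast
  have p: "p \<in> GC" using GY_car mult(2) .
  have "el l \<star> p \<star> el a = el l \<star> (el a \<star> p)" using l p a mult(3) by (simp add: R.m_assoc)
  also have "\<dots> = el a \<star> (el l \<star> p)" using l p a la by (simp flip: R.m_assoc)
  finally show ?case .
qed

text \<open>Restricted to the carrier because members of \<open>auto\<close> are extensional
  functions.\<close>

definition subst :: "('v \<Rightarrow> 'v word set) \<Rightarrow> 'v aut" where
  "subst f = restrict (pres_lift (raag \<Gamma>) (\<lambda>v. if v \<in> X then f v else gen \<Gamma> v)) (GC)"

lemma gen_car: "v \<in> pverts \<Gamma> \<Longrightarrow> gen \<Gamma> v \<in> GC"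
  using elt_car[of "(v, True)"] by simp

text \<open>No two vertices of \<open>[x]\<close> are adjacent, and a neighbour of one of them
  commutes with all of \<open>GY\<close>; so arbitrary values in \<open>GY\<close> respect the
  relations.\<close>

lemma subst_respecting:
  assumes f: "f ` X \<subseteq> GY"
  shows "raag_respecting \<Gamma> (raag \<Gamma>) (\<lambda>v. if v \<in> X then f v else gen \<Gamma> v)"
  unfolding raag_respecting_def
proof (intro conjI allI impI)
  show "group (raag \<Gamma>)" by (rule g.raag_group)
  show "(\<lambda>v. if v \<in> X then f v else gen \<Gamma> v) ` pverts \<Gamma> \<subseteq> GC"
    using f GY_car gen_car by auto
  fix y z assume yz: "(y, z) \<in> parcs \<Gamma>"
  then have l: "z \<in> lk \<Gamma> y" "y \<in> lk \<Gamma> z" using g.lk_iff g.lk_sym by blast+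
  consider "y \<in> X" "z \<notin> X" | "y \<notin> X" "z \<in> X" | "y \<notin> X" "z \<notin> X"
    using l X_indep by blast
  then show "(if y \<in> X then f y else gen \<Gamma> y) \<star> (if z \<in> X then f z else gen \<Gamma> z) =
    (if z \<in> X then f z else gen \<Gamma> z) \<star> (if y \<in> X then f y else gen \<Gamma> y)"
  proof cases
    case 1
    then have "z \<in> lk \<Gamma> x" "f y \<in> GY" using l X_lk f by auto
    then show ?thesis using GY_lk_commute[of "f y" "(z, True)"] 1 by simp
  next
    case 2
    then have "y \<in> lk \<Gamma> x" "f z \<in> GY" using l X_lk f by auto
    then show ?thesis using GY_lk_commute[of "f z" "(y, True)"] 2 by simp
  next
    case 3
    then show ?thesis using g.gen_commute[OF yz] by simp
  qed
qed

lemma subst_hom: "f ` X \<subseteq> GY \<Longrightarrow> subst f \<in> EH"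
  using g.raag_lift_hom[OF subst_respecting] unfolding subst_def hom_def by auto

lemma subst_gen:
  assumes "f ` X \<subseteq> GY" "v \<in> pverts \<Gamma>"
  shows "subst f (gen \<Gamma> v) = (if v \<in> X then f v else gen \<Gamma> v)"
  using g.raag_lift_gen[OF subst_respecting[OF assms(1)] assms(2)] gen_car[OF assms(2)]
  by (simp add: subst_def)

lemma hom_elt:
  assumes "\<phi> \<in> EH" "fst l \<in> pverts \<Gamma>"
  shows "\<phi> (el (linv l)) = ginv (\<phi> (el l))"
proof -
  interpret h: group_hom "raag \<Gamma>" "raag \<Gamma>" \<phi>
    by (rule raag_gh[OF assms(1)])
  show ?thesis using elt_linv'[OF assms(2)] h.hom_inv elt_car[OF assms(2)] by simp
qed

lemma hom_fix_par:
  assumes \<phi>: "\<phi> \<in> EH" and W: "W \<subseteq> pverts \<Gamma>"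
    and fx: "\<And>v. v \<in> W \<Longrightarrow> \<phi> (gen \<Gamma> v) = gen \<Gamma> v" and p: "p \<in> par_subgroup \<Gamma> W"
  shows "\<phi> p = p"
proof -
  interpret h: group_hom "raag \<Gamma>" "raag \<Gamma>" \<phi>
    by (rule raag_gh[OF \<phi>])
  from W p show ?thesis
  proof (induction rule: g.par_induct)
    case one
    show ?case by (rule h.hom_one)
  next
    case (mult l p)
    have v: "fst l \<in> pverts \<Gamma>" using mult(1) W by blast
    have pc: "p \<in> GC" using mult(2) subgroup.mem_carrier[OF g.par_subgroup_subgroup[OF W]] by blast
    have "\<phi> (el l) = el l"
      by (rule elt_sign_cases[OF v]) (metis fx[OF mult(1)], metis fx[OF mult(1)] h.hom_inv gen_car[OF v])
    then show ?case using h.hom_mult[OF elt_car[OF v] pc] mult(3) by simp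
  qed
qed

lemma hom_par_closed:
  assumes \<phi>: "\<phi> \<in> EH" and W: "W \<subseteq> pverts \<Gamma>"
    and S: "subgroup S (raag \<Gamma>)" and fx: "\<And>v. v \<in> W \<Longrightarrow> \<phi> (gen \<Gamma> v) \<in> S" and p: "p \<in> par_subgroup \<Gamma> W"
  shows "\<phi> p \<in> S"
proof -
  interpret h: group_hom "raag \<Gamma>" "raag \<Gamma>" \<phi>
    by (rule raag_gh[OF \<phi>])
  from W p show ?thesis
  proof (induction rule: g.par_induct)
    case one
    show ?case using h.hom_one subgroup.one_closed[OF S] by simp
  next
    case (mult l p)
    have v: "fst l \<in> pverts \<Gamma>" using mult(1) W by blast
    have pc: "p \<in> GC" using mult(2) subgroup.mem_carrier[OF g.par_subgroup_subgroup[OF W]] by blast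
    have "\<phi> (el l) \<in> S"
      by (rule elt_sign_cases[OF v])
        (metis fx[OF mult(1)], metis fx[OF mult(1)] h.hom_inv gen_car[OF v] subgroup.m_inv_closed[OF S])
    then show ?case using h.hom_mult[OF elt_car[OF v] pc] mult(3) subgroup.m_closed[OF S] by simp
  qed
qed

section \<open>Restriction to \<open>GY\<close> and extension from it\<close>

lemma StvlD:
  assumes "\<phi> \<in> SS"
  shows "\<phi> \<in> EH" "\<phi> \<in> extensional (GC)"
    "bij_betw \<phi> (GC) (GC)"
    "v \<in> pverts \<Gamma> \<Longrightarrow> v \<notin> X \<Longrightarrow> \<phi> (gen \<Gamma> v) = gen \<Gamma> v"
    "v \<in> X \<Longrightarrow> \<phi> (gen \<Gamma> v) \<in> GY"
    "W \<in> adm \<Gamma> ` pverts \<Gamma> \<Longrightarrow> \<phi> ` par_subgroup \<Gamma> W = par_subgroup \<Gamma> W"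
  using assms unfolding Stvl_def Stv_def StK_def auto_def Bij_def by auto

lemma Stvl_auto: "\<phi> \<in> SS \<Longrightarrow> \<phi> \<in> auto (raag \<Gamma>)"
  unfolding Stvl_def Stv_def StK_def by auto

lemma Stvl_ext:
  assumes "\<phi> \<in> SS" "\<psi> \<in> SS" "\<And>v. v \<in> X \<Longrightarrow> \<phi> (gen \<Gamma> v) = \<psi> (gen \<Gamma> v)"
  shows "\<phi> = \<psi>"
proof (rule extensionalityI[OF StvlD(2)[OF assms(1)] StvlD(2)[OF assms(2)]])
  fix p assume p: "p \<in> GC"
  show "\<phi> p = \<psi> p"
  proof (rule g.raag_hom_eq[OF g.raag_group StvlD(1)[OF assms(1)] StvlD(1)[OF assms(2)] _ p])
    fix v assume "v \<in> pverts \<Gamma>"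
    then show "\<phi> (gen \<Gamma> v) = \<psi> (gen \<Gamma> v)"
      using assms(3) StvlD(4)[OF assms(1)] StvlD(4)[OF assms(2)] by (cases "v \<in> X") auto
  qed
qed

lemma adm_verts: "adm \<Gamma> v \<subseteq> pverts \<Gamma>"
  by (auto simp: adm_def)

lemma lk_verts': "lk \<Gamma> x \<subseteq> pverts \<Gamma>"
  by (rule g.lk_verts)

lemma par_mono: "W \<subseteq> W' \<Longrightarrow> par_subgroup \<Gamma> W \<subseteq> par_subgroup \<Gamma> W'"
  unfolding par_subgroup_def by (rule R.mono_generate) blast

text \<open>Letters from the link commute with those from \<open>Y\<close> and can be collected on
  the right.\<close>

lemma adm_decomp:
  assumes "p \<in> par_subgroup \<Gamma> (Y \<union> lk \<Gamma> x)"
  shows "\<exists>q\<in>GY. \<exists>c\<in>par_subgroup \<Gamma> (lk \<Gamma> x). p = q \<star> c"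
proof -
  have W: "Y \<union> lk \<Gamma> x \<subseteq> pverts \<Gamma>" using Y_verts lk_verts' by blast
  have sub_C: "subgroup (par_subgroup \<Gamma> (lk \<Gamma> x)) (raag \<Gamma>)" using g.par_subgroup_subgroup[OF lk_verts'] .
  from W assms show ?thesis
  proof (induction rule: g.par_induct)
    case one
    show ?case using GY_one subgroup.one_closed[OF sub_C] by (metis R.one_closed R.r_one)
  next
    case (mult l p)
    then obtain q c where qc: "q \<in> GY" "c \<in> par_subgroup \<Gamma> (lk \<Gamma> x)" "p = q \<star> c" by blast
    have v: "fst l \<in> pverts \<Gamma>" using mult(1) W by blast
    have car: "q \<in> GC" "c \<in> GC" "el l \<in> GC"
      using qc GY_car subgroup.mem_carrier[OF sub_C] elt_car[OF v] by auto
    show ?case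
    proof (cases "fst l \<in> Y")
      case True
      then have "el l \<star> q \<in> GY" using GY_mult g.elt_par[OF Y_verts] qc(1) by blast
      moreover have "el l \<star> p = el l \<star> q \<star> c" using car qc(3) by (simp add: R.m_assoc)
      ultimately show ?thesis using qc(2) by blast
    next
      case False
      then have l: "fst l \<in> lk \<Gamma> x" using mult(1) by blast
      then have "el l \<star> c \<in> par_subgroup \<Gamma> (lk \<Gamma> x)"
        using subgroup.m_closed[OF sub_C] g.elt_par[OF lk_verts'] qc(2) by blast
      moreover have "el l \<star> p = q \<star> (el l \<star> c)"
        using car qc(3) GY_lk_commute[OF qc(1) l] by (simp flip: R.m_assoc)
      ultimately show ?thesis using qc(1) by blast
    qed
  qed
qed

lemma nf_lk: "c \<in> par_subgroup \<Gamma> (lk \<Gamma> x) \<Longrightarrow> nf c = ([], gone)"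
  using lk_verts'
proof -
  assume c: "c \<in> par_subgroup \<Gamma> (lk \<Gamma> x)"
  from lk_verts' c show ?thesis
  proof (induction rule: g.par_induct)
    case one
    show ?case by (rule nf_one)
  next
    case (mult l p)
    have "p \<in> GC" using mult(2) subgroup.mem_carrier[OF g.par_subgroup_subgroup[OF lk_verts']] by blast
    moreover have "fst l \<in> pverts \<Gamma>" using mult(1) lk_verts' by blast
    ultimately have "nf (el l \<star> p) = act l (nf p)" using nf_elt by blast
    then show ?case using mult(1,3) lk_not_Y[OF mult(1)] by (simp add: act_def)
  qed
qed

lemma Stvl_hom_GY: "\<phi> \<in> SS \<Longrightarrow> p \<in> GY \<Longrightarrow> \<phi> p \<in> GY"
proof -
  assume \<phi>: "\<phi> \<in> SS" and p: "p \<in> GY"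
  show ?thesis
  proof (rule hom_par_closed[OF StvlD(1)[OF \<phi>] Y_verts sub_GY _ p])
    fix v assume v: "v \<in> Y"
    show "\<phi> (gen \<Gamma> v) \<in> GY"
    proof (cases "v \<in> X")
      case True
      then show ?thesis using StvlD(5)[OF \<phi>] by blast
    next
      case False
      then show ?thesis using StvlD(4)[OF \<phi>, of v] g.elt_par[OF Y_verts, of "(v, True)"] v subsetD[OF Y_verts v] by simp
    qed
  qed
qed

lemma Stvl_H: "\<phi> \<in> SS \<Longrightarrow> h \<in> H \<Longrightarrow> \<phi> h = h"
  using hom_fix_par[OF StvlD(1) O_verts] StvlD(4) X_O O_verts by blast

text \<open>The stabilizer condition speaks of \<open>G(adm x)\<close>, which may be larger than
  \<open>GY\<close>, so surjectivity on \<open>GY\<close> has to be argued. A preimage is written as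
  \<open>q \<star> c\<close> with \<open>c\<close> over the link of \<open>x\<close>. Then
  \<open>c\<close> is fixed by \<phi>, so it lies in \<open>GY\<close>; its normal form is empty, so
  it is trivial.\<close>

lemma Stvl_Au:
  assumes \<phi>: "\<phi> \<in> SS"
  shows "\<phi> \<in> F.Au"
proof -
  note h = StvlD(1)[OF \<phi>]
  have inj: "inj_on \<phi> (GC)" using StvlD(3)[OF \<phi>] by (simp add: bij_betw_def)
  have 1: "\<phi> \<in> hom RY RY"
    unfolding hom_def using hom_mult[OF h] GY_car Stvl_hom_GY[OF \<phi>] by auto
  have 2: "inj_on \<phi> GY" by (rule inj_on_subset[OF inj]) (use GY_car in blast)
  have 3: "GY \<subseteq> \<phi> ` GY"
  proof
    fix p assume p: "p \<in> GY"
    have "p \<in> par_subgroup \<Gamma> (adm \<Gamma> x)" using par_mono[OF Y_adm] p by blast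
    then have "p \<in> \<phi> ` par_subgroup \<Gamma> (adm \<Gamma> x)" using StvlD(6)[OF \<phi>] x by blast
    then obtain p' where p': "p' \<in> par_subgroup \<Gamma> (adm \<Gamma> x)" "p = \<phi> p'" by blast
    then obtain q c where qc: "q \<in> GY" "c \<in> par_subgroup \<Gamma> (lk \<Gamma> x)" "p' = q \<star> c"
      using adm_decomp par_mono[OF adm_sub] by blast
    have cc: "c \<in> GC"
      using qc(2) subgroup.mem_carrier[OF g.par_subgroup_subgroup[OF lk_verts']] by blast
    have "\<phi> c = c"
      by (rule hom_fix_par[OF h lk_verts' _ qc(2)]) (use StvlD(4)[OF \<phi>] lk_not_Y lk_verts' in blast)
    then have pq: "p = \<phi> q \<star> c" using p'(2) qc hom_mult[OF h GY_car[OF qc(1)] cc] by simp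
    have "c = ginv (\<phi> q) \<star> p" using pq cc GY_car[OF Stvl_hom_GY[OF \<phi> qc(1)]] by simp
    then have "c \<in> GY" using GY_mult[OF GY_inv[OF Stvl_hom_GY[OF \<phi> qc(1)]] p] by simp
    then have "c = ev (nf c)" using ev_nf by simp
    then have "c = gone" using nf_lk[OF qc(2)] by (simp add: ev_def)
    then have "p = \<phi> q" using pq GY_car[OF Stvl_hom_GY[OF \<phi> qc(1)]] by simp
    then show "p \<in> \<phi> ` GY" using qc(1) by blast
  qed
  have "bij_betw \<phi> GY GY" unfolding bij_betw_def using 2 3 Stvl_hom_GY[OF \<phi>] by blast
  then show ?thesis unfolding F.Au_def using 1 Stvl_H[OF \<phi>] by simp
qed

text \<open>Both bijectivity and equality of \<open>G(adm v)\<close> with its image come from the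
  inverse substitution \<open>f'\<close>; that either substitution maps \<open>G(adm v)\<close> into
  itself is \<open>adm_absorbs\<close>.\<close>

lemma Stvl_subst:
  assumes f: "f ` X \<subseteq> GY" "f' ` X \<subseteq> GY"
    and inv: "\<And>y. y \<in> X \<Longrightarrow> subst f (f' y) = gen \<Gamma> y" "\<And>y. y \<in> X \<Longrightarrow> subst f' (f y) = gen \<Gamma> y"
  shows "subst f \<in> SS"
proof -
  have comp: "subst f (subst f' p) = p"
    if f: "f ` X \<subseteq> GY" "f' ` X \<subseteq> GY" "\<And>y. y \<in> X \<Longrightarrow> subst f (f' y) = gen \<Gamma> y"
      and p: "p \<in> GC" for f f' p
  proof -
    have "(subst f \<circ> subst f') p = id p"
    proof (rule g.raag_hom_eq[OF g.raag_group _ _ _ p])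
      show "subst f \<circ> subst f' \<in> EH"
        using hom_compose[OF subst_hom[OF f(2)] subst_hom[OF f(1)]] by simp
      show "id \<in> EH" by (simp add: hom_def)
      fix v assume v: "v \<in> pverts \<Gamma>"
      show "(subst f \<circ> subst f') (gen \<Gamma> v) = id (gen \<Gamma> v)"
        using subst_gen[OF f(2) v] subst_gen[OF f(1) v] f(3) by simp
    qed
    then show ?thesis by simp
  qed
  have closed: "subst f p \<in> GC" if "f ` X \<subseteq> GY" "p \<in> GC" for f p
    using hom_in_carrier[OF subst_hom[OF that(1)] that(2)] .
  have bij: "bij_betw (subst f) (GC) (GC)"
    by (rule bij_betwI[of _ _ _ "subst f'"])
      (use closed f comp[OF f inv(1)] comp[OF f(2,1) inv(2)] in auto)
  have "subst f \<in> extensional (GC)" unfolding subst_def by simp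
  then have "subst f \<in> auto (raag \<Gamma>)" using bij subst_hom[OF f(1)] unfolding auto_def Bij_def by simp
  moreover have "subst f ` par_subgroup \<Gamma> W = par_subgroup \<Gamma> W" if W: "W \<in> adm \<Gamma> ` pverts \<Gamma>" for W
  proof -
    obtain v where v: "v \<in> pverts \<Gamma>" "W = adm \<Gamma> v" using W by blast
    then have Wv: "W \<subseteq> pverts \<Gamma>" using adm_verts by blast
    note sub_W = g.par_subgroup_subgroup[OF Wv]
    have into: "subst f p \<in> par_subgroup \<Gamma> W" if f: "f ` X \<subseteq> GY" and p: "p \<in> par_subgroup \<Gamma> W" for f p
    proof (rule hom_par_closed[OF subst_hom[OF f] Wv sub_W _ p])
      fix u assume u: "u \<in> W"
      have up: "u \<in> pverts \<Gamma>" using u Wv by blast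
      show "subst f (gen \<Gamma> u) \<in> par_subgroup \<Gamma> W"
      proof (cases "u \<in> X")
        case True
        then have "Y \<subseteq> W" using adm_absorbs[OF v(1)] u v(2) by blast
        then have "GY \<subseteq> par_subgroup \<Gamma> W" by (rule par_mono)
        then show ?thesis using subst_gen[OF f up] True f by auto
      next
        case False
        then show ?thesis using subst_gen[OF f up] g.elt_par[OF Wv, of "(u, True)"] u by simp
      qed
    qed
    show ?thesis
    proof
      show "subst f ` par_subgroup \<Gamma> W \<subseteq> par_subgroup \<Gamma> W" using into[OF f(1)] by blast
      show "par_subgroup \<Gamma> W \<subseteq> subst f ` par_subgroup \<Gamma> W"
      proof
        fix p assume p: "p \<in> par_subgroup \<Gamma> W"
        then have "p = subst f (subst f' p)" using comp[OF f inv(1)] subgroup.mem_carrier[OF sub_W] by simp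
        then show "p \<in> subst f ` par_subgroup \<Gamma> W" using into[OF f(2) p] by blast
      qed
    qed
  qed
  ultimately have "subst f \<in> StK \<Gamma>" unfolding StK_def by blast
  moreover have "subst f (gen \<Gamma> v) = gen \<Gamma> v" if "v \<in> pverts \<Gamma> - X" for v
    using subst_gen[OF f(1), of v] that by simp
  moreover have "subst f (gen \<Gamma> v) \<in> GY" if "v \<in> X" for v
    using subst_gen[OF f(1), of v] that f(1) X_verts by auto
  ultimately show ?thesis unfolding Stvl_def Stv_def by blast
qed

lemma Au_inv_into:
  assumes "\<alpha> \<in> F.Au"
  shows "inv_into GY \<alpha> \<in> F.Au"
proof -
  have bij: "bij_betw \<alpha> GY GY" using F.AuD(2)[OF assms] by simp
  have "inv_into GY \<alpha> \<in> hom RY RY"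
    using F.AuD(1)[OF assms] bij F.iso_set_sym[of \<alpha> RY] by (simp add: iso_def)
  moreover have "bij_betw (inv_into GY \<alpha>) GY GY" using bij_betw_inv_into[OF bij] .
  moreover have "inv_into GY \<alpha> h = h" if "h \<in> H" for h
    using that F.AuD(3)[OF assms that] H_GY inv_into_f_f[OF bij_betw_imp_inj_on[OF bij], of h] by auto
  ultimately show ?thesis unfolding F.Au_def by simp
qed

text \<open>The inverse of restriction to \<open>GY\<close>: the vertices outside \<open>[x]\<close>
  are fixed.\<close>

definition ext :: "'v aut \<Rightarrow> 'v aut" where
  "ext \<alpha> = subst (\<lambda>y. \<alpha> (gen \<Gamma> y))"

lemma ext_image: "\<alpha> \<in> F.Au \<Longrightarrow> (\<lambda>y. \<alpha> (gen \<Gamma> y)) ` X \<subseteq> GY"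
  using F.Au_closed[of \<alpha>] elt_L_GY by (auto simp: L_iff)

lemma ext_eq:
  assumes \<alpha>: "\<alpha> \<in> F.Au" and p: "p \<in> GY"
  shows "ext \<alpha> p = \<alpha> p"
proof -
  note f = ext_image[OF \<alpha>]
  interpret h: group_hom "raag \<Gamma>" "raag \<Gamma>" "ext \<alpha>"
    unfolding ext_def
    by (rule raag_gh[OF subst_hom[OF f]])
  have gY: "gen \<Gamma> v \<in> GY" if "v \<in> Y" for v using g.elt_par[OF Y_verts, of "(v, True)"] that by simp
  have gen: "ext \<alpha> (gen \<Gamma> v) = \<alpha> (gen \<Gamma> v)" if v: "v \<in> Y" for v
  proof (cases "v \<in> X")
    case True
    then show ?thesis unfolding ext_def using subst_gen[OF f, of v] subsetD[OF X_verts] by simp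
  next
    case False
    then have "v \<in> aout" using v by blast
    then have "gen \<Gamma> v \<in> H" using elt_H[of "(v, True)"] by simp
    then show ?thesis unfolding ext_def
      using subst_gen[OF f, of v] subsetD[OF Y_verts v] False F.AuD(3)[OF \<alpha>] by simp
  qed
  from Y_verts p show ?thesis
  proof (induction rule: g.par_induct)
    case one
    have "\<alpha> gone = gone" using F.AuD(3)[OF \<alpha> H_one] .
    then show ?case using h.hom_one by simp
  next
    case (mult l p)
    have v: "fst l \<in> pverts \<Gamma>" using mult(1) Y_verts by blast
    have lY: "el l \<in> GY" using g.elt_par[OF Y_verts mult(1)] .
    have i: "\<alpha> (ginv q) = ginv (\<alpha> q)" if "q \<in> GY" for q
      using F.Au_inv[OF \<alpha>, of q] that F.Au_closed[OF \<alpha>, of q] by (simp add: RY_inv)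
    have "ext \<alpha> (el l) = \<alpha> (el l)"
      by (rule elt_sign_cases[OF v])
        (metis gen[OF mult(1)], metis gen[OF mult(1)] h.hom_inv gen_car[OF v] i[OF gY[OF mult(1)]])
    then show ?case
      using h.hom_mult[OF elt_car[OF v] GY_car[OF mult(2)]] F.Au_mult[OF \<alpha>, of "el l" p] lY mult by simp
  qed
qed

lemma ext_Stvl:
  assumes \<alpha>: "\<alpha> \<in> F.Au"
  shows "ext \<alpha> \<in> SS"
proof -
  let ?\<beta> = "inv_into GY \<alpha>"
  have \<beta>: "?\<beta> \<in> F.Au" using Au_inv_into[OF \<alpha>] .
  have bij: "bij_betw \<alpha> GY GY" using F.AuD(2)[OF \<alpha>] by simp
  have gY: "gen \<Gamma> y \<in> GY" if "y \<in> X" for y using elt_L_GY[of "(y, True)"] that by (simp add: L_iff)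
  show ?thesis unfolding ext_def
  proof (rule Stvl_subst[OF ext_image[OF \<alpha>] ext_image[OF \<beta>]])
    fix y assume y: "y \<in> X"
    have "?\<beta> (gen \<Gamma> y) \<in> GY" using F.Au_closed[OF \<beta>] gY[OF y] by simp
    then show "subst (\<lambda>y. \<alpha> (gen \<Gamma> y)) (?\<beta> (gen \<Gamma> y)) = gen \<Gamma> y"
      using ext_eq[OF \<alpha>] bij_betw_inv_into_right[OF bij gY[OF y]] by (simp add: ext_def)
    have "\<alpha> (gen \<Gamma> y) \<in> GY" using F.Au_closed[OF \<alpha>] gY[OF y] by simp
    then show "subst (\<lambda>y. ?\<beta> (gen \<Gamma> y)) (\<alpha> (gen \<Gamma> y)) = gen \<Gamma> y"
      using ext_eq[OF \<beta>] bij_betw_inv_into_left[OF bij gY[OF y]] by (simp add: ext_def)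
  qed
qed

lemma Stvl_elt_ext:
  assumes "\<phi> \<in> SS" "\<psi> \<in> SS" "\<And>u. u \<in> L \<Longrightarrow> \<phi> (el u) = \<psi> (el u)"
  shows "\<phi> = \<psi>"
  using assms by (intro Stvl_ext) (auto simp: L_iff)

section \<open>The stabilizer as a group\<close>

abbreviation SG where "SG \<equiv> Stvl_group \<Gamma> x"

lemma SG_carrier [simp]: "carrier SG = SS"
  by (simp add: Stvl_group_def)

lemma SG_mult_eq: "mult SG = mult (aut_right (raag \<Gamma>))"
  by (simp add: Stvl_group_def)

lemma SG_mult:
  assumes "\<phi> \<in> SS" "\<psi> \<in> SS"
  shows "\<phi> \<otimes>\<^bsub>SG\<^esub> \<psi> = compose (GC) \<psi> \<phi>"
proof -
  have "\<phi> \<in> Bij (GC)" "\<psi> \<in> Bij (GC)"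
    using Stvl_auto assms by (auto simp: auto_def)
  then show ?thesis by (simp add: SG_mult_eq aut_right_def AutoGroup_def BijGroup_def)
qed

lemma SG_mult_apply:
  assumes "\<phi> \<in> SS" "\<psi> \<in> SS" "p \<in> GC"
  shows "(\<phi> \<otimes>\<^bsub>SG\<^esub> \<psi>) p = \<psi> (\<phi> p)"
  using assms by (simp add: SG_mult compose_eq)

text \<open>The composite is recognised as the extension of an automorphism of the free product, for
  which membership is already known.\<close>

lemma SG_closed:
  assumes "\<phi> \<in> SS" "\<psi> \<in> SS"
  shows "\<phi> \<otimes>\<^bsub>SG\<^esub> \<psi> \<in> SS"
proof -
  note A = Stvl_Au[OF assms(1)] and B = Stvl_Au[OF assms(2)]
  have C: "\<psi> \<circ> \<phi> \<in> F.Au" by (rule F.Au_comp[OF A B]) simp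
  have "\<phi> \<otimes>\<^bsub>SG\<^esub> \<psi> = ext (\<psi> \<circ> \<phi>)"
  proof (rule extensionalityI[of _ "GC"])
    show "\<phi> \<otimes>\<^bsub>SG\<^esub> \<psi> \<in> extensional (GC)" by (simp add: SG_mult assms)
    show "ext (\<psi> \<circ> \<phi>) \<in> extensional (GC)" using StvlD(2)[OF ext_Stvl[OF C]] .
    fix p assume p: "p \<in> GC"
    have "(\<psi> \<circ> \<phi>) p = ext (\<psi> \<circ> \<phi>) p"
    proof (rule g.raag_hom_eq[OF g.raag_group _ StvlD(1)[OF ext_Stvl[OF C]] _ p])
      show "\<psi> \<circ> \<phi> \<in> EH"
        using hom_compose[OF StvlD(1)[OF assms(1)] StvlD(1)[OF assms(2)]] by simp
      fix v assume v: "v \<in> pverts \<Gamma>"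
      show "(\<psi> \<circ> \<phi>) (gen \<Gamma> v) = ext (\<psi> \<circ> \<phi>) (gen \<Gamma> v)"
      proof (cases "v \<in> X")
        case True
        then show ?thesis using ext_eq[OF C] elt_L_GY[of "(v, True)"] by (simp add: L_iff)
      next
        case False
        then show ?thesis
          using StvlD(4)[OF assms(1) v] StvlD(4)[OF assms(2) v] StvlD(4)[OF ext_Stvl[OF C] v] by simp
      qed
    qed
    then show "(\<phi> \<otimes>\<^bsub>SG\<^esub> \<psi>) p = ext (\<psi> \<circ> \<phi>) p" using SG_mult_apply[OF assms p] by simp
  qed
  then show ?thesis using ext_Stvl[OF C] by simp
qed

definition idS :: "'v aut" where
  "idS = restrict (\<lambda>p. p) (GC)"

lemma SG_one: "\<one>\<^bsub>SG\<^esub> = idS"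
  by (simp add: Stvl_group_def aut_right_def AutoGroup_def BijGroup_def idS_def)

lemma idS_Stvl: "idS \<in> SS"
proof -
  have "idS = ext id"
  proof (rule extensionalityI[of _ "GC"])
    show "ext id \<in> extensional (GC)" using StvlD(2)[OF ext_Stvl[OF F.id_Au]] .
    fix p assume p: "p \<in> GC"
    have "id p = ext id p"
    proof (rule g.raag_hom_eq[OF g.raag_group _ StvlD(1)[OF ext_Stvl[OF F.id_Au]] _ p])
      show "id \<in> EH" by (simp add: hom_def)
      fix v assume v: "v \<in> pverts \<Gamma>"
      show "id (gen \<Gamma> v) = ext id (gen \<Gamma> v)"
        using ext_eq[OF F.id_Au] elt_L_GY[of "(v, True)"] StvlD(4)[OF ext_Stvl[OF F.id_Au] v]
        by (cases "v \<in> X") (simp_all add: L_iff)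
    qed
    then show "idS p = ext id p" using p by (simp add: idS_def)
  qed (simp add: idS_def)
  then show ?thesis using ext_Stvl[OF F.id_Au] by simp
qed

lemma SG_group: "group SG"
proof (rule groupI)
  show "\<one>\<^bsub>SG\<^esub> \<in> carrier SG" using SG_one idS_Stvl by simp
  fix \<phi> \<psi> assume "\<phi> \<in> carrier SG" "\<psi> \<in> carrier SG"
  then have \<phi>: "\<phi> \<in> SS" and \<psi>: "\<psi> \<in> SS" by simp_all
  show "\<phi> \<otimes>\<^bsub>SG\<^esub> \<psi> \<in> carrier SG" using SG_closed[OF \<phi> \<psi>] by simp
  have gc: "gen \<Gamma> v \<in> GC" if "v \<in> X" for v using gen_car that X_verts by blast
  show "\<one>\<^bsub>SG\<^esub> \<otimes>\<^bsub>SG\<^esub> \<phi> = \<phi>"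
    by (rule Stvl_ext) (use SG_one idS_Stvl SG_closed \<phi> SG_mult_apply gc in \<open>auto simp: idS_def\<close>)
  show "\<exists>\<chi>\<in>carrier SG. \<chi> \<otimes>\<^bsub>SG\<^esub> \<phi> = \<one>\<^bsub>SG\<^esub>"
  proof (intro bexI)
    have bij: "bij_betw \<phi> GY GY" using F.AuD(2)[OF Stvl_Au[OF \<phi>]] by simp
    let ?\<beta> = "inv_into GY \<phi>"
    have \<beta>: "?\<beta> \<in> F.Au" using Au_inv_into[OF Stvl_Au[OF \<phi>]] .
    show e: "ext ?\<beta> \<in> carrier SG" using ext_Stvl[OF \<beta>] by simp
    show "ext ?\<beta> \<otimes>\<^bsub>SG\<^esub> \<phi> = \<one>\<^bsub>SG\<^esub>"
    proof (rule Stvl_ext)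
      show "ext ?\<beta> \<otimes>\<^bsub>SG\<^esub> \<phi> \<in> SS" using SG_closed ext_Stvl[OF \<beta>] \<phi> by blast
      show "\<one>\<^bsub>SG\<^esub> \<in> SS" using SG_one idS_Stvl by simp
      fix v assume v: "v \<in> X"
      have gY: "gen \<Gamma> v \<in> GY" using elt_L_GY[of "(v, True)"] v by (simp add: L_iff)
      show "(ext ?\<beta> \<otimes>\<^bsub>SG\<^esub> \<phi>) (gen \<Gamma> v) = \<one>\<^bsub>SG\<^esub> (gen \<Gamma> v)"
        using SG_mult_apply[OF ext_Stvl[OF \<beta>] \<phi> gc[OF v]] ext_eq[OF \<beta> gY] SG_one gc[OF v]
          bij_betw_inv_into_right[OF bij gY] by (simp add: idS_def)
    qed
  qed
  fix \<chi> assume "\<chi> \<in> carrier SG"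
  then have \<chi>: "\<chi> \<in> SS" by simp
  show "\<phi> \<otimes>\<^bsub>SG\<^esub> \<psi> \<otimes>\<^bsub>SG\<^esub> \<chi> = \<phi> \<otimes>\<^bsub>SG\<^esub> (\<psi> \<otimes>\<^bsub>SG\<^esub> \<chi>)"
  proof (rule Stvl_ext)
    fix v assume v: "v \<in> X"
    have "\<phi> (gen \<Gamma> v) \<in> GC" using StvlD(5)[OF \<phi> v] GY_car by blast
    then show "(\<phi> \<otimes>\<^bsub>SG\<^esub> \<psi> \<otimes>\<^bsub>SG\<^esub> \<chi>) (gen \<Gamma> v) = (\<phi> \<otimes>\<^bsub>SG\<^esub> (\<psi> \<otimes>\<^bsub>SG\<^esub> \<chi>)) (gen \<Gamma> v)"
      using SG_mult_apply SG_closed \<phi> \<psi> \<chi> gc[OF v] by simp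
  qed (use SG_closed \<phi> \<psi> \<chi> in blast)+
qed

section \<open>Whitehead automorphisms\<close>


text \<open>Admits \<open>A = {a}\<close>, which denotes the identity, so that the relations can be
  manipulated without exceptions. The multiplier may lie over \<open>[x]\<close> or over
  \<open>a_out\<close>.\<close>

definition good :: "'v letter set \<Rightarrow> 'v letter \<Rightarrow> bool" where
  "good A a \<longleftrightarrow> a \<in> A \<and> linv a \<notin> A \<and> A - {a} \<subseteq> L \<and> fst a \<in> Y"

definition mA :: "'v letter set \<Rightarrow> 'v letter \<Rightarrow> 'v letter \<Rightarrow> 'v word set" where
  "mA A a u = (if u \<in> A then el a else gone)"

definition wv :: "'v letter set \<Rightarrow> 'v letter \<Rightarrow> 'v letter \<Rightarrow> 'v word set" where
  "wv A a u = ginv (mA A a (linv u)) \<star> (if fst u = fst a then gone else el u) \<star> mA A a u"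

definition whf :: "'v letter set \<Rightarrow> 'v letter \<Rightarrow> 'v aut" where
  "whf A a = subst (\<lambda>y. wv A a (y, True))"

lemma eltY: "fst u \<in> Y \<Longrightarrow> el u \<in> GY"
  by (rule g.elt_par[OF Y_verts])

lemma Y_car: "fst u \<in> Y \<Longrightarrow> el u \<in> GC"
  using eltY GY_car by blast

lemma L_Y: "u \<in> L \<Longrightarrow> fst u \<in> Y"
  by (simp add: L_iff)

lemma L_car [simp]: "u \<in> L \<Longrightarrow> el u \<in> GC"
  by (rule elt_L)

lemma elt_linvY: "fst u \<in> Y \<Longrightarrow> el (linv u) = ginv (el u)"
  using elt_linv'[of u] Y_verts by blast

lemma goodD:
  assumes "good A a"
  shows "a \<in> A" "linv a \<notin> A" "fst a \<in> Y" "el a \<in> GC" "el a \<in> GY"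
    "u \<in> A \<Longrightarrow> u \<noteq> a \<Longrightarrow> u \<in> L"
  using assms Y_car eltY unfolding good_def by blast+

lemma mA_car: "fst a \<in> Y \<Longrightarrow> mA A a u \<in> GC"
  by (simp add: mA_def Y_car)

lemma mA_GY: "fst a \<in> Y \<Longrightarrow> mA A a u \<in> GY"
  by (simp add: mA_def eltY GY_one)

lemma wv_GY: "fst a \<in> Y \<Longrightarrow> fst u \<in> Y \<Longrightarrow> wv A a u \<in> GY"
  unfolding wv_def using mA_GY[of a A] GY_mult GY_inv GY_one eltY[of u] by simp

lemma wv_linv:
  assumes "fst a \<in> Y" "fst u \<in> Y"
  shows "wv A a (linv u) = ginv (wv A a u)"
  using assms mA_car[of a A] Y_car[of u]
  by (simp add: wv_def R.inv_mult_group R.m_assoc elt_linvY)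

lemma wv_image: "fst a \<in> Y \<Longrightarrow> (\<lambda>y. wv A a (y, True)) ` X \<subseteq> GY"
  unfolding image_subset_iff using wv_GY[of a "(_, True)" A] by simp

lemma letter_cases: "u = (fst u, True) \<or> u = linv (fst u, True)"
  by (simp add: linv_def prod_eq_iff)

lemma subst_elt:
  assumes f: "\<And>u. u \<in> L \<Longrightarrow> f u \<in> GY" "\<And>u. u \<in> L \<Longrightarrow> f (linv u) = ginv (f u)" and u: "u \<in> L"
  shows "subst (\<lambda>y. f (y, True)) (el u) = f u"
proof -
  have y: "fst u \<in> X" "fst u \<in> pverts \<Gamma>" "(fst u, True) \<in> L" using u X_verts by (auto simp: L_iff)
  have im: "(\<lambda>y. f (y, True)) ` X \<subseteq> GY" using f(1) by (auto simp: L_iff)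
  have pos: "subst (\<lambda>y. f (y, True)) (gen \<Gamma> (fst u)) = f (fst u, True)"
    using subst_gen[OF im y(2)] y(1) by simp
  show ?thesis
  proof (cases "u = (fst u, True)")
    case True
    then show ?thesis using pos by metis
  next
    case False
    then have *: "u = linv (fst u, True)" using letter_cases by blast
    have "subst (\<lambda>y. f (y, True)) (el (linv (fst u, True))) = ginv (f (fst u, True))"
      using hom_elt[OF subst_hom[OF im], of "(fst u, True)"] pos y(2) by simp
    then show ?thesis using * f(2)[OF y(3)] by metis
  qed
qed

lemma whf_elt: "fst a \<in> Y \<Longrightarrow> u \<in> L \<Longrightarrow> whf A a (el u) = wv A a u"
  unfolding whf_def using subst_elt[of "wv A a" u] wv_GY wv_linv L_Y by simp

lemma subst_H: "f ` X \<subseteq> GY \<Longrightarrow> h \<in> H \<Longrightarrow> subst f h = h"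
proof -
  assume f: "f ` X \<subseteq> GY" and h: "h \<in> H"
  have "subst f (gen \<Gamma> v) = gen \<Gamma> v" if v: "v \<in> aout" for v
  proof -
    have "v \<notin> X" using v X_O by blast
    then show ?thesis using subst_gen[OF f subsetD[OF O_verts v]] by simp
  qed
  then show ?thesis using hom_fix_par[OF subst_hom[OF f] O_verts _ h] by blast
qed

lemma wv_self: "good A a \<Longrightarrow> wv A a a = el a"
  using goodD[of A a] by (simp add: wv_def mA_def)

lemma whf_self: "good A a \<Longrightarrow> whf A a (el a) = el a"
proof (cases "fst a \<in> X")
  case True
  assume "good A a"
  then show ?thesis using whf_elt[of a a A] True goodD(3) wv_self by (simp add: L_iff)
next
  case False
  assume a: "good A a"
  then have "el a \<in> H" using elt_H goodD(3) False by blast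
  then show ?thesis unfolding whf_def using subst_H[OF wv_image[OF goodD(3)[OF a]]] by blast
qed

lemma good_inv: "good A a \<Longrightarrow> good (insert (linv a) (A - {a})) (linv a)"
  unfolding good_def by auto

lemma whf_hom: "fst a \<in> Y \<Longrightarrow> whf A a \<in> EH"
  unfolding whf_def by (rule subst_hom[OF wv_image])

lemma whf_inverse:
  assumes good: "good A a" and u: "u \<in> L"
  shows "whf A a (wv (insert (linv a) (A - {a})) (linv a) u) = el u"
proof -
  let ?A = "insert (linv a) (A - {a})"
  note g = goodD[OF good]
  interpret h: group_hom "raag \<Gamma>" "raag \<Gamma>" "whf A a"
    by (rule raag_gh[OF whf_hom[OF g(3)]])
  have la: "el (linv a) = ginv (el a)" "whf A a (ginv (el a)) = ginv (el a)"
    using elt_linvY[OF g(3)] whf_self[OF good] h.hom_inv[OF g(4)] by simp_all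
  have m: "whf A a (mA ?A (linv a) v) = mA ?A (linv a) v" "mA ?A (linv a) v \<in> GC" for v
  proof -
    show "whf A a (mA ?A (linv a) v) = mA ?A (linv a) v" unfolding mA_def using la h.hom_one by simp
    show "mA ?A (linv a) v \<in> GC" using mA_car[of "linv a"] g(3) by simp
  qed
  show ?thesis
  proof (cases "fst u = fst a")
    case True
    then have "u = a \<or> u = linv a" using fst_eq_linv by blast
    then show ?thesis using True la m g h.hom_one whf_self[OF good] by (auto simp: wv_def mA_def)
  next
    case False
    then have ne: "u \<noteq> a" "u \<noteq> linv a" "linv u \<noteq> a" "linv u \<noteq> linv a" by auto
    have "whf A a (wv ?A (linv a) u) = ginv (mA ?A (linv a) (linv u)) \<star> wv A a u \<star> mA ?A (linv a) u"
      using False m u whf_elt[OF g(3) u] h.hom_inv wv_def[of ?A "linv a" u] by simp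
    then show ?thesis
      using False ne u g(4) la(1) by (simp add: wv_def mA_def R.m_assoc R.inv_mult_group)
  qed
qed

lemma whf_Stvl:
  assumes good: "good A a"
  shows "whf A a \<in> SS"
proof -
  let ?A = "insert (linv a) (A - {a})"
  have g: "fst a \<in> Y" "fst (linv a) \<in> Y" using goodD(3)[OF good] by simp_all
  have "a \<notin> A - {a}" "insert a (?A - {linv a}) = A" using goodD[OF good] by auto
  then have inv: "whf ?A (linv a) (wv A a u) = el u" if "u \<in> L" for u
    using whf_inverse[OF good_inv[OF good] that] by simp
  show ?thesis
    unfolding whf_def
    by (rule Stvl_subst[OF wv_image[OF g(1)] wv_image[OF g(2), of ?A]])
      (use whf_inverse[OF good] inv in \<open>simp_all add: whf_def L_iff\<close>)
qed

lemma Stvl_elt: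
  assumes "\<phi> \<in> SS" "fst l \<in> pverts \<Gamma>" "fst l \<notin> X"
  shows "\<phi> (el l) = el l"
proof (cases "l = (fst l, True)")
  case True
  then show ?thesis using StvlD(4)[OF assms] by metis
next
  case False
  then have "l = linv (fst l, True)" using letter_cases by blast
  then show ?thesis using hom_elt[OF StvlD(1)[OF assms(1)], of "(fst l, True)"]
      StvlD(4)[OF assms] elt_linv'[of "(fst l, True)"] assms(2) by simp
qed

text \<open>The exponent sum of \<open>fst u\<close> is invariant under the relations; it appears
  here as an action of the letters on the integers by translation.\<close>

lemma elt_inj:
  assumes u: "fst u \<in> pverts \<Gamma>" "fst v \<in> pverts \<Gamma>" and eq: "el u = el v"
  shows "u = v"
proof -
  define act' :: "'v letter \<Rightarrow> int \<Rightarrow> int" where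
    "act' l s = (if fst l = fst u then (if snd l then s + 1 else s - 1) else s)" for l s
  have "([u], [v]) \<in> pres_rel (pverts \<Gamma>) (raag_rels \<Gamma>)"
    using eq u by (simp add: elt_def pres_class_eq_iff)
  then have "foldr act' [u] 0 = foldr act' [v] 0"
    by (rule g.elt_eq_act[where M = UNIV, rotated 3]) (auto simp: act'_def linv_def)
  then show ?thesis by (auto simp: act'_def prod_eq_iff split: if_splits)
qed

lemma elt_ne_one: "fst u \<in> pverts \<Gamma> \<Longrightarrow> el u \<noteq> gone"
  using elt_inj[of u "linv u"] elt_linv'[of u] by auto

text \<open>If the vertices are not adjacent, no relation involves both. Letting them act as the
  transpositions (0 1) and (1 2), and all others trivially, therefore respects the relations, but
  the two transpositions do not commute.\<close>

lemma elt_commute_imp_lk: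
  assumes v: "v \<in> pverts \<Gamma>" "fst l \<in> pverts \<Gamma>" "v \<noteq> fst l"
    and eq: "gen \<Gamma> v \<star> el l = el l \<star> gen \<Gamma> v"
  shows "v \<in> lk \<Gamma> (fst l)"
proof (rule ccontr)
  assume n: "v \<notin> lk \<Gamma> (fst l)"
  then have n': "fst l \<notin> lk \<Gamma> v" using g.lk_sym by blast
  define act' :: "'v letter \<Rightarrow> nat \<Rightarrow> nat" where
    "act' k s = (if fst k = v then (if s = 0 then 1 else if s = 1 then 0 else s)
       else if fst k = fst l then (if s = 1 then 2 else if s = 2 then 1 else s) else s)" for k s
  have "([(v, True), l], [l, (v, True)]) \<in> pres_rel (pverts \<Gamma>) (raag_rels \<Gamma>)"
    using eq v by (simp add: raag_def elt_def mult_pres_class pres_class_eq_iff)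
  then have "foldr act' [(v, True), l] 0 = foldr act' [l, (v, True)] 0"
  proof (rule g.elt_eq_act[where M = UNIV, rotated 3])
    show "act' (y, True) (act' (z, True) s) = act' (z, True) (act' (y, True) s)"
      if "(y, z) \<in> parcs \<Gamma>" for y z s
      using that n n' g.lk_iff by (auto simp: act'_def)
  qed (use v in \<open>auto simp: act'_def\<close>)
  then show False using v(3) by (simp add: act'_def)
qed

lemma isolated_component:
  assumes v: "v \<in> W" and iso: "\<And>w. w \<in> W \<Longrightarrow> (v, w) \<notin> parcs \<Gamma>"
  shows "{v} \<in> pre_digraph.sccs_verts (induce_subgraph (with_proj \<Gamma>) W)"
proof -
  let ?D = "induce_subgraph (with_proj \<Gamma>) W"
  have no: "(v, w) \<notin> arcs_ends ?D" for w
    using iso by (auto simp: arcs_ends_conv induce_subgraph_def)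
  have r: "w = v" if "reachable ?D v w" for w
  proof -
    have "(v, w) \<in> rtrancl_on (verts ?D) (arcs_ends ?D)" using that by (simp add: reachable_def)
    then show ?thesis by (induction rule: rtrancl_on_induct) (use no in blast)+
  qed
  have s: "reachable ?D v v"
    unfolding reachable_def by (rule rtrancl_on.rtrancl_on_refl) (use v in \<open>simp add: induce_subgraph_def\<close>)
  show ?thesis unfolding pre_digraph.sccs_verts_def using r s by blast
qed

lemma lk_sub_st: "y \<in> X \<Longrightarrow> v \<in> Y \<Longrightarrow> lk \<Gamma> y \<subseteq> st \<Gamma> v"
  unfolding st_def using lk_Y[of _ v] X_lk[of y] g.lk_sym[of v] by blast

definition wC :: "'v letter set \<Rightarrow> 'v letter \<Rightarrow> 'v set" where
  "wC A a = {v. (v, True) \<in> A - {a} \<and> (v, False) \<in> A - {a}}"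

definition wT :: "'v letter set \<Rightarrow> 'v letter \<Rightarrow> 'v letter set" where
  "wT A a = {u \<in> A - {a}. linv u \<notin> A - {a}}"

lemma wC_sgn: "u \<in> sgn_set (wC A a) \<longleftrightarrow> u \<in> A - {a} \<and> linv u \<in> A - {a}"
proof -
  obtain v b where "u = (v, b)" by (cases u)
  then show ?thesis by (cases b) (auto simp: sgn_set_def wC_def linv_def)
qed

text \<open>The link of a vertex of \<open>[x]\<close> lies in the star of \<open>fst a\<close>, so
  the vertex is isolated once that star is removed, and every set of such vertices is a union of
  components.\<close>

lemma good_split:
  assumes good: "good A a" and ne: "A \<noteq> {a}"
  shows "wh_split \<Gamma> A a (wC A a) (wT A a) {}"
proof -
  note g = goodD[OF good]
  have AL: "A - {a} \<subseteq> L" using good by (simp add: good_def)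
  have CX: "wC A a \<subseteq> X" using AL by (auto simp: wC_def L_iff)
  have Cst: "wC A a \<subseteq> pverts \<Gamma> - st \<Gamma> (fst a)"
  proof
    fix v assume v: "v \<in> wC A a"
    then have "v \<noteq> fst a" using g(2) by (cases a; cases "snd a") (auto simp: wC_def)
    moreover have "v \<notin> lk \<Gamma> (fst a)" using lk_nX[of v "fst a"] g.lk_sym CX v g(3) by blast
    ultimately show "v \<in> pverts \<Gamma> - st \<Gamma> (fst a)" using v CX X_verts by (auto simp: st_def)
  qed
  have comp: "wC A a \<in> unions_of_components \<Gamma> (pverts \<Gamma> - st \<Gamma> (fst a))"
  proof -
    have "{v} \<in> pre_digraph.sccs_verts (induce_subgraph (with_proj \<Gamma>) (pverts \<Gamma> - st \<Gamma> (fst a)))"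
      if v: "v \<in> wC A a" for v
    proof (rule isolated_component)
      show "v \<in> pverts \<Gamma> - st \<Gamma> (fst a)" using v Cst by blast
      fix w assume w: "w \<in> pverts \<Gamma> - st \<Gamma> (fst a)"
      have "lk \<Gamma> v \<subseteq> st \<Gamma> (fst a)" using lk_sub_st[of v "fst a"] v CX g(3) by blast
      then have "w \<notin> lk \<Gamma> v" using w by blast
      then show "(v, w) \<notin> parcs \<Gamma>" using g.lk_iff by blast
    qed
    then have "(\<lambda>v. {v}) ` wC A a \<subseteq> pre_digraph.sccs_verts (induce_subgraph (with_proj \<Gamma>) (pverts \<Gamma> - st \<Gamma> (fst a)))"
      by blast
    moreover have "wC A a = \<Union> ((\<lambda>v. {v}) ` wC A a)" by blast
    ultimately show ?thesis unfolding unions_of_components_def by blast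
  qed
  have Al: "A \<subseteq> letters \<Gamma>"
  proof
    fix u assume u: "u \<in> A"
    have "u = a \<or> u \<in> L" using u AL by blast
    then have "fst u \<in> pverts \<Gamma>" using g(3) Y_verts X_verts unfolding L_iff by blast
    then show "u \<in> letters \<Gamma>" by (simp add: letters_def sgn_set_def mem_Times_iff)
  qed
  have dec: "A - {a} = sgn_set (wC A a) \<union> wT A a \<union> sgn_set {}"
  proof -
    have "A - {a} = sgn_set (wC A a) \<union> wT A a"
      unfolding set_eq_iff Un_iff wT_def mem_Collect_eq wC_sgn by blast
    then show ?thesis by (simp add: sgn_set_def)
  qed
  have T: "wT A a \<subseteq> letters \<Gamma> - {a, linv a}" unfolding wT_def using Al g(2) by blast
  have lkT: "lk \<Gamma> (fst t) \<subseteq> st \<Gamma> (fst a)" if "t \<in> wT A a" for t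
  proof -
    have "t \<in> L" using that AL unfolding wT_def by blast
    then show ?thesis using lk_sub_st[of "fst t" "fst a"] g(3) by (simp add: L_iff)
  qed
  have ne': "wC A a \<noteq> {} \<or> wT A a \<noteq> {}" using dec ne g(1) unfolding sgn_set_def by blast
  have d1: "sgn_set (wC A a) \<inter> wT A a = {}" "wT A a \<inter> linv ` wT A a = {}"
  proof -
    show "sgn_set (wC A a) \<inter> wT A a = {}" unfolding wT_def set_eq_iff Int_iff mem_Collect_eq wC_sgn by blast
    show "wT A a \<inter> linv ` wT A a = {}" unfolding wT_def by blast
  qed
  have emp: "sgn_set {} = {}" by (simp add: sgn_set_def)
  show ?thesis unfolding wh_split_def
    by (intro conjI ballI Al g(1,2) dec d1 Cst comp T lkT ne' empty_subsetI) (simp_all only: emp Int_empty_right)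
qed

lemma split_unique:
  assumes good: "good A a" and s: "wh_split \<Gamma> A a C T U"
  shows "C = wC A a" "T = wT A a"
proof -
  note g = goodD[OF good]
  have AL: "A - {a} \<subseteq> L" using good by (simp add: good_def)
  note s' = s[unfolded wh_split_def]
  have dec: "A - {a} = sgn_set C \<union> T \<union> sgn_set U" using s' by (elim conjE)
  have d: "sgn_set C \<inter> T = {}" "T \<inter> linv ` T = {}" proof -
    show "sgn_set C \<inter> T = {}" using s' by (elim conjE)
    show "T \<inter> linv ` T = {}" using s' by (elim conjE)
  qed
  have U: "U \<subseteq> lk \<Gamma> (fst a)" using s' by (elim conjE)
  \<comment> \<open>A vertex of \<open>U\<close> would lie in \<open>[x]\<close> and be adjacent to
    \<open>fst a\<close>, which lies in \<open>Y\<close>.\<close>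
  have "U = {}"
  proof (rule ccontr)
    assume "U \<noteq> {}"
    then obtain v where v: "v \<in> U" by blast
    then have "(v, True) \<in> L" using dec AL unfolding sgn_set_def by blast
    then have "v \<in> X" by (simp add: L_iff)
    then show False using lk_nX[of v "fst a"] g(3) U v g.lk_sym by blast
  qed
  then have dec: "A - {a} = sgn_set C \<union> T" using dec by (simp add: sgn_set_def)
  have Tl: "u \<in> T \<Longrightarrow> linv u \<notin> T" for u
    using d(2) imageI[of "linv u" T linv] by (metis IntI empty_iff linv_linv)
  have Cs: "u \<in> sgn_set C \<longleftrightarrow> u \<in> A - {a} \<and> linv u \<in> A - {a}" for u
  proof
    assume "u \<in> sgn_set C"
    then show "u \<in> A - {a} \<and> linv u \<in> A - {a}" using dec linv_sgn_set[of u C] by blast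
  next
    assume "u \<in> A - {a} \<and> linv u \<in> A - {a}"
    then show "u \<in> sgn_set C" using dec Tl[of u] linv_sgn_set[of u C] by blast
  qed
  show "C = wC A a"
  proof (rule Set.set_eqI)
    fix v show "v \<in> C \<longleftrightarrow> v \<in> wC A a"
      using Cs[of "(v, True)"] by (simp add: wC_def sgn_set_def linv_def)
  qed
  then show "T = wT A a"
    using dec d(1) Cs unfolding wT_def by blast
qed

lemma is_wh_whf:
  assumes good: "good A a" and ne: "A \<noteq> {a}"
  shows "is_wh \<Gamma> A a (whf A a)"
proof -
  note g = goodD[OF good]
  have AL: "A - {a} \<subseteq> L" using good by (simp add: good_def)
  have S: "whf A a \<in> SS" by (rule whf_Stvl[OF good])
  have neq: "fst u \<noteq> fst a" if "u \<in> A - {a}" for u using that g(2) fst_eq_linv[of u a] by auto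
  have c: "whf A a (gen \<Gamma> c) = el (linv a) \<star> gen \<Gamma> c \<star> el a" if "c \<in> wC A a" for c
  proof -
    have m: "(c, True) \<in> A - {a}" "linv (c, True) \<in> A - {a}" using that by (auto simp: wC_def linv_def)
    then have "(c, True) \<in> L" using AL by blast
    then show ?thesis
      using whf_elt[OF g(3), of "(c, True)"] m neq[OF m(1)] elt_linvY[OF g(3)] by (simp add: wv_def mA_def)
  qed
  have t: "whf A a (el t) = el t \<star> el a" if "t \<in> wT A a" for t
  proof -
    have m: "t \<in> A - {a}" "linv t \<notin> A - {a}" using that by (auto simp: wT_def)
    then have "linv t \<notin> A" using g(2) by (auto simp: linv_eq_iff)
    moreover have "t \<in> L" using AL m by blast
    ultimately show ?thesis
      using whf_elt[OF g(3), of t] m neq[OF m(1)] by (simp add: wv_def mA_def)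
  qed
  have o: "whf A a (gen \<Gamma> v) = gen \<Gamma> v"
    if v: "v \<in> pverts \<Gamma>" "v \<notin> wC A a" "(v, True) \<notin> wT A a \<union> linv ` wT A a" for v
  proof (cases "v \<in> X")
    case False
    then show ?thesis using StvlD(4)[OF S v(1)] by blast
  next
    case True
    then have vL: "(v, True) \<in> L" by (simp add: L_iff)
    have lv: "linv (v, True) = (v, False)" by (simp add: linv_def)
    have vF: "(v, False) \<notin> wT A a"
    proof
      assume "(v, False) \<in> wT A a"
      then have "linv (v, False) \<in> linv ` wT A a" by blast
      then show False using v(3) by (simp add: linv_def)
    qed
    have n: "(v, True) \<notin> A - {a}" "(v, False) \<notin> A - {a}"
      using v(2,3) vF lv by (auto simp: wC_def wT_def linv_def)
    show ?thesis
    proof (cases "fst a = v")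
      case False
      then have "(v, True) \<notin> A" "(v, False) \<notin> A" using n by auto
      then show ?thesis using whf_elt[OF g(3) vL] False vL lv by (simp add: wv_def mA_def)
    next
      case True
      then consider "a = (v, True)" | "a = linv (v, True)" using letter_cases[of a] by auto
      then show ?thesis
      proof cases
        case 1
        then show ?thesis using whf_self[OF good] by simp
      next
        case 2
        have "whf A a (el (linv a)) = ginv (whf A a (el a))"
          using hom_elt[OF whf_hom[OF g(3)], of a] g(3) Y_verts by blast
        then show ?thesis using 2 whf_self[OF good] elt_linvY[OF g(3)] by simp
      qed
    qed
  qed
  show ?thesis unfolding is_wh_def
    using Stvl_auto[OF S] good_split[OF good ne] c t o by blast
qed

lemma is_wh_unique:
  assumes good: "good A a" and \<phi>: "is_wh \<Gamma> A a \<phi>" and \<psi>: "is_wh \<Gamma> A a \<psi>"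
  shows "\<phi> = \<psi>"
proof -
  have D: "\<phi> \<in> auto (raag \<Gamma>) \<and>
    (\<forall>c\<in>wC A a. \<phi> (gen \<Gamma> c) = el (linv a) \<star> gen \<Gamma> c \<star> el a) \<and>
    (\<forall>t\<in>wT A a. \<phi> (el t) = el t \<star> el a) \<and>
    (\<forall>v\<in>pverts \<Gamma>. v \<notin> wC A a \<and> (v, True) \<notin> wT A a \<union> linv ` wT A a \<longrightarrow> \<phi> (gen \<Gamma> v) = gen \<Gamma> v)"
    if "is_wh \<Gamma> A a \<phi>" for \<phi>
    using that split_unique[OF good] unfolding is_wh_def by metis
  note P = D[OF \<phi>] and Q = D[OF \<psi>]
  have h: "\<phi> \<in> EH" "\<psi> \<in> EH"
    "\<phi> \<in> extensional (GC)" "\<psi> \<in> extensional (GC)"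
    using P Q by (auto simp: auto_def Bij_def)
  have eq: "\<phi> (gen \<Gamma> v) = \<psi> (gen \<Gamma> v)" if v: "v \<in> pverts \<Gamma>" for v
  proof (cases "(v, True) \<in> linv ` wT A a")
    case True
    then obtain t where t: "t \<in> wT A a" "(v, True) = linv t" by blast
    then have ft: "fst t \<in> pverts \<Gamma>" using v by (metis fst_conv fst_linv)
    have "\<phi> (el t) = \<psi> (el t)" using P Q t(1) by simp
    then have "\<phi> (el (linv t)) = \<psi> (el (linv t))" using hom_elt[OF h(1) ft] hom_elt[OF h(2) ft] by simp
    then show ?thesis using t(2) by simp
  next
    case False
    then show ?thesis using P Q v by (cases "v \<in> wC A a"; cases "(v, True) \<in> wT A a") simp_all
  qed
  show ?thesis
    by (rule extensionalityI[OF h(3,4)]) (rule g.raag_hom_eq[OF g.raag_group h(1,2) eq])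
qed

lemma wh_whf: "good A a \<Longrightarrow> A \<noteq> {a} \<Longrightarrow> wh \<Gamma> A a = whf A a"
  unfolding wh_def using is_wh_whf is_wh_unique by (intro the_equality) blast+

lemma sgn_iff: "u \<in> sgn_set W \<longleftrightarrow> fst u \<in> W"
  by (simp add: sgn_set_def mem_Times_iff)

lemma Omega2_iff: "Omega2 \<Gamma> x A a \<longleftrightarrow> good A a \<and> A \<noteq> {a}"
proof
  assume O: "Omega2 \<Gamma> x A a"
  then obtain C T U where s: "wh_split \<Gamma> A a C T U" unfolding Omega2_def wh_pair_def by blast
  note s' = s[unfolded wh_split_def]
  have 1: "a \<in> A" using s' by (elim conjE)
  have 2: "linv a \<notin> A" using s' by (elim conjE)
  have 3: "A - {a} = sgn_set C \<union> T \<union> sgn_set U" using s' by (elim conjE)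
  have 4: "C \<noteq> {} \<or> T \<noteq> {}" using s' by (elim conjE)
  have "sgn_set C = {} \<longleftrightarrow> C = {}" by (simp add: sgn_set_def)
  then have "A - {a} \<noteq> {}" unfolding 3 using 4 by (simp, metis)
  then have "A \<noteq> {a}" by (metis Diff_cancel)
  moreover have "good A a" unfolding good_def
    using conjunct1[OF conjunct2[OF O[unfolded Omega2_def]]] conjunct2[OF conjunct2[OF O[unfolded Omega2_def]]] 1 2
    by (simp add: sgn_iff)
  ultimately show "good A a \<and> A \<noteq> {a}" by blast
next
  assume g: "good A a \<and> A \<noteq> {a}"
  then have "wh_pair \<Gamma> A a" using good_split[of A a] unfolding wh_pair_def by blast
  moreover have "A - {a} \<subseteq> L" "fst a \<in> Y" using g unfolding good_def by blast+
  ultimately show "Omega2 \<Gamma> x A a"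
    unfolding Omega2_def Un_iff sgn_iff by blast
qed

lemma wh_Omega:
  assumes "good A a" "A \<noteq> {a}"
  shows "wh \<Gamma> A a \<in> Omega \<Gamma> x"
  unfolding Omega_def wh_whf[OF assms] using whf_Stvl[OF assms(1)] is_wh_whf[OF assms] by blast


section \<open>Type 1 automorphisms as signed permutations of the class\<close>

definition sperm :: "('v letter \<Rightarrow> 'v letter) \<Rightarrow> bool" where
  "sperm \<sigma> \<longleftrightarrow> bij_betw \<sigma> L L \<and> (\<forall>u\<in>L. \<sigma> (linv u) = linv (\<sigma> u))"

definition tau :: "('v letter \<Rightarrow> 'v letter) \<Rightarrow> 'v aut" where
  "tau \<sigma> = subst (\<lambda>y. el (\<sigma> (y, True)))"

lemma spermD:
  assumes "sperm \<sigma>"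
  shows "u \<in> L \<Longrightarrow> \<sigma> u \<in> L" "u \<in> L \<Longrightarrow> \<sigma> (linv u) = linv (\<sigma> u)"
    "u \<in> L \<Longrightarrow> v \<in> L \<Longrightarrow> \<sigma> u = \<sigma> v \<longleftrightarrow> u = v" "v \<in> L \<Longrightarrow> \<exists>u\<in>L. \<sigma> u = v"
proof -
  have s: "inj_on \<sigma> L" "\<sigma> ` L = L" "\<forall>u\<in>L. \<sigma> (linv u) = linv (\<sigma> u)"
    using assms unfolding sperm_def bij_betw_def by simp_all
  show "\<sigma> u \<in> L" if "u \<in> L" using imageI[OF that, of \<sigma>] s(2) by simp
  show "\<sigma> (linv u) = linv (\<sigma> u)" if "u \<in> L" using s(3) that by blast
  show "\<sigma> u = \<sigma> v \<longleftrightarrow> u = v" if "u \<in> L" "v \<in> L" using inj_on_eq_iff[OF s(1) that] .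
  show "\<exists>u\<in>L. \<sigma> u = v" if "v \<in> L"
  proof -
    have "v \<in> \<sigma> ` L" using that s(2) by simp
    then show ?thesis by blast
  qed
qed

lemma elt_linvL: "u \<in> L \<Longrightarrow> el (linv u) = ginv (el u)"
  using elt_linvY L_Y by blast

lemma tau_elt: "sperm \<sigma> \<Longrightarrow> u \<in> L \<Longrightarrow> tau \<sigma> (el u) = el (\<sigma> u)"
  unfolding tau_def
  by (rule subst_elt[of "\<lambda>u. el (\<sigma> u)"]) (simp_all add: elt_L_GY elt_linvL spermD(1,2))

lemma tau_image: "sperm \<sigma> \<Longrightarrow> (\<lambda>y. el (\<sigma> (y, True))) ` X \<subseteq> GY"
  unfolding image_subset_iff
proof
  fix y assume "sperm \<sigma>" "y \<in> X"
  then show "el (\<sigma> (y, True)) \<in> GY" using elt_L_GY[OF spermD(1)[of \<sigma> "(y, True)"]] by (simp add: L_iff)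
qed

lemma sperm_inv:
  assumes "sperm \<sigma>"
  shows "sperm (inv_into L \<sigma>)"
proof -
  have b: "bij_betw \<sigma> L L" using assms by (simp add: sperm_def)
  have "inv_into L \<sigma> (linv u) = linv (inv_into L \<sigma> u)" if u: "u \<in> L" for u
  proof -
    obtain v where v: "v \<in> L" "\<sigma> v = u" using spermD(4)[OF assms u] by blast
    then have "\<sigma> (linv v) = linv u" using spermD(2)[OF assms] by simp
    then have "inv_into L \<sigma> (linv u) = linv v"
      using bij_betw_inv_into_left[OF b, of "linv v"] v(1) by simp
    then show ?thesis using bij_betw_inv_into_left[OF b v(1)] v(2) by simp
  qed
  then show ?thesis unfolding sperm_def using bij_betw_inv_into[OF b] by blast
qed

lemma tau_Stvl:
  assumes "sperm \<sigma>"
  shows "tau \<sigma> \<in> SS"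
proof -
  have b: "bij_betw \<sigma> L L" using assms by (simp add: sperm_def)
  note i = sperm_inv[OF assms]
  have yL: "(y, True) \<in> L" if "y \<in> X" for y using that by (simp add: L_iff)
  show ?thesis
    unfolding tau_def
  proof (rule Stvl_subst[OF tau_image[OF assms] tau_image[OF i]])
    fix y assume y: "y \<in> X"
    show "subst (\<lambda>y. el (\<sigma> (y, True))) (el (inv_into L \<sigma> (y, True))) = gen \<Gamma> y"
      using tau_elt[OF assms spermD(1)[OF i yL[OF y]]] bij_betw_inv_into_right[OF b yL[OF y]]
      by (simp add: tau_def)
    show "subst (\<lambda>y. el (inv_into L \<sigma> (y, True))) (el (\<sigma> (y, True))) = gen \<Gamma> y"
      using tau_elt[OF i spermD(1)[OF assms yL[OF y]]] bij_betw_inv_into_left[OF b yL[OF y]]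
      by (simp add: tau_def)
  qed
qed

lemma letters_iff: "u \<in> letters \<Gamma> \<longleftrightarrow> fst u \<in> pverts \<Gamma>"
  by (simp add: letters_def sgn_iff)

lemma L_letters: "u \<in> L \<Longrightarrow> u \<in> letters \<Gamma>"
  unfolding letters_iff L_iff using X_verts by blast

lemma tau_other: "sperm \<sigma> \<Longrightarrow> u \<in> letters \<Gamma> \<Longrightarrow> u \<notin> L \<Longrightarrow> tau \<sigma> (el u) = el u"
  using Stvl_elt[OF tau_Stvl, of \<sigma> u] by (simp add: letters_iff L_iff)

lemma tau_type1:
  assumes "sperm \<sigma>"
  shows "type1 \<Gamma> (tau \<sigma>)"
proof -
  have "tau \<sigma> ` el ` letters \<Gamma> = el ` letters \<Gamma>"
  proof
    show "tau \<sigma> ` el ` letters \<Gamma> \<subseteq> el ` letters \<Gamma>"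
    proof
      fix p assume "p \<in> tau \<sigma> ` el ` letters \<Gamma>"
      then obtain u where u: "u \<in> letters \<Gamma>" "p = tau \<sigma> (el u)" by blast
      show "p \<in> el ` letters \<Gamma>"
      proof (cases "u \<in> L")
        case True
        then show ?thesis using u(2) tau_elt[OF assms, of u] L_letters[OF spermD(1)[OF assms, of u]] by simp
      next
        case False
        then show ?thesis using u tau_other[OF assms u(1)] by simp
      qed
    qed
    show "el ` letters \<Gamma> \<subseteq> tau \<sigma> ` el ` letters \<Gamma>"
    proof
      fix p assume "p \<in> el ` letters \<Gamma>"
      then obtain u where u: "u \<in> letters \<Gamma>" "p = el u" by blast
      show "p \<in> tau \<sigma> ` el ` letters \<Gamma>"
      proof (cases "u \<in> L")
        case True
        then obtain v where "v \<in> L" "\<sigma> v = u" using spermD(4)[OF assms] by blast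
        then have "p = tau \<sigma> (el v)" "v \<in> letters \<Gamma>" using tau_elt[OF assms, of v] u L_letters[of v] by simp_all
        then show ?thesis by blast
      next
        case False
        then have "p = tau \<sigma> (el u)" using tau_other[OF assms u(1)] u by simp
        then show ?thesis using u by blast
      qed
    qed
  qed
  then show ?thesis unfolding type1_def using Stvl_auto[OF tau_Stvl[OF assms]] by blast
qed

lemma tau_Omega1: "sperm \<sigma> \<Longrightarrow> tau \<sigma> \<in> Omega1 \<Gamma> x"
  unfolding Omega1_def Omega_def using tau_type1 tau_Stvl by blast

lemma Omega1_tau:
  assumes "\<phi> \<in> Omega1 \<Gamma> x"
  shows "\<exists>\<sigma>. sperm \<sigma> \<and> \<phi> = tau \<sigma>"
proof -
  have S: "\<phi> \<in> SS" and t: "\<phi> ` el ` letters \<Gamma> = el ` letters \<Gamma>"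
    using assms unfolding Omega1_def Omega_def type1_def by blast+
  have inj: "inj_on \<phi> (GC)" using StvlD(3)[OF S] by (simp add: bij_betw_def)
  have ex: "\<exists>m\<in>L. \<phi> (el u) = el m" if u: "u \<in> L" for u
  proof -
    have ul: "u \<in> letters \<Gamma>" using L_letters[OF u] .
    then have "\<phi> (el u) \<in> el ` letters \<Gamma>" using t by blast
    then obtain m where m: "m \<in> letters \<Gamma>" "\<phi> (el u) = el m" by blast
    \<comment> \<open>Letters outside \<open>L\<close> are fixed and so are already their own
      images.\<close>
    have "m \<in> L"
    proof (rule ccontr)
      assume "m \<notin> L"
      then have "\<phi> (el m) = \<phi> (el u)" using Stvl_elt[OF S, of m] m by (simp add: letters_iff L_iff)
      then have "el m = el u"
        using inj_onD[OF inj] elt_car[of m] elt_car[of u] m(1) ul by (simp add: letters_iff)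
      then have "m = u" using elt_inj[of m u] m(1) ul by (simp add: letters_iff)
      then show False using u \<open>m \<notin> L\<close> by simp
    qed
    then show ?thesis using m by blast
  qed
  then obtain \<sigma> where \<sigma>: "\<And>u. u \<in> L \<Longrightarrow> \<sigma> u \<in> L" "\<And>u. u \<in> L \<Longrightarrow> \<phi> (el u) = el (\<sigma> u)" by metis
  have Lv: "fst u \<in> pverts \<Gamma>" if "u \<in> L" for u using L_letters[OF that] by (simp add: letters_iff)
  have "inj_on \<sigma> L"
  proof (rule inj_onI)
    fix u v assume uv: "u \<in> L" "v \<in> L" "\<sigma> u = \<sigma> v"
    then have "\<phi> (el u) = \<phi> (el v)" using \<sigma>(2) by simp
    then have "el u = el v" using inj_onD[OF inj] elt_car[OF Lv] uv(1,2) by blast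
    then show "u = v" using elt_inj Lv uv by blast
  qed
  then have "bij_betw \<sigma> L L"
    using \<sigma>(1) finite_sgn_set[OF finX] by (simp add: bij_betw_def endo_inj_surj image_subset_iff)
  moreover have "\<sigma> (linv u) = linv (\<sigma> u)" if u: "u \<in> L" for u
  proof -
    have "el (\<sigma> (linv u)) = el (linv (\<sigma> u))"
      using hom_elt[OF StvlD(1)[OF S] Lv[OF u]] \<sigma>(2)[of "linv u"] \<sigma>(2)[OF u] u elt_linvL[OF \<sigma>(1)[OF u]]
      by simp
    then show ?thesis using elt_inj[of "\<sigma> (linv u)" "linv (\<sigma> u)"] Lv[OF \<sigma>(1)] Lv[OF \<sigma>(1)[OF u]] u by simp
  qed
  ultimately have sp: "sperm \<sigma>" by (simp add: sperm_def)
  then have "\<phi> = tau \<sigma>" using tau_elt \<sigma>(2) by (intro Stvl_elt_ext[OF S tau_Stvl]) simp_all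
  then show ?thesis using sp by blast
qed

lemma lact_tau:
  assumes "sperm \<sigma>" "u \<in> letters \<Gamma>"
  shows "lact \<Gamma> u (tau \<sigma>) = (if u \<in> L then \<sigma> u else u)"
proof -
  let ?m = "if u \<in> L then \<sigma> u else u"
  have m: "?m \<in> letters \<Gamma>" using assms(2) L_letters[OF spermD(1)[OF assms(1), of u]] by simp
  have e: "el ?m = tau \<sigma> (el u)" using tau_elt[OF assms(1), of u] tau_other[OF assms] by simp
  show ?thesis unfolding lact_def
  proof (rule the_equality)
    show "?m \<in> letters \<Gamma> \<and> el ?m = tau \<sigma> (el u)" using m e by blast
    fix v assume "v \<in> letters \<Gamma> \<and> el v = tau \<sigma> (el u)"
    then show "v = ?m" using elt_inj[of v ?m] m e unfolding letters_iff by metis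
  qed
qed

definition cyc :: "'v letter \<Rightarrow> 'v letter \<Rightarrow> 'v letter \<Rightarrow> 'v letter" where
  "cyc a b u = (if u = a then linv b else if u = linv b then linv a else if u = linv a then b
     else if u = b then a else u)"

lemma cyc_sperm:
  assumes "a \<in> L" "b \<in> L" "a \<noteq> b" "a \<noteq> linv b"
  shows "sperm (cyc a b)"
proof -
  have ne: "linv a \<noteq> b" using assms(4) by auto
  have inj: "u = v" if "cyc a b u = cyc a b v" for u v
    using that assms(3,4) ne unfolding cyc_def by (simp split: if_splits)
  have "inj_on (cyc a b) L" by (rule inj_onI) (rule inj)
  moreover have "cyc a b ` L \<subseteq> L" unfolding image_subset_iff cyc_def using assms(1,2) by simp
  ultimately have "bij_betw (cyc a b) L L"
    using finite_sgn_set[OF finX] by (simp add: bij_betw_def endo_inj_surj)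
  moreover have "cyc a b (linv u) = linv (cyc a b u)" for u
    unfolding cyc_def linv_eq_iff using assms(3,4) ne by simp
  ultimately show ?thesis by (simp add: sperm_def)
qed

lemma sigma_tau:
  assumes "a \<in> L" "b \<in> L" "a \<noteq> b" "a \<noteq> linv b"
  shows "sigma \<Gamma> a b = tau (cyc a b)"
proof -
  have ne: "linv a \<noteq> b" using assms(4) by auto
  note sp = cyc_sperm[OF assms]
  have c: "cyc a b a = linv b" "cyc a b (linv b) = linv a" "cyc a b (linv a) = b" "cyc a b b = a"
    using assms(3,4) ne by (simp_all add: cyc_def)
  have o: "tau (cyc a b) (el l) = el l" if "l \<in> letters \<Gamma> - {a, linv b, linv a, b}" for l
  proof (cases "l \<in> L")
    case True
    then show ?thesis using tau_elt[OF sp True] that by (simp add: cyc_def)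
  next
    case False
    then show ?thesis using tau_other[OF sp _ False] that by simp
  qed
  show ?thesis unfolding sigma_def
  proof (rule the_equality)
    show "type1 \<Gamma> (tau (cyc a b)) \<and> tau (cyc a b) (el a) = el (linv b) \<and>
      tau (cyc a b) (el (linv b)) = el (linv a) \<and> tau (cyc a b) (el (linv a)) = el b \<and>
      tau (cyc a b) (el b) = el a \<and>
      (\<forall>l\<in>letters \<Gamma> - {a, linv b, linv a, b}. tau (cyc a b) (el l) = el l)"
      using tau_type1[OF sp] tau_elt[OF sp] c assms(1,2) o by simp
    fix \<phi> assume \<phi>: "type1 \<Gamma> \<phi> \<and> \<phi> (el a) = el (linv b) \<and>
      \<phi> (el (linv b)) = el (linv a) \<and> \<phi> (el (linv a)) = el b \<and> \<phi> (el b) = el a \<and>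
      (\<forall>l\<in>letters \<Gamma> - {a, linv b, linv a, b}. \<phi> (el l) = el l)"
    have h: "\<phi> \<in> EH" "\<phi> \<in> extensional (GC)"
      using \<phi> by (simp_all add: type1_def auto_def Bij_def)
    have moved: "\<phi> (el l) = el (cyc a b l) \<and> l \<in> L" if l: "l \<in> {a, linv b, linv a, b}" for l
    proof -
      consider "l = a" | "l = linv b" | "l = linv a" | "l = b" using l by blast
      then show ?thesis by cases (use \<phi> c assms(1,2) in simp_all)
    qed
    note S = tau_Stvl[OF sp]
    show "\<phi> = tau (cyc a b)"
    proof (rule extensionalityI[OF h(2) StvlD(2)[OF S]])
      fix p assume p: "p \<in> GC"
      show "\<phi> p = tau (cyc a b) p"
      proof (rule g.raag_hom_eq[OF g.raag_group h(1) StvlD(1)[OF S] _ p])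
        fix v assume v: "v \<in> pverts \<Gamma>"
        show "\<phi> (gen \<Gamma> v) = tau (cyc a b) (gen \<Gamma> v)"
        proof (cases "(v, True) \<in> {a, linv b, linv a, b}")
          case True
          then have "\<phi> (el (v, True)) = el (cyc a b (v, True))" "(v, True) \<in> L"
            using moved by blast+
          then show ?thesis using tau_elt[OF sp, of "(v, True)"] by simp
        next
          case False
          then have "(v, True) \<in> letters \<Gamma> - {a, linv b, linv a, b}" using v by (simp add: letters_iff)
          then show ?thesis using \<phi> o by simp
        qed
      qed
    qed
  qed
qed


text \<open>The definition of Type 2 allows a nonempty \<open>U\<close> and an arbitrary multiplier.
  Dropping \<open>U\<close> leaves the automorphism unchanged. As all vertices outside
  \<open>[x]\<close> are fixed, while neither conjugation on \<open>C\<close> nor multiplication on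
  \<open>T\<close> by \<open>a\<close> can be trivial, both \<open>C\<close> and \<open>T\<close>
  lie over \<open>[x]\<close>; what remains is to place the multiplier.\<close>

lemma Omega_cases:
  assumes "\<phi> \<in> Omega \<Gamma> x"
  obtains "\<phi> \<in> Omega1 \<Gamma> x" | A a where "good A a" "A \<noteq> {a}" "\<phi> = wh \<Gamma> A a"
proof -
  have S: "\<phi> \<in> SS" using assms by (simp add: Omega_def)
  note hm = StvlD(1)[OF S]
  consider "type1 \<Gamma> \<phi>" | A a where "is_wh \<Gamma> A a \<phi>" using assms unfolding Omega_def by blast
  then show ?thesis
  proof cases
    case 1
    then show ?thesis using that(1) assms by (simp add: Omega1_def)
  next
    case (2 A a)
    then obtain C T U where s: "wh_split \<Gamma> A a C T U"
      and c: "\<And>c. c \<in> C \<Longrightarrow> \<phi> (gen \<Gamma> c) = el (linv a) \<star> gen \<Gamma> c \<star> el a"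
      and t: "\<And>t. t \<in> T \<Longrightarrow> \<phi> (el t) = el t \<star> el a"
      and o: "\<And>v. v \<in> pverts \<Gamma> \<Longrightarrow> v \<notin> C \<Longrightarrow> (v, True) \<notin> T \<union> linv ` T \<Longrightarrow> \<phi> (gen \<Gamma> v) = gen \<Gamma> v"
      unfolding is_wh_def by blast
    note s' = s[unfolded wh_split_def]
    have sp: "A \<subseteq> letters \<Gamma>" "a \<in> A" "linv a \<notin> A" "A - {a} = sgn_set C \<union> T \<union> sgn_set U"
      "C \<subseteq> pverts \<Gamma> - st \<Gamma> (fst a)" "C \<noteq> {} \<or> T \<noteq> {}"
    proof -
      show "A \<subseteq> letters \<Gamma>" using s' by (elim conjE)
      show "a \<in> A" using s' by (elim conjE)
      show "linv a \<notin> A" using s' by (elim conjE)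
      show "A - {a} = sgn_set C \<union> T \<union> sgn_set U" using s' by (elim conjE)
      show "C \<subseteq> pverts \<Gamma> - st \<Gamma> (fst a)" using s' by (elim conjE)
      show "C \<noteq> {} \<or> T \<noteq> {}" using s' by (elim conjE)
    qed
    have av: "fst a \<in> pverts \<Gamma>" using sp(1,2) letters_iff by blast
    have ac: "el a \<in> GC" using elt_car[OF av] .
    have Tv: "fst u \<in> pverts \<Gamma>" if "u \<in> T" for u using that sp(1,4) letters_iff by blast
    have conj: False if v: "v \<in> C" and e: "el (linv a) \<star> gen \<Gamma> v \<star> el a = gen \<Gamma> v" for v
    proof -
      have vv: "v \<in> pverts \<Gamma>" "v \<notin> st \<Gamma> (fst a)" using v sp(5) by auto
      have gv: "gen \<Gamma> v \<in> GC" using gen_car[OF vv(1)] .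
      have "el a \<star> (ginv (el a) \<star> gen \<Gamma> v \<star> el a) = el a \<star> gen \<Gamma> v"
        using e elt_linv'[OF av] by simp
      then have "gen \<Gamma> v \<star> el a = el a \<star> gen \<Gamma> v" using ac gv by (simp add: R.m_assoc)
      then have "v \<in> lk \<Gamma> (fst a)" using elt_commute_imp_lk[OF vv(1) av] vv(2) by (auto simp: st_def)
      then show False using vv(2) by (simp add: st_def)
    qed
    have mul: False if v: "u \<in> T" and e: "el u \<star> el a = el u" for u
      using e R.l_cancel_one[OF elt_car[OF Tv[OF v]] ac] elt_ne_one[OF av] by simp
    have CX: "C \<subseteq> X"
    proof
      fix v assume v: "v \<in> C"
      show "v \<in> X"
      proof (rule ccontr)
        assume "v \<notin> X"
        then have "\<phi> (gen \<Gamma> v) = gen \<Gamma> v" using StvlD(4)[OF S] v sp(5) by blast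
        then show False using conj[OF v] c[OF v] by simp
      qed
    qed
    have TL: "T \<subseteq> L"
    proof
      fix u assume u: "u \<in> T"
      show "u \<in> L"
      proof (rule ccontr)
        assume "u \<notin> L"
        then have "\<phi> (el u) = el u" using Stvl_elt[OF S Tv[OF u]] by (simp add: L_iff)
        then show False using mul[OF u] t[OF u] by simp
      qed
    qed
    have aY: "fst a \<in> Y"
    proof (rule ccontr)
      assume n: "fst a \<notin> Y"
      \<comment> \<open>The retraction onto \<open>GY\<close> that kills all other vertices. It
        fixes the images of \<open>[x]\<close>, which lie in \<open>GY\<close>, but would erase
        \<open>a\<close> from them.\<close>
      define f where "f v = (if v \<in> Y then gen \<Gamma> v else gone)" for v
      have rf: "raag_respecting \<Gamma> (raag \<Gamma>) f"
        unfolding raag_respecting_def f_def using g.raag_group gen_car g.gen_commute g.in_arcsD1 g.in_arcsD2 by auto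
      let ?r = "pres_lift (raag \<Gamma>) f"
      note rh = g.raag_lift_hom[OF rf]
      interpret r: group_hom "raag \<Gamma>" "raag \<Gamma>" ?r
        by (rule raag_gh[OF rh])
      have rY: "?r p = p" if "p \<in> GY" for p
        by (rule hom_fix_par[OF rh Y_verts _ that]) (use g.raag_lift_gen[OF rf] Y_verts in \<open>auto simp: f_def\<close>)
      have ra: "?r (el a) = gone"
        using g.raag_lift_gen[OF rf av] n r.hom_inv[OF gen_car[OF av]]
        by (rule_tac elt_sign_cases[OF av]) (metis f_def, metis f_def R.inv_one)
      have ral: "?r (el (linv a)) = gone" using hom_elt[OF rh av] ra by simp
      show False
      proof (cases "C = {}")
        case False
        then obtain v where v: "v \<in> C" by blast
        have vX: "v \<in> X" "v \<in> pverts \<Gamma>" using v CX X_verts by auto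
        have gY: "gen \<Gamma> v \<in> GY" using eltY[of "(v, True)"] vX by simp
        have "el (linv a) \<star> gen \<Gamma> v \<star> el a \<in> GY" using StvlD(5)[OF S vX(1)] c[OF v] by simp
        then have "el (linv a) \<star> gen \<Gamma> v \<star> el a = ?r (el (linv a) \<star> gen \<Gamma> v \<star> el a)"
          using rY by simp
        also have "\<dots> = gen \<Gamma> v"
          using ra ral rY[OF gY] elt_car[of "linv a"] av ac gen_car[OF vX(2)] by simp
        finally show False using conj[OF v] by simp
      next
        case True
        then obtain u where u: "u \<in> T" using sp(6) by blast
        have uL: "u \<in> L" using TL u by blast
        have "\<phi> (el u) \<in> GY" using Stvl_hom_GY[OF S elt_L_GY[OF uL]] .
        then have "el u \<star> el a = ?r (el u \<star> el a)" using rY t[OF u] by simp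
        also have "\<dots> = el u" using ra rY[OF elt_L_GY[OF uL]] ac uL by simp
        finally show False using mul[OF u] by simp
      qed
    qed
    define A' where "A' = insert a (sgn_set C \<union> T)"
    have anot: "a \<notin> sgn_set C \<union> T" using sp(4) by blast
    have A'sub: "A' \<subseteq> A" using sp(2,4) by (auto simp: A'_def)
    have diff: "A' - {a} = sgn_set C \<union> T" using anot by (auto simp: A'_def)
    have good: "good A' a"
      unfolding good_def diff using aY sp(3) A'sub CX TL by (auto simp: A'_def sgn_set_def)
    have ne: "A' \<noteq> {a}" using sp(6) diff by (auto simp: sgn_set_def)
    have s': "wh_split \<Gamma> A' a C T {}"
      using s A'sub sp(1,2,3) diff unfolding wh_split_def by (auto simp: sgn_set_def[of "{}"] A'_def)
    have "is_wh \<Gamma> A' a \<phi>"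
      unfolding is_wh_def using Stvl_auto[OF S] s' c t o by blast
    then have "\<phi> = wh \<Gamma> A' a" using is_wh_unique[OF good _ is_wh_whf[OF good ne]] wh_whf[OF good ne] by simp
    then show ?thesis using that(2) good ne by blast
  qed
qed

section \<open>The relations hold\<close>


lemma whf_eltY:
  assumes good: "good B b" and u: "fst u \<in> Y"
  shows "whf B b (el u) = wv B b u"
proof (cases "u \<in> L")
  case True
  then show ?thesis using whf_elt goodD(3)[OF good] by blast
next
  case False
  have S: "whf B b (el u) = el u"
    using Stvl_elt[OF whf_Stvl[OF good]] u False Y_verts unfolding L_iff by blast
  note g = goodD[OF good]
  consider "u = b" | "u = linv b" | "fst u \<noteq> fst b" using fst_eq_linv by blast
  then show ?thesis
  proof cases
    case 1
    then show ?thesis using S wv_self[OF good] by simp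
  next
    case 2
    then show ?thesis using S wv_linv[OF g(3,3)] wv_self[OF good] elt_linvY[OF g(3)] by simp
  next
    case 3
    have "u \<notin> B" using g(6)[of u] False 3 by blast
    moreover have "linv u \<notin> B" 
    proof -
      have "linv u \<noteq> b" using 3 by auto
      then show ?thesis using g(6)[of "linv u"] False linv_sgn_set[of u X] by blast
    qed
    ultimately show ?thesis using S 3 Y_car[OF u] by (simp add: wv_def mA_def)
  qed
qed

lemma whf_wv:
  assumes good: "good B b" and a: "fst a \<in> Y" and u: "fst u \<in> Y"
  shows "whf B b (wv A a u) = ginv (if linv u \<in> A then wv B b a else gone) \<star>
    (if fst u = fst a then gone else wv B b u) \<star> (if u \<in> A then wv B b a else gone)"
proof -
  interpret h: group_hom "raag \<Gamma>" "raag \<Gamma>" "whf B b"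
    by (rule raag_gh[OF whf_hom[OF goodD(3)[OF good]]])
  have m: "whf B b (mA A a v) = (if v \<in> A then wv B b a else gone)" for v
    using whf_eltY[OF good a] by (simp add: mA_def)
  show ?thesis
    unfolding wv_def[of A a u] using m[of u] m[of "linv u"] mA_car[OF a] Y_car[OF u] whf_eltY[OF good u] by simp
qed

lemma whf_linv:
  assumes good: "good B b" and a: "fst a \<in> Y" and u: "fst u \<in> Y"
  shows "whf B b (wv A a (linv u)) = ginv (whf B b (wv A a u))"
proof -
  interpret h: group_hom "raag \<Gamma>" "raag \<Gamma>" "whf B b"
    by (rule raag_gh[OF whf_hom[OF goodD(3)[OF good]]])
  show ?thesis using wv_linv[OF a u] h.hom_inv GY_car[OF wv_GY[OF a u]] by simp
qed

lemma SG_whf: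
  assumes "good A a" "good B b" "u \<in> L"
  shows "(whf A a \<otimes>\<^bsub>SG\<^esub> whf B b) (el u) = whf B b (wv A a u)"
  using SG_mult_apply[OF whf_Stvl[OF assms(1)] whf_Stvl[OF assms(2)] elt_L[OF assms(3)]]
    whf_elt[OF goodD(3)[OF assms(1)] assms(3)] by simp

text \<open>The letters over \<open>a\<close> and \<open>b\<close> are singled out because the
  middle factor of \<open>wv\<close> is trivial at the multiplier; values at their inverses follow
  by inversion.\<close>

lemma comm_rule:
  assumes A: "good A a" and B: "good B b" and C: "good C c"
    and 1: "whf B b (wv A a a) = whf C c (wv B b a)"
    and 2: "whf B b (wv A a b) = whf C c (wv B b b)"
    and 3: "\<And>u. u \<in> L \<Longrightarrow> fst u \<noteq> fst a \<Longrightarrow> fst u \<noteq> fst b \<Longrightarrow> whf B b (wv A a u) = whf C c (wv B b u)"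
  shows "whf A a \<otimes>\<^bsub>SG\<^esub> whf B b = whf B b \<otimes>\<^bsub>SG\<^esub> whf C c"
proof (rule Stvl_elt_ext)
  note S = whf_Stvl[OF A] whf_Stvl[OF B] whf_Stvl[OF C]
  show "whf A a \<otimes>\<^bsub>SG\<^esub> whf B b \<in> SS" "whf B b \<otimes>\<^bsub>SG\<^esub> whf C c \<in> SS"
    using SG_closed S by blast+
  note Y = goodD(3)[OF A] goodD(3)[OF B]
  fix u assume u: "u \<in> L"
  have "whf B b (wv A a u) = whf C c (wv B b u)"
  proof -
    consider "u = a" | "u = linv a" | "u = b" | "u = linv b" | "fst u \<noteq> fst a" "fst u \<noteq> fst b"
      using fst_eq_linv by blast
    then show ?thesis
    proof cases
      case 2
      then show ?thesis using 1 whf_linv[OF B Y(1,1)] whf_linv[OF C Y(2,1)] by simp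
    next
      case 4
      then show ?thesis using 2 whf_linv[OF B Y(1,2)] whf_linv[OF C Y(2,2)] by simp
    qed (use 1 2 3 u in simp_all)
  qed
  then show "(whf A a \<otimes>\<^bsub>SG\<^esub> whf B b) (el u) = (whf B b \<otimes>\<^bsub>SG\<^esub> whf C c) (el u)"
    using SG_whf[OF A B u] SG_whf[OF B C u] by simp
qed

lemma SG_inverse:
  assumes A: "good A a"
  shows "whf (insert (linv a) (A - {a})) (linv a) \<otimes>\<^bsub>SG\<^esub> whf A a = \<one>\<^bsub>SG\<^esub>"
proof (rule Stvl_elt_ext)
  note S = whf_Stvl[OF A] whf_Stvl[OF good_inv[OF A]]
  show "whf (insert (linv a) (A - {a})) (linv a) \<otimes>\<^bsub>SG\<^esub> whf A a \<in> SS" using SG_closed S by blast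
  show "\<one>\<^bsub>SG\<^esub> \<in> SS" using idS_Stvl SG_one by simp
  fix u assume u: "u \<in> L"
  show "(whf (insert (linv a) (A - {a})) (linv a) \<otimes>\<^bsub>SG\<^esub> whf A a) (el u) = \<one>\<^bsub>SG\<^esub> (el u)"
    using SG_whf[OF good_inv[OF A] A u] whf_inverse[OF A u] SG_one elt_L[OF u] by (simp add: idS_def)
qed

lemma good_join: "good A a \<Longrightarrow> good B a \<Longrightarrow> good (A \<union> B) a"
  unfolding good_def by blast

lemma SG_join:
  assumes A: "good A a" and B: "good B a" and i: "A \<inter> B = {a}"
  shows "whf A a \<otimes>\<^bsub>SG\<^esub> whf B a = whf (A \<union> B) a"
proof (rule Stvl_elt_ext)
  note S = whf_Stvl[OF A] whf_Stvl[OF B] and g = goodD[OF A] goodD[OF B]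
  show "whf A a \<otimes>\<^bsub>SG\<^esub> whf B a \<in> SS" using SG_closed S by blast
  show "whf (A \<union> B) a \<in> SS" using whf_Stvl[OF good_join[OF A B]] .
  fix u assume u: "u \<in> L"
  have Y: "fst u \<in> Y" using L_Y[OF u] .
  note c = Y_car[OF Y] Y_car[OF g(3)]
  have d: "v \<in> A \<Longrightarrow> v \<noteq> a \<Longrightarrow> v \<notin> B" for v using i by blast
  have "whf B a (wv A a u) = wv (A \<union> B) a u"
  proof (cases "fst u = fst a")
    case True
    then have "u = a \<or> u = linv a" using fst_eq_linv by blast
    then show ?thesis
    proof
      assume "u = a"
      then show ?thesis unfolding whf_wv[OF B g(3) Y] using g(1-5) g(7-11) wv_self[OF B] by (simp add: wv_def mA_def)
    next
      assume "u = linv a"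
      then show ?thesis unfolding whf_wv[OF B g(3) Y] using g(1-5) g(7-11) wv_self[OF B] by (simp add: wv_def mA_def)
    qed
  next
    case False
    then have ne: "u \<noteq> a" "linv u \<noteq> a" by auto
    show ?thesis
      unfolding whf_wv[OF B g(3) Y] wv_self[OF B] using d[of u] d[of "linv u"] ne False c
      by (cases "u \<in> A"; cases "linv u \<in> A"; cases "u \<in> B"; cases "linv u \<in> B")
        (simp_all add: wv_def mA_def R.m_assoc R.inv_mult_group)
  qed
  then show "(whf A a \<otimes>\<^bsub>SG\<^esub> whf B a) (el u) = whf (A \<union> B) a (el u)"
    using SG_whf[OF A B u] whf_elt[OF goodD(3)[OF good_join[OF A B]] u] by simp
qed

lemma SG_commute:
  assumes A: "good A a" and B: "good B b" and n: "linv a \<notin> B" "linv b \<notin> A" and i: "A \<inter> B = {}"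
  shows "whf A a \<otimes>\<^bsub>SG\<^esub> whf B b = whf B b \<otimes>\<^bsub>SG\<^esub> whf A a"
proof (rule comm_rule[OF A B A])
  note gA = goodD[OF A] and gB = goodD[OF B]
  note c = Y_car[OF gA(3)] Y_car[OF gB(3)]
  have d: "v \<in> A \<Longrightarrow> v \<notin> B" for v using i by blast
  have m: "a \<notin> B" "b \<notin> A" "a \<noteq> b" "a \<noteq> linv b" using d gA gB n by blast+
  then have f: "fst a \<noteq> fst b" "fst b \<noteq> fst a" using fst_eq_linv by metis+
  note W = whf_wv[OF B gA(3)] whf_wv[OF A gB(3)]
  show "whf B b (wv A a a) = whf A a (wv B b a)"
    unfolding W(1)[OF gA(3)] W(2)[OF gA(3)] using gA gB m n f c by (simp add: wv_def mA_def)
  show "whf B b (wv A a b) = whf A a (wv B b b)"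
    unfolding W(1)[OF gB(3)] W(2)[OF gB(3)] using gA gB m n f c by (simp add: wv_def mA_def)
  fix u assume u: "u \<in> L" "fst u \<noteq> fst a" "fst u \<noteq> fst b"
  show "whf B b (wv A a u) = whf A a (wv B b u)"
    unfolding W(1)[OF L_Y[OF u(1)]] W(2)[OF L_Y[OF u(1)]] using u m n f c d[of u] d[of "linv u"]
    by (cases "u \<in> A"; cases "linv u \<in> A"; cases "u \<in> B"; cases "linv u \<in> B")
      (simp_all add: wv_def mA_def R.m_assoc R.inv_mult_group)
qed

text \<open>Adjacent multipliers must both lie over \<open>a_out\<close>, since \<open>[x]\<close>
  is adjacent to nothing in \<open>Y\<close>. So neither occurs in the set of the other, and the two
  products differ only in the order of commuting multipliers.\<close>

lemma SG_commute_lk: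
  assumes A: "good A a" and B: "good B b" and l: "fst a \<in> lk \<Gamma> (fst b)"
  shows "whf A a \<otimes>\<^bsub>SG\<^esub> whf B b = whf B b \<otimes>\<^bsub>SG\<^esub> whf A a"
proof (rule comm_rule[OF A B A])
  note gA = goodD[OF A] and gB = goodD[OF B]
  note c = Y_car[OF gA(3)] Y_car[OF gB(3)]
  have l': "fst b \<in> lk \<Gamma> (fst a)" using l g.lk_sym by blast
  have nX: "fst a \<notin> X" "fst b \<notin> X" using lk_nX l l' gA(3) gB(3) by blast+
  have f: "fst a \<noteq> fst b" "fst b \<noteq> fst a" using l g.lk_irrefl by metis+
  then have ne: "a \<noteq> b" "linv a \<noteq> b" "b \<noteq> a" "linv b \<noteq> a" by auto
  have m: "a \<notin> B" "b \<notin> A" "linv a \<notin> B" "linv b \<notin> A"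
    using gA(6)[of b] gA(6)[of "linv b"] gB(6)[of a] gB(6)[of "linv a"] nX ne unfolding L_iff fst_linv by blast+
  have com: "el a \<star> el b = el b \<star> el a" using elt_commute[of a b] l' g.lk_iff by blast
  have com': "ginv (el a) \<star> (ginv (el b) \<star> p) = ginv (el b) \<star> (ginv (el a) \<star> p)"
    if "p \<in> GC" for p
  proof -
    have "ginv (el b \<star> el a) = ginv (el a \<star> el b)" using com by simp
    then show ?thesis using that c by (simp add: R.inv_mult_group flip: R.m_assoc)
  qed
  note W = whf_wv[OF B gA(3)] whf_wv[OF A gB(3)]
  show "whf B b (wv A a a) = whf A a (wv B b a)"
    unfolding W(1)[OF gA(3)] W(2)[OF gA(3)] using gA gB m f c by (simp add: wv_def mA_def)
  show "whf B b (wv A a b) = whf A a (wv B b b)"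
    unfolding W(1)[OF gB(3)] W(2)[OF gB(3)] using gA gB m f c by (simp add: wv_def mA_def)
  fix u assume u: "u \<in> L" "fst u \<noteq> fst a" "fst u \<noteq> fst b"
  note cu = Y_car[OF L_Y[OF u(1)]]
  show "whf B b (wv A a u) = whf A a (wv B b u)"
    unfolding W(1)[OF L_Y[OF u(1)]] W(2)[OF L_Y[OF u(1)]] using u m f c cu com com'[of "el u"] com'[of "el u \<star> el a"]
      com'[of "el u \<star> el b"] com'[of "el u \<star> (el b \<star> el a)"]
    by (cases "u \<in> A"; cases "linv u \<in> A"; cases "u \<in> B"; cases "linv u \<in> B")
      (simp_all add: wv_def mA_def R.m_assoc R.inv_mult_group)
qed

lemma SG_commute_sub:
  assumes A: "good A a" and B: "good B b" and n: "linv a \<in> B" "b \<notin> A" and i: "A \<subseteq> B"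
  shows "whf A a \<otimes>\<^bsub>SG\<^esub> whf B b = whf B b \<otimes>\<^bsub>SG\<^esub> whf A a"
proof (rule comm_rule[OF A B A])
  note gA = goodD[OF A] and gB = goodD[OF B]
  note c = Y_car[OF gA(3)] Y_car[OF gB(3)]
  have d: "v \<in> A \<Longrightarrow> v \<in> B" for v using i by blast
  have m: "a \<in> B" "linv b \<notin> A" "a \<noteq> b" "a \<noteq> linv b" using d gA gB n by blast+
  then have f: "fst a \<noteq> fst b" "fst b \<noteq> fst a" using fst_eq_linv by metis+
  note W = whf_wv[OF B gA(3)] whf_wv[OF A gB(3)]
  show "whf B b (wv A a a) = whf A a (wv B b a)"
    unfolding W(1)[OF gA(3)] W(2)[OF gA(3)] using gA gB m n f c by (simp add: wv_def mA_def R.m_assoc)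
  show "whf B b (wv A a b) = whf A a (wv B b b)"
    unfolding W(1)[OF gB(3)] W(2)[OF gB(3)] using gA gB m n f c by (simp add: wv_def mA_def R.m_assoc)
  fix u assume u: "u \<in> L" "fst u \<noteq> fst a" "fst u \<noteq> fst b"
  show "whf B b (wv A a u) = whf A a (wv B b u)"
    unfolding W(1)[OF L_Y[OF u(1)]] W(2)[OF L_Y[OF u(1)]] using u m n f c d[of u] d[of "linv u"]
    by (cases "u \<in> A"; cases "linv u \<in> A"; cases "u \<in> B"; cases "linv u \<in> B")
      (simp_all add: wv_def mA_def R.m_assoc R.inv_mult_group)
qed

lemma good_slide:
  assumes "good A a" "good B b" "linv a \<notin> B" "linv b \<in> A" "A \<inter> B = {}"
  shows "good (A \<union> B - {b}) a" "A \<union> B - {b} \<noteq> {a}"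
proof -
  note gA = goodD[OF assms(1)] and gB = goodD[OF assms(2)]
  have "a \<noteq> b" using gA(1) gB(1) assms(5) by blast
  moreover have "linv b \<noteq> a" using gB(1) assms(3) by (metis linv_linv)
  ultimately have ne: "a \<noteq> b" "linv b \<noteq> a" .
  show "good (A \<union> B - {b}) a" unfolding good_def using assms ne unfolding good_def by blast
  show "A \<union> B - {b} \<noteq> {a}" using ne assms(4) linv_neq(1)[of b] by blast
qed

lemma SG_slide:
  assumes A: "good A a" and B: "good B b" and n: "linv a \<notin> B" "linv b \<in> A" and i: "A \<inter> B = {}"
  shows "whf A a \<otimes>\<^bsub>SG\<^esub> whf B b = whf B b \<otimes>\<^bsub>SG\<^esub> whf (A \<union> B - {b}) a"
proof (rule comm_rule[OF A B good_slide(1)[OF assms]])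
  note gA = goodD[OF A] and gB = goodD[OF B] and gC = good_slide(1)[OF assms]
  note c = Y_car[OF gA(3)] Y_car[OF gB(3)]
  have d: "v \<in> A \<Longrightarrow> v \<notin> B" for v using i by blast
  have m: "a \<notin> B" "b \<notin> A" "a \<noteq> b" using d gA gB n by blast+
  have "linv b \<noteq> a" using gB(1) n(1) by (metis linv_linv)
  then have "a \<noteq> linv b" by blast
  then have f: "fst a \<noteq> fst b" "fst b \<noteq> fst a" using m fst_eq_linv by metis+
  note W = whf_wv[OF B gA(3)] whf_wv[OF gC gB(3)]
  show "whf B b (wv A a a) = whf (A \<union> B - {b}) a (wv B b a)"
    unfolding W(1)[OF gA(3)] W(2)[OF gA(3)] using gA gB m n f c by (simp add: wv_def mA_def R.m_assoc)
  show "whf B b (wv A a b) = whf (A \<union> B - {b}) a (wv B b b)"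
    unfolding W(1)[OF gB(3)] W(2)[OF gB(3)] using gA gB m n f c by (simp add: wv_def mA_def R.m_assoc)
  fix u assume u: "u \<in> L" "fst u \<noteq> fst a" "fst u \<noteq> fst b"
  then have "u \<noteq> b" "linv u \<noteq> b" by auto
  then show "whf B b (wv A a u) = whf (A \<union> B - {b}) a (wv B b u)"
    unfolding W(1)[OF L_Y[OF u(1)]] W(2)[OF L_Y[OF u(1)]] using u m n gB(1,2) f c d[of u] d[of "linv u"]
    by (cases "u \<in> A"; cases "linv u \<in> A"; cases "u \<in> B"; cases "linv u \<in> B")
      (simp_all add: wv_def mA_def R.m_assoc R.inv_mult_group)
qed

lemma good_slide':
  assumes "good A a" "good B b" "linv a \<in> B" "b \<in> A" "A \<subseteq> B"
  shows "good (insert (linv b) (B - A)) (linv a)" "insert (linv b) (B - A) \<noteq> {linv a}"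
proof -
  note gA = goodD[OF assms(1)] and gB = goodD[OF assms(2)]
  have ne: "a \<noteq> b" using gB(2) assms(3) by blast
  have "a \<noteq> linv b" using gA(1) gB(2) assms(5) by blast
  moreover have "b \<in> L" using gA(6)[OF assms(4)] ne by blast
  then have "linv b \<in> L" by simp
  moreover have "v \<in> L" if "v \<in> B" "v \<notin> A" for v using gB(6)[OF that(1)] that assms(4) by blast
  ultimately show "good (insert (linv b) (B - A)) (linv a)"
    unfolding good_def using gA(1-3) assms(3) by auto
  show "insert (linv b) (B - A) \<noteq> {linv a}" using ne by (metis insertI1 linv_inject singletonD)
qed

lemma SG_slide':
  assumes A: "good A a" and B: "good B b" and n: "linv a \<in> B" "b \<in> A" and i: "A \<subseteq> B"
  shows "whf A a \<otimes>\<^bsub>SG\<^esub> whf B b = whf B b \<otimes>\<^bsub>SG\<^esub> whf (insert (linv b) (B - A)) (linv a)"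
proof (rule comm_rule[OF A B good_slide'(1)[OF assms]])
  let ?C = "insert (linv b) (B - A)"
  note gA = goodD[OF A] and gB = goodD[OF B] and gC = good_slide'(1)[OF assms]
  note c = Y_car[OF gA(3)] Y_car[OF gB(3)]
  have d: "v \<in> A \<Longrightarrow> v \<in> B" for v using i by blast
  have m: "a \<in> B" "linv b \<notin> A" "a \<noteq> b" "a \<noteq> linv b" "linv a \<noteq> b" "linv b \<noteq> a"
    using d gA gB n by (metis linv_linv)+
  then have f: "fst a \<noteq> fst b" "fst b \<noteq> fst a" using fst_eq_linv by metis+
  note W = whf_wv[OF B gA(3)] whf_wv[OF gC gB(3)]
  note E = elt_linvY[OF gA(3)]
  show "whf B b (wv A a a) = whf ?C (linv a) (wv B b a)"
    unfolding W(1)[OF gA(3)] W(2)[OF gA(3)] using gA gB m n f c E by (simp add: wv_def mA_def R.m_assoc R.inv_mult_group)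
  show "whf B b (wv A a b) = whf ?C (linv a) (wv B b b)"
    unfolding W(1)[OF gB(3)] W(2)[OF gB(3)] using gA gB m n f c E by (simp add: wv_def mA_def R.m_assoc R.inv_mult_group)
  fix u assume u: "u \<in> L" "fst u \<noteq> fst a" "fst u \<noteq> fst b"
  then have "u \<noteq> linv b" "linv u \<noteq> linv b" by auto
  then show "whf B b (wv A a u) = whf ?C (linv a) (wv B b u)"
    unfolding W(1)[OF L_Y[OF u(1)]] W(2)[OF L_Y[OF u(1)]] using u m n gB(1,2) f c d[of u] d[of "linv u"] E
    by (cases "u \<in> A"; cases "linv u \<in> A"; cases "u \<in> B"; cases "linv u \<in> B")
      (simp_all add: wv_def mA_def R.m_assoc R.inv_mult_group)
qed

lemma good_exchange:
  assumes "good A a" "a \<in> L" "b \<in> L" "a \<noteq> b" "b \<in> A" "linv b \<notin> A"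
  shows "good (insert (linv a) (A - {a})) b" "insert (linv a) (A - {a}) \<noteq> {b}"
    "good (insert (linv b) (A - {b})) a" "insert (linv b) (A - {b}) \<noteq> {a}"
proof -
  have a: "a \<in> A" "linv a \<notin> A" "A - {a} \<subseteq> L" "fst b \<in> Y" "linv a \<in> L" "linv b \<in> L" "fst a \<in> Y"
    using assms(1-3) L_Y unfolding good_def linv_sgn_set by blast+
  show "good (insert (linv a) (A - {a})) b" unfolding good_def using a assms(4-6) by auto
  show "insert (linv a) (A - {a}) \<noteq> {b}" using a(2) assms(5) by blast
  show "good (insert (linv b) (A - {b})) a" unfolding good_def using a assms(2-6) by auto
  show "insert (linv b) (A - {b}) \<noteq> {a}" using a(1) assms(6) by blast
qed

lemma SG_exchange:
  assumes A: "good A a" and a: "a \<in> L" and b: "b \<in> L" and n: "a \<noteq> b" "b \<in> A" "linv b \<notin> A"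
  shows "whf A a \<otimes>\<^bsub>SG\<^esub> whf (insert (linv a) (A - {a})) b =
    tau (cyc a b) \<otimes>\<^bsub>SG\<^esub> whf (insert (linv b) (A - {b})) a"
proof (rule Stvl_elt_ext)
  let ?B = "insert (linv a) (A - {a})" and ?C = "insert (linv b) (A - {b})"
  note gA = goodD[OF A] and B = good_exchange(1)[OF assms] and C = good_exchange(3)[OF assms]
  have m: "a \<noteq> linv b" "linv a \<noteq> b" "linv b \<noteq> a" "b \<noteq> a" using gA n by blast+
  then have f: "fst a \<noteq> fst b" "fst b \<noteq> fst a" using n fst_eq_linv by metis+
  have sp: "sperm (cyc a b)" using cyc_sperm[OF a b n(1) m(1)] .
  show "whf A a \<otimes>\<^bsub>SG\<^esub> whf ?B b \<in> SS" using SG_closed whf_Stvl A B by blast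
  show "tau (cyc a b) \<otimes>\<^bsub>SG\<^esub> whf ?C a \<in> SS" using SG_closed whf_Stvl C tau_Stvl[OF sp] by blast
  fix u assume u: "u \<in> L"
  have r: "(tau (cyc a b) \<otimes>\<^bsub>SG\<^esub> whf ?C a) (el u) = wv ?C a (cyc a b u)"
    using SG_mult_apply[OF tau_Stvl[OF sp] whf_Stvl[OF C] elt_L[OF u]] tau_elt[OF sp u]
      whf_elt[OF goodD(3)[OF C] spermD(1)[OF sp u]] by simp
  note W = whf_wv[OF B gA(3)]
  note c = elt_L[OF a] elt_L[OF b] elt_L[OF u]
  note E = elt_linvL[OF a] elt_linvL[OF b]
  have "whf ?B b (wv A a u) = wv ?C a (cyc a b u)"
  proof -
    consider "u = a" | "u = linv a" | "u = b" | "u = linv b" | "fst u \<noteq> fst a" "fst u \<noteq> fst b"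
      using fst_eq_linv by blast
    then show ?thesis
    proof cases
      case 5
      then have "u \<noteq> a" "u \<noteq> b" "u \<noteq> linv a" "u \<noteq> linv b" "linv u \<noteq> a" "linv u \<noteq> b" by auto
      then show ?thesis unfolding W[OF L_Y[OF u]] using 5 c gA(1,2) m n f E
        by (cases "u \<in> A"; cases "linv u \<in> A") (simp_all add: wv_def mA_def cyc_def R.m_assoc R.inv_mult_group)
    qed (unfold W[OF L_Y[OF u]], use c gA(1,2) m n f E in \<open>simp_all add: wv_def mA_def cyc_def R.m_assoc R.inv_mult_group\<close>)
  qed
  then show "(whf A a \<otimes>\<^bsub>SG\<^esub> whf ?B b) (el u) = (tau (cyc a b) \<otimes>\<^bsub>SG\<^esub> whf ?C a) (el u)"
    using r SG_whf[OF A B u] by simp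
qed

text \<open>A signed permutation moves only letters over \<open>[x]\<close>, while the multiplier of
  a pair may lie over \<open>a_out\<close>; this is the induced permutation of all letters, see
  \<open>lact_hat\<close>.\<close>

definition hat :: "('v letter \<Rightarrow> 'v letter) \<Rightarrow> 'v letter \<Rightarrow> 'v letter" where
  "hat \<sigma> u = (if u \<in> L then \<sigma> u else u)"

lemma hat_L: "sperm \<sigma> \<Longrightarrow> hat \<sigma> u \<in> L \<longleftrightarrow> u \<in> L"
  unfolding hat_def using spermD(1)[of \<sigma> u] by simp

lemma hat_inj:
  assumes "sperm \<sigma>"
  shows "hat \<sigma> u = hat \<sigma> v \<longleftrightarrow> u = v"
proof
  assume eq: "hat \<sigma> u = hat \<sigma> v"
  have m: "u \<in> L \<longleftrightarrow> v \<in> L" using hat_L[OF assms, of u] unfolding eq hat_L[OF assms, of v] by (rule HOL.sym)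
  show "u = v"
  proof (cases "u \<in> L")
    case True
    then have v: "v \<in> L" using m by blast
    have "\<sigma> u = \<sigma> v" using eq unfolding hat_def if_P[OF True] if_P[OF v] .
    then show ?thesis using spermD(3)[OF assms True v] by blast
  next
    case False
    then have v: "v \<notin> L" using m by blast
    show ?thesis using eq unfolding hat_def if_not_P[OF False] if_not_P[OF v] .
  qed
next
  assume "u = v"
  then show "hat \<sigma> u = hat \<sigma> v" by (rule arg_cong)
qed

lemma hat_linv: "sperm \<sigma> \<Longrightarrow> hat \<sigma> (linv u) = linv (hat \<sigma> u)"
  unfolding hat_def using spermD(2)[of \<sigma> u] by simp

lemma hat_mem: "sperm \<sigma> \<Longrightarrow> hat \<sigma> u \<in> hat \<sigma> ` A \<longleftrightarrow> u \<in> A"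
  by (rule inj_image_mem_iff[OF injI]) (rule iffD1[OF hat_inj])

lemma hat_Y: "sperm \<sigma> \<Longrightarrow> fst u \<in> Y \<Longrightarrow> fst (hat \<sigma> u) \<in> Y"
  unfolding hat_def using L_Y[OF spermD(1)[of \<sigma> u]] by simp

lemma good_hat:
  assumes "sperm \<sigma>" "good A a"
  shows "good (hat \<sigma> ` A) (hat \<sigma> a)"
proof -
  note g = goodD[OF assms(2)]
  have "v \<in> L" if v: "v \<in> hat \<sigma> ` A - {hat \<sigma> a}" for v
  proof -
    obtain u where u: "u \<in> A" "v = hat \<sigma> u" using v by blast
    then have "u \<noteq> a" using v by blast
    then show ?thesis using g(6)[OF u(1)] hat_L[OF assms(1)] u(2) by blast
  qed
  moreover have "linv (hat \<sigma> a) \<notin> hat \<sigma> ` A" unfolding hat_linv[OF assms(1), symmetric] hat_mem[OF assms(1)] by (rule g(2))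
  ultimately show ?thesis
    unfolding good_def using hat_Y[OF assms(1) g(3)] g(1) by blast
qed

lemma SG_tau:
  assumes \<sigma>: "sperm \<sigma>" and A: "good A a"
  shows "whf A a \<otimes>\<^bsub>SG\<^esub> tau \<sigma> = tau \<sigma> \<otimes>\<^bsub>SG\<^esub> whf (hat \<sigma> ` A) (hat \<sigma> a)"
proof (rule Stvl_elt_ext)
  note g = goodD[OF A] and B = good_hat[OF \<sigma> A] and T = tau_Stvl[OF \<sigma>]
  interpret h: group_hom "raag \<Gamma>" "raag \<Gamma>" "tau \<sigma>"
    by (rule raag_gh[OF StvlD(1)[OF T]])
  show "whf A a \<otimes>\<^bsub>SG\<^esub> tau \<sigma> \<in> SS" using SG_closed whf_Stvl A T by blast
  show "tau \<sigma> \<otimes>\<^bsub>SG\<^esub> whf (hat \<sigma> ` A) (hat \<sigma> a) \<in> SS" using SG_closed whf_Stvl B T by blast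
  have th: "tau \<sigma> (el v) = el (hat \<sigma> v)" if v: "fst v \<in> Y" for v
  proof (cases "v \<in> L")
    case True
    then show ?thesis using tau_elt[OF \<sigma> True] by (simp add: hat_def)
  next
    case False
    moreover have "v \<in> letters \<Gamma>" unfolding letters_iff using v Y_verts by blast
    ultimately show ?thesis using tau_other[OF \<sigma> _ False] by (simp add: hat_def)
  qed
  fix u assume u: "u \<in> L"
  have hu: "hat \<sigma> u = \<sigma> u" using u by (simp add: hat_def)
  have m: "tau \<sigma> (mA A a v) = mA (hat \<sigma> ` A) (hat \<sigma> a) (hat \<sigma> v)" for v
    unfolding mA_def hat_mem[OF \<sigma>] using th[OF g(3)] by simp
  have f: "fst (hat \<sigma> u) = fst (hat \<sigma> a) \<longleftrightarrow> fst u = fst a"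
    unfolding fst_eq_linv hat_linv[OF \<sigma>, symmetric] hat_inj[OF \<sigma>] by blast
  have "tau \<sigma> (wv A a u) = wv (hat \<sigma> ` A) (hat \<sigma> a) (hat \<sigma> u)"
    unfolding wv_def f using m[of u] m[of "linv u"] mA_car[OF g(3)] elt_L[OF u] th[OF L_Y[OF u]] hat_linv[OF \<sigma>]
    by simp
  then show "(whf A a \<otimes>\<^bsub>SG\<^esub> tau \<sigma>) (el u) = (tau \<sigma> \<otimes>\<^bsub>SG\<^esub> whf (hat \<sigma> ` A) (hat \<sigma> a)) (el u)"
    using SG_mult_apply[OF whf_Stvl[OF A] T elt_L[OF u]] SG_mult_apply[OF T whf_Stvl[OF B] elt_L[OF u]]
      whf_elt[OF g(3) u] tau_elt[OF \<sigma> u] whf_elt[OF goodD(3)[OF B] spermD(1)[OF \<sigma> u]] hu by simp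
qed

section \<open>Soundness of the relations\<close>

abbreviation Om where "Om \<equiv> Omega \<Gamma> x"
abbreviation wd :: "'v letter set \<Rightarrow> 'v letter \<Rightarrow> bool" where "wd A a \<equiv> good A a \<and> A \<noteq> {a}"

lemma Om_Stvl: "\<phi> \<in> Om \<Longrightarrow> \<phi> \<in> SS"
  by (simp add: Omega_def)

lemma wh_Om: "wd A a \<Longrightarrow> wh \<Gamma> A a \<in> Om"
  using wh_Omega by blast

lemma tau_Om: "sperm \<sigma> \<Longrightarrow> tau \<sigma> \<in> Om"
  using tau_Omega1 by (simp add: Omega1_def)

lemma good_inv_wd:
  assumes "wd A a"
  shows "wd (insert (linv a) (A - {a})) (linv a)"
proof -
  have "good (insert (linv a) (A - {a})) (linv a)" using good_inv assms by blast
  moreover have "insert (linv a) (A - {a}) \<noteq> {linv a}" using assms unfolding good_def by blast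
  ultimately show ?thesis by blast
qed

lemma good_join_wd: "wd A a \<Longrightarrow> wd B a \<Longrightarrow> wd (A \<union> B) a"
  using good_join[of A a B] goodD(1)[of A a] by blast

lemma good_hat_wd:
  assumes \<sigma>: "sperm \<sigma>" and wd: "wd A a"
  shows "wd (hat \<sigma> ` A) (hat \<sigma> a)"
proof -
  have "a \<in> A" using goodD(1) wd by blast
  then obtain v where v: "v \<in> A" "v \<noteq> a" using wd by blast
  then have "hat \<sigma> v \<in> hat \<sigma> ` A" "hat \<sigma> v \<noteq> hat \<sigma> a" using hat_inj[OF \<sigma>] by blast+
  then show ?thesis using good_hat[OF \<sigma>, of A a] wd by blast
qed

lemma lact_hat: "sperm \<sigma> \<Longrightarrow> u \<in> letters \<Gamma> \<Longrightarrow> lact \<Gamma> u (tau \<sigma>) = hat \<sigma> u"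
  using lact_tau by (simp add: hat_def)

lemma good_letters:
  assumes "good A a" "u \<in> A"
  shows "u \<in> letters \<Gamma>"
proof (cases "u = a")
  case True
  then show ?thesis unfolding letters_iff using goodD(3)[OF assms(1)] Y_verts by blast
next
  case False
  then show ?thesis using goodD(6)[OF assms] L_letters by blast
qed

lemma lact_image:
  assumes "sperm \<sigma>" "good A a"
  shows "(\<lambda>l. lact \<Gamma> l (tau \<sigma>)) ` A = hat \<sigma> ` A" "lact \<Gamma> a (tau \<sigma>) = hat \<sigma> a"
  using lact_hat[OF assms(1) good_letters[OF assms(2)]] goodD(1)[OF assms(2)] by (simp_all cong: image_cong)

lemma sperm_comp:
  assumes "sperm \<sigma>" "sperm \<rho>"
  shows "sperm (\<lambda>u. \<rho> (\<sigma> u))"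
  unfolding sperm_def
proof
  show "bij_betw (\<lambda>u. \<rho> (\<sigma> u)) L L"
    using bij_betw_trans[of \<sigma> L L \<rho> L] assms by (simp add: sperm_def comp_def)
  show "\<forall>u\<in>L. \<rho> (\<sigma> (linv u)) = linv (\<rho> (\<sigma> u))"
    using spermD(1,2)[OF assms(1)] spermD(2)[OF assms(2)] by simp
qed

lemma tau_mult:
  assumes "sperm \<sigma>" "sperm \<rho>"
  shows "tau \<sigma> \<otimes>\<^bsub>SG\<^esub> tau \<rho> = tau (\<lambda>u. \<rho> (\<sigma> u))"
proof (rule Stvl_elt_ext)
  note T = tau_Stvl[OF assms(1)] tau_Stvl[OF assms(2)]
  show "tau \<sigma> \<otimes>\<^bsub>SG\<^esub> tau \<rho> \<in> SS" using SG_closed T by blast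
  show "tau (\<lambda>u. \<rho> (\<sigma> u)) \<in> SS" using tau_Stvl[OF sperm_comp[OF assms]] .
  fix u assume u: "u \<in> L"
  show "(tau \<sigma> \<otimes>\<^bsub>SG\<^esub> tau \<rho>) (el u) = tau (\<lambda>u. \<rho> (\<sigma> u)) (el u)"
    using SG_mult_apply[OF T elt_L[OF u]] tau_elt[OF assms(1) u] tau_elt[OF assms(2) spermD(1)[OF assms(1) u]]
      tau_elt[OF sperm_comp[OF assms] u] by simp
qed

lemma SG_tau_mult:
  assumes "\<phi> \<in> Omega1 \<Gamma> x" "\<psi> \<in> Omega1 \<Gamma> x"
  shows "\<phi> \<otimes>\<^bsub>SG\<^esub> \<psi> \<in> Om"
proof -
  obtain \<sigma> \<rho> where s: "sperm \<sigma>" "\<phi> = tau \<sigma>" "sperm \<rho>" "\<psi> = tau \<rho>"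
    using Omega1_tau assms by meson
  show ?thesis unfolding s(2,4) tau_mult[OF s(1,3)] by (rule tau_Om[OF sperm_comp[OF s(1,3)]])
qed

sublocale S: group SG
  by (rule SG_group)

lemma conj_word:
  assumes "\<phi> \<in> Om" "\<psi> \<in> Om" "\<chi> \<in> Om" "\<phi> \<otimes>\<^bsub>SG\<^esub> \<psi> = \<psi> \<otimes>\<^bsub>SG\<^esub> \<chi>"
  shows "[(\<psi>, False), (\<phi>, True), (\<psi>, True)] \<in> words Om \<and> [(\<chi>, True)] \<in> words Om \<and>
    wprod SG id [(\<psi>, False), (\<phi>, True), (\<psi>, True)] = wprod SG id [(\<chi>, True)]"
  using assms Om_Stvl by simp

lemma Rels_sound:
  assumes "(u, v) \<in> Rels \<Gamma> x"
  shows "u \<in> words Om \<and> v \<in> words Om \<and> wprod SG id u = wprod SG id v"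
proof -
  have eq: "wh \<Gamma> A a = whf A a" if "wd A a" for A a using wh_whf that by blast
  note wS = whf_Stvl
  from assms consider "(u, v) \<in> R1 \<Gamma> x" | "(u, v) \<in> R2 \<Gamma> x" | "(u, v) \<in> R3 \<Gamma> x" | "(u, v) \<in> R3s \<Gamma> x"
    | "(u, v) \<in> R4 \<Gamma> x" | "(u, v) \<in> R4s \<Gamma> x" | "(u, v) \<in> R5 \<Gamma> x" | "(u, v) \<in> R6 \<Gamma> x" | "(u, v) \<in> R7 \<Gamma> x"
    unfolding Rels_def by blast
  then show ?thesis
  proof cases
    case 1
    then obtain A a where A: "wd A a" and uv: "u = [(wh \<Gamma> A a, False)]"
      "v = [(wh \<Gamma> (insert (linv a) (A - {a})) (linv a), True)]"
      unfolding R1_def Omega2_iff by blast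
    note B = good_inv_wd[OF A]
    have S: "whf A a \<in> SS" "whf (insert (linv a) (A - {a})) (linv a) \<in> SS" using wS A B by blast+
    have "inv\<^bsub>SG\<^esub> (whf A a) = whf (insert (linv a) (A - {a})) (linv a)"
      using S.inv_equality[OF SG_inverse] A S by simp
    then show ?thesis unfolding uv using wh_Om[OF A] wh_Om[OF B] eq[OF A] eq[OF B] S by simp
  next
    case 2
    then obtain A B a where A: "wd A a" and B: "wd B a" and i: "A \<inter> B = {a}"
      and uv: "u = [(wh \<Gamma> A a, True), (wh \<Gamma> B a, True)]" "v = [(wh \<Gamma> (A \<union> B) a, True)]"
      unfolding R2_def Omega2_iff by blast
    note C = good_join_wd[OF A B]
    have S: "whf A a \<in> SS" "whf B a \<in> SS" "whf (A \<union> B) a \<in> SS" using wS A B C by blast+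
    have j: "whf A a \<otimes>\<^bsub>SG\<^esub> whf B a = whf (A \<union> B) a" using SG_join A B i by blast
    show ?thesis unfolding uv
      using wh_Om[OF A] wh_Om[OF B] wh_Om[OF C] eq[OF A] eq[OF B] eq[OF C] S j by simp
  next
    case 3
    then obtain A a B b where A: "wd A a" and B: "wd B b" and n: "linv a \<notin> B" "linv b \<notin> A"
      and i: "A \<inter> B = {} \<or> a \<in> sgn_set (lk \<Gamma> (fst b))"
      and uv: "u = [(wh \<Gamma> B b, False), (wh \<Gamma> A a, True), (wh \<Gamma> B b, True)]" "v = [(wh \<Gamma> A a, True)]"
      unfolding R3_def Omega2_iff by blast
    have "whf A a \<otimes>\<^bsub>SG\<^esub> whf B b = whf B b \<otimes>\<^bsub>SG\<^esub> whf A a"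
      using i SG_commute[of A a B b] SG_commute_lk[of A a B b] A B n unfolding sgn_iff by blast
    then show ?thesis unfolding uv
      using conj_word[OF wh_Om[OF A] wh_Om[OF B] wh_Om[OF A]] eq[OF A] eq[OF B] by simp
  next
    case 4
    then obtain A a B b where A: "wd A a" and B: "wd B b" and n: "linv a \<in> B" "b \<notin> A" and i: "A \<subseteq> B"
      and uv: "u = [(wh \<Gamma> B b, False), (wh \<Gamma> A a, True), (wh \<Gamma> B b, True)]" "v = [(wh \<Gamma> A a, True)]"
      unfolding R3s_def Omega2_iff by blast
    have "whf A a \<otimes>\<^bsub>SG\<^esub> whf B b = whf B b \<otimes>\<^bsub>SG\<^esub> whf A a"
      using i SG_commute_sub[of A a B b] A B n by blast
    then show ?thesis unfolding uv
      using conj_word[OF wh_Om[OF A] wh_Om[OF B] wh_Om[OF A]] eq[OF A] eq[OF B] by simp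
  next
    case 5
    then obtain A a B b where A: "wd A a" and B: "wd B b" and n: "linv a \<notin> B" "linv b \<in> A" and i: "A \<inter> B = {}"
      and uv: "u = [(wh \<Gamma> B b, False), (wh \<Gamma> A a, True), (wh \<Gamma> B b, True)]"
        "v = [(wh \<Gamma> (A \<union> B - {b}) a, True)]"
      unfolding R4_def Omega2_iff by blast
    have C: "wd (A \<union> B - {b}) a" using good_slide[OF _ _ n i] A B by blast
    have "whf A a \<otimes>\<^bsub>SG\<^esub> whf B b = whf B b \<otimes>\<^bsub>SG\<^esub> whf (A \<union> B - {b}) a"
      using i SG_slide[of A a B b] A B n by blast
    then show ?thesis unfolding uv
      using conj_word[OF wh_Om[OF A] wh_Om[OF B] wh_Om[OF C]] eq[OF A] eq[OF B] eq[OF C] by simp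
  next
    case 6
    then obtain A a B b where A: "wd A a" and B: "wd B b" and n: "linv a \<in> B" "b \<in> A" and i: "A \<subseteq> B"
      and uv: "u = [(wh \<Gamma> B b, False), (wh \<Gamma> A a, True), (wh \<Gamma> B b, True)]"
        "v = [(wh \<Gamma> (insert (linv b) (B - A)) (linv a), True)]"
      unfolding R4s_def Omega2_iff by blast
    have C: "wd (insert (linv b) (B - A)) (linv a)" using good_slide'[OF _ _ n i] A B by blast
    have "whf A a \<otimes>\<^bsub>SG\<^esub> whf B b = whf B b \<otimes>\<^bsub>SG\<^esub> whf (insert (linv b) (B - A)) (linv a)"
      using i SG_slide'[of A a B b] A B n by blast
    then show ?thesis unfolding uv
      using conj_word[OF wh_Om[OF A] wh_Om[OF B] wh_Om[OF C]] eq[OF A] eq[OF B] eq[OF C] by simp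
  next
    case 7
    then obtain A a b where A: "wd A a" and L: "a \<in> L" "b \<in> L" and n: "a \<noteq> b" "b \<in> A" "linv b \<notin> A"
      and uv: "u = [(wh \<Gamma> A a, True), (wh \<Gamma> (insert (linv a) (A - {a})) b, True)]"
        "v = [(sigma \<Gamma> a b, True), (wh \<Gamma> (insert (linv b) (A - {b})) a, True)]"
      unfolding R5_def Omega2_iff by blast
    have gA: "good A a" using A by blast
    have B: "wd (insert (linv a) (A - {a})) b" and C: "wd (insert (linv b) (A - {b})) a"
      using good_exchange[OF gA L n] by blast+
    have m: "a \<noteq> linv b" using n(3) goodD(1)[OF gA] by blast
    note sp = cyc_sperm[OF L n(1) m]
    have S: "whf A a \<in> SS" "whf (insert (linv a) (A - {a})) b \<in> SS"
      "whf (insert (linv b) (A - {b})) a \<in> SS" using wS A B C by blast+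
    show ?thesis unfolding uv sigma_tau[OF L n(1) m]
      using wh_Om[OF A] wh_Om[OF B] wh_Om[OF C] tau_Om[OF sp] eq[OF A] eq[OF B] eq[OF C] S
        SG_exchange[OF gA L n] tau_Stvl[OF sp] by simp
  next
    case 8
    then obtain A a \<phi> where A: "wd A a" and \<phi>: "\<phi> \<in> Omega1 \<Gamma> x"
      and uv: "u = [(\<phi>, False), (wh \<Gamma> A a, True), (\<phi>, True)]"
        "v = [(wh \<Gamma> ((\<lambda>l. lact \<Gamma> l \<phi>) ` A) (lact \<Gamma> a \<phi>), True)]"
      unfolding R6_def Omega2_iff by blast
    obtain \<sigma> where \<sigma>: "sperm \<sigma>" "\<phi> = tau \<sigma>" using Omega1_tau[OF \<phi>] by blast
    have gA: "good A a" using A by blast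
    note C = good_hat_wd[OF \<sigma>(1) A]
    show ?thesis unfolding uv \<sigma>(2) lact_image[OF \<sigma>(1) gA]
      using conj_word[OF wh_Om[OF A] tau_Om[OF \<sigma>(1)] wh_Om[OF C]] eq[OF A] eq[OF C] SG_tau[OF \<sigma>(1) gA] by simp
  next
    case 9
    then obtain \<phi> \<psi> where S: "\<phi> \<in> Omega1 \<Gamma> x" "\<psi> \<in> Omega1 \<Gamma> x"
      and uv: "u = [(\<phi>, True), (\<psi>, True)]" "v = [(\<phi> \<otimes>\<^bsub>aut_right (raag \<Gamma>)\<^esub> \<psi>, True)]"
      unfolding R7_def by blast
    have O: "\<phi> \<in> Om" "\<psi> \<in> Om" using S by (simp_all add: Omega1_def)
    have c: "\<phi> \<otimes>\<^bsub>SG\<^esub> \<psi> \<in> Om" using SG_tau_mult S by blast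
    show ?thesis unfolding uv SG_mult_eq[symmetric] using O c Om_Stvl by simp
  qed
qed

lemma pres_map_SG: "pres_map SG id Om (Rels \<Gamma> x)"
  unfolding pres_map_def using Rels_sound Om_Stvl SG_group by auto

end

section \<open>The presented group\<close>

lemma (in group) commute_mult:
  assumes "a \<in> carrier G" "b \<in> carrier G" "c \<in> carrier G" "a \<otimes> c = c \<otimes> a" "b \<otimes> c = c \<otimes> b"
  shows "a \<otimes> b \<otimes> c = c \<otimes> (a \<otimes> b)"
proof -
  have "a \<otimes> b \<otimes> c = a \<otimes> (c \<otimes> b)" using assms by (simp add: m_assoc)
  also have "\<dots> = c \<otimes> a \<otimes> b" using assms by (simp flip: m_assoc)
  finally show ?thesis using assms by (simp add: m_assoc)
qed

context raag_class
begin

abbreviation PG where "PG \<equiv> pres_group Om (Rels \<Gamma> x)"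
abbreviation pm (infixl "\<bullet>" 70) where "a \<bullet> b \<equiv> a \<otimes>\<^bsub>PG\<^esub> b"
abbreviation pone where "pone \<equiv> \<one>\<^bsub>PG\<^esub>"
abbreviation pinv where "pinv a \<equiv> inv\<^bsub>PG\<^esub> a"
abbreviation q where "q \<phi> \<equiv> pres_class Om (Rels \<Gamma> x) [(\<phi>, True)]"

sublocale Pg: group PG
  by (rule group_pres_group)

lemma q_car [simp]: "\<phi> \<in> Om \<Longrightarrow> q \<phi> \<in> carrier PG"
  by (rule pres_class_carrier) simp

lemma rel_class: "(u, v) \<in> Rels \<Gamma> x \<Longrightarrow> pres_class Om (Rels \<Gamma> x) u = pres_class Om (Rels \<Gamma> x) v"
  using Rels_sound[of u v] pres_rel.relation[of u v "Rels \<Gamma> x" Om] by (simp add: pres_class_eq_iff)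

lemma q_neg: "\<phi> \<in> Om \<Longrightarrow> pres_class Om (Rels \<Gamma> x) [(\<phi>, False)] = pinv (q \<phi>)"
  using pres_class_linv[of "(\<phi>, True)" Om "Rels \<Gamma> x"] by (simp add: linv_def)

lemma q_pair: "\<phi> \<in> Om \<Longrightarrow> \<psi> \<in> Om \<Longrightarrow> pres_class Om (Rels \<Gamma> x) [(\<phi>, True), (\<psi>, True)] = q \<phi> \<bullet> q \<psi>"
  by (simp add: mult_pres_class)

lemma q_conj:
  assumes "\<phi> \<in> Om" "\<psi> \<in> Om" "\<chi> \<in> Om"
    and r: "([(\<psi>, False), (\<phi>, True), (\<psi>, True)], [(\<chi>, True)]) \<in> Rels \<Gamma> x"
  shows "q \<phi> \<bullet> q \<psi> = q \<psi> \<bullet> q \<chi>"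
proof -
  have "q \<chi> = pres_class Om (Rels \<Gamma> x) [(\<psi>, False)] \<bullet> pres_class Om (Rels \<Gamma> x) [(\<phi>, True), (\<psi>, True)]"
    using rel_class[OF r] assms by (simp add: mult_pres_class)
  then have "q \<chi> = pinv (q \<psi>) \<bullet> (q \<phi> \<bullet> q \<psi>)" using q_neg q_pair assms by simp
  then show ?thesis using assms q_car by simp
qed

text \<open>The relations speak of pairs with an element besides the multiplier; the value 1 at
  \<open>{a}\<close> extends their consequences to all \<open>good\<close> pairs.\<close>

definition W :: "'v letter set \<Rightarrow> 'v letter \<Rightarrow> 'v aut word set" where
  "W A a = (if A = {a} then pone else q (wh \<Gamma> A a))"

lemma W_car [simp]: "good A a \<Longrightarrow> W A a \<in> carrier PG"
  using wh_Om[of A a] by (simp add: W_def)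

lemma W_single [simp]: "W {a} a = pone"
  by (simp add: W_def)

lemma W_q: "A \<noteq> {a} \<Longrightarrow> W A a = q (wh \<Gamma> A a)"
  by (simp add: W_def)

lemma W_inv:
  assumes "good A a"
  shows "pinv (W A a) = W (insert (linv a) (A - {a})) (linv a)"
proof (cases "A = {a}")
  case True
  then show ?thesis by (simp add: W_def)
next
  case False
  then have wd: "wd A a" using assms by blast
  note wd' = good_inv_wd[OF wd]
  have "([(wh \<Gamma> A a, False)], [(wh \<Gamma> (insert (linv a) (A - {a})) (linv a), True)]) \<in> Rels \<Gamma> x"
    unfolding Rels_def R1_def Omega2_iff using wd by blast
  then show ?thesis using rel_class q_neg[OF wh_Om[OF wd]] W_q[OF False] W_q[OF conjunct2[OF wd']] by metis
qed

lemma W_join: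
  assumes A: "good A a" and B: "good B a" and i: "A \<inter> B = {a}"
  shows "W A a \<bullet> W B a = W (A \<union> B) a"
proof -
  have aA: "a \<in> A" "a \<in> B" using goodD(1) A B by blast+
  show ?thesis
  proof (cases "A = {a} \<or> B = {a}")
    case True
    then show ?thesis
    proof
      assume e: "A = {a}"
      then have "A \<union> B = B" using aA by blast
      then show ?thesis using e W_car[OF B] by simp
    next
      assume e: "B = {a}"
      then have "A \<union> B = A" using aA by blast
      then show ?thesis using e W_car[OF A] by simp
    qed
  next
    case False
    then have wd: "wd A a" "wd B a" using A B by blast+
    note wd' = good_join_wd[OF wd]
    have "([(wh \<Gamma> A a, True), (wh \<Gamma> B a, True)], [(wh \<Gamma> (A \<union> B) a, True)]) \<in> Rels \<Gamma> x"
      unfolding Rels_def R2_def Omega2_iff using wd i by blast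
    from rel_class[OF this] show ?thesis
      using q_pair[OF wh_Om[OF wd(1)] wh_Om[OF wd(2)]] wd wd' by (simp add: W_q)
  qed
qed

lemma W_conj:
  assumes "wd A a" "wd B b" "wd C c"
    and "([(wh \<Gamma> B b, False), (wh \<Gamma> A a, True), (wh \<Gamma> B b, True)], [(wh \<Gamma> C c, True)]) \<in> Rels \<Gamma> x"
  shows "W A a \<bullet> W B b = W B b \<bullet> W C c"
  using q_conj[OF wh_Om[OF assms(1)] wh_Om[OF assms(2)] wh_Om[OF assms(3)] assms(4)] assms(1-3)
  by (simp add: W_q)

lemma W_commute:
  assumes A: "good A a" and B: "good B b" and n: "linv a \<notin> B" "linv b \<notin> A"
    and i: "A \<inter> B = {} \<or> fst a \<in> lk \<Gamma> (fst b)"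
  shows "W A a \<bullet> W B b = W B b \<bullet> W A a"
proof (cases "A = {a} \<or> B = {b}")
  case True
  then show ?thesis using W_car[OF A] W_car[OF B] by (elim disjE) simp_all
next
  case False
  then have wd: "wd A a" "wd B b" using A B by blast+
  show ?thesis
    by (rule W_conj[OF wd wd(1)]) (unfold Rels_def R3_def Omega2_iff sgn_iff, use wd n i in blast)
qed

lemma W_commute_sub:
  assumes A: "good A a" and B: "good B b" and n: "linv a \<in> B" "b \<notin> A" and i: "A \<subseteq> B"
  shows "W A a \<bullet> W B b = W B b \<bullet> W A a"
proof (cases "A = {a} \<or> B = {b}")
  case True
  then show ?thesis using W_car[OF A] W_car[OF B] by (elim disjE) simp_all
next
  case False
  then have wd: "wd A a" "wd B b" using A B by blast+
  show ?thesis
    by (rule W_conj[OF wd wd(1)]) (unfold Rels_def R3s_def Omega2_iff, use wd n i in blast)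
qed

lemma W_slide:
  assumes A: "good A a" and B: "good B b" and n: "linv a \<notin> B" "linv b \<in> A" and i: "A \<inter> B = {}"
  shows "W A a \<bullet> W B b = W B b \<bullet> W (A \<union> B - {b}) a"
proof (cases "B = {b}")
  case True
  then have "A \<union> B - {b} = A" using i by blast
  then show ?thesis using True W_car[OF A] by simp
next
  case False
  note C = good_slide[OF A B n i]
  have "linv b \<noteq> a"
  proof
    assume "linv b = a"
    then have "linv a = b" by auto
    then show False using n(1) goodD(1)[OF B] by simp
  qed
  then have "A \<noteq> {a}" using n(2) by blast
  then have wd: "wd A a" "wd B b" "wd (A \<union> B - {b}) a" using A B C False by blast+
  show ?thesis
    by (rule W_conj[OF wd]) (unfold Rels_def R4_def Omega2_iff, use wd n i in blast)
qed

lemma W_slide':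
  assumes A: "good A a" and B: "good B b" and n: "linv a \<in> B" "b \<in> A" and i: "A \<subseteq> B"
  shows "W A a \<bullet> W B b = W B b \<bullet> W (insert (linv b) (B - A)) (linv a)"
proof -
  note C = good_slide'[OF A B n i]
  have ne: "a \<noteq> b" using goodD(2)[OF B] n(1) by blast
  then have "A \<noteq> {a}" "B \<noteq> {b}" using n(2) goodD(1)[OF A] i by blast+
  then have wd: "wd A a" "wd B b" "wd (insert (linv b) (B - A)) (linv a)" using A B C by blast+
  show ?thesis
    by (rule W_conj[OF wd]) (unfold Rels_def R4s_def Omega2_iff, use wd n i in blast)
qed

lemma W_exchange:
  assumes A: "good A a" and L: "a \<in> L" "b \<in> L" and n: "a \<noteq> b" "b \<in> A" "linv b \<notin> A"
  shows "W A a \<bullet> W (insert (linv a) (A - {a})) b = q (tau (cyc a b)) \<bullet> W (insert (linv b) (A - {b})) a"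
proof -
  note E = good_exchange[OF A L n]
  have m: "a \<noteq> linv b" using n(3) goodD(1)[OF A] by blast
  have wd: "wd A a" using A n by blast
  have wd': "wd (insert (linv a) (A - {a})) b" "wd (insert (linv b) (A - {b})) a" using E by blast+
  have "([(wh \<Gamma> A a, True), (wh \<Gamma> (insert (linv a) (A - {a})) b, True)],
      [(sigma \<Gamma> a b, True), (wh \<Gamma> (insert (linv b) (A - {b})) a, True)]) \<in> Rels \<Gamma> x"
    unfolding Rels_def R5_def Omega2_iff using wd L n by blast
  from rel_class[OF this] show ?thesis
    using q_pair[OF wh_Om[OF wd] wh_Om[OF wd'(1)]] q_pair[OF tau_Om[OF cyc_sperm[OF L n(1) m]] wh_Om[OF wd'(2)]]
      sigma_tau[OF L n(1) m] W_q[OF conjunct2[OF wd]] W_q[OF conjunct2[OF wd'(1)]] W_q[OF conjunct2[OF wd'(2)]]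
    by simp
qed

lemma W_tau:
  assumes \<sigma>: "sperm \<sigma>" and A: "good A a"
  shows "W A a \<bullet> q (tau \<sigma>) = q (tau \<sigma>) \<bullet> W (hat \<sigma> ` A) (hat \<sigma> a)"
proof (cases "A = {a}")
  case True
  then show ?thesis using tau_Om[OF \<sigma>] by (simp add: W_def)
next
  case False
  then have wd: "wd A a" using A by blast
  note wd' = good_hat_wd[OF \<sigma> wd]
  have "([(tau \<sigma>, False), (wh \<Gamma> A a, True), (tau \<sigma>, True)],
      [(wh \<Gamma> ((\<lambda>l. lact \<Gamma> l (tau \<sigma>)) ` A) (lact \<Gamma> a (tau \<sigma>)), True)]) \<in> Rels \<Gamma> x"
    unfolding Rels_def R6_def Omega2_iff using wd tau_Omega1[OF \<sigma>] by blast
  then show ?thesis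
    using q_conj[OF wh_Om[OF wd] tau_Om[OF \<sigma>] wh_Om[OF wd']] lact_image[OF \<sigma> A]
      W_q[OF False] W_q[OF conjunct2[OF wd']] by simp
qed

lemma q_tau_mult:
  assumes "sperm \<sigma>" "sperm \<rho>"
  shows "q (tau \<sigma>) \<bullet> q (tau \<rho>) = q (tau (\<lambda>u. \<rho> (\<sigma> u)))"
proof -
  have "([(tau \<sigma>, True), (tau \<rho>, True)], [(tau \<sigma> \<otimes>\<^bsub>aut_right (raag \<Gamma>)\<^esub> tau \<rho>, True)]) \<in> Rels \<Gamma> x"
    unfolding Rels_def R7_def using tau_Omega1 assms by blast
  from rel_class[OF this] show ?thesis
    using q_pair tau_Om assms tau_mult[OF assms] SG_mult_eq by metis
qed

lemma sperm_id: "sperm (\<lambda>u. u)"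
  by (simp add: sperm_def bij_betw_def)

text \<open>The multiplication table makes this element idempotent, hence trivial in a
  group.\<close>

lemma q_tau_id: "q (tau (\<lambda>u. u)) = pone"
  using q_tau_mult[OF sperm_id sperm_id] q_car[OF tau_Om[OF sperm_id]] Pg.l_cancel_one by metis

lemma tau_cong:
  assumes "sperm \<sigma>" "sperm \<rho>" "\<And>u. u \<in> L \<Longrightarrow> \<sigma> u = \<rho> u"
  shows "tau \<sigma> = tau \<rho>"
proof (rule Stvl_elt_ext[OF tau_Stvl[OF assms(1)] tau_Stvl[OF assms(2)]])
  fix u assume u: "u \<in> L"
  show "tau \<sigma> (el u) = tau \<rho> (el u)"
    unfolding tau_elt[OF assms(1) u] tau_elt[OF assms(2) u] assms(3)[OF u] by (rule HOL.refl)
qed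

section \<open>Pairs with multiplier in \<open>a_out\<close> and the twists they generate\<close>

lemma XO_ne: "u \<in> L \<Longrightarrow> fst b \<in> aout \<Longrightarrow> fst u \<noteq> fst b"
  unfolding L_iff using X_O by (metis IntI empty_iff)

lemma XO_ne':
  assumes "u \<in> L" "fst b \<in> aout"
  shows "u \<noteq> b" "u \<noteq> linv b" "linv u \<noteq> b" "linv u \<noteq> linv b" "b \<noteq> u" "linv b \<noteq> u"
  using XO_ne[OF assms] by auto

lemma aout_notin_L: "fst b \<in> aout \<Longrightarrow> b \<notin> L" "fst b \<in> aout \<Longrightarrow> linv b \<notin> L"
  unfolding L_iff fst_linv using X_O by blast+

lemma good_level:
  assumes "D \<subseteq> L" "fst b \<in> aout"
  shows "good (insert b D) b"
  unfolding good_def using assms aout_notin_L[of b] by auto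

lemma good_level1: "y \<in> L \<Longrightarrow> fst b \<in> aout \<Longrightarrow> good {y, b} b"
  using good_level[of "{y}" b] by (simp add: insert_commute)

lemma level_commute_same:
  assumes "y \<in> L" "z \<in> L" "y \<noteq> z" "fst b \<in> aout"
  shows "W {y, b} b \<bullet> W {z, b} b = W {z, b} b \<bullet> W {y, b} b"
proof -
  have i: "{y, b} \<inter> {z, b} = {b}" "{z, b} \<inter> {y, b} = {b}"
    using XO_ne'[OF assms(1,4)] XO_ne'[OF assms(2,4)] assms(3) by blast+
  show ?thesis
    unfolding W_join[OF good_level1[OF assms(1,4)] good_level1[OF assms(2,4)] i(1)]
      W_join[OF good_level1[OF assms(2,4)] good_level1[OF assms(1,4)] i(2)] by (simp add: Un_commute)
qed

lemma level_inv:
  assumes "y \<in> L" "fst b \<in> aout"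
  shows "pinv (W {y, b} b) = W {y, linv b} (linv b)"
proof -
  have "insert (linv b) ({y, b} - {b}) = {y, linv b}" using XO_ne'[OF assms] by blast
  then show ?thesis using W_inv[OF good_level1[OF assms]] by simp
qed

text \<open>The disjoint case is a relation. For equal multipliers the joining relation is read in
  both orders, and inverse multipliers are brought to equal ones by inverting one factor.\<close>

lemma level_commute:
  assumes y: "y \<in> L" and z: "z \<in> L" and ne: "y \<noteq> z" and b: "fst b \<in> aout" and c: "fst c \<in> aout"
  shows "W {y, b} b \<bullet> W {z, c} c = W {z, c} c \<bullet> W {y, b} b"
proof -
  consider "b = c" | "b = linv c" | "b \<noteq> c" "linv b \<noteq> c" using linv_eq_iff[of b c] by blast
  then show ?thesis
  proof cases
    case 1
    then show ?thesis using level_commute_same[OF y z ne b] by simp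
  next
    case 2
    have "W {y, c} c \<bullet> W {z, c} c = W {z, c} c \<bullet> W {y, c} c" by (rule level_commute_same[OF y z ne c])
    then have "pinv (W {y, c} c) \<bullet> W {z, c} c = W {z, c} c \<bullet> pinv (W {y, c} c)"
      by (rule Pg.commute_inv[OF W_car[OF good_level1[OF y c]] W_car[OF good_level1[OF z c]]])
    then show ?thesis using level_inv[OF y c] 2 by simp
  next
    case 3
    have "linv c \<noteq> b" using 3 by auto
    then show ?thesis
      by (intro W_commute good_level1 y z b c)
        (use 3 ne XO_ne'[OF y b] XO_ne'[OF y c] XO_ne'[OF z b] XO_ne'[OF z c] in \<open>simp_all\<close>)
  qed
qed

text \<open>Lifts the multiplications of one letter \<open>y\<close> by H to the presented group. A
  generator multiplies \<open>y\<close> by its inverse; as products are read from left to right,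
  this sign makes \<open>T y\<close> a homomorphism and not an antihomomorphism.\<close>

definition T :: "'v letter \<Rightarrow> 'v word set \<Rightarrow> 'v aut word set" where
  "T y = pres_lift PG (\<lambda>v. if v \<in> aout then W {y, (v, False)} (v, False) else pone)"

text \<open>Both sets contain \<open>y\<close>, so commutation comes from the clause of
  \<open>R3\<close> for adjacent multipliers.\<close>

lemma T_respecting:
  assumes y: "y \<in> L"
  shows "raag_respecting \<Gamma> PG (\<lambda>v. if v \<in> aout then W {y, (v, False)} (v, False) else pone)"
  unfolding raag_respecting_def
proof (intro conjI allI impI)
  have c: "(if v \<in> aout then W {y, (v, False)} (v, False) else pone) \<in> carrier PG" for v
    using W_car[OF good_level1[OF y, of "(v, False)"]] by simp
  then show "(\<lambda>v. if v \<in> aout then W {y, (v, False)} (v, False) else pone) ` pverts \<Gamma> \<subseteq> carrier PG" by blast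
  fix v z assume "(v, z) \<in> parcs \<Gamma>"
  then have l: "v \<in> lk \<Gamma> z" "v \<noteq> z" using g.lk_iff g.lk_sym g.lk_irrefl by blast+
  show "(if v \<in> aout then W {y, (v, False)} (v, False) else pone) \<bullet> (if z \<in> aout then W {y, (z, False)} (z, False) else pone) =
    (if z \<in> aout then W {y, (z, False)} (z, False) else pone) \<bullet> (if v \<in> aout then W {y, (v, False)} (v, False) else pone)"
  proof (cases "v \<in> aout \<and> z \<in> aout")
    case True
    have "W {y, (v, False)} (v, False) \<bullet> W {y, (z, False)} (z, False) = W {y, (z, False)} (z, False) \<bullet> W {y, (v, False)} (v, False)"
      by (rule W_commute[OF good_level1[OF y] good_level1[OF y]])
        (use True l XO_ne'[OF y, of "(v, False)"] XO_ne'[OF y, of "(z, False)"] in \<open>simp_all add: linv_def\<close>)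
    then show ?thesis using True by simp
  next
    case False
    then show ?thesis using c[of v] c[of z] by (auto split: if_splits)
  qed
qed (rule Pg.is_group)

lemma T_hom: "y \<in> L \<Longrightarrow> T y \<in> hom (raag \<Gamma>) PG"
  unfolding T_def by (rule g.raag_lift_hom[OF T_respecting])

lemma T_elt:
  assumes y: "y \<in> L" and b: "fst b \<in> aout"
  shows "T y (el b) = W {y, linv b} (linv b)"
proof -
  interpret h: group_hom "raag \<Gamma>" PG "T y"
    by (rule group_hom.intro[OF g.raag_group Pg.is_group group_hom_axioms.intro[OF T_hom[OF y]]])
  have v: "fst b \<in> pverts \<Gamma>" using b O_verts by blast
  have 1: "T y (gen \<Gamma> (fst b)) = W {y, (fst b, False)} (fst b, False)"
    unfolding T_def using g.raag_lift_gen[OF T_respecting[OF y] v] b by simp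
  have lt: "linv (fst b, True) = (fst b, False)" "linv (fst b, False) = (fst b, True)" by (simp_all add: linv_def)
  show ?thesis
  proof (rule elt_sign_cases[OF v])
    assume "b = (fst b, True)"
    then show ?thesis using 1 lt by metis
  next
    assume e: "b = linv (fst b, True)" "el b = ginv (gen \<Gamma> (fst b))"
    have "T y (el b) = pinv (W {y, (fst b, False)} (fst b, False))" using e(2) h.hom_inv gen_car[OF v] 1 by simp
    then show ?thesis using level_inv[OF y, of "(fst b, False)"] b e(1) lt by (metis fst_conv)
  qed
qed

lemma T_car [simp]: "y \<in> L \<Longrightarrow> h \<in> H \<Longrightarrow> T y h \<in> carrier PG"
  using hom_in_carrier[OF T_hom] H_car by blast

lemma T_mult: "y \<in> L \<Longrightarrow> h \<in> H \<Longrightarrow> k \<in> H \<Longrightarrow> T y (h \<star> k) = T y h \<bullet> T y k"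
  using hom_mult[OF T_hom] H_car by blast

lemma T_one: "y \<in> L \<Longrightarrow> T y gone = pone"
  using group_hom.hom_one[OF group_hom.intro[OF g.raag_group Pg.is_group group_hom_axioms.intro[OF T_hom]]] .

lemma T_commute:
  assumes y: "y \<in> L" and z: "z \<in> L" and ne: "y \<noteq> z" and h: "h \<in> H" and k: "k \<in> H"
  shows "T y h \<bullet> T z k = T z k \<bullet> T y h"
proof -
  have *: "T z k \<bullet> T y (el b) = T y (el b) \<bullet> T z k" if b: "fst b \<in> aout" for b
    using O_verts k
  proof (induction rule: g.par_induct)
    case one
    show ?case using T_one[OF z] T_car[OF y elt_H[OF b]] by simp
  next
    case (mult l p)
    have "T z (el l) \<bullet> T y (el b) = T y (el b) \<bullet> T z (el l)"
      unfolding T_elt[OF y b] T_elt[OF z mult(1)] by (rule level_commute) (use y z ne b mult(1) in auto)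
    then show ?case
      using Pg.commute_mult T_car[OF z elt_H[OF mult(1)]] T_car[OF z mult(2)] T_car[OF y elt_H[OF b]] mult(3)
        T_mult[OF z elt_H[OF mult(1)] mult(2)] by simp
  qed
  from O_verts h show ?thesis
  proof (induction rule: g.par_induct)
    case one
    show ?case using T_one[OF y] T_car[OF z k] by simp
  next
    case (mult l p)
    then show ?case
      using Pg.commute_mult T_car[OF y elt_H[OF mult(1)]] T_car[OF y mult(2)] T_car[OF z k] *[OF mult(1)]
        T_mult[OF y elt_H[OF mult(1)] mult(2)] by simp
  qed
qed

definition Tprod :: "'v letter list \<Rightarrow> ('v letter \<Rightarrow> 'v word set) \<Rightarrow> 'v aut word set" where
  "Tprod ys s = foldr (\<lambda>y p. T y (s y) \<bullet> p) ys pone"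

lemma Tprod_Nil [simp]: "Tprod [] s = pone"
  by (simp add: Tprod_def)

lemma Tprod_Cons [simp]: "Tprod (y # ys) s = T y (s y) \<bullet> Tprod ys s"
  by (simp add: Tprod_def)

lemma Tprod_car: "set ys \<subseteq> L \<Longrightarrow> s ` L \<subseteq> H \<Longrightarrow> Tprod ys s \<in> carrier PG"
  by (induction ys) (simp_all add: image_subset_iff)

lemma Tprod_commute:
  assumes y: "y \<in> L" and h: "h \<in> H" and s: "s ` L \<subseteq> H"
  shows "set ys \<subseteq> L \<Longrightarrow> y \<notin> set ys \<Longrightarrow> Tprod ys s \<bullet> T y h = T y h \<bullet> Tprod ys s"
proof (induction ys)
  case Nil
  then show ?case using T_car[OF y h] by simp
next
  case (Cons z ys)
  then have z: "z \<in> L" "set ys \<subseteq> L" "z \<noteq> y" "y \<notin> set ys" by auto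
  have sz: "s z \<in> H" using s z(1) by blast
  show ?case
    using Pg.commute_mult[OF T_car[OF z(1) sz] Tprod_car[OF z(2) s] T_car[OF y h] T_commute[OF z(1) y z(3) sz h]]
      Cons.IH z by simp
qed

lemma Tprod_mult:
  assumes s: "s ` L \<subseteq> H" and r: "r ` L \<subseteq> H"
  shows "set ys \<subseteq> L \<Longrightarrow> distinct ys \<Longrightarrow> Tprod ys (\<lambda>u. s u \<star> r u) = Tprod ys s \<bullet> Tprod ys r"
proof (induction ys)
  case (Cons y ys)
  then have y: "y \<in> L" "set ys \<subseteq> L" "y \<notin> set ys" "distinct ys" by auto
  have h: "s y \<in> H" "r y \<in> H" using s r y(1) by blast+
  have c: "Tprod ys s \<in> carrier PG" "Tprod ys r \<in> carrier PG" using Tprod_car y s r by blast+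
  have "Tprod (y # ys) (\<lambda>u. s u \<star> r u) = T y (s y) \<bullet> T y (r y) \<bullet> (Tprod ys s \<bullet> Tprod ys r)"
    using Cons.IH[OF y(2,4)] T_mult[OF y(1) h] by simp
  also have "\<dots> = T y (s y) \<bullet> (T y (r y) \<bullet> Tprod ys s) \<bullet> Tprod ys r"
    using c T_car[OF y(1)] h by (simp add: Pg.m_assoc)
  also have "\<dots> = T y (s y) \<bullet> (Tprod ys s \<bullet> T y (r y)) \<bullet> Tprod ys r"
    using Tprod_commute[OF y(1) h(2) s y(2,3)] by simp
  also have "\<dots> = Tprod (y # ys) s \<bullet> Tprod (y # ys) r"
    using c T_car[OF y(1)] h by (simp add: Pg.m_assoc)
  finally show ?case .
qed simp

lemma Tprod_cong: "set ys \<subseteq> L \<Longrightarrow> (\<And>u. u \<in> L \<Longrightarrow> s u = r u) \<Longrightarrow> Tprod ys s = Tprod ys r"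
  by (induction ys) auto

lemma Tprod_one: "set ys \<subseteq> L \<Longrightarrow> Tprod ys (\<lambda>_. gone) = pone"
  by (induction ys) (simp_all add: T_one)

lemma Tprod_single:
  assumes h: "h \<in> H" and y: "y \<in> L"
  shows "set ys \<subseteq> L \<Longrightarrow> distinct ys \<Longrightarrow>
    Tprod ys (\<lambda>u. if u = y then h else gone) = (if y \<in> set ys then T y h else pone)"
proof (induction ys)
  case (Cons z ys)
  then have z: "z \<in> L" "set ys \<subseteq> L" "z \<notin> set ys" "distinct ys" by auto
  show ?case using Cons.IH[OF z(2,4)] T_one[OF z(1)] T_car[OF y h] z(3)
    by (cases "z = y") simp_all
qed simp

text \<open>By \<open>T_commute\<close> the factors commute, so the enumeration of \<open>L\<close>
  serves only to write the product down.\<close>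

definition theta :: "('v letter \<Rightarrow> 'v word set) \<Rightarrow> 'v aut word set" where
  "theta = Tprod (SOME ys. distinct ys \<and> set ys = L)"

lemma theta_list: "\<exists>ys. theta = Tprod ys \<and> distinct ys \<and> set ys = L"
proof -
  have "\<exists>ys. distinct ys \<and> set ys = L" using finite_distinct_list[OF finite_sgn_set[OF finX]] by blast
  from someI_ex[OF this] show ?thesis unfolding theta_def by blast
qed

lemma theta_car [simp]: "s ` L \<subseteq> H \<Longrightarrow> theta s \<in> carrier PG"
proof -
  obtain ys where ys: "theta = Tprod ys" "set ys = L" using theta_list by blast
  assume "s ` L \<subseteq> H"
  then show ?thesis unfolding ys(1) using Tprod_car[of ys s] ys(2) by simp
qed

lemma theta_mult: "s ` L \<subseteq> H \<Longrightarrow> r ` L \<subseteq> H \<Longrightarrow> theta (\<lambda>u. s u \<star> r u) = theta s \<bullet> theta r"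
proof -
  obtain ys where ys: "theta = Tprod ys" "distinct ys" "set ys = L" using theta_list by blast
  assume "s ` L \<subseteq> H" "r ` L \<subseteq> H"
  then show ?thesis unfolding ys(1) using Tprod_mult[of s r ys] ys(2,3) by simp
qed

lemma theta_cong: "(\<And>u. u \<in> L \<Longrightarrow> s u = r u) \<Longrightarrow> theta s = theta r"
proof -
  obtain ys where ys: "theta = Tprod ys" "set ys = L" using theta_list by blast
  assume "\<And>u. u \<in> L \<Longrightarrow> s u = r u"
  then show ?thesis unfolding ys(1) using ys(2) by (intro Tprod_cong) simp_all
qed

lemma theta_one: "theta (\<lambda>_. gone) = pone"
proof -
  obtain ys where ys: "theta = Tprod ys" "set ys = L" using theta_list by blast
  show ?thesis unfolding ys(1) using ys(2) by (intro Tprod_one) simp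
qed

lemma theta_single:
  assumes "h \<in> H" "y \<in> L"
  shows "theta (\<lambda>u. if u = y then h else gone) = T y h"
proof -
  obtain ys where ys: "theta = Tprod ys" "distinct ys" "set ys = L" using theta_list by blast
  show ?thesis unfolding ys(1) using Tprod_single[OF assms, of ys] ys assms(2) by simp
qed

lemma single_H: "h \<in> H \<Longrightarrow> (\<lambda>u. if u = y then h else gone) ` L \<subseteq> H"
  using H_one by auto

text \<open>A twist is built from steps with one letter and one generator of H, each a single pair
  \<open>{y, b}\<close>. The case \<open>cong\<close> is present because only values on
  \<open>L\<close> count.\<close>

lemma theta_induct [consumes 1, case_names cong one step]:
  assumes s: "s ` L \<subseteq> H"
    and cong: "\<And>s r. (\<And>u. u \<in> L \<Longrightarrow> s u = r u) \<Longrightarrow> Q s \<Longrightarrow> Q r"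
    and one: "Q (\<lambda>_. gone)"
    and step: "\<And>y b s. y \<in> L \<Longrightarrow> fst b \<in> aout \<Longrightarrow> s ` L \<subseteq> H \<Longrightarrow> Q s \<Longrightarrow>
      Q (\<lambda>u. (if u = y then el b else gone) \<star> s u)"
  shows "Q s"
proof -
  have rc: "r u \<in> GC" if "r ` L \<subseteq> H" "u \<in> L" for r :: "'v letter \<Rightarrow> 'v word set" and u
    using that H_car by blast
  have single: "Q (\<lambda>u. (if u = y then h else gone) \<star> r u)"
    if y: "y \<in> L" and h: "h \<in> H" and r: "r ` L \<subseteq> H" "Q r" for y h r
    using O_verts h
  proof (induction rule: g.par_induct)
    case one
    show ?case by (rule cong[OF _ r(2)]) (use r(1) H_car in auto)
  next
    case (mult l p)
    have c: "(\<lambda>u. (if u = y then p else gone) \<star> r u) ` L \<subseteq> H"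
      using mult(2) r(1) H_one H_mult by (auto simp: image_subset_iff)
    show ?case
      by (rule cong[OF _ step[OF y mult(1) c mult(3)]])
        (use H_car[OF mult(2)] H_car[OF elt_H[OF mult(1)]] rc[OF r(1) y] rc[OF r(1)] in \<open>simp add: R.m_assoc\<close>)
  qed
  have "Q (\<lambda>u. if u \<in> K then s u else gone)" if "finite K" "K \<subseteq> L" for K
    using that
  proof (induction K rule: finite_induct)
    case empty
    then show ?case using one by simp
  next
    case (insert y K)
    have y: "y \<in> L" "s y \<in> H" using insert.prems s by auto
    have c: "(\<lambda>u. if u \<in> K then s u else gone) ` L \<subseteq> H" using s H_one by auto
    show ?case
      by (rule cong[OF _ single[OF y c insert.IH]])
        (use insert s H_car in \<open>auto simp: image_subset_iff\<close>)
  qed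
  from this[OF finite_sgn_set[OF finX] order_refl] show ?thesis
    by (rule cong[rotated]) simp
qed

lemma theta_step:
  assumes "y \<in> L" "fst b \<in> aout" "s ` L \<subseteq> H"
  shows "theta (\<lambda>u. (if u = y then el b else gone) \<star> s u) = W {y, linv b} (linv b) \<bullet> theta s"
  using theta_mult[OF single_H[OF elt_H[OF assms(2)]] assms(3)] theta_single[OF elt_H[OF assms(2)] assms(1)]
    T_elt[OF assms(1,2)] by simp

text \<open>A pair with multiplier over \<open>a_out\<close> is a twist that is constant on its set,
  which is how all such pairs enter \<open>Lam\<close>.\<close>

lemma level_theta:
  assumes b: "fst b \<in> aout"
  shows "finite D \<Longrightarrow> D \<subseteq> L \<Longrightarrow> W (insert (linv b) D) (linv b) = theta (\<lambda>u. if u \<in> D then el b else gone)"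
proof (induction D rule: finite_induct)
  case empty
  then show ?case using theta_one by (simp add: W_def)
next
  case (insert y D)
  have b': "fst (linv b) \<in> aout" using b by simp
  have y: "y \<in> L" "D \<subseteq> L" using insert.prems by auto
  have i: "{y, linv b} \<inter> insert (linv b) D = {linv b}" using insert.hyps(2) XO_ne'[OF y(1) b] by blast
  have "W (insert (linv b) (insert y D)) (linv b) = W {y, linv b} (linv b) \<bullet> W (insert (linv b) D) (linv b)"
    unfolding W_join[OF good_level1[OF y(1) b'] good_level[OF y(2) b'] i] by (simp add: insert_commute)
  also have "\<dots> = theta (\<lambda>u. (if u = y then el b else gone) \<star> (if u \<in> D then el b else gone))"
    using theta_step[OF y(1) b, of "\<lambda>u. if u \<in> D then el b else gone"] insert.IH[OF y(2)] elt_H[OF b] H_one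
    by (simp add: image_subset_iff)
  also have "\<dots> = theta (\<lambda>u. if u \<in> insert y D then el b else gone)"
    by (rule theta_cong) (use insert.hyps(2) H_car[OF elt_H[OF b]] in simp)
  finally show ?case .
qed


section \<open>The homomorphism to automorphisms and the subgroup \<open>Lam\<close>\<close>

abbreviation PhiL where "PhiL \<equiv> pres_lift SG id"

lemma Phi_hom: "PhiL \<in> hom PG SG"
  by (rule pres_lift_hom[OF pres_map_SG])

lemma Phi_q: "\<phi> \<in> Om \<Longrightarrow> PhiL (q \<phi>) = \<phi>"
  using pres_lift_gen[OF pres_map_SG] by simp

lemma Phi_Stvl: "p \<in> carrier PG \<Longrightarrow> PhiL p \<in> SS"
  using hom_in_carrier[OF Phi_hom] by simp

lemma Phi_mult:
  assumes "p \<in> carrier PG" "r \<in> carrier PG" "k \<in> GC"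
  shows "PhiL (p \<bullet> r) k = PhiL r (PhiL p k)"
  using hom_mult[OF Phi_hom assms(1,2)] SG_mult_apply[OF Phi_Stvl[OF assms(1)] Phi_Stvl[OF assms(2)] assms(3)]
  by simp

lemma Phi_one: "PhiL pone = idS"
  using group_hom.hom_one[OF group_hom.intro[OF Pg.is_group SG_group group_hom_axioms.intro[OF Phi_hom]]] SG_one
  by simp

lemma whf_single:
  assumes "good {a} a"
  shows "whf {a} a = idS"
proof (rule Stvl_elt_ext[OF whf_Stvl[OF assms] idS_Stvl])
  note g = goodD[OF assms]
  fix u assume u: "u \<in> L"
  consider "u = a" | "u = linv a" | "fst u \<noteq> fst a" using fst_eq_linv by blast
  then have "wv {a} a u = el u"
  proof cases
    case 1
    then show ?thesis using g(4) by (simp add: wv_def mA_def)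
  next
    case 2
    then show ?thesis using g(4) elt_linvY[OF g(3)] by (simp add: wv_def mA_def)
  next
    case 3
    then have "u \<noteq> a" "linv u \<noteq> a" by auto
    then show ?thesis using 3 elt_L[OF u] by (simp add: wv_def mA_def)
  qed
  then show "whf {a} a (el u) = idS (el u)" using whf_elt[OF g(3) u] elt_L[OF u] by (simp add: idS_def)
qed

lemma Phi_W:
  assumes "good A a"
  shows "PhiL (W A a) = whf A a"
proof (cases "A = {a}")
  case True
  then show ?thesis using whf_single[of a] assms Phi_one by simp
next
  case False
  then show ?thesis using Phi_q[OF wh_Om[of A a]] wh_whf[OF assms False] assms W_q[OF False] by simp
qed

lemma theta_act:
  assumes "s ` L \<subseteq> H" "u \<in> L"
  shows "PhiL (theta s) (el u) = s (linv u) \<star> el u \<star> ginv (s u)"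
proof -
  have "\<forall>u\<in>L. PhiL (theta s) (el u) = s (linv u) \<star> el u \<star> ginv (s u)"
    using assms(1)
  proof (induction rule: theta_induct)
    case (cong s r)
    have "theta s = theta r" using cong(1) by (rule theta_cong)
    then show ?case using cong(1,2) by simp
  next
    case one
    show ?case unfolding theta_one Phi_one idS_def using elt_L by simp
  next
    case (step y b s)
    let ?y = "\<lambda>u. if u = y then el b else gone"
    have b': "fst (linv b) \<in> aout" using step(2) by simp
    note g = good_level1[OF step(1) b']
    have bY: "fst (linv b) \<in> Y" using b' by blast
    note bc = H_car[OF elt_H[OF step(2)]]
    have S: "PhiL (theta s) \<in> SS" using Phi_Stvl theta_car step(3) by blast
    interpret h: group_hom "raag \<Gamma>" "raag \<Gamma>" "PhiL (theta s)"
      by (rule raag_gh[OF StvlD(1)[OF S]])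
    have hb: "PhiL (theta s) (el b) = el b" using Stvl_H[OF S elt_H[OF step(2)]] .
    have lb: "el (linv b) = ginv (el b)" using elt_linvY[of b] step(2) by simp
    show ?case
    proof
      fix u assume u: "u \<in> L"
      have su: "s u \<in> GC" "s (linv u) \<in> GC"
        using step(3) u H_car linv_sgn_set[of u X] by blast+
      note ub = XO_ne'[OF u step(2)] and uc = elt_L[OF u]
      have m: "mA {y, linv b} (linv b) v = ginv (?y v)" if "v \<noteq> linv b" for v
        using that lb by (simp add: mA_def)
      have w: "wv {y, linv b} (linv b) u = ?y (linv u) \<star> el u \<star> ginv (?y u)"
        unfolding wv_def using m[OF ub(2)] m[OF ub(4)] XO_ne[OF u step(2)] bc by simp
      have "PhiL (theta (\<lambda>u. ?y u \<star> s u)) (el u) = PhiL (theta s) (PhiL (W {y, linv b} (linv b)) (el u))"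
        unfolding theta_step[OF step(1-3)] using Phi_mult W_car[OF g] theta_car[OF step(3)] uc by simp
      also have "\<dots> = PhiL (theta s) (?y (linv u) \<star> el u \<star> ginv (?y u))"
        using Phi_W[OF g] whf_elt[OF bY u] w by simp
      also have "\<dots> = ?y (linv u) \<star> (s (linv u) \<star> el u \<star> ginv (s u)) \<star> ginv (?y u)"
      proof -
        have st: "PhiL (theta s) (el u) = s (linv u) \<star> el u \<star> ginv (s u)" using step(4) u by blast
        have "PhiL (theta s) (?y v) = ?y v" for v using hb by simp
        moreover have "?y v \<in> GC" for v using bc by simp
        ultimately show ?thesis using uc by (simp only: h.hom_mult h.hom_inv R.m_closed R.inv_closed st)
      qed
      also have "\<dots> = ?y (linv u) \<star> s (linv u) \<star> el u \<star> ginv (?y u \<star> s u)"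
        using bc uc su by (simp add: R.m_assoc R.inv_mult_group)
      finally show "PhiL (theta (\<lambda>u. ?y u \<star> s u)) (el u) =
        ?y (linv u) \<star> s (linv u) \<star> el u \<star> ginv (?y u \<star> s u)" .
    qed
  qed
  then show ?thesis using assms(2) by blast
qed

text \<open>The functions from \<open>L\<close> to H extended by the signed permutations; by
  \<open>tau_theta\<close> this set of products is closed under multiplication.\<close>

definition Lam :: "'v aut word set set" where
  "Lam = {theta s \<bullet> q (tau \<sigma>) |s \<sigma>. s ` L \<subseteq> H \<and> sperm \<sigma>}"

lemma q_tau_car: "sperm \<sigma> \<Longrightarrow> q (tau \<sigma>) \<in> carrier PG"
  by (rule q_car[OF tau_Om])

lemma LamI: "s ` L \<subseteq> H \<Longrightarrow> sperm \<sigma> \<Longrightarrow> theta s \<bullet> q (tau \<sigma>) \<in> Lam"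
  unfolding Lam_def by blast

lemma LamE:
  assumes "l \<in> Lam"
  obtains s \<sigma> where "s ` L \<subseteq> H" "sperm \<sigma>" "l = theta s \<bullet> q (tau \<sigma>)"
  using assms unfolding Lam_def by blast

lemma Lam_car: "l \<in> Lam \<Longrightarrow> l \<in> carrier PG"
  by (elim LamE) (simp add: q_tau_car)

lemma theta_Lam: "s ` L \<subseteq> H \<Longrightarrow> theta s \<in> Lam"
  using LamI[of s, OF _ sperm_id] q_tau_id by simp

lemma one_H: "(\<lambda>_. gone) ` L \<subseteq> H"
  using H_one by blast

lemma tau_Lam: "sperm \<sigma> \<Longrightarrow> q (tau \<sigma>) \<in> Lam"
  using LamI[OF one_H, of \<sigma>] theta_one q_tau_car by simp

text \<open>By \<open>R6\<close> a permutation moves past each single step, changing only the letter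
  at which the step acts.\<close>

lemma tau_theta:
  assumes \<sigma>: "sperm \<sigma>" and s: "s ` L \<subseteq> H"
  shows "q (tau \<sigma>) \<bullet> theta s = theta (\<lambda>u. s (\<sigma> u)) \<bullet> q (tau \<sigma>)"
  using s
proof (induction rule: theta_induct)
  case (cong s r)
  have "theta s = theta r" using cong(1) by (rule theta_cong)
  moreover have "theta (\<lambda>u. s (\<sigma> u)) = theta (\<lambda>u. r (\<sigma> u))"
    using cong(1) spermD(1)[OF \<sigma>] by (intro theta_cong) blast
  ultimately show ?case using cong(2) by simp
next
  case one
  show ?case using theta_one q_tau_car[OF \<sigma>] by simp
next
  case (step y b s)
  obtain z where z: "z \<in> L" "\<sigma> z = y" using spermD(4)[OF \<sigma> step(1)] by blast
  have b': "fst (linv b) \<in> aout" using step(2) by simp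
  have hz: "hat \<sigma> z = y" using z by (simp add: hat_def)
  have hb: "hat \<sigma> (linv b) = linv b" unfolding hat_def using aout_notin_L(2)[OF step(2)] by (rule if_not_P)
  have W1: "W {z, linv b} (linv b) \<bullet> q (tau \<sigma>) = q (tau \<sigma>) \<bullet> W {y, linv b} (linv b)"
    using W_tau[OF \<sigma> good_level1[OF z(1) b']] hz hb by simp
  have s\<sigma>: "(\<lambda>u. s (\<sigma> u)) ` L \<subseteq> H" using step(3) spermD(1)[OF \<sigma>] by blast
  note c = q_tau_car[OF \<sigma>] W_car[OF good_level1[OF z(1) b']] W_car[OF good_level1[OF step(1) b']]
    theta_car[OF step(3)] theta_car[OF s\<sigma>]
  have "q (tau \<sigma>) \<bullet> theta (\<lambda>u. (if u = y then el b else gone) \<star> s u)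
      = q (tau \<sigma>) \<bullet> W {y, linv b} (linv b) \<bullet> theta s"
    unfolding theta_step[OF step(1-3)] using c by (simp add: Pg.m_assoc)
  also have "\<dots> = W {z, linv b} (linv b) \<bullet> (theta (\<lambda>u. s (\<sigma> u)) \<bullet> q (tau \<sigma>))"
    unfolding W1[symmetric] using c step(4) by (simp add: Pg.m_assoc)
  also have "\<dots> = theta (\<lambda>u. (if u = z then el b else gone) \<star> s (\<sigma> u)) \<bullet> q (tau \<sigma>)"
    unfolding theta_step[OF z(1) step(2) s\<sigma>] using c by (simp add: Pg.m_assoc)
  also have "theta (\<lambda>u. (if u = z then el b else gone) \<star> s (\<sigma> u)) =
      theta (\<lambda>u. (if \<sigma> u = y then el b else gone) \<star> s (\<sigma> u))"
  proof (rule theta_cong)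
    fix u assume u: "u \<in> L"
    have "\<sigma> u = y \<longleftrightarrow> u = z" using spermD(3)[OF \<sigma> u z(1)] unfolding z(2) .
    then show "(if u = z then el b else gone) \<star> s (\<sigma> u) = (if \<sigma> u = y then el b else gone) \<star> s (\<sigma> u)"
      by simp
  qed
  finally show ?case .
qed

lemma tau_inv:
  assumes \<sigma>: "sperm \<sigma>"
  shows "pinv (q (tau \<sigma>)) = q (tau (inv_into L \<sigma>))"
proof -
  note i = sperm_inv[OF \<sigma>]
  have b: "bij_betw \<sigma> L L" using \<sigma> by (simp add: sperm_def)
  have "tau (\<lambda>u. \<sigma> (inv_into L \<sigma> u)) = tau (\<lambda>u. u)"
    by (rule tau_cong[OF sperm_comp[OF i \<sigma>] sperm_id]) (rule bij_betw_inv_into_right[OF b])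
  then have "q (tau (inv_into L \<sigma>)) \<bullet> q (tau \<sigma>) = pone" using q_tau_mult[OF i \<sigma>] q_tau_id by simp
  then show ?thesis using Pg.inv_equality q_tau_car \<sigma> i by blast
qed

lemma theta_inv:
  assumes "s ` L \<subseteq> H"
  shows "pinv (theta s) = theta (\<lambda>u. ginv (s u))"
proof -
  have i: "(\<lambda>u. ginv (s u)) ` L \<subseteq> H" using assms H_inv by blast
  have c: "s u \<in> GC" if "u \<in> L" for u using assms that H_car by blast
  have "theta (\<lambda>u. ginv (s u)) \<bullet> theta s = theta (\<lambda>u. ginv (s u) \<star> s u)" using theta_mult[OF i assms] by simp
  also have "\<dots> = theta (\<lambda>_. gone)" by (rule theta_cong) (use c in simp)
  finally show ?thesis using Pg.inv_equality theta_car[OF assms] theta_car[OF i] theta_one by simp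
qed

lemma Lam_mult:
  assumes "l \<in> Lam" "m \<in> Lam"
  shows "l \<bullet> m \<in> Lam"
proof -
  obtain s \<sigma> where l: "s ` L \<subseteq> H" "sperm \<sigma>" "l = theta s \<bullet> q (tau \<sigma>)" using assms(1) by (rule LamE)
  obtain r \<rho> where m: "r ` L \<subseteq> H" "sperm \<rho>" "m = theta r \<bullet> q (tau \<rho>)" using assms(2) by (rule LamE)
  have r\<sigma>: "(\<lambda>u. r (\<sigma> u)) ` L \<subseteq> H" using m(1) spermD(1)[OF l(2)] by blast
  note c = q_tau_car[OF l(2)] q_tau_car[OF m(2)] theta_car[OF l(1)] theta_car[OF m(1)] theta_car[OF r\<sigma>]
  have "l \<bullet> m = theta s \<bullet> (q (tau \<sigma>) \<bullet> theta r) \<bullet> q (tau \<rho>)" using l(3) m(3) c by (simp add: Pg.m_assoc)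
  also have "\<dots> = (theta s \<bullet> theta (\<lambda>u. r (\<sigma> u))) \<bullet> (q (tau \<sigma>) \<bullet> q (tau \<rho>))"
    unfolding tau_theta[OF l(2) m(1)] using c by (simp add: Pg.m_assoc)
  also have "\<dots> = theta (\<lambda>u. s u \<star> r (\<sigma> u)) \<bullet> q (tau (\<lambda>u. \<rho> (\<sigma> u)))"
    using theta_mult[OF l(1) r\<sigma>] q_tau_mult[OF l(2) m(2)] by simp
  also have "\<dots> \<in> Lam"
  proof (rule LamI[OF _ sperm_comp[OF l(2) m(2)]])
    show "(\<lambda>u. s u \<star> r (\<sigma> u)) ` L \<subseteq> H" using l(1) r\<sigma> H_mult by blast
  qed
  finally show ?thesis .
qed

lemma Lam_inv:
  assumes "l \<in> Lam"
  shows "pinv l \<in> Lam"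
proof -
  obtain s \<sigma> where l: "s ` L \<subseteq> H" "sperm \<sigma>" "l = theta s \<bullet> q (tau \<sigma>)" using assms by (rule LamE)
  have "(\<lambda>u. ginv (s u)) ` L \<subseteq> H" using l(1) H_inv by blast
  then have "pinv (theta s) \<in> Lam" using theta_inv[OF l(1)] theta_Lam by simp
  moreover have "pinv (q (tau \<sigma>)) \<in> Lam" using tau_inv[OF l(2)] tau_Lam[OF sperm_inv[OF l(2)]] by simp
  ultimately have "pinv (q (tau \<sigma>)) \<bullet> pinv (theta s) \<in> Lam" by (rule Lam_mult[rotated])
  then show ?thesis using l q_tau_car[OF l(2)] by (simp add: Pg.inv_mult_group)
qed

lemma Lam_sub: "subgroup Lam PG"
  by (rule Pg.subgroupI) (use Lam_car Lam_mult Lam_inv tau_Lam[OF sperm_id] in blast)+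

lemma Lam_act:
  assumes s: "s ` L \<subseteq> H" and \<sigma>: "sperm \<sigma>" and u: "u \<in> L"
  shows "PhiL (theta s \<bullet> q (tau \<sigma>)) (el u) = s (linv u) \<star> el (\<sigma> u) \<star> ginv (s u)"
proof -
  note S = tau_Stvl[OF \<sigma>]
  interpret h: group_hom "raag \<Gamma>" "raag \<Gamma>" "tau \<sigma>"
    by (rule raag_gh[OF StvlD(1)[OF S]])
  have sH: "s u \<in> H" "s (linv u) \<in> H" using s u linv_sgn_set[of u X] by blast+
  have "PhiL (theta s \<bullet> q (tau \<sigma>)) (el u) = tau \<sigma> (s (linv u) \<star> el u \<star> ginv (s u))"
    using Phi_mult[OF theta_car[OF s] q_tau_car[OF \<sigma>] elt_L[OF u]] Phi_q[OF tau_Om[OF \<sigma>]] theta_act[OF s u] by simp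
  also have "\<dots> = s (linv u) \<star> el (\<sigma> u) \<star> ginv (s u)"
    using Stvl_H[OF S sH(1)] Stvl_H[OF S sH(2)] H_car[OF sH(1)] H_car[OF sH(2)] elt_L[OF u] tau_elt[OF \<sigma> u] by simp
  finally show ?thesis .
qed

lemma twist_iff:
  "F.twist s \<sigma> \<psi> \<longleftrightarrow> \<psi> \<in> F.Au \<and> s ` L \<subseteq> H \<and> sperm \<sigma> \<and>
    (\<forall>u\<in>L. \<psi> (el u) = s (linv u) \<star> el (\<sigma> u) \<star> ginv (s u))"
proof -
  have "inv\<^bsub>RY\<^esub> (s u) = ginv (s u)" if "s ` L \<subseteq> H" "u \<in> L" for u using RY_inv[of "s u"] H_GY that by blast
  then show ?thesis unfolding F.twist_def sperm_def by (simp cong: conj_cong)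
qed

lemma twist_Lam:
  assumes "s ` L \<subseteq> H" "sperm \<sigma>"
  shows "F.twist s \<sigma> (PhiL (theta s \<bullet> q (tau \<sigma>)))"
  unfolding twist_iff using assms Lam_act[OF assms] Stvl_Au[OF Phi_Stvl[OF Lam_car[OF LamI[OF assms]]]] by simp

text \<open>The normal form of the image of a letter displays both coefficients and the letter
  between them, hence \<open>s\<close> and \<sigma>; so injectivity here needs no reduction of
  length.\<close>

lemma Lam_inj:
  assumes l: "l \<in> Lam" and fx: "\<forall>u\<in>L. PhiL l (el u) = el u"
  shows "l = pone"
proof -
  obtain s \<sigma> where s: "s ` L \<subseteq> H" "sperm \<sigma>" "l = theta s \<bullet> q (tau \<sigma>)" using l by (rule LamE)
  have nf_letter: "nf (h \<star> el v \<star> k) = ([(h, v)], k)" if "h \<in> H" "k \<in> H" "v \<in> L" for h k v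
  proof -
    have c: "h \<in> GC" "k \<in> GC" "el v \<in> GC"
      using H_car[OF that(1)] H_car[OF that(2)] elt_L[OF that(3)] by simp_all
    have v: "fst v \<in> pverts \<Gamma>" "fst v \<in> X" "fst v \<notin> aout" using that(3) X_verts X_O unfolding L_iff by blast+
    have "nf (el v) = ([(gone, v)], gone)"
      using nf_elt[OF v(1) R.one_closed] c(3) v(2,3) nf_one by (simp add: act_def)
    then have "nf (h \<star> el v) = ([(h, v)], gone)" using nf_H[OF that(1) c(3)] c(1) by simp
    then show ?thesis using nf_right[OF that(2), of "h \<star> el v"] c by (simp add: rscale_def)
  qed
  have eq: "\<sigma> u = u \<and> s u = gone" if u: "u \<in> L" for u
  proof -
    have sH: "s u \<in> H" "s (linv u) \<in> H" using s(1) u linv_sgn_set[of u X] by blast+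
    have "s (linv u) \<star> el (\<sigma> u) \<star> ginv (s u) = gone \<star> el u \<star> gone"
      using fx u s(3) Lam_act[OF s(1,2) u] elt_L[OF u] by simp
    then have "([(s (linv u), \<sigma> u)], ginv (s u)) = ([(gone, u)], gone)"
      using nf_letter[OF sH(2) H_inv[OF sH(1)] spermD(1)[OF s(2) u]] nf_letter[OF H_one H_one u] by metis
    then show ?thesis using H_car[OF sH(1)] by simp
  qed
  have "theta s = pone" using theta_one theta_cong[of s "\<lambda>_. gone"] eq by simp
  moreover have "tau \<sigma> = tau (\<lambda>u. u)" by (rule tau_cong[OF s(2) sperm_id]) (use eq in blast)
  ultimately show ?thesis using s(3) q_tau_id by simp
qed

section \<open>Interaction of \<open>Lam\<close> with the pairs whose multiplier lies in
  \<open>[x]\<close>\<close>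

lemma wp_good: "F.wp D a \<Longrightarrow> good D a"
  unfolding F.wp_def good_def using L_Y by blast

lemma wp_L: "F.wp D a \<Longrightarrow> a \<in> L" "F.wp D a \<Longrightarrow> D \<subseteq> L"
  unfolding F.wp_def by blast+

lemma W_acts:
  assumes "F.wp D a"
  shows "F.acts_w (PhiL (W D a)) D a"
proof -
  note g = wp_good[OF assms]
  have S: "PhiL (W D a) \<in> F.Au" using Stvl_Au Phi_Stvl W_car[OF g] by blast
  have "inv\<^bsub>RY\<^esub> (F.mulp D a v) = ginv (mA D a v)" for v
    using RY_inv elt_L_GY[OF wp_L(1)[OF assms]] GY_one by (simp add: F.mulp_def mA_def)
  then have "F.wform D a u = wv D a u" for u
    unfolding F.wform_def wv_def by (simp add: F.mulp_def mA_def)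
  then show ?thesis unfolding F.acts_w_def
    using S assms Phi_W[OF g] whf_elt[OF goodD(3)[OF g]] by simp
qed

text \<open>The permutation stands to the left of the pair, so the pair has to be transported by the
  inverse permutation.\<close>

lemma Lam_W:
  assumes l: "l \<in> Lam" and D: "F.wp D a"
  shows "\<exists>s D' a'. s ` L \<subseteq> H \<and> F.wp D' a' \<and> (\<exists>l'\<in>Lam. l \<bullet> W D a = theta s \<bullet> W D' a' \<bullet> l')"
proof -
  obtain s \<sigma> where s: "s ` L \<subseteq> H" "sperm \<sigma>" "l = theta s \<bullet> q (tau \<sigma>)" using l by (rule LamE)
  note i = sperm_inv[OF s(2)] and g = wp_good[OF D]
  have b: "bij_betw \<sigma> L L" using s(2) by (simp add: sperm_def)
  define D' a' where "D' = hat (inv_into L \<sigma>) ` D" and "a' = hat (inv_into L \<sigma>) a"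
  have hh: "hat \<sigma> (hat (inv_into L \<sigma>) u) = u" if "u \<in> L" for u
    using that bij_betw_inv_into_right[OF b that] spermD(1)[OF i that] by (simp add: hat_def)
  have g': "good D' a'" unfolding D'_def a'_def by (rule good_hat[OF i g])
  have a'L: "a' \<in> L" using hat_L[OF i, of a] wp_L(1)[OF D] by (simp add: a'_def)
  have D'L: "D' \<subseteq> L" unfolding D'_def image_subset_iff hat_L[OF i] using wp_L(2)[OF D] by blast
  have wp': "F.wp D' a'" unfolding F.wp_def using D'L goodD(1,2)[OF g'] by blast
  have "(\<lambda>u. hat \<sigma> (hat (inv_into L \<sigma>) u)) ` D = (\<lambda>u. u) ` D"
    by (rule image_cong[OF HOL.refl]) (use hh wp_L(2)[OF D] in blast)
  then have "hat \<sigma> ` D' = D" unfolding D'_def image_image by simp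
  moreover have "hat \<sigma> a' = a" unfolding a'_def using hh wp_L(1)[OF D] by blast
  ultimately have t: "W D' a' \<bullet> q (tau \<sigma>) = q (tau \<sigma>) \<bullet> W D a" using W_tau[OF s(2) g'] by simp
  have "l \<bullet> W D a = theta s \<bullet> (q (tau \<sigma>) \<bullet> W D a)"
    using s(3) theta_car[OF s(1)] q_tau_car[OF s(2)] W_car[OF g] by (simp add: Pg.m_assoc)
  also have "\<dots> = theta s \<bullet> W D' a' \<bullet> q (tau \<sigma>)"
    unfolding t[symmetric] using theta_car[OF s(1)] q_tau_car[OF s(2)] W_car[OF g'] by (simp add: Pg.m_assoc)
  finally show ?thesis using s(1) wp' tau_Lam[OF s(2)] by blast
qed

lemma level_Lam:
  assumes "D \<subseteq> L" "fst b \<in> aout"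
  shows "W (insert b D) b \<in> Lam"
proof -
  have b': "fst (linv b) \<in> aout" using assms(2) by simp
  have f: "finite D" using finite_subset[OF assms(1) finite_sgn_set[OF finX]] .
  have "W (insert b D) b = theta (\<lambda>u. if u \<in> D then el (linv b) else gone)"
    using level_theta[OF b' f assms(1)] by simp
  then show ?thesis using theta_Lam[of "\<lambda>u. if u \<in> D then el (linv b) else gone"] elt_H[OF b'] H_one
    by (simp add: image_subset_iff)
qed

text \<open>Says that the conjugate of \<open>p\<close> by \<open>W D a\<close> lies in
  \<open>Lam\<close>. This is multiplicative in \<open>p\<close>, so it can be checked on the
  factors of a twist.\<close>

definition Cj :: "'v letter set \<Rightarrow> 'v letter \<Rightarrow> 'v aut word set \<Rightarrow> bool" where
  "Cj D a p \<longleftrightarrow> (\<exists>l\<in>Lam. p \<bullet> W D a = W D a \<bullet> l)"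

lemma Cj_mult:
  assumes "good D a" "p \<in> carrier PG" "r \<in> carrier PG" "Cj D a p" "Cj D a r"
  shows "Cj D a (p \<bullet> r)"
proof -
  obtain l m where lm: "l \<in> Lam" "m \<in> Lam" "p \<bullet> W D a = W D a \<bullet> l" "r \<bullet> W D a = W D a \<bullet> m"
    using assms(4,5) unfolding Cj_def by blast
  note c = W_car[OF assms(1)] Lam_car[OF lm(1)] Lam_car[OF lm(2)]
  have "p \<bullet> r \<bullet> W D a = p \<bullet> (r \<bullet> W D a)" using c assms(2,3) by (simp add: Pg.m_assoc)
  also have "\<dots> = p \<bullet> W D a \<bullet> m" unfolding lm(4) using c assms(2) by (simp add: Pg.m_assoc)
  also have "\<dots> = W D a \<bullet> (l \<bullet> m)" unfolding lm(3) using c by (simp add: Pg.m_assoc)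
  finally show ?thesis unfolding Cj_def using Lam_mult[OF lm(1,2)] by blast
qed

lemma Cj_one: "good D a \<Longrightarrow> Cj D a pone"
  unfolding Cj_def using W_car subgroup.one_closed[OF Lam_sub] by (intro bexI[of _ pone]) simp_all

text \<open>If \<open>y\<close> is the inverse of \<open>a\<close>, the sliding relation spreads the
  step over the rest of \<open>D\<close>; otherwise the two pairs are disjoint and commute.\<close>

lemma Cj_off1:
  assumes D: "F.wp D a" and y: "y \<in> L" "y \<notin> D" and b: "fst b \<in> aout"
  shows "Cj D a (W {y, b} b)"
proof -
  note g = wp_good[OF D] and gy = good_level1[OF y(1) b]
  have aL: "a \<in> L" "D \<subseteq> L" using wp_L[OF D] by blast+
  have bD: "b \<notin> D" "linv b \<notin> D" using aL(2) aout_notin_L[OF b] by blast+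
  have i: "{y, b} \<inter> D = {}" using y(2) bD by blast
  show ?thesis
  proof (cases "y = linv a")
    case True
    have "W {y, b} b \<bullet> W D a = W D a \<bullet> W ({y, b} \<union> D - {a}) b"
      by (rule W_slide[OF gy g bD(2) _ i]) (simp add: True)
    moreover have "{y, b} \<union> D - {a} = insert b (insert y D - {a})" using XO_ne'[OF aL(1) b] by blast
    moreover have "W (insert b (insert y D - {a})) b \<in> Lam" by (rule level_Lam) (use aL y b in blast)+
    ultimately show ?thesis unfolding Cj_def by metis
  next
    case False
    then have "linv a \<notin> {y, b}" using XO_ne'[OF aL(1) b] by blast
    then have "W {y, b} b \<bullet> W D a = W D a \<bullet> W {y, b} b"
      using W_commute[OF gy g bD(2)] i by blast
    moreover have "W {y, b} b \<in> Lam" using level_Lam[of "{y}" b] y b by (simp add: insert_commute)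
    ultimately show ?thesis unfolding Cj_def by blast
  qed
qed

lemma Cj_off:
  assumes D: "F.wp D a" and s: "s ` L \<subseteq> H"
  shows "Cj D a (theta (\<lambda>u. if u \<in> D then gone else s u))"
  using s
proof (induction rule: theta_induct)
  case (cong s r)
  have "theta (\<lambda>u. if u \<in> D then gone else s u) = theta (\<lambda>u. if u \<in> D then gone else r u)"
    by (rule theta_cong) (use cong(1) in simp)
  then show ?case using cong(2) by simp
next
  case one
  show ?case using theta_one Cj_one[OF wp_good[OF D]] by simp
next
  case (step y b s)
  let ?s = "\<lambda>u. if u \<in> D then gone else s u"
  have sH: "?s ` L \<subseteq> H" using step(3) H_one by (auto simp: image_subset_iff)
  have b': "fst (linv b) \<in> aout" using step(2) by simp
  show ?case
  proof (cases "y \<in> D")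
    case True
    have "theta (\<lambda>u. if u \<in> D then gone else (if u = y then el b else gone) \<star> s u) = theta ?s"
      by (rule theta_cong) (use True step(3) H_car in \<open>auto simp: image_subset_iff\<close>)
    then show ?thesis using step(4) by simp
  next
    case False
    have "theta (\<lambda>u. if u \<in> D then gone else (if u = y then el b else gone) \<star> s u) =
        theta (\<lambda>u. (if u = y then el b else gone) \<star> ?s u)"
      by (rule theta_cong) (use False in auto)
    also have "\<dots> = W {y, linv b} (linv b) \<bullet> theta ?s" by (rule theta_step[OF step(1,2) sH])
    finally show ?thesis
      using Cj_mult[OF wp_good[OF D] W_car[OF good_level1[OF step(1) b']] theta_car[OF sH]
          Cj_off1[OF D step(1) False b'] step(4)] by simp
  qed
qed

text \<open>Sliding the single step at \<open>a\<close> past the inverse of \<open>W D a\<close>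
  produces the step on all of \<open>D\<close>; read backwards, conjugation contracts the latter to
  a step at \<open>a\<close>.\<close>

lemma Cj_on1:
  assumes D: "F.wp D a" and b: "fst b \<in> aout"
  shows "Cj D a (W (insert b D) b)"
proof -
  note g = wp_good[OF D]
  have aL: "a \<in> L" "D \<subseteq> L" using wp_L[OF D] by blast+
  have aD: "a \<in> D" "linv a \<notin> D" using goodD(1,2)[OF g] by blast+
  have bD: "b \<notin> D" "linv b \<notin> D" using aL(2) aout_notin_L[OF b] by blast+
  let ?D = "insert (linv a) (D - {a})"
  note ne = XO_ne'[OF aL(1) b]
  have i: "{a, b} \<inter> ?D = {}" using bD ne linv_neq[of a] by blast
  have i2: "linv b \<notin> ?D" using bD(2) ne(4) by (metis Diff_iff insertE)
  have "{a, b} \<union> ?D - {linv a} = insert b D" using aD bD ne linv_neq[of a] by blast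
  then have s: "W {a, b} b \<bullet> W ?D (linv a) = W ?D (linv a) \<bullet> W (insert b D) b"
    using W_slide[OF good_level1[OF aL(1) b] good_inv[OF g] i2 _ i] by simp
  note c = W_car[OF g] W_car[OF good_level1[OF aL(1) b]] W_car[OF good_level[OF aL(2) b]]
  have "W D a \<bullet> W {a, b} b = W D a \<bullet> (W {a, b} b \<bullet> pinv (W D a)) \<bullet> W D a" using c by (simp add: Pg.m_assoc)
  also have "\<dots> = W D a \<bullet> (pinv (W D a) \<bullet> W (insert b D) b) \<bullet> W D a" using s W_inv[OF g] by simp
  also have "\<dots> = W (insert b D) b \<bullet> W D a" using c by simp
  finally have "W (insert b D) b \<bullet> W D a = W D a \<bullet> W {a, b} b" by (rule HOL.sym)
  moreover have "W {a, b} b \<in> Lam" using level_Lam[of "{a}" b] aL b by (simp add: insert_commute)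
  ultimately show ?thesis unfolding Cj_def by blast
qed

lemma Cj_on:
  assumes D: "F.wp D a" and h: "h \<in> H"
  shows "Cj D a (theta (\<lambda>u. if u \<in> D then h else gone))"
  using O_verts h
proof (induction rule: g.par_induct)
  case one
  show ?case using theta_one Cj_one[OF wp_good[OF D]] by simp
next
  case (mult b p)
  have b': "fst (linv b) \<in> aout" using mult(1) by simp
  have f: "finite D" using finite_subset[OF wp_L(2)[OF D] finite_sgn_set[OF finX]] .
  have H1: "(\<lambda>u. if u \<in> D then el b else gone) ` L \<subseteq> H" "(\<lambda>u. if u \<in> D then p else gone) ` L \<subseteq> H"
    using elt_H[OF mult(1)] mult(2) H_one by (simp_all add: image_subset_iff)
  have "theta (\<lambda>u. if u \<in> D then el b \<star> p else gone) =
      theta (\<lambda>u. (if u \<in> D then el b else gone) \<star> (if u \<in> D then p else gone))"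
    by (rule theta_cong) simp
  also have "\<dots> = W (insert (linv b) D) (linv b) \<bullet> theta (\<lambda>u. if u \<in> D then p else gone)"
    using theta_mult[OF H1] level_theta[OF mult(1) f wp_L(2)[OF D]] by simp
  finally show ?case
    using Cj_mult[OF wp_good[OF D] W_car[OF good_level[OF wp_L(2)[OF D] b']] theta_car[OF H1(2)] Cj_on1[OF D b'] mult(3)]
    by simp
qed

text \<open>The twist is split into the constant \<open>h\<close> on \<open>D\<close>, built from
  steps on all of \<open>D\<close>, and a twist vanishing on \<open>D\<close>, built from steps at
  letters outside.\<close>

lemma theta_W:
  assumes s: "s ` L \<subseteq> H" and D: "F.wp D a" and c: "\<forall>u\<in>D. s u = h"
  shows "\<exists>l\<in>Lam. theta s \<bullet> W D a = W D a \<bullet> l"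
proof -
  have "s a = h" using c goodD(1)[OF wp_good[OF D]] by blast
  then have h: "h \<in> H" using s wp_L(1)[OF D] by blast
  have H1: "(\<lambda>u. if u \<in> D then h else gone) ` L \<subseteq> H" "(\<lambda>u. if u \<in> D then gone else s u) ` L \<subseteq> H"
    using h s H_one by (auto simp: image_subset_iff)
  have "theta s = theta (\<lambda>u. (if u \<in> D then h else gone) \<star> (if u \<in> D then gone else s u))"
  proof (rule theta_cong)
    fix u assume "u \<in> L"
    then have "s u \<in> GC" using s H_car by blast
    then show "s u = (if u \<in> D then h else gone) \<star> (if u \<in> D then gone else s u)"
      using c H_car[OF h] by simp
  qed
  then have "Cj D a (theta s)"
    using theta_mult[OF H1] Cj_mult[OF wp_good[OF D] theta_car[OF H1(1)] theta_car[OF H1(2)] Cj_on[OF D h] Cj_off[OF D s]]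
    by simp
  then show ?thesis unfolding Cj_def .
qed

text \<open>This is the exchange relation for the inverse of \<open>W A a\<close>, whose multiplier
  is \<open>linv a\<close>.\<close>

lemma W_exchange':
  assumes A: "F.wp A a" and B: "F.wp A b" and ne: "a \<noteq> b"
  shows "\<exists>l\<in>Lam. pinv (W A a) \<bullet> W A b = l \<bullet> W (insert (linv a) (insert (linv b) (A - {a, b}))) (linv a)"
proof -
  note g = wp_good[OF A] and gB = wp_good[OF B]
  let ?C = "insert (linv a) (A - {a})"
  have m: "a \<in> A" "linv a \<notin> A" "b \<in> A" "linv b \<notin> A" using goodD(1,2)[OF g] goodD(1,2)[OF gB] by blast+
  have L: "linv a \<in> L" "b \<in> L" using wp_L(1)[OF A] wp_L(1)[OF B] by simp_all
  have n: "linv a \<noteq> b" "b \<in> ?C" "linv b \<notin> ?C" using m ne by auto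
  have e1: "insert (linv (linv a)) (?C - {linv a}) = A" using m by auto
  have e2: "insert (linv b) (?C - {b}) = insert (linv a) (insert (linv b) (A - {a, b}))" using n(1) by blast
  have nb: "linv a \<noteq> linv b" using ne by simp
  have sp: "sperm (cyc (linv a) b)" by (rule cyc_sperm[OF L n(1) nb])
  show ?thesis
    using W_exchange[OF good_inv[OF g] L n] tau_Lam[OF sp] unfolding e1 e2 W_inv[OF g] by blast
qed

text \<open>A generator of Type 1 lies in \<open>Lam\<close>; one of Type 2 is some
  \<open>W D a\<close> or lies in \<open>Lam\<close>, according to whether its multiplier is over
  \<open>[x]\<close> or over \<open>a_out\<close>.\<close>

lemma PG_gen: "carrier PG = generate PG (Lam \<union> {W D a |D a. F.wp D a})"
proof
  let ?S = "Lam \<union> {W D a |D a. F.wp D a}"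
  have S: "?S \<subseteq> carrier PG" using Lam_car W_car wp_good by blast
  show "generate PG ?S \<subseteq> carrier PG" using Pg.generate_incl[OF S] .
  have q: "q \<phi> \<in> ?S" if \<phi>: "\<phi> \<in> Om" for \<phi>
    using \<phi>
  proof (rule Omega_cases)
    assume "\<phi> \<in> Omega1 \<Gamma> x"
    then obtain \<sigma> where "sperm \<sigma>" "\<phi> = tau \<sigma>" using Omega1_tau by blast
    then show ?thesis using tau_Lam by blast
  next
    fix A a assume A: "good A a" "A \<noteq> {a}" "\<phi> = wh \<Gamma> A a"
    then have qW: "q \<phi> = W A a" using W_q by simp
    note g = goodD[OF A(1)]
    have AL: "A - {a} \<subseteq> L" using A(1) unfolding good_def by blast
    show ?thesis
    proof (cases "a \<in> L")
      case True
      then have "F.wp A a" unfolding F.wp_def using AL g(1,2) by blast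
      then show ?thesis using qW by blast
    next
      case False
      then have "fst a \<in> aout" using g(3) unfolding L_iff by blast
      then have "W (insert a (A - {a})) a \<in> Lam" by (rule level_Lam[OF AL])
      then show ?thesis using qW insert_Diff[OF g(1)] by simp
    qed
  qed
  show "carrier PG \<subseteq> generate PG ?S"
  proof
    fix p assume "p \<in> carrier PG"
    then show "p \<in> generate PG ?S"
    proof (induction rule: pres_induct)
      case one
      show ?case by (rule generate.one)
    next
      case (mult l p)
      have "pres_class Om (Rels \<Gamma> x) [l] \<in> generate PG ?S"
      proof (cases "snd l")
        case True
        then have "l = (fst l, True)" by (simp add: prod_eq_iff)
        then show ?thesis using generate.incl[OF q[OF mult(1)], of PG] by metis
      next
        case False
        then have "l = (fst l, False)" by (simp add: prod_eq_iff)
        then show ?thesis using generate.inv[OF q[OF mult(1)], of PG] q_neg[OF mult(1)] by metis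
      qed
      then show ?case using mult(3) by (rule generate.eng)
    qed
  qed
qed

section \<open>Peak reduction applied to the presented group\<close>

lemma wh_group_PG: "wh_group RY H X (el) ZY lenY PG PhiL W Lam theta"
proof (intro wh_group.intro rel_free_RY Pg.is_group wh_group_axioms.intro, goal_cases)
  case (1 p) then show ?case using Stvl_Au Phi_Stvl by blast
next case (2 p r k) then show ?case using Phi_mult GY_car by simp
next case (3 D a) then show ?case using W_car wp_good by blast
next case (4 D a) then show ?case by (rule W_acts)
next case 5 show ?case by (rule Lam_sub)
next case (6 s) then show ?case by (rule theta_Lam)
next case (7 s)
  then show ?case using twist_Lam[OF 7 sperm_id] q_tau_id theta_car[OF 7] by (simp add: id_def)
next case (8 l)
  then obtain s \<sigma> where "s ` L \<subseteq> H" "sperm \<sigma>" "l = theta s \<bullet> q (tau \<sigma>)" by (rule LamE)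
  then show ?case using twist_Lam by blast
next case (9 s \<sigma> \<phi>)
  then have t: "s ` L \<subseteq> H" "sperm \<sigma>" "\<forall>u\<in>L. \<phi> (el u) = s (linv u) \<star> el (\<sigma> u) \<star> ginv (s u)"
    unfolding twist_iff by simp_all
  then show ?case using LamI[OF t(1,2)] Lam_act[OF t(1,2)] by (intro bexI[of _ "theta s \<bullet> q (tau \<sigma>)"]) simp_all
next case (10 l) then show ?case by (rule Lam_inj)
next case (11 s r) then show ?case using theta_mult by simp
next case (12 s r) then show ?case by (rule theta_cong)
next case (13 l D a) then show ?case by (rule Lam_W)
next case (14 s D a h) then show ?case by (rule theta_W)
next case (15 a) show ?case by (rule W_single)
next case (16 A a) then show ?case using W_inv wp_good by blast
next case (17 A a B) then show ?case using W_join wp_good by blast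
next case (18 A a B b) then show ?case using W_commute wp_good by blast
next case (19 A a B b) then show ?case using W_commute_sub wp_good by blast
next case (20 A a B b) then show ?case using W_slide wp_good by blast
next case (21 A a B b) then show ?case using W_slide' wp_good by blast
next case (22 A a b) then show ?case by (rule W_exchange')
next case 23 show ?case by (rule PG_gen)
qed

lemma presentation: "has_presentation SG Om (Rels \<Gamma> x)"
proof -
  interpret Wg: wh_group RY H X "el" ZY lenY PG PhiL W Lam theta by (rule wh_group_PG)
  interpret h: group_hom PG SG PhiL
    by (rule group_hom.intro[OF Pg.is_group SG_group group_hom_axioms.intro[OF Phi_hom]])
  have "p = pone" if p: "p \<in> carrier PG" "PhiL p = \<one>\<^bsub>SG\<^esub>" for p
    by (rule Wg.Phi_inj[OF p(1)]) (use p(2) SG_one elt_L in \<open>simp add: idS_def\<close>)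
  then have "inj_on PhiL (carrier PG)" by (intro h.inj_on_one_iff[THEN iffD2]) blast
  moreover have "SS \<subseteq> PhiL ` carrier PG"
  proof
    fix \<phi> assume \<phi>: "\<phi> \<in> SS"
    obtain p where p: "p \<in> carrier PG" "\<forall>u\<in>L. PhiL p (el u) = \<phi> (el u)"
      using Wg.Phi_surj[OF Stvl_Au[OF \<phi>]] by blast
    have "PhiL p = \<phi>" by (rule Stvl_elt_ext[OF Phi_Stvl[OF p(1)] \<phi>]) (use p(2) in blast)
    then show "\<phi> \<in> PhiL ` carrier PG" using p(1) by blast
  qed
  then have "PhiL ` carrier PG = carrier SG" using Phi_Stvl by auto
  ultimately have "PhiL \<in> iso PG SG" using Phi_hom by (simp add: iso_def bij_betw_def)
  moreover have "Rels \<Gamma> x \<subseteq> words Om \<times> words Om" using Rels_sound by auto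
  moreover have "Om \<subseteq> carrier SG" using Om_Stvl by auto
  ultimately show ?thesis unfolding has_presentation_def using SG_group Phi_q by blast
qed

end

theorem theorem4p6:
  fixes \<Gamma> :: "'v pair_pre_digraph" and x :: 'v
  assumes "pair_graph \<Gamma>"
    and "x \<in> pverts \<Gamma>"
    and "adm \<Gamma> x \<noteq> cl \<Gamma> x"
  shows "has_presentation (Stvl_group \<Gamma> x) (Omega \<Gamma> x) (Rels \<Gamma> x)"
  by (rule raag_class.presentation[OF raag_class.intro[OF assms]])

end
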